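(* Let $J$ be an almost complex structure on $A$ and suppose that the right bimodule covariant derivative $(\Omega^1A,\square,\sigma^{-1})$ satisfies: a) $\wedge:\Omega^{1,0}A\otimes_A\Omega^{0,1}A\to\Omega^{1,1}A$ is an isomorphism with inverse $\phi$; b) $(J\otimes\mathrm{id})\square=\square\,J:\Omega^1A\to\Omega^1A\otimes_A\Omega^1A$; c) $\pi^{1,1}\mathrm{Tor}_R:\Omega^1A\to\Omega^{1,1}A$ vanishes, where $\mathrm{Tor}_R=\mathrm d+\wedge\,\square$; d) $\pi^{1,1}\wedge\sigma^{-1}=-\pi^{0,1}\wedge\pi^{1,0}-\pi^{1,0}\wedge\pi^{0,1}$ on $\Omega^1A\otimes_A\Omega^1A$. Then for all $\underline v,\underline w\in\mathcal T\mathrm{Vec}^{*,0}A_\bullet$, $$\bar\partial_{\mathcal{HD}}(\underline v\bullet\underline w)=\bar\partial_{\mathcal{HD}}(\underline v)\bullet\underline w+\underline v\triangleright\big(\bar\partial_{\mathcal{HD}}(\underline w)\big).$$ Thus the $\bullet$ product of holomorphic elements of $\mathcal T\mathrm{Vec}^{*,0}A_\bullet$ (those $\underline v$ with $\bar\partial_{\mathcal{HD}}(\underline v)=0$) is holomorphic.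
   Context: $A$ is a unital $*$-algebra over $\mathbb C$ with a differential graded algebra $(\Omega A=\oplus_n\Omega^nA,\mathrm d,\wedge)$, $\Omega^0A=A$, $\mathrm d^2=0$, graded Leibniz rule, generated over $A$ by $\Omega^1A$, with $\Omega^1A=A.\mathrm dA$, such that $a.\mathrm db\mapsto\mathrm db^*.a^*$ is a well defined star operation on $\Omega^1A$ extending to all $\Omega^nA$. $\Omega^1A$ is finitely generated projective as a right $A$-module. An almost complex structure is an $A$-bimodule map $J:\Omega^1A\to\Omega^1A$ with $J(\xi^* )=J(\xi)^*$, $J^2=-\mathrm{id}$, such that $J\otimes\mathrm{id}^{\otimes n-1}+\dots+\mathrm{id}^{\otimes n-1}\otimes J$ descends via $\wedge$ to a well defined map $J:\Omega^nA\to\Omega^nA$ for each $n$. $\Omega^{p,q}A$ ($p,q\ge0$) is the $\mathrm i(p-q)$-eigenspace of $J$ in $\Omega^{p+q}A$, $\pi^{p,q}:\Omega^{p+q}A\to\Omega^{p,q}A$ the projection, $\partial=\pi^{p+1,q}\mathrm d$ and $\bar\partial=\pi^{p,q+1}\mathrm d$ on $\Omega^{p,q}A$; $\pi^{0,1}\wedge\pi^{1,0}=\wedge\circ(\pi^{0,1}\otimes\pi^{1,0})$, etc. $\mathrm{Vec}A=\mathrm{Hom}_A(\Omega^1A,A)$ (right module maps), a bimodule by $(a.v)(\xi)=a\,v(\xi)$, $(v.a)(\xi)=v(a\xi)$; $J(v)=v\circ J$; $\mathrm{Vec}^{1,0}A$ is the $+\mathrm i$ eigenspace of $J$ on $\mathrm{Vec}A$.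 $\Omega^{\otimes n}A$, $\mathrm{Vec}^{\otimes n}A$ are $n$-fold tensor powers over $A$ ($A$ for $n=0$), $\Omega^{\otimes n,0}A=(\Omega^{1,0}A)^{\otimes_An}$, $\mathrm{Vec}^{\otimes n,0}A=(\mathrm{Vec}^{1,0}A)^{\otimes_An}$, $\mathcal T\mathrm{Vec}^{*,0}A=\bigoplus_{n\ge0}\mathrm{Vec}^{\otimes n,0}A$. $\mathrm{ev}$ is evaluation, $\mathrm{ev}^{\langle1\rangle}=\mathrm{ev}$, $\mathrm{ev}^{\langle n+1\rangle}=\mathrm{ev}(\mathrm{id}\otimes\mathrm{ev}^{\langle n\rangle}\otimes\mathrm{id})$, $\mathrm{coev}(1)=\sum_i\xi_i\otimes u_i\in\Omega^1A\otimes_A\mathrm{Vec}A$ is the dual basis, and $\sum_i\eta_i\otimes\eta^i\in\Omega^{1,0}A\otimes_A\mathrm{Vec}^{1,0}A$ is a dual basis for $\Omega^{1,0}A$. Right bimodule covariant derivative: $\square:\Omega^1A\to\Omega^1A\otimes_A\Omega^1A$, $\square(\xi a)=\square(\xi)a+\xi\otimes\mathrm da$, $\square(a\xi)=a\square(\xi)+\sigma^{-1}(\mathrm da\otimes\xi)$, $\sigma^{-1}$ a bimodule map on $\Omega^1A\otimes_A\Omega^1A$ (not assumed invertible). On forms: $\square^{\langle0\rangle}=\mathrm d$, $\square^{\langle1\rangle}=\square$, $\square^{\langle n+1\rangle}=\mathrm{id}^{\otimes n}\otimes\square+(\mathrm{id}^{\otimes n}\otimes\sigma^{-1})(\square^{\langle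 n\rangle}\otimes\mathrm{id})$. The dual $\square:\mathrm{Vec}A\to\Omega^1A\otimes_A\mathrm{Vec}A$ is determined by $\mathrm d\circ\mathrm{ev}=(\mathrm{id}\otimes\mathrm{ev})(\square\otimes\mathrm{id})+(\mathrm{ev}\otimes\mathrm{id})(\mathrm{id}\otimes\square)$, with $\sigma=(\mathrm{ev}\otimes\mathrm{id}\otimes\mathrm{id})(\mathrm{id}\otimes\sigma^{-1}\otimes\mathrm{id})(\mathrm{id}\otimes\mathrm{id}\otimes\mathrm{coev}(1))$; it extends to $\square^{\langle n\rangle}:\mathrm{Vec}^{\otimes n}A\to\Omega^1A\otimes_A\mathrm{Vec}^{\otimes n}A$ by $\square^{\langle0\rangle}=\mathrm d$, $\square^{\langle n+1\rangle}=\square\otimes\mathrm{id}^{\otimes n}+(\sigma\otimes\mathrm{id}^{\otimes n})(\mathrm{id}\otimes\square^{\langle n\rangle})$. $\mathcal T\mathrm{Vec}A_\bullet=\bigoplus_{n\ge0}\mathrm{Vec}^{\otimes n}A$ with the associative unital product $\bullet$ determined by $a\bullet\underline w=a.\underline w$, $u\bullet\underline w=u\otimes\underline w+(\mathrm{ev}\otimes\mathrm{id}^{\otimes m})(u\otimes\square^{\langle m\rangle}\underline w)$ and $(u\otimes\underline v)\bullet\underline w=u\bullet(\underline v\bullet\underline w)-\big((\mathrm{ev}\otimes\mathrm{id}^{\otimes n})(u\otimes\square^{\langle n\rangle}\underline v)\big)\bullet\underline w$, for $a\in A$, $u\in\mathrm{Vec}A$, $\underline v\in\mathrm{Vec}^{\otimes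 n}A$, $\underline w\in\mathrm{Vec}^{\otimes m}A$; left $A$-action the usual one, right $A$-action by $\bullet$. Under b), $\mathcal T\mathrm{Vec}^{*,0}A$ is a subalgebra, denoted $\mathcal T\mathrm{Vec}^{*,0}A_\bullet$. Action. If $E$ is a left $A$-module with $\partial_E:E\to\Omega^{1,0}A\otimes_AE$ satisfying $\partial_E(ae)=\partial a\otimes e+a\partial_E(e)$, then $\mathcal T\mathrm{Vec}^{*,0}A_\bullet$ acts on $E$ by $\underline v\triangleright e=(\mathrm{ev}^{\langle n\rangle}\otimes\mathrm{id}_E)(\underline v\otimes\partial_E^{(n)}e)$ for $\underline v\in\mathrm{Vec}^{\otimes n,0}A$, where $\partial_E^{(1)}=\partial_E$, $\partial_E^{(n+1)}=((\mathrm{id}^{\otimes n}\otimes\pi^{1,0})\square^{\langle n\rangle}\otimes\mathrm{id}_E+\mathrm{id}^{\otimes n}\otimes\partial_E)\partial_E^{(n)}$ (and $a\triangleright e=ae$). In the claim this is applied to $E=\Omega^{0,1}A\otimes_A\mathcal T\mathrm{Vec}^{*,0}A_\bullet$ with the tensor product derivative $\partial_E(\xi\otimes\underline w)=\phi\,\pi^{1,1}\mathrm d\xi\otimes\underline w-\sum_i\phi(\xi\wedge\eta_i)\otimes(\eta^i\bullet\underline w)$, built from $\phi\pi^{1,1}\mathrm d$ on $\Omega^{0,1}A$ (with $\xi\otimes\eta\mapsto-\phi\pi^{1,1}(\xi\wedge\eta)$ as associated bimodule map) and $\underline w\mapsto\sum_i\eta_i\otimes\eta^i\bullet\underline w$ on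 $\mathcal T\mathrm{Vec}^{*,0}A_\bullet$. Also $(\xi\otimes\underline x)\bullet\underline w=\xi\otimes(\underline x\bullet\underline w)$. $\bar\partial_{\mathcal{HD}}:\mathcal T\mathrm{Vec}^{*,0}A_\bullet\to\Omega^{0,1}A\otimes_A\mathcal T\mathrm{Vec}^{*,0}A_\bullet$ is the (well defined under a)–d)) left $\bar\partial$ covariant derivative (i.e. $\bar\partial_{\mathcal{HD}}(a\underline v)=\bar\partial a\otimes\underline v+a\bar\partial_{\mathcal{HD}}(\underline v)$) given recursively by $\bar\partial_{\mathcal{HD}}=\bar\partial$ on $A$, $\bar\partial_{\mathcal{HD}}=(\pi^{0,1}\otimes\mathrm{id})\square$ on $\mathrm{Vec}^{1,0}A$, and, for $u\in\mathrm{Vec}^{1,0}A$, $\underline v\in\mathrm{Vec}^{\otimes n,0}A$ with $\xi\otimes\underline w=\bar\partial_{\mathcal{HD}}(\underline v)$ (summation implicit), $\bar\partial_{\mathcal{HD}}(u\bullet\underline v)=((\pi^{0,1}\otimes\mathrm{id})\square u)\bullet\underline v-(\mathrm{ev}\otimes\mathrm{id})(u\otimes\phi(\pi^{0,1}\wedge\pi^{1,0})\square(\xi))\otimes\underline w-\sum_i(\mathrm{ev}\otimes\mathrm{id})(u\otimes\phi(\xi\wedge\eta_i))\otimes\eta^i\bullet\underline w$. *)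

theory Defs
  imports
    Complex_Main
    "HOL-Library.Poly_Mapping"
    "HOL-Library.Product_Plus"
    "HOL-Computational_Algebra.Group_Closure"
begin

section \<open>The differential graded star algebra\<close>

text \<open>
  The whole of $\Omega A$ is one type, its product is the wedge product, and the algebra $A$ is
  the degree 0 part. The sort is \<^class>\<open>ring\<close> with \<^class>\<open>monoid_mult\<close> rather than
  \<^class>\<open>ring_1\<close>, because the latter would exclude $A = 0$.
\<close>

class graded_complex_algebra = ring + monoid_mult +
  fixes cscale :: "complex \<Rightarrow> 'a \<Rightarrow> 'a"
    and Om :: "nat \<Rightarrow> 'a set"
  assumes cscale_add_right: "cscale c (x + y) = cscale c x + cscale c y"
    and cscale_add_left: "cscale (b + c) x = cscale b x + cscale c x"
    and cscale_cscale: "cscale b (cscale c x) = cscale (b * c) x"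
    and cscale_one: "cscale 1 x = x"
    and cscale_mult_left: "cscale c x * y = cscale c (x * y)"
    and cscale_mult_right: "x * cscale c y = cscale c (x * y)"
    and Om_zero: "0 \<in> Om n"
    and Om_add: "x \<in> Om n \<Longrightarrow> y \<in> Om n \<Longrightarrow> x + y \<in> Om n"
    and Om_cscale: "x \<in> Om n \<Longrightarrow> cscale c x \<in> Om n"
    and Om_one: "1 \<in> Om 0"
    and Om_mult: "x \<in> Om m \<Longrightarrow> y \<in> Om n \<Longrightarrow> x * y \<in> Om (m + n)"
    and Om_direct_sum:
      "\<exists>!f. (\<forall>n. f n \<in> Om n) \<and> finite {n. f n \<noteq> 0} \<and> x = (\<Sum>n | f n \<noteq> 0. f n)"

text \<open>
  The star is $*$ on all of $\Omega A$. On forms it satisfies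
  $(\xi\wedge\eta)^* = (-1)^{|\xi||\eta|}\,\eta^*\wedge\xi^*$; compatibility of the star with the
  differential follows from the axioms.
\<close>

class star_dga = graded_complex_algebra +
  fixes dif :: "'a \<Rightarrow> 'a"
    and star :: "'a \<Rightarrow> 'a"
  assumes dif_add: "dif (x + y) = dif x + dif y"
    and dif_cscale: "dif (cscale c x) = cscale c (dif x)"
    and dif_degree: "x \<in> Om n \<Longrightarrow> dif x \<in> Om (Suc n)"
    and dif_dif: "dif (dif x) = 0"
    and dif_mult: "x \<in> Om n \<Longrightarrow> dif (x * y) = dif x * y + (- 1) ^ n * (x * dif y)"
    and Om_generated: "Om (Suc n) \<subseteq> group_closure {x * y |x y. x \<in> Om 1 \<and> y \<in> Om n}"
    and Om_1_eq_A_dA: "Om 1 \<subseteq> group_closure {a * dif b |a b. a \<in> Om 0 \<and> b \<in> Om 0}"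
    and star_add: "star (x + y) = star x + star y"
    and star_cscale: "star (cscale c x) = cscale (cnj c) (star x)"
    and star_star: "star (star x) = x"
    and star_degree: "x \<in> Om n \<Longrightarrow> star x \<in> Om n"
    and star_mult:
      "x \<in> Om m \<Longrightarrow> y \<in> Om n \<Longrightarrow> star (x * y) = (- 1) ^ (m * n) * (star y * star x)"
    and star_A_dA: "a \<in> Om 0 \<Longrightarrow> b \<in> Om 0 \<Longrightarrow> star (a * dif b) = dif (star b) * star a"

text \<open>
  Vector fields are right module maps $\Omega^1A\to A$, extended by 0 outside of $\Omega^1A$ so
  that equal vector fields are equal functions.
\<close>

definition VecA :: "('w::graded_complex_algebra \<Rightarrow> 'w) set" where
  "VecA = {v. (\<forall>\<xi>\<in>Om 1. v \<xi> \<in> Om 0) \<and>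
              (\<forall>\<xi>\<in>Om 1. \<forall>\<eta>\<in>Om 1. v (\<xi> + \<eta>) = v \<xi> + v \<eta>) \<and>
              (\<forall>\<xi>\<in>Om 1. \<forall>a\<in>Om 0. v (\<xi> * a) = v \<xi> * a) \<and>
              (\<forall>\<xi>. \<xi> \<notin> Om 1 \<longrightarrow> v \<xi> = 0)}"

definition vadd :: "('w::graded_complex_algebra \<Rightarrow> 'w) \<Rightarrow> ('w \<Rightarrow> 'w) \<Rightarrow> 'w \<Rightarrow> 'w" where
  "vadd v w = (\<lambda>\<xi>. v \<xi> + w \<xi>)"

definition vlact :: "'w::graded_complex_algebra \<Rightarrow> ('w \<Rightarrow> 'w) \<Rightarrow> 'w \<Rightarrow> 'w" where
  "vlact a v = (\<lambda>\<xi>. a * v \<xi>)"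

definition vract :: "('w::graded_complex_algebra \<Rightarrow> 'w) \<Rightarrow> 'w \<Rightarrow> 'w \<Rightarrow> 'w" where
  "vract v a = (\<lambda>\<xi>. if \<xi> \<in> Om 1 then v (a * \<xi>) else 0)"

text \<open>
  Finitely generated projective right modules, as retracts of the free modules $A^n$; elements
  of $A^n$ are sequences vanishing from index $n$ on.
\<close>

definition fgp_right :: "'w::graded_complex_algebra set \<Rightarrow> bool" where
  "fgp_right M \<longleftrightarrow> (\<exists>n (inc :: 'w \<Rightarrow> nat \<Rightarrow> 'w) (pr :: (nat \<Rightarrow> 'w) \<Rightarrow> 'w).
     let F = {f. (\<forall>i<n. f i \<in> Om 0) \<and> (\<forall>i\<ge>n. f i = 0)} in
       (\<forall>m\<in>M. inc m \<in> F) \<and>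
       (\<forall>m\<in>M. \<forall>m'\<in>M. inc (m + m') = (\<lambda>i. inc m i + inc m' i)) \<and>
       (\<forall>m\<in>M. \<forall>a\<in>Om 0. inc (m * a) = (\<lambda>i. inc m i * a)) \<and>
       (\<forall>f\<in>F. pr f \<in> M) \<and>
       (\<forall>f\<in>F. \<forall>g\<in>F. pr (\<lambda>i. f i + g i) = pr f + pr g) \<and>
       (\<forall>f\<in>F. \<forall>a\<in>Om 0. pr (\<lambda>i. f i * a) = pr f * a) \<and>
       (\<forall>m\<in>M. pr (inc m) = m))"

definition dual_basis ::
    "'w::graded_complex_algebra set \<Rightarrow> ('w \<Rightarrow> 'w) set \<Rightarrow> ('w \<times> ('w \<Rightarrow> 'w)) list \<Rightarrow> bool" where
  "dual_basis M V bs \<longleftrightarrow>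
     set bs \<subseteq> M \<times> V \<and> (\<forall>m\<in>M. m = (\<Sum>(\<xi>, u)\<leftarrow>bs. \<xi> * u m))"


section \<open>Tensor products over the algebra\<close>

text \<open>
  All tensor products over $A$ of copies of $\Omega^1A$ and $\mathrm{Vec}A$ (and of their
  sub-bimodules that are direct summands, such as $\Omega^{1,0}A$) are realised inside one ring,
  the tensor algebra $T_A(\Omega^1A\oplus\mathrm{Vec}A)$ of the bimodule
  $\Omega^1A\oplus\mathrm{Vec}A$: the product of the ring is $\otimes_A$, and for instance
  $\Omega^1A\otimes_A\mathrm{Vec}A$ is the additive span of the products of an element of
  $\Omega^1A$ with an element of $\mathrm{Vec}A$. The ring is the free ring on symbols for the
  elements of $A$, $\Omega^1A$ and $\mathrm{Vec}A$ modulo the usual relations; symbols for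
  elements outside of these sets are set to 0. The complex scalars are in $A$.
\<close>

datatype 'b free_monoid = FM "'b list"

instantiation free_monoid :: (type) monoid_add
begin

definition zero_free_monoid :: "'a free_monoid" where
  "0 = FM []"

fun plus_free_monoid :: "'a free_monoid \<Rightarrow> 'a free_monoid \<Rightarrow> 'a free_monoid" where
  "FM xs + FM ys = FM (xs @ ys)"

instance
proof
  fix a b c :: "'a free_monoid"
  show "a + b + c = a + (b + c)"
    by (cases a; cases b; cases c) simp
  show "0 + a = a" and "a + 0 = a"
    by (cases a; simp add: zero_free_monoid_def)+
qed

end

datatype 'w atom = Sc 'w | Fm 'w | Vc "'w \<Rightarrow> 'w"

type_synonym 'w free_tens = "'w atom free_monoid \<Rightarrow>\<^sub>0 int"

definition gen :: "'w atom \<Rightarrow> 'w free_tens" where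
  "gen t = Poly_Mapping.single (FM [t]) 1"

inductive_set tens_relators :: "'w::graded_complex_algebra free_tens set" where
  sc_add: "a \<in> Om 0 \<Longrightarrow> b \<in> Om 0 \<Longrightarrow> gen (Sc (a + b)) - gen (Sc a) - gen (Sc b) \<in> tens_relators"
| sc_mult: "a \<in> Om 0 \<Longrightarrow> b \<in> Om 0 \<Longrightarrow> gen (Sc (a * b)) - gen (Sc a) * gen (Sc b) \<in> tens_relators"
| sc_one: "gen (Sc 1) - 1 \<in> tens_relators"
| sc_junk: "a \<notin> Om 0 \<Longrightarrow> gen (Sc a) \<in> tens_relators"
| fm_add: "\<xi> \<in> Om 1 \<Longrightarrow> \<eta> \<in> Om 1 \<Longrightarrow> gen (Fm (\<xi> + \<eta>)) - gen (Fm \<xi>) - gen (Fm \<eta>) \<in> tens_relators"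
| fm_left: "a \<in> Om 0 \<Longrightarrow> \<xi> \<in> Om 1 \<Longrightarrow> gen (Fm (a * \<xi>)) - gen (Sc a) * gen (Fm \<xi>) \<in> tens_relators"
| fm_right: "\<xi> \<in> Om 1 \<Longrightarrow> a \<in> Om 0 \<Longrightarrow> gen (Fm (\<xi> * a)) - gen (Fm \<xi>) * gen (Sc a) \<in> tens_relators"
| fm_junk: "\<xi> \<notin> Om 1 \<Longrightarrow> gen (Fm \<xi>) \<in> tens_relators"
| vc_add: "u \<in> VecA \<Longrightarrow> v \<in> VecA \<Longrightarrow> gen (Vc (vadd u v)) - gen (Vc u) - gen (Vc v) \<in> tens_relators"
| vc_left: "a \<in> Om 0 \<Longrightarrow> v \<in> VecA \<Longrightarrow> gen (Vc (vlact a v)) - gen (Sc a) * gen (Vc v) \<in> tens_relators"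
| vc_right: "v \<in> VecA \<Longrightarrow> a \<in> Om 0 \<Longrightarrow> gen (Vc (vract v a)) - gen (Vc v) * gen (Sc a) \<in> tens_relators"
| vc_junk: "v \<notin> VecA \<Longrightarrow> gen (Vc v) \<in> tens_relators"

definition tens_ideal :: "'w::graded_complex_algebra free_tens set" where
  "tens_ideal = group_closure {p * r * q |p r q. r \<in> tens_relators}"

definition tens_eq :: "'w::graded_complex_algebra free_tens \<Rightarrow> 'w free_tens \<Rightarrow> bool" where
  "tens_eq x y \<longleftrightarrow> x - y \<in> tens_ideal"

lemma tens_ideal_diff: "x \<in> tens_ideal \<Longrightarrow> y \<in> tens_ideal \<Longrightarrow> x - y \<in> tens_ideal"
  unfolding tens_ideal_def by (rule group_closure.diff)

lemma tens_ideal_uminus: "x \<in> tens_ideal \<Longrightarrow> - x \<in> tens_ideal"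
  unfolding tens_ideal_def by simp

lemma tens_ideal_add: "x \<in> tens_ideal \<Longrightarrow> y \<in> tens_ideal \<Longrightarrow> x + y \<in> tens_ideal"
  unfolding tens_ideal_def by (rule group_closure_add)

lemma tens_ideal_mult:
  assumes "x \<in> tens_ideal"
  shows "p * x \<in> tens_ideal" and "x * q \<in> tens_ideal"
proof -
  have "p * x * q \<in> tens_ideal" for p q
    using assms unfolding tens_ideal_def
  proof (induction rule: group_closure.induct)
    case (base s)
    show ?case
    proof (cases "s = 0")
      case False
      with base obtain p' r q' where s: "s = p' * r * q'" and r: "r \<in> tens_relators"
        by auto
      have "p * s * q = (p * p') * r * (q' * q)"
        by (simp add: s mult.assoc)
      with r show ?thesis
        by (intro group_closure.base insertI2) blast
    qed simp
  next
    case (diff s t)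
    have "p * (s - t) * q = p * s * q - p * t * q"
      by (simp add: algebra_simps)
    with diff.IH show ?case
      by (simp add: group_closure.diff)
  qed
  from this[of p 1] this[of 1 q] show "p * x \<in> tens_ideal" and "x * q \<in> tens_ideal"
    by simp_all
qed

quotient_type (overloaded) 'w tens = "'w::graded_complex_algebra free_tens" / tens_eq
proof (rule equivpI)
  show "reflp (tens_eq :: 'w free_tens \<Rightarrow> _)"
    by (rule reflpI) (simp add: tens_eq_def tens_ideal_def)
  show "symp (tens_eq :: 'w free_tens \<Rightarrow> _)"
  proof (rule sympI)
    fix x y :: "'w free_tens"
    assume "tens_eq x y"
    then have "- (x - y) \<in> tens_ideal"
      unfolding tens_eq_def by (rule tens_ideal_uminus)
    then show "tens_eq y x"
      by (simp add: tens_eq_def)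
  qed
  show "transp (tens_eq :: 'w free_tens \<Rightarrow> _)"
  proof (rule transpI)
    fix x y z :: "'w free_tens"
    assume "tens_eq x y" and "tens_eq y z"
    then have "(x - y) + (y - z) \<in> tens_ideal"
      unfolding tens_eq_def by (rule tens_ideal_add)
    then show "tens_eq x z"
      by (simp add: tens_eq_def)
  qed
qed

instantiation tens :: (graded_complex_algebra) "{ring, monoid_mult}"
begin

lift_definition zero_tens :: "'a tens" is 0 .

lift_definition one_tens :: "'a tens" is 1 .

lift_definition plus_tens :: "'a tens \<Rightarrow> 'a tens \<Rightarrow> 'a tens" is "(+)"
proof -
  fix x x' y y' :: "'a free_tens"
  assume "tens_eq x x'" and "tens_eq y y'"
  then have "(x - x') + (y - y') \<in> tens_ideal"
    unfolding tens_eq_def by (rule tens_ideal_add)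
  then show "tens_eq (x + y) (x' + y')"
    by (simp add: tens_eq_def algebra_simps)
qed

lift_definition minus_tens :: "'a tens \<Rightarrow> 'a tens \<Rightarrow> 'a tens" is "(-)"
proof -
  fix x x' y y' :: "'a free_tens"
  assume "tens_eq x x'" and "tens_eq y y'"
  then have "(x - x') - (y - y') \<in> tens_ideal"
    unfolding tens_eq_def by (rule tens_ideal_diff)
  then show "tens_eq (x - y) (x' - y')"
    by (simp add: tens_eq_def algebra_simps)
qed

lift_definition uminus_tens :: "'a tens \<Rightarrow> 'a tens" is uminus
proof -
  fix x x' :: "'a free_tens"
  assume "tens_eq x x'"
  then have "- (x - x') \<in> tens_ideal"
    unfolding tens_eq_def by (rule tens_ideal_uminus)
  then show "tens_eq (- x) (- x')"
    by (simp add: tens_eq_def)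
qed

lift_definition times_tens :: "'a tens \<Rightarrow> 'a tens \<Rightarrow> 'a tens" is "(*)"
proof -
  fix x x' y y' :: "'a free_tens"
  assume "tens_eq x x'" and "tens_eq y y'"
  then have "(x - x') * y + x' * (y - y') \<in> tens_ideal"
    unfolding tens_eq_def by (intro tens_ideal_add tens_ideal_mult)
  then show "tens_eq (x * y) (x' * y')"
    by (simp add: tens_eq_def algebra_simps)
qed

instance
proof
  have eqI: "tens_eq x y" if "x = y" for x y :: "'a free_tens"
    using that by (simp add: tens_eq_def tens_ideal_def)
  fix a b c :: "'a tens"
  show "a + b + c = a + (b + c)"
    by transfer (rule eqI, simp add: algebra_simps)
  show "a + b = b + a"
    by transfer (rule eqI, simp add: algebra_simps)
  show "0 + a = a"
    by transfer (rule eqI, simp)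
  show "- a + a = 0"
    by transfer (rule eqI, simp)
  show "a - b = a + - b"
    by transfer (rule eqI, simp)
  show "a * b * c = a * (b * c)"
    by transfer (rule eqI, simp add: mult.assoc)
  show "(a + b) * c = a * c + b * c"
    by transfer (rule eqI, simp add: algebra_simps)
  show "a * (b + c) = a * b + a * c"
    by transfer (rule eqI, simp add: algebra_simps)
  show "1 * a = a"
    by transfer (rule eqI, simp)
  show "a * 1 = a"
    by transfer (rule eqI, simp)
qed

end

lift_definition sc :: "'w::graded_complex_algebra \<Rightarrow> 'w tens" is "\<lambda>a. gen (Sc a)" .
lift_definition fm :: "'w::graded_complex_algebra \<Rightarrow> 'w tens" is "\<lambda>\<xi>. gen (Fm \<xi>)" .
lift_definition vc :: "('w::graded_complex_algebra \<Rightarrow> 'w) \<Rightarrow> 'w tens" is "\<lambda>v. gen (Vc v)" .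

definition TA :: "'w::graded_complex_algebra tens set" where
  "TA = sc ` Om 0"

definition TOm :: "'w::graded_complex_algebra tens set" where
  "TOm = fm ` Om 1"

definition TVec :: "'w::graded_complex_algebra tens set" where
  "TVec = vc ` VecA"

definition tprod ::
    "'w::graded_complex_algebra tens set \<Rightarrow> 'w tens set \<Rightarrow> 'w tens set" (infixr "\<otimes>\<^sub>A" 75) where
  "X \<otimes>\<^sub>A Y = group_closure {x * y |x y. x \<in> X \<and> y \<in> Y}"

primrec tpow :: "'w::graded_complex_algebra tens set \<Rightarrow> nat \<Rightarrow> 'w tens set" where
  "tpow M 0 = TA"
| "tpow M (Suc n) = M \<otimes>\<^sub>A tpow M n"

definition tpowers :: "'w::graded_complex_algebra tens set \<Rightarrow> 'w tens set" where
  "tpowers M = group_closure (\<Union>n. tpow M n)"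

text \<open>
  \<open>add_ext I b f\<close> is the additive map on the span of the elements \<open>b i\<close> (\<open>i \<in> I\<close>) determined by
  \<open>b i \<mapsto> f i\<close>; its graph is the additive group generated by the pairs \<open>(b i, f i)\<close>. It is used
  for maps that are given by a formula on elementary tensors; \<open>add_ext_ok\<close> says that the formula
  gives a well defined map.
\<close>

definition add_ext ::
    "'i set \<Rightarrow> ('i \<Rightarrow> 'x::ab_group_add) \<Rightarrow> ('i \<Rightarrow> 'y::ab_group_add) \<Rightarrow> 'x \<Rightarrow> 'y" where
  "add_ext I b f x = (THE y. (x, y) \<in> group_closure ((\<lambda>i. (b i, f i)) ` I))"

definition add_ext_ok ::
    "'i set \<Rightarrow> ('i \<Rightarrow> 'x::ab_group_add) \<Rightarrow> ('i \<Rightarrow> 'y::ab_group_add) \<Rightarrow> bool" where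
  "add_ext_ok I b f \<longleftrightarrow> (\<forall>y. (0, y) \<in> group_closure ((\<lambda>i. (b i, f i)) ` I) \<longrightarrow> y = 0)"

text \<open>\<open>tmap X T Z f\<close> is $\mathrm{id}\otimes f\otimes\mathrm{id}$ on $X\otimes_A T\otimes_A Z$;
  an absent outer factor is given as \<open>{1}\<close>.\<close>

definition tmap ::
    "'w::graded_complex_algebra tens set \<Rightarrow> 'w tens set \<Rightarrow> 'w tens set \<Rightarrow>
     ('w tens \<Rightarrow> 'w tens) \<Rightarrow> 'w tens \<Rightarrow> 'w tens" where
  "tmap X T Z f =
     add_ext (X \<times> T \<times> Z) (\<lambda>(x, t, z). x * t * z) (\<lambda>(x, t, z). x * f t * z)"

definition tens2 ::
    "('w::graded_complex_algebra \<Rightarrow> 'w) \<Rightarrow> ('w \<Rightarrow> 'w) \<Rightarrow> 'w tens \<Rightarrow> 'w tens" where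
  "tens2 f g = add_ext (Om 1 \<times> Om 1) (\<lambda>(\<xi>, \<eta>). fm \<xi> * fm \<eta>) (\<lambda>(\<xi>, \<eta>). fm (f \<xi>) * fm (g \<eta>))"

definition fmap1 :: "('w::graded_complex_algebra \<Rightarrow> 'w) \<Rightarrow> 'w tens \<Rightarrow> 'w tens" where
  "fmap1 f = add_ext (Om 1) fm (\<lambda>\<xi>. fm (f \<xi>))"

definition wedge :: "'w::graded_complex_algebra tens \<Rightarrow> 'w" where
  "wedge = add_ext (Om 1 \<times> Om 1) (\<lambda>(\<xi>, \<eta>). fm \<xi> * fm \<eta>) (\<lambda>(\<xi>, \<eta>). \<xi> * \<eta>)"

definition ev :: "'w::graded_complex_algebra tens \<Rightarrow> 'w tens" where
  "ev = add_ext (VecA \<times> Om 1) (\<lambda>(v, \<xi>). vc v * fm \<xi>) (\<lambda>(v, \<xi>). sc (v \<xi>))"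

text \<open>$\mathrm{ev}\otimes\mathrm{id}$, for any remaining tensor factors on the right.\<close>

definition ev_id :: "'w::graded_complex_algebra tens \<Rightarrow> 'w tens" where
  "ev_id = tmap {1} (TVec \<otimes>\<^sub>A TOm) UNIV ev"

fun evn :: "nat \<Rightarrow> 'w::graded_complex_algebra tens \<Rightarrow> 'w tens" where
  "evn 0 x = x"
| "evn (Suc 0) x = ev x"
| "evn (Suc (Suc n)) x =
     ev (tmap TVec (tpow TVec (Suc n) \<otimes>\<^sub>A tpow TOm (Suc n)) TOm (evn (Suc n)) x)"

definition tdif :: "'w::star_dga tens \<Rightarrow> 'w tens" where
  "tdif = add_ext (Om 0) sc (\<lambda>a. fm (dif a))"


section \<open>Almost complex structures and right bimodule covariant derivatives\<close>

context
  fixes J :: "'w::star_dga \<Rightarrow> 'w"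
begin

text \<open>
  $J$ is given on $\Omega^1A$; \<open>J_form n\<close> is the map induced on $\Omega^nA$, which is 0 on
  $\Omega^0A = A$.
\<close>

definition J_form_tuples :: "nat \<Rightarrow> 'w list set" where
  "J_form_tuples n = {\<xi>s. length \<xi>s = n \<and> set \<xi>s \<subseteq> Om 1}"

definition J_form_rhs :: "'w list \<Rightarrow> 'w" where
  "J_form_rhs \<xi>s = (\<Sum>j<length \<xi>s. prod_list (\<xi>s[j := J (\<xi>s ! j)]))"

definition J_form :: "nat \<Rightarrow> 'w \<Rightarrow> 'w" where
  "J_form n x = (if n = 0 then 0 else add_ext (J_form_tuples n) prod_list J_form_rhs x)"

definition almost_complex :: bool where
  "almost_complex \<longleftrightarrow>
     (\<forall>\<xi>\<in>Om 1. J \<xi> \<in> Om 1) \<and>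
     (\<forall>\<xi>\<in>Om 1. \<forall>\<eta>\<in>Om 1. J (\<xi> + \<eta>) = J \<xi> + J \<eta>) \<and>
     (\<forall>a\<in>Om 0. \<forall>\<xi>\<in>Om 1. J (a * \<xi>) = a * J \<xi> \<and> J (\<xi> * a) = J \<xi> * a) \<and>
     (\<forall>\<xi>\<in>Om 1. J (star \<xi>) = star (J \<xi>)) \<and>
     (\<forall>\<xi>\<in>Om 1. J (J \<xi>) = - \<xi>) \<and>
     (\<forall>n\<ge>1. add_ext_ok (J_form_tuples n) prod_list J_form_rhs)"

definition Om_pq :: "nat \<Rightarrow> nat \<Rightarrow> 'w set" where
  "Om_pq p q = {x \<in> Om (p + q). J_form (p + q) x = cscale (\<i> * of_int (int p - int q)) x}"

definition proj :: "nat \<Rightarrow> nat \<Rightarrow> 'w \<Rightarrow> 'w" where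
  "proj p q x = (THE y. \<exists>f. (\<forall>k\<le>p + q. f k \<in> Om_pq k (p + q - k)) \<and>
                            x = (\<Sum>k\<le>p + q. f k) \<and> y = f p)"

definition del :: "nat \<Rightarrow> nat \<Rightarrow> 'w \<Rightarrow> 'w" where
  "del p q x = proj (Suc p) q (dif x)"

definition delbar :: "nat \<Rightarrow> nat \<Rightarrow> 'w \<Rightarrow> 'w" where
  "delbar p q x = proj p (Suc q) (dif x)"

definition J_vec :: "('w \<Rightarrow> 'w) \<Rightarrow> 'w \<Rightarrow> 'w" where
  "J_vec v = (\<lambda>\<xi>. if \<xi> \<in> Om 1 then v (J \<xi>) else 0)"

definition Vec10 :: "('w \<Rightarrow> 'w) set" where
  "Vec10 = {v \<in> VecA. J_vec v = (\<lambda>\<xi>. cscale \<i> (v \<xi>))}"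

definition TOm10 :: "'w tens set" where
  "TOm10 = fm ` Om_pq 1 0"

definition TOm01 :: "'w tens set" where
  "TOm01 = fm ` Om_pq 0 1"

definition TVec10 :: "'w tens set" where
  "TVec10 = vc ` Vec10"

definition phi :: "'w \<Rightarrow> 'w tens" where
  "phi = inv_into (TOm10 \<otimes>\<^sub>A TOm01) wedge"

definition p01_id :: "'w tens \<Rightarrow> 'w tens" where
  "p01_id = tmap {1} TOm UNIV (fmap1 (proj 0 1))"

end

text \<open>
  The covariant derivative $\square$ is a function on $\Omega^1A$, and $\sigma^{-1}$ a function on
  the tensor algebra of which only the restriction to $\Omega^1A\otimes_A\Omega^1A$ matters.
\<close>

definition right_bimod_cov_deriv ::
    "('w::star_dga \<Rightarrow> 'w tens) \<Rightarrow> ('w tens \<Rightarrow> 'w tens) \<Rightarrow> bool" where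
  "right_bimod_cov_deriv box sinv \<longleftrightarrow>
     (\<forall>\<xi>\<in>Om 1. box \<xi> \<in> TOm \<otimes>\<^sub>A TOm) \<and>
     (\<forall>\<xi>\<in>Om 1. \<forall>\<eta>\<in>Om 1. box (\<xi> + \<eta>) = box \<xi> + box \<eta>) \<and>
     (\<forall>\<xi>\<in>Om 1. \<forall>a\<in>Om 0. box (\<xi> * a) = box \<xi> * sc a + fm \<xi> * fm (dif a)) \<and>
     (\<forall>a\<in>Om 0. \<forall>\<xi>\<in>Om 1. box (a * \<xi>) = sc a * box \<xi> + sinv (fm (dif a) * fm \<xi>)) \<and>
     (\<forall>x\<in>TOm \<otimes>\<^sub>A TOm. sinv x \<in> TOm \<otimes>\<^sub>A TOm) \<and>
     (\<forall>x\<in>TOm \<otimes>\<^sub>A TOm. \<forall>y\<in>TOm \<otimes>\<^sub>A TOm. sinv (x + y) = sinv x + sinv y) \<and>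
     (\<forall>x\<in>TOm \<otimes>\<^sub>A TOm. \<forall>a\<in>Om 0. sinv (sc a * x) = sc a * sinv x \<and> sinv (x * sc a) = sinv x * sc a)"

definition torsion_R :: "('w::star_dga \<Rightarrow> 'w tens) \<Rightarrow> 'w \<Rightarrow> 'w" where
  "torsion_R box \<xi> = dif \<xi> + wedge (box \<xi>)"

text \<open>
  \<open>J\<close>, \<open>box\<close> and \<open>sinv\<close> are $J$, $\square$ and $\sigma^{-1}$; \<open>xis\<close> and \<open>etas\<close> are the dual bases
  $\sum_i\xi_i\otimes u_i$ and $\sum_i\eta_i\otimes\eta^i$ of $\Omega^1A$ and $\Omega^{1,0}A$.
\<close>

context
  fixes J :: "'w::star_dga \<Rightarrow> 'w"
    and box :: "'w \<Rightarrow> 'w tens"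
    and sinv :: "'w tens \<Rightarrow> 'w tens"
    and xis :: "('w \<times> ('w \<Rightarrow> 'w)) list"
    and etas :: "('w \<times> ('w \<Rightarrow> 'w)) list"
begin

fun box_Om :: "nat \<Rightarrow> 'w tens \<Rightarrow> 'w tens" where
  "box_Om 0 = tdif"
| "box_Om (Suc 0) = add_ext (Om 1) fm box"
| "box_Om (Suc (Suc n)) =
     add_ext (tpow TOm (Suc n) \<times> Om 1) (\<lambda>(x, \<xi>). x * fm \<xi>)
       (\<lambda>(x, \<xi>). x * box \<xi>
          + tmap (tpow TOm (Suc n)) (TOm \<otimes>\<^sub>A TOm) {1} sinv (box_Om (Suc n) x * fm \<xi>))"

definition coev1 :: "'w tens" where
  "coev1 = (\<Sum>(\<xi>, u)\<leftarrow>xis. fm \<xi> * vc u)"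

definition sigma :: "'w tens \<Rightarrow> 'w tens" where
  "sigma x = ev_id (tmap TVec (TOm \<otimes>\<^sub>A TOm) TVec sinv (x * coev1))"

definition box_vec :: "('w \<Rightarrow> 'w) \<Rightarrow> 'w tens" where
  "box_vec u = (THE y. y \<in> TOm \<otimes>\<^sub>A TVec \<and>
     (\<forall>\<xi>\<in>Om 1. tdif (ev (vc u * fm \<xi>)) =
        tmap TOm (TVec \<otimes>\<^sub>A TOm) {1} ev (y * fm \<xi>) + ev_id (vc u * box \<xi>)))"

primrec box_Vec :: "nat \<Rightarrow> 'w tens \<Rightarrow> 'w tens" where
  "box_Vec 0 = tdif"
| "box_Vec (Suc n) =
     add_ext (VecA \<times> tpow TVec n) (\<lambda>(u, w). vc u * w)
       (\<lambda>(u, w). box_vec u * w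
          + tmap {1} (TVec \<otimes>\<^sub>A TOm) (tpow TVec n) sigma (vc u * box_Vec n w))"

definition box_TVec :: "'w tens \<Rightarrow> 'w tens" where
  "box_TVec = add_ext (SIGMA m:UNIV. tpow TVec m) snd (\<lambda>(m, w). box_Vec m w)"

definition vec_bullet :: "('w \<Rightarrow> 'w) \<Rightarrow> 'w tens \<Rightarrow> 'w tens" where
  "vec_bullet u w = vc u * w + ev_id (vc u * box_TVec w)"

text \<open>
  $\underline v\bullet\underline w$ for $\underline v\in\mathrm{Vec}^{\otimes n}A$, by recursion
  on $n$: since $\mathrm{Vec}^{\otimes(n+1)}A$ is spanned by the $u\otimes\underline v$, the rule
  for $(u\otimes\underline v)\bullet\underline w$ determines the product.
\<close>

primrec bullet_hom :: "nat \<Rightarrow> 'w tens \<Rightarrow> 'w tens \<Rightarrow> 'w tens" where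
  "bullet_hom 0 = (\<lambda>a w. a * w)"
| "bullet_hom (Suc n) = (\<lambda>x w.
     add_ext (VecA \<times> tpow TVec n) (\<lambda>(u, v). vc u * v)
       (\<lambda>(u, v). vec_bullet u (bullet_hom n v w)
                   - bullet_hom n (ev_id (vc u * box_Vec n v)) w) x)"

definition bullet :: "'w tens \<Rightarrow> 'w tens \<Rightarrow> 'w tens" (infixl "\<bullet>" 70) where
  "v \<bullet> w = add_ext (SIGMA n:UNIV. tpow TVec n) snd (\<lambda>(n, v). bullet_hom n v w) v"

fun del_iter ::
    "'w tens set \<Rightarrow> ('w tens \<Rightarrow> 'w tens) \<Rightarrow> nat \<Rightarrow> 'w tens \<Rightarrow> 'w tens" where
  "del_iter E dE 0 e = e"
| "del_iter E dE (Suc 0) e = dE e"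
| "del_iter E dE (Suc (Suc n)) e =
     add_ext (tpow (TOm10 J) (Suc n) \<times> E) (\<lambda>(x, e'). x * e')
       (\<lambda>(x, e'). tmap (tpow TOm (Suc n)) TOm {1} (fmap1 (proj J 1 0)) (box_Om (Suc n) x) * e'
                    + x * dE e')
       (del_iter E dE (Suc n) e)"

definition act :: "'w tens set \<Rightarrow> ('w tens \<Rightarrow> 'w tens) \<Rightarrow> 'w tens \<Rightarrow> 'w tens \<Rightarrow> 'w tens" where
  "act E dE v e =
     add_ext (SIGMA n:UNIV. tpow (TVec10 J) n) snd
       (\<lambda>(n, v). tmap {1} (tpow TVec n \<otimes>\<^sub>A tpow TOm n) E (evn n) (v * del_iter E dE n e)) v"

definition TVecs10 :: "'w tens set" where
  "TVecs10 = tpowers (TVec10 J)"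

text \<open>$E = \Omega^{0,1}A\otimes_A\mathcal T\mathrm{Vec}^{*,0}A_\bullet$ with its derivative and its
  right multiplication $(\xi\otimes\underline x)\bullet\underline w$.\<close>

definition E01 :: "'w tens set" where
  "E01 = TOm01 J \<otimes>\<^sub>A TVecs10"

definition del_E01 :: "'w tens \<Rightarrow> 'w tens" where
  "del_E01 = add_ext (Om_pq J 0 1 \<times> TVecs10) (\<lambda>(\<xi>, w). fm \<xi> * w)
     (\<lambda>(\<xi>, w). phi J (proj J 1 1 (dif \<xi>)) * w
        - (\<Sum>(\<eta>, h)\<leftarrow>etas. phi J (\<xi> * \<eta>) * (vc h \<bullet> w)))"

definition E01_bullet :: "'w tens \<Rightarrow> 'w tens \<Rightarrow> 'w tens" where
  "E01_bullet y w = tmap (TOm01 J) TVecs10 {1} (\<lambda>x. x \<bullet> w) y"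

definition act_E01 :: "'w tens \<Rightarrow> 'w tens \<Rightarrow> 'w tens" where
  "act_E01 = act E01 del_E01"

text \<open>The last two terms of the recursion for $\bar\partial_{\mathcal{HD}}(u\bullet\underline v)$,
  as functions of $\xi\otimes\underline w = \bar\partial_{\mathcal{HD}}(\underline v)$.\<close>

definition HD_correction :: "('w \<Rightarrow> 'w) \<Rightarrow> 'w tens \<Rightarrow> 'w tens" where
  "HD_correction u = add_ext (Om_pq J 0 1 \<times> TVecs10) (\<lambda>(\<xi>, w). fm \<xi> * w)
     (\<lambda>(\<xi>, w). - ev_id (vc u * phi J (wedge (tens2 (proj J 0 1) (proj J 1 0) (box \<xi>)))) * w
        - (\<Sum>(\<eta>, h)\<leftarrow>etas. ev_id (vc u * phi J (\<xi> * \<eta>)) * (vc h \<bullet> w)))"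

text \<open>
  The graph of $\bar\partial_{\mathcal{HD}}$, as the additive relation generated by the recursion.
  It is single valued, and total on $\mathcal T\mathrm{Vec}^{*,0}A$, under the hypotheses a)--d)
  on $\square$. The left $\bar\partial$-Leibniz rule is a consequence.
\<close>

inductive_set HD_graph :: "('w tens \<times> 'w tens) set" where
  scalar: "a \<in> Om 0 \<Longrightarrow> (sc a, fm (delbar J 0 0 a)) \<in> HD_graph"
| vector: "u \<in> Vec10 J \<Longrightarrow> (vc u, p01_id J (box_vec u)) \<in> HD_graph"
| bullet: "u \<in> Vec10 J \<Longrightarrow> v \<in> tpow (TVec10 J) n \<Longrightarrow> (v, y) \<in> HD_graph \<Longrightarrow>
    (vc u \<bullet> v, E01_bullet (p01_id J (box_vec u)) v + HD_correction u y) \<in> HD_graph"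
| diff: "(x, y) \<in> HD_graph \<Longrightarrow> (x', y') \<in> HD_graph \<Longrightarrow> (x - x', y - y') \<in> HD_graph"

definition HD :: "'w tens \<Rightarrow> 'w tens" where
  "HD v = (THE y. (v, y) \<in> HD_graph)"

end

end

theory Submission
  imports Defs "HOL-Library.Function_Algebras"
begin

text \<open>
The tensor algebra is the direct sum of \<open>A\<close> and \<open>(\<Omega>\<^sup>1A \<oplus> VecA) \<otimes> T\<close>, so an additive map out of it is
given by formulas balanced over \<open>A\<close>. Conditions b)--d) turn the two correction terms in the recursion
for the holomorphic differential of \<open>u \<bullet> v\<close> into \<open>u \<triangleright> y\<close>, where \<open>y\<close> is the differential of \<open>v\<close>. The
recursion is thus the asserted rule for \<open>u\<close> of degree one, and it is balanced because the action is
compatible with the module structures. For left factors of higher degree write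
\<open>u \<otimes> v = u \<bullet> v - (ev \<otimes> id)(u \<otimes> \<box>v)\<close> and use induction on the degree, associativity of \<open>\<bullet>\<close>
and the action property.
\<close>

section \<open>Additive maps on subgroups\<close>

text \<open>Nearly every map here is given by a formula on elementary tensors and means something
  only once that formula is known to respect all relations between them. Relations inside a
  sub-bimodule of the tensor algebra are controlled by projecting onto it, which is where the
  projections of type (1,0) and (0,1) enter. The universal property splits off the first letter,
  whereas the iterated derivatives split off the last form or the element of \<open>E\<close>. These
  are tested by evaluation against vector fields instead, under which they are dual to the
  derivative on vector fields. For the holomorphic differential the critical point is moving a
  scalar a from u to v in u \<otimes> v. There b) keeps the types apart, d) gives \<sigma> the shape
  of the wedge term in the derivative on \<open>E\<close>, and c) together with dda = 0 makes the
  remaining terms cancel.\<close>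

definition sgrp :: "'x::ab_group_add set \<Rightarrow> bool" where
  "sgrp S \<longleftrightarrow> 0 \<in> S \<and> (\<forall>x\<in>S. \<forall>y\<in>S. x - y \<in> S)"

text \<open>Differences are used because they are the inductive step of
  \<open>group_closure\<close>. The function is total, but only its values on \<open>S\<close> are
  constrained.\<close>

definition add_on :: "'x::ab_group_add set \<Rightarrow> ('x \<Rightarrow> 'y::ab_group_add) \<Rightarrow> bool" where
  "add_on S f \<longleftrightarrow> sgrp S \<and> (\<forall>x\<in>S. \<forall>y\<in>S. f (x - y) = f x - f y)"

lemma sgrp_zero: "sgrp S \<Longrightarrow> 0 \<in> S"
  and sgrp_diff: "sgrp S \<Longrightarrow> x \<in> S \<Longrightarrow> y \<in> S \<Longrightarrow> x - y \<in> S"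
  by (auto simp: sgrp_def)

lemma sgrp_uminus: "sgrp S \<Longrightarrow> x \<in> S \<Longrightarrow> - x \<in> S"
  using sgrp_diff[of S 0 x] by (simp add: sgrp_def)

lemma sgrp_add: "sgrp S \<Longrightarrow> x \<in> S \<Longrightarrow> y \<in> S \<Longrightarrow> x + y \<in> S"
  using sgrp_diff[of S x "- y"] by (simp add: sgrp_uminus)

lemma sgrp_sum: "sgrp S \<Longrightarrow> (\<And>i. i \<in> I \<Longrightarrow> f i \<in> S) \<Longrightarrow> sum f I \<in> S"
  by (induction I rule: infinite_finite_induct) (auto simp: sgrp_zero sgrp_add)

lemma sgrp_UNIV [simp]: "sgrp UNIV"
  by (simp add: sgrp_def)

lemma sgrp_group_closure [simp]: "sgrp (group_closure G)"
  by (simp add: sgrp_def group_closure.diff)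

lemma group_closure_gen: "x \<in> G \<Longrightarrow> x \<in> group_closure G"
  by (simp add: group_closure.base)

lemma group_closure_subset: "G \<subseteq> S \<Longrightarrow> sgrp S \<Longrightarrow> group_closure G \<subseteq> S"
proof
  fix x assume "G \<subseteq> S" "sgrp S" "x \<in> group_closure G"
  from this(3) this(1,2) show "x \<in> S"
    by induction (auto simp: sgrp_def)
qed

lemma group_closure_mono: "G \<subseteq> H \<Longrightarrow> group_closure G \<subseteq> group_closure H"
  by (rule group_closure_subset) (auto intro: group_closure_gen)

lemma group_closure_sgrp: "sgrp S \<Longrightarrow> group_closure S = S"
  using group_closure_subset[of S S] by (auto intro: group_closure_gen)

lemma add_onI: "sgrp S \<Longrightarrow> (\<And>x y. x \<in> S \<Longrightarrow> y \<in> S \<Longrightarrow> f (x - y) = f x - f y) \<Longrightarrow> add_on S f"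
  by (simp add: add_on_def)

lemma add_onI_plus:
  assumes "sgrp S" and add: "\<And>x y. x \<in> S \<Longrightarrow> y \<in> S \<Longrightarrow> f (x + y) = f x + f y"
  shows "add_on S f"
proof (rule add_onI[OF assms(1)])
  fix x y assume "x \<in> S" "y \<in> S"
  then show "f (x - y) = f x - f y"
    using add[of "x - y" y] sgrp_diff[OF assms(1)] by simp
qed

lemma add_on_sgrp: "add_on S f \<Longrightarrow> sgrp S"
  by (simp add: add_on_def)

lemma add_on_diff: "add_on S f \<Longrightarrow> x \<in> S \<Longrightarrow> y \<in> S \<Longrightarrow> f (x - y) = f x - f y"
  by (simp add: add_on_def)

lemma add_on_zero: "add_on S f \<Longrightarrow> f 0 = 0"
  using add_on_diff[of S f 0 0] by (simp add: add_on_def sgrp_def)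

lemma add_on_uminus: "add_on S f \<Longrightarrow> x \<in> S \<Longrightarrow> f (- x) = - f x"
  using add_on_diff[of S f 0 x] add_on_zero[of S f] by (simp add: add_on_def sgrp_def)

lemma add_on_add: "add_on S f \<Longrightarrow> x \<in> S \<Longrightarrow> y \<in> S \<Longrightarrow> f (x + y) = f x + f y"
  using add_on_diff[of S f x "- y"] add_on_uminus[of S f y] sgrp_uminus[of S y]
  by (simp add: add_on_def)

lemma add_on_sum:
  "add_on S f \<Longrightarrow> (\<And>i. i \<in> I \<Longrightarrow> g i \<in> S) \<Longrightarrow> f (sum g I) = (\<Sum>i\<in>I. f (g i))"
  by (induction I rule: infinite_finite_induct)
    (auto simp: add_on_zero add_on_add add_on_sgrp sgrp_sum)

lemma add_on_subset: "add_on S f \<Longrightarrow> T \<subseteq> S \<Longrightarrow> sgrp T \<Longrightarrow> add_on T f"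
  by (auto simp: add_on_def)

lemma add_on_comp:
  "add_on S f \<Longrightarrow> add_on T g \<Longrightarrow> (\<And>x. x \<in> S \<Longrightarrow> f x \<in> T) \<Longrightarrow> add_on S (\<lambda>x. g (f x))"
  by (auto simp: add_on_def)

lemma add_on_eq:
  assumes "x \<in> group_closure G" "add_on S f" "add_on S g" "G \<subseteq> S" "\<And>x. x \<in> G \<Longrightarrow> f x = g x"
  shows "f x = g x"
proof -
  have "x \<in> S \<and> f x = g x"
    using assms(1)
  proof induction
    case (base s)
    then show ?case
      using assms(2-) by (auto simp: add_on_zero dest: add_on_sgrp sgrp_zero)
  next
    case (diff s t)
    then show ?case
      using assms(2,3) by (auto simp: add_on_diff dest: add_on_sgrp sgrp_diff)
  qed
  then show ?thesis ..
qed

lemma add_on_into: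
  assumes "x \<in> group_closure G" "add_on S f" "G \<subseteq> S" "sgrp T" "\<And>x. x \<in> G \<Longrightarrow> f x \<in> T"
  shows "f x \<in> T"
proof -
  have "x \<in> S \<and> f x \<in> T"
    using assms(1)
  proof induction
    case (base s)
    then show ?case
      using assms(2-) by (auto simp: add_on_zero sgrp_zero dest: add_on_sgrp sgrp_zero)
  next
    case (diff s t)
    then show ?case
      using assms(2-) by (auto simp: add_on_diff sgrp_diff dest: add_on_sgrp sgrp_diff)
  qed
  then show ?thesis ..
qed

text \<open>A compatibility of \<open>F\<close> and \<open>G\<close> on generators propagates along
  the whole generated relation. Allowing \<open>G\<close> other than the identity makes it possible
  to test values through a family of functionals, as is done later with evaluations against vector
  fields.\<close>

lemma add_ext_rel:
  assumes "(x, y) \<in> group_closure ((\<lambda>i. (b i, f i)) ` I)"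
    and "add_on S F" "b ` I \<subseteq> S" "add_on UNIV G" "\<And>i. i \<in> I \<Longrightarrow> F (b i) = G (f i)"
  shows "F x = G y"
proof -
  have "fst z \<in> S \<and> F (fst z) = G (snd z)" if "z \<in> group_closure ((\<lambda>i. (b i, f i)) ` I)" for z
    using that
  proof induction
    case (base s)
    then show ?case
      using assms(2-) sgrp_zero[OF add_on_sgrp[OF assms(2)]] by (auto simp: add_on_zero)
  next
    case (diff s t)
    then show ?case
      using assms(2,4) by (auto simp: add_on_diff dest: add_on_sgrp sgrp_diff)
  qed
  from this[OF assms(1)] show ?thesis by simp
qed

text \<open>An additive \<open>F\<close> with the prescribed values settles existence and uniqueness
  at once: its graph contains the generators, and \<open>add_ext_rel\<close> with the identity gives
  uniqueness.\<close>

lemma add_ext_unique: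
  assumes F: "add_on S F" "b ` I \<subseteq> S" "\<And>i. i \<in> I \<Longrightarrow> F (b i) = f i"
    and x: "x \<in> group_closure (b ` I)"
  shows "add_ext I b f x = F x"
  unfolding add_ext_def
proof (rule the_equality)
  from x have "x \<in> S \<and> (x, F x) \<in> group_closure ((\<lambda>i. (b i, f i)) ` I)"
  proof induction
    case (base s)
    then show ?case
      using F sgrp_zero[OF add_on_sgrp[OF F(1)]]
      by (auto simp: add_on_zero zero_prod_def[symmetric] intro: group_closure_gen)
  next
    case (diff s t)
    then show ?case
      using F(1) group_closure.diff[of "(s, F s)" "(\<lambda>i. (b i, f i)) ` I" "(t, F t)"]
      by (auto simp: add_on_diff dest: add_on_sgrp sgrp_diff)
  qed
  then show "(x, F x) \<in> group_closure ((\<lambda>i. (b i, f i)) ` I)" ..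
  show "y = F x" if "(x, y) \<in> group_closure ((\<lambda>i. (b i, f i)) ` I)" for y
    using add_ext_rel[OF that F(1,2), of "\<lambda>y. y"] F(3) by (simp add: add_on_def)
qed

text \<open>Being single valued over 0 is enough, since two values over one point differ by a value
  over 0.\<close>

lemma add_ext_ok:
  assumes "add_ext_ok I b f"
  shows add_on_add_ext: "add_on (group_closure (b ` I)) (add_ext I b f)"
    and add_ext_gen: "i \<in> I \<Longrightarrow> add_ext I b f (b i) = f i"
proof -
  let ?G = "group_closure ((\<lambda>i. (b i, f i)) ` I)"
  have uniq: "y = y'" if "(x, y) \<in> ?G" "(x, y') \<in> ?G" for x y y'
    using assms group_closure.diff[OF that] by (auto simp: add_ext_ok_def)
  have ex: "\<exists>y. (x, y) \<in> ?G" if "x \<in> group_closure (b ` I)" for x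
    using that
  proof induction
    case (base s)
    then consider "s = 0" | i where "i \<in> I" "s = b i" by auto
    then show ?case
    proof cases
      case 1
      then show ?thesis by (auto simp: zero_prod_def[symmetric] intro!: exI[of _ 0])
    next
      case 2
      then show ?thesis by (auto intro!: exI[of _ "f i"] group_closure_gen)
    qed
  next
    case (diff s t)
    then show ?case
      using group_closure.diff[of "(s, _)" _ "(t, _)"] by fastforce
  qed
  have eq: "add_ext I b f x = y" if "(x, y) \<in> ?G" for x y
    unfolding add_ext_def using uniq that by blast
  show "add_on (group_closure (b ` I)) (add_ext I b f)"
  proof (rule add_onI)
    fix x y assume "x \<in> group_closure (b ` I)" "y \<in> group_closure (b ` I)"
    then obtain x' y' where xy: "(x, x') \<in> ?G" "(y, y') \<in> ?G" using ex by blast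
    show "add_ext I b f (x - y) = add_ext I b f x - add_ext I b f y"
      using eq[OF group_closure.diff[OF xy, simplified]] eq[OF xy(1)] eq[OF xy(2)] by simp
  qed simp
  show "add_ext I b f (b i) = f i" if "i \<in> I"
    by (rule eq) (auto intro: group_closure_gen that)
qed

lemma add_ext_okI:
  assumes "add_on S F" "b ` I \<subseteq> S" "\<And>i. i \<in> I \<Longrightarrow> F (b i) = f i"
  shows "add_ext_ok I b f"
  unfolding add_ext_ok_def
  using add_ext_rel[OF _ assms(1,2), of 0 _ f "\<lambda>y. y"] assms(3) add_on_zero[OF assms(1)]
  by (fastforce simp: add_on_def)

section \<open>Modules over the tensor algebra\<close>

text \<open>An additive group on which the symbols act additively and compatibly with the relators is a
  module over the tensor algebra. As a general abelian group carries no notation for integer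
  multiples, these are introduced by hand.\<close>

definition zmul :: "int \<Rightarrow> 'n::ab_group_add \<Rightarrow> 'n" where
  "zmul k g = (\<Sum>i<nat k. g) - (\<Sum>i<nat (- k). g)"

lemma zmul_Suc: "zmul (k + 1) g = zmul k g + g"
proof (cases "k \<ge> 0")
  case True
  then show ?thesis by (simp add: zmul_def nat_add_distrib)
next
  case False
  then have "nat (- k) = Suc (nat (- (k + 1)))" "nat k = 0" "nat (k + 1) = 0" by auto
  then show ?thesis by (simp add: zmul_def)
qed

lemma zmul_0: "zmul 0 g = 0" and zmul_1: "zmul 1 g = g"
  by (simp_all add: zmul_def)

lemma zmul_pred: "zmul (k - 1) g = zmul k g - g"
  using zmul_Suc[of "k - 1" g] by (simp add: algebra_simps)

lemma zmul_add: "zmul (j + k) g = zmul j g + zmul k g"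
proof (induction k rule: int_induct[of _ 0])
  case (step1 k)
  then show ?case using zmul_Suc[of "j + k" g] by (simp add: zmul_Suc add.assoc)
next
  case (step2 k)
  then show ?case using zmul_pred[of "j + k" g] by (simp add: zmul_pred algebra_simps)
qed (simp add: zmul_0)

text \<open>The universal map out of the free abelian group on \<open>'k\<close>.\<close>

definition lin_ext :: "('k \<Rightarrow> 'n::ab_group_add) \<Rightarrow> ('k \<Rightarrow>\<^sub>0 int) \<Rightarrow> 'n" where
  "lin_ext \<phi> p = Sum_any (\<lambda>k. zmul (Poly_Mapping.lookup p k) (\<phi> k))"

lemma lin_ext_add: "lin_ext \<phi> (p + q) = lin_ext \<phi> p + lin_ext \<phi> q"
proof -
  have fin: "finite {k. zmul (Poly_Mapping.lookup p k) (\<phi> k) \<noteq> 0}" for p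
    by (rule finite_subset[OF _ finite_lookup[of p]]) (auto simp: zmul_0)
  show ?thesis
    unfolding lin_ext_def by (simp add: lookup_add zmul_add Sum_any.distrib fin)
qed

lemma add_on_lin_ext: "add_on UNIV (lin_ext \<phi>)"
  by (rule add_onI_plus) (simp_all add: lin_ext_add)

lemma lin_ext_single: "lin_ext \<phi> (Poly_Mapping.single k c) = zmul c (\<phi> k)"
proof -
  have "lin_ext \<phi> (Poly_Mapping.single k c) = Sum_any (\<lambda>j. zmul c (\<phi> k) when j = k)"
    unfolding lin_ext_def
    by (rule Sum_any.cong) (auto simp: lookup_single when_def zmul_0)
  then show ?thesis by simp
qed

lemma free_induct [case_names zero single diff]:
  fixes p :: "'k \<Rightarrow>\<^sub>0 int"
  assumes "P 0" and "\<And>k. P (Poly_Mapping.single k 1)"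
    and "\<And>p q. P p \<Longrightarrow> P q \<Longrightarrow> P (p - q)"
  shows "P p"
  by (rule frag_induction[of p UNIV]) (use assms in auto)

text \<open>Letters act from the last to the first, so a product of words acts as a composition, as
  in a left module.\<close>

definition free_act ::
    "('w atom \<Rightarrow> 'n \<Rightarrow> 'n::ab_group_add) \<Rightarrow> 'w free_tens \<Rightarrow> 'n \<Rightarrow> 'n" where
  "free_act \<alpha> p n = lin_ext (\<lambda>m. case m of FM xs \<Rightarrow> foldr \<alpha> xs n) p"

lemma free_act_diff_left: "free_act \<alpha> (p - q) n = free_act \<alpha> p n - free_act \<alpha> q n"
  unfolding free_act_def using add_on_diff[OF add_on_lin_ext] by blast

lemma free_act_zero: "free_act \<alpha> 0 n = 0"
  using free_act_diff_left[of \<alpha> 0 0 n] by simp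

lemma free_act_gen: "free_act \<alpha> (gen t) n = \<alpha> t n"
  by (simp add: free_act_def gen_def lin_ext_single zmul_1)

lemma free_act_one: "free_act \<alpha> 1 n = n"
  by (simp add: free_act_def single_one[symmetric] lin_ext_single zmul_1 zero_free_monoid_def)

context
  fixes \<alpha> :: "'w::graded_complex_algebra atom \<Rightarrow> 'n \<Rightarrow> 'n::ab_group_add"
  assumes \<alpha>: "\<And>t. add_on UNIV (\<alpha> t)"
begin

lemma add_on_foldr: "add_on UNIV (foldr \<alpha> xs)"
proof (induction xs)
  case (Cons t xs)
  then show ?case using add_on_comp[OF Cons \<alpha>[of t]] by (simp add: comp_def)
qed (simp add: add_on_def)

lemma add_on_free_act: "add_on UNIV (free_act \<alpha> p)"
proof (induction p rule: free_induct)
  case (single k)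
  obtain xs where "k = FM xs" by (cases k)
  then have "free_act \<alpha> (Poly_Mapping.single k 1) = foldr \<alpha> xs"
    by (simp add: free_act_def lin_ext_single zmul_1 fun_eq_iff)
  then show ?case using add_on_foldr by simp
next
  case (diff p q)
  then show ?case
    by (simp add: add_on_def free_act_diff_left)
qed (simp add: add_on_def free_act_zero)

lemma free_act_mult: "free_act \<alpha> (p * q) n = free_act \<alpha> p (free_act \<alpha> q n)"
proof (induction p rule: free_induct)
  case (single k)
  show ?case
  proof (induction q rule: free_induct)
    case (single l)
    obtain xs ys where "k = FM xs" "l = FM ys" by (cases k; cases l)
    then show ?case
      by (simp add: mult_single free_act_def lin_ext_single zmul_1)
  next
    case (diff p q)
    then show ?case
      by (simp add: right_diff_distrib free_act_diff_left add_on_diff[OF add_on_free_act])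
  qed (simp add: free_act_zero add_on_zero[OF add_on_free_act])
next
  case (diff p q)
  then show ?case by (simp add: left_diff_distrib free_act_diff_left)
qed (simp add: free_act_zero)

end

lemma relator_ideal: "r \<in> tens_relators \<Longrightarrow> r \<in> tens_ideal"
  unfolding tens_ideal_def by (rule group_closure_gen, rule CollectI, rule exI[of _ 1], rule exI[of _ r], rule exI[of _ 1]) simp

lemma Om_0_mult: "a \<in> Om 0 \<Longrightarrow> x \<in> Om n \<Longrightarrow> a * x \<in> Om n"
  and Om_mult_0: "x \<in> Om n \<Longrightarrow> a \<in> Om 0 \<Longrightarrow> x * a \<in> Om n"
  using Om_mult[of a 0 x n] Om_mult[of x n a 0] by simp_all

lemma cscale_minus_one: "cscale (- 1) x = - (x :: 'w::graded_complex_algebra)"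
proof -
  have "cscale 0 x = 0" using cscale_add_left[of 0 0 x] by simp
  then show ?thesis
    using cscale_add_left[of "-1" 1 x] by (simp add: cscale_one eq_neg_iff_add_eq_0)
qed

lemma sgrp_Om [simp]: "sgrp (Om n)"
proof -
  have "- x \<in> Om n" if "x \<in> Om n" for x :: 'a
    using Om_cscale[OF that, of "-1"] by (simp add: cscale_minus_one)
  then show ?thesis
    using Om_add[of _ n "- _"] by (fastforce simp: sgrp_def Om_zero)
qed

lemma sc_add: "a \<in> Om 0 \<Longrightarrow> b \<in> Om 0 \<Longrightarrow> sc (a + b) = sc a + sc b"
  by transfer (use relator_ideal[OF tens_relators.sc_add] in \<open>simp add: tens_eq_def algebra_simps\<close>)

lemma sc_mult: "a \<in> Om 0 \<Longrightarrow> b \<in> Om 0 \<Longrightarrow> sc (a * b) = sc a * sc b"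
  by transfer (use relator_ideal[OF tens_relators.sc_mult] in \<open>simp add: tens_eq_def algebra_simps\<close>)

lemma sc_one [simp]: "sc 1 = 1"
  by transfer (use relator_ideal[OF tens_relators.sc_one] in \<open>simp add: tens_eq_def algebra_simps\<close>)

lemma sc_junk: "a \<notin> Om 0 \<Longrightarrow> sc a = 0"
  by transfer (use relator_ideal[OF tens_relators.sc_junk] in \<open>simp add: tens_eq_def algebra_simps\<close>)

lemma fm_add: "\<xi> \<in> Om 1 \<Longrightarrow> \<eta> \<in> Om 1 \<Longrightarrow> fm (\<xi> + \<eta>) = fm \<xi> + fm \<eta>"
  by transfer (use relator_ideal[OF tens_relators.fm_add] in \<open>simp add: tens_eq_def algebra_simps\<close>)

lemma fm_left: "a \<in> Om 0 \<Longrightarrow> \<xi> \<in> Om 1 \<Longrightarrow> fm (a * \<xi>) = sc a * fm \<xi>"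
  by transfer (use relator_ideal[OF tens_relators.fm_left] in \<open>simp add: tens_eq_def algebra_simps\<close>)

lemma fm_right: "\<xi> \<in> Om 1 \<Longrightarrow> a \<in> Om 0 \<Longrightarrow> fm (\<xi> * a) = fm \<xi> * sc a"
  by transfer (use relator_ideal[OF tens_relators.fm_right] in \<open>simp add: tens_eq_def algebra_simps\<close>)

lemma fm_junk: "\<xi> \<notin> Om 1 \<Longrightarrow> fm \<xi> = 0"
  by transfer (use relator_ideal[OF tens_relators.fm_junk] in \<open>simp add: tens_eq_def algebra_simps\<close>)

lemma vc_add: "u \<in> VecA \<Longrightarrow> v \<in> VecA \<Longrightarrow> vc (vadd u v) = vc u + vc v"
  by transfer (use relator_ideal[OF tens_relators.vc_add] in \<open>simp add: tens_eq_def algebra_simps\<close>)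

lemma vc_left: "a \<in> Om 0 \<Longrightarrow> v \<in> VecA \<Longrightarrow> vc (vlact a v) = sc a * vc v"
  by transfer (use relator_ideal[OF tens_relators.vc_left] in \<open>simp add: tens_eq_def algebra_simps\<close>)

lemma vc_right: "v \<in> VecA \<Longrightarrow> a \<in> Om 0 \<Longrightarrow> vc (vract v a) = vc v * sc a"
  by transfer (use relator_ideal[OF tens_relators.vc_right] in \<open>simp add: tens_eq_def algebra_simps\<close>)

lemma vc_junk: "v \<notin> VecA \<Longrightarrow> vc v = 0"
  by transfer (use relator_ideal[OF tens_relators.vc_junk] in \<open>simp add: tens_eq_def algebra_simps\<close>)

lemma add_on_sc: "add_on (Om 0) sc" and add_on_fm: "add_on (Om 1) fm"
  by (simp_all add: add_onI_plus sc_add fm_add)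

section \<open>Words and normal forms in the tensor algebra\<close>

definition tens_word :: "'w::graded_complex_algebra atom list \<Rightarrow> 'w tens" where
  "tens_word xs = abs_tens (Poly_Mapping.single (FM xs) 1)"

definition tens_atom :: "'w::graded_complex_algebra atom \<Rightarrow> 'w tens" where
  "tens_atom t = abs_tens (gen t)"

lemma tens_atom_simps: "tens_atom (Sc a) = sc a" "tens_atom (Fm \<xi>) = fm \<xi>" "tens_atom (Vc v) = vc v"
  by (simp_all add: tens_atom_def sc.abs_eq fm.abs_eq vc.abs_eq)

lemma tens_word_Nil: "tens_word [] = 1"
  by (simp add: tens_word_def one_tens.abs_eq single_one[symmetric] zero_free_monoid_def)

lemma tens_word_Cons: "tens_word (t # xs) = tens_atom t * tens_word xs"
  by (simp add: tens_word_def tens_atom_def gen_def times_tens.abs_eq mult_single)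

lemma tens_word_induct [case_names word diff]:
  assumes "\<And>xs. P (tens_word xs)" and "\<And>x y. P x \<Longrightarrow> P y \<Longrightarrow> P (x - y)"
  shows "P x"
proof (induction x rule: tens.abs_induct)
  case (1 p)
  show ?case
  proof (induction p rule: free_induct)
    case zero
    have "abs_tens 0 = tens_word [] - tens_word []" by (simp add: zero_tens.abs_eq[symmetric])
    then show ?case using assms by metis
  next
    case (single k)
    then show ?case using assms(1) by (cases k) (simp add: tens_word_def)
  next
    case (diff p q)
    then show ?case using assms(2) by (simp add: minus_tens.abs_eq[symmetric])
  qed
qed

text \<open>Normal form of a tensor: a scalar letter is absorbed into the letter behind it, so
  differences of scalars and of elements that begin with a form or a vector field reach
  everything.\<close>

lemma tens_induct [case_names sc fm vc diff]:
  assumes sc: "\<And>a. a \<in> Om 0 \<Longrightarrow> P (sc a)"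
    and fm: "\<And>\<xi> y. \<xi> \<in> Om 1 \<Longrightarrow> P y \<Longrightarrow> P (fm \<xi> * y)"
    and vc: "\<And>u y. u \<in> VecA \<Longrightarrow> P y \<Longrightarrow> P (vc u * y)"
    and diff: "\<And>x y. P x \<Longrightarrow> P y \<Longrightarrow> P (x - y)"
  shows "P x"
proof -
  have zero: "P 0"
    using diff[OF sc sc, of 1 1] by (simp add: Om_one)
  \<comment> \<open>A scalar in front is carried along, so that leading scalar letters of the word
    merge into it.\<close>
  have "\<forall>a\<in>Om 0. P (sc a * tens_word xs)" for xs
  proof (induction xs)
    case Nil
    then show ?case using sc by (simp add: tens_word_Nil)
  next
    case (Cons t xs)
    have P: "P (tens_word xs)" using bspec[OF Cons Om_one] by simp
    show ?case
    proof
      fix a :: 'a assume a: "a \<in> Om 0"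
      show "P (sc a * tens_word (t # xs))"
      proof (cases t)
        case (Sc b)
        show ?thesis
          using Cons a zero
          by (cases "b \<in> Om 0") (simp_all add: tens_word_Cons tens_atom_simps Sc sc_junk
              sc_mult[symmetric] mult.assoc[symmetric] Om_0_mult)
      next
        case (Fm \<xi>)
        show ?thesis
          using fm[of "a * \<xi>", OF _ P] a zero
          by (cases "\<xi> \<in> Om 1") (simp_all add: tens_word_Cons tens_atom_simps Fm fm_junk
              fm_left mult.assoc[symmetric] Om_0_mult)
      next
        case (Vc u)
        have "u \<in> VecA \<Longrightarrow> vlact a u \<in> VecA"
          using a by (auto simp: VecA_def vlact_def algebra_simps Om_0_mult)
        then show ?thesis
          using vc[of "vlact a u", OF _ P] a zero
          by (cases "u \<in> VecA") (simp_all add: tens_word_Cons tens_atom_simps Vc vc_junk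
              vc_left mult.assoc[symmetric])
      qed
    qed
  qed
  from bspec[OF this Om_one] have "P (tens_word xs)" for xs by simp
  then show ?thesis using diff by (induction x rule: tens_word_induct) auto
qed

lemma tens_ext:
  assumes "add_on UNIV f" "add_on UNIV g" "\<And>a. a \<in> Om 0 \<Longrightarrow> f (sc a) = g (sc a)"
    and "\<And>\<xi> y. \<xi> \<in> Om 1 \<Longrightarrow> f (fm \<xi> * y) = g (fm \<xi> * y)"
    and "\<And>u y. u \<in> VecA \<Longrightarrow> f (vc u * y) = g (vc u * y)"
  shows "f x = g x"
  by (induction x rule: tens_induct) (simp_all add: assms add_on_diff[OF assms(1)] add_on_diff[OF assms(2)])

text \<open>The chosen representative is harmless on a subgroup where the relators act as 0; see
  \<open>tens_act_abs\<close>.\<close>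

definition tens_act ::
    "('w::graded_complex_algebra atom \<Rightarrow> 'n \<Rightarrow> 'n::ab_group_add) \<Rightarrow> 'w tens \<Rightarrow> 'n \<Rightarrow> 'n" where
  "tens_act \<alpha> x = free_act \<alpha> (rep_tens x)"

text \<open>The relators are required only on an invariant subgroup \<open>S\<close>. In the
  coinduced module used for \<open>tens_rec\<close> the ambient type also contains functions of the
  scalar that are not additive or do not vanish off \<open>Om 0\<close>, and on those the scalar
  relators can fail.\<close>

locale tens_action =
  fixes S :: "'n::ab_group_add set" and \<alpha> :: "'w::graded_complex_algebra atom \<Rightarrow> 'n \<Rightarrow> 'n"
  assumes additive: "add_on UNIV (\<alpha> t)"
    and subgroup: "sgrp S"
    and closed: "n \<in> S \<Longrightarrow> \<alpha> t n \<in> S"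
    and sc_add: "n \<in> S \<Longrightarrow> a \<in> Om 0 \<Longrightarrow> b \<in> Om 0 \<Longrightarrow> \<alpha> (Sc (a + b)) n = \<alpha> (Sc a) n + \<alpha> (Sc b) n"
    and sc_mult: "n \<in> S \<Longrightarrow> a \<in> Om 0 \<Longrightarrow> b \<in> Om 0 \<Longrightarrow> \<alpha> (Sc (a * b)) n = \<alpha> (Sc a) (\<alpha> (Sc b) n)"
    and sc_one: "n \<in> S \<Longrightarrow> \<alpha> (Sc 1) n = n"
    and sc_junk: "n \<in> S \<Longrightarrow> a \<notin> Om 0 \<Longrightarrow> \<alpha> (Sc a) n = 0"
    and fm_add: "n \<in> S \<Longrightarrow> \<xi> \<in> Om 1 \<Longrightarrow> \<eta> \<in> Om 1 \<Longrightarrow> \<alpha> (Fm (\<xi> + \<eta>)) n = \<alpha> (Fm \<xi>) n + \<alpha> (Fm \<eta>) n"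
    and fm_left: "n \<in> S \<Longrightarrow> a \<in> Om 0 \<Longrightarrow> \<xi> \<in> Om 1 \<Longrightarrow> \<alpha> (Fm (a * \<xi>)) n = \<alpha> (Sc a) (\<alpha> (Fm \<xi>) n)"
    and fm_right: "n \<in> S \<Longrightarrow> \<xi> \<in> Om 1 \<Longrightarrow> a \<in> Om 0 \<Longrightarrow> \<alpha> (Fm (\<xi> * a)) n = \<alpha> (Fm \<xi>) (\<alpha> (Sc a) n)"
    and fm_junk: "n \<in> S \<Longrightarrow> \<xi> \<notin> Om 1 \<Longrightarrow> \<alpha> (Fm \<xi>) n = 0"
    and vc_add: "n \<in> S \<Longrightarrow> u \<in> VecA \<Longrightarrow> v \<in> VecA \<Longrightarrow> \<alpha> (Vc (vadd u v)) n = \<alpha> (Vc u) n + \<alpha> (Vc v) n"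
    and vc_left: "n \<in> S \<Longrightarrow> a \<in> Om 0 \<Longrightarrow> v \<in> VecA \<Longrightarrow> \<alpha> (Vc (vlact a v)) n = \<alpha> (Sc a) (\<alpha> (Vc v) n)"
    and vc_right: "n \<in> S \<Longrightarrow> v \<in> VecA \<Longrightarrow> a \<in> Om 0 \<Longrightarrow> \<alpha> (Vc (vract v a)) n = \<alpha> (Vc v) (\<alpha> (Sc a) n)"
    and vc_junk: "n \<in> S \<Longrightarrow> v \<notin> VecA \<Longrightarrow> \<alpha> (Vc v) n = 0"
begin

lemma free_act_closed: "n \<in> S \<Longrightarrow> free_act \<alpha> p n \<in> S"
proof (induction p rule: free_induct)
  case (single k)
  obtain xs where k: "k = FM xs" by (cases k)
  have "foldr \<alpha> xs n \<in> S" by (induction xs) (simp_all add: single closed)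
  then show ?case by (simp add: k free_act_def lin_ext_single zmul_1)
qed (simp_all add: free_act_zero free_act_diff_left sgrp_zero[OF subgroup] sgrp_diff[OF subgroup])

lemma free_act_ideal:
  assumes "p \<in> tens_ideal" "n \<in> S"
  shows "free_act \<alpha> p n = 0"
proof -
  have rel: "free_act \<alpha> r n = 0" if "r \<in> tens_relators" "n \<in> S" for r n
    using that
    by induction (simp_all add: free_act_diff_left free_act_gen free_act_one
        free_act_mult[OF additive] sc_add sc_mult sc_one sc_junk fm_add fm_left fm_right fm_junk
        vc_add vc_left vc_right vc_junk)
  show ?thesis
    using assms(1) unfolding tens_ideal_def
  proof induction
    case (base s)
    then show ?case
      using rel assms(2)
      by (auto simp: free_act_zero free_act_mult[OF additive] free_act_closed
          add_on_zero[OF add_on_free_act[OF additive]])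
  qed (simp add: free_act_diff_left)
qed

lemma tens_act_abs: "n \<in> S \<Longrightarrow> tens_act \<alpha> (abs_tens p) n = free_act \<alpha> p n"
proof -
  assume "n \<in> S"
  have "tens_eq (rep_tens (abs_tens p)) p"
    using Quotient3_rep_abs[OF Quotient3_tens] by (simp add: tens_eq_def tens_ideal_def)
  then have "free_act \<alpha> (rep_tens (abs_tens p) - p) n = 0"
    using \<open>n \<in> S\<close> by (intro free_act_ideal) (simp_all add: tens_eq_def)
  then show ?thesis by (simp add: tens_act_def free_act_diff_left)
qed

lemma act_sc: "n \<in> S \<Longrightarrow> tens_act \<alpha> (sc a) n = \<alpha> (Sc a) n"
  and act_fm: "n \<in> S \<Longrightarrow> tens_act \<alpha> (fm \<xi>) n = \<alpha> (Fm \<xi>) n"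
  and act_vc: "n \<in> S \<Longrightarrow> tens_act \<alpha> (vc v) n = \<alpha> (Vc v) n"
  by (simp_all add: sc.abs_eq fm.abs_eq vc.abs_eq tens_act_abs free_act_gen)

lemma act_closed: "n \<in> S \<Longrightarrow> tens_act \<alpha> x n \<in> S"
  by (simp add: tens_act_def free_act_closed)

lemma act_diff: "n \<in> S \<Longrightarrow> tens_act \<alpha> (x - y) n = tens_act \<alpha> x n - tens_act \<alpha> y n"
  by (induction x rule: tens.abs_induct, induction y rule: tens.abs_induct)
    (simp add: minus_tens.abs_eq tens_act_abs free_act_diff_left)

lemma act_mult: "n \<in> S \<Longrightarrow> tens_act \<alpha> (x * y) n = tens_act \<alpha> x (tens_act \<alpha> y n)"
  by (induction x rule: tens.abs_induct, induction y rule: tens.abs_induct)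
    (simp add: times_tens.abs_eq tens_act_abs free_act_closed free_act_mult[OF additive])

end

text \<open>The universal property of the tensor algebra as a left module: it is the direct sum of
  \<open>A\<close> and of \<open>(\<Omega>\<^sup>1A \<oplus> VecA) \<otimes>\<^sub>A T\<close>. Since the target of an additive map out of the second
  summand is only an abelian group, the module used for its construction is coinduced.\<close>

definition form_balanced :: "('w::graded_complex_algebra \<Rightarrow> 'w tens \<Rightarrow> 'g::ab_group_add) \<Rightarrow> bool" where
  "form_balanced f \<longleftrightarrow> (\<forall>\<xi>\<in>Om 1. add_on UNIV (f \<xi>)) \<and>
     (\<forall>\<xi>\<in>Om 1. \<forall>\<eta>\<in>Om 1. \<forall>y. f (\<xi> + \<eta>) y = f \<xi> y + f \<eta> y) \<and>
     (\<forall>\<xi>\<in>Om 1. \<forall>a\<in>Om 0. \<forall>y. f (\<xi> * a) y = f \<xi> (sc a * y))"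

definition vec_balanced ::
    "(('w::graded_complex_algebra \<Rightarrow> 'w) \<Rightarrow> 'w tens \<Rightarrow> 'g::ab_group_add) \<Rightarrow> bool" where
  "vec_balanced f \<longleftrightarrow> (\<forall>u\<in>VecA. add_on UNIV (f u)) \<and>
     (\<forall>u\<in>VecA. \<forall>v\<in>VecA. \<forall>y. f (vadd u v) y = f u y + f v y) \<and>
     (\<forall>u\<in>VecA. \<forall>a\<in>Om 0. \<forall>y. f (vract u a) y = f u (sc a * y))"

text \<open>The module consists of pairs. The first component reproduces the acting tensor; the
  second records, for every scalar a, the value of the map on a times that tensor, which is how the
  left action of \<open>A\<close> is stored although \<open>'g\<close> has none. Evaluating at a = 1
  after acting on \<open>(1, 0)\<close> gives a map that vanishes on \<open>A\<close>.\<close>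

definition tens_rec ::
    "('w::graded_complex_algebra \<Rightarrow> 'w tens \<Rightarrow> 'g::ab_group_add) \<Rightarrow>
     (('w \<Rightarrow> 'w) \<Rightarrow> 'w tens \<Rightarrow> 'g) \<Rightarrow> 'w tens \<Rightarrow> 'g" where
  "tens_rec f g x = snd (tens_act
     (\<lambda>t (y, e). case t of
        Sc b \<Rightarrow> if b \<in> Om 0 then (sc b * y, \<lambda>a. if a \<in> Om 0 then e (a * b) else 0) else 0
      | Fm \<xi> \<Rightarrow> if \<xi> \<in> Om 1 then (fm \<xi> * y, \<lambda>a. if a \<in> Om 0 then f (a * \<xi>) y else 0) else 0
      | Vc v \<Rightarrow> if v \<in> VecA then (vc v * y, \<lambda>a. if a \<in> Om 0 then g (vlact a v) y else 0) else 0)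
     x (1, 0)) 1"

lemma VecA_app: "u \<in> VecA \<Longrightarrow> \<xi> \<in> Om 1 \<Longrightarrow> u \<xi> \<in> Om 0"
  and VecA_app_add: "u \<in> VecA \<Longrightarrow> \<xi> \<in> Om 1 \<Longrightarrow> \<eta> \<in> Om 1 \<Longrightarrow> u (\<xi> + \<eta>) = u \<xi> + u \<eta>"
  and VecA_app_right: "u \<in> VecA \<Longrightarrow> \<xi> \<in> Om 1 \<Longrightarrow> a \<in> Om 0 \<Longrightarrow> u (\<xi> * a) = u \<xi> * a"
  and VecA_junk: "u \<in> VecA \<Longrightarrow> \<xi> \<notin> Om 1 \<Longrightarrow> u \<xi> = 0"
  by (auto simp: VecA_def)

lemma add_on_VecA: "u \<in> VecA \<Longrightarrow> add_on (Om 1) u"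
  by (simp add: add_onI_plus VecA_app_add)

lemma vadd_VecA: "u \<in> VecA \<Longrightarrow> v \<in> VecA \<Longrightarrow> vadd u v \<in> VecA"
  by (auto simp: VecA_def vadd_def algebra_simps Om_add)

lemma vlact_VecA: "a \<in> Om 0 \<Longrightarrow> u \<in> VecA \<Longrightarrow> vlact a u \<in> VecA"
  by (auto simp: VecA_def vlact_def algebra_simps Om_0_mult)

lemma vract_VecA:
  assumes u: "u \<in> VecA" and a: "a \<in> Om 0" shows "vract u a \<in> VecA"
  unfolding VecA_def
proof (intro CollectI conjI ballI allI impI)
  fix \<xi> \<eta> b :: 'a
  show "vract u a \<xi> = 0" if "\<xi> \<notin> Om 1" using that by (simp add: vract_def)
  assume \<xi>: "\<xi> \<in> Om 1"
  show "vract u a \<xi> \<in> Om 0" using u a \<xi> by (simp add: vract_def Om_0_mult VecA_app)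
  show "vract u a (\<xi> + \<eta>) = vract u a \<xi> + vract u a \<eta>" if "\<eta> \<in> Om 1"
    using u a \<xi> that by (simp add: vract_def Om_0_mult VecA_app_add Om_add distrib_left)
  show "vract u a (\<xi> * b) = vract u a \<xi> * b" if "b \<in> Om 0"
    using u a \<xi> that
    by (simp add: vract_def Om_0_mult Om_mult_0 VecA_app_right mult.assoc[symmetric])
qed

lemma tens_rec:
  fixes f :: "'w::graded_complex_algebra \<Rightarrow> 'w tens \<Rightarrow> 'g::ab_group_add"
  assumes f: "form_balanced f" and g: "vec_balanced g"
  shows add_on_tens_rec: "add_on UNIV (tens_rec f g)"
    and tens_rec_sc: "tens_rec f g (sc a) = 0"
    and tens_rec_fm: "\<xi> \<in> Om 1 \<Longrightarrow> tens_rec f g (fm \<xi> * y) = f \<xi> y"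
    and tens_rec_vc: "v \<in> VecA \<Longrightarrow> tens_rec f g (vc v * y) = g v y"
proof -
  define \<alpha> :: "'w atom \<Rightarrow> 'w tens \<times> ('w \<Rightarrow> 'g) \<Rightarrow> 'w tens \<times> ('w \<Rightarrow> 'g)" where
    "\<alpha> = (\<lambda>t (y, e). case t of
        Sc b \<Rightarrow> if b \<in> Om 0 then (sc b * y, \<lambda>a. if a \<in> Om 0 then e (a * b) else 0) else 0
      | Fm \<xi> \<Rightarrow> if \<xi> \<in> Om 1 then (fm \<xi> * y, \<lambda>a. if a \<in> Om 0 then f (a * \<xi>) y else 0) else 0
      | Vc v \<Rightarrow> if v \<in> VecA then (vc v * y, \<lambda>a. if a \<in> Om 0 then g (vlact a v) y else 0) else 0)"
  define S :: "('w tens \<times> ('w \<Rightarrow> 'g)) set" where "S = {(y, e). (\<forall>a. a \<notin> Om 0 \<longrightarrow> e a = 0) \<and>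
      (\<forall>a\<in>Om 0. \<forall>b\<in>Om 0. e (a + b) = e a + e b)}"
  have f_diff: "f \<xi> (y - z) = f \<xi> y - f \<xi> z" if "\<xi> \<in> Om 1" for \<xi> y z
    using f that by (auto simp: form_balanced_def add_on_def)
  have g_diff: "g v (y - z) = g v y - g v z" if "v \<in> VecA" for v y z
    using g that by (auto simp: vec_balanced_def add_on_def)
  have f_add: "f (\<xi> + \<eta>) y = f \<xi> y + f \<eta> y" if "\<xi> \<in> Om 1" "\<eta> \<in> Om 1" for \<xi> \<eta> y
    using f that by (auto simp: form_balanced_def)
  have g_add: "g (vadd u v) y = g u y + g v y" if "u \<in> VecA" "v \<in> VecA" for u v y
    using g that by (auto simp: vec_balanced_def)
  have f_bal: "f (\<xi> * a) y = f \<xi> (sc a * y)" if "\<xi> \<in> Om 1" "a \<in> Om 0" for \<xi> a y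
    using f that by (auto simp: form_balanced_def)
  have g_bal: "g (vract v a) y = g v (sc a * y)" if "v \<in> VecA" "a \<in> Om 0" for v a y
    using g that by (auto simp: vec_balanced_def)
  have vl: "vlact a (vadd u v) = vadd (vlact a u) (vlact a v)"
    "vlact a (vlact b v) = vlact (a * b) v" "vlact a (vract v b) = vract (vlact a v) b"
    "vlact (a + b) v = vadd (vlact a v) (vlact b v)"
    for a b :: 'w and u v
    by (auto simp: vlact_def vadd_def vract_def fun_eq_iff algebra_simps)
  interpret tens_action S \<alpha>
  proof
    fix t
    show "add_on UNIV (\<alpha> t)"
      by (rule add_onI) (auto simp: \<alpha>_def fun_eq_iff right_diff_distrib f_diff g_diff Om_0_mult
          vlact_VecA split: atom.split)
    show "sgrp S" by (auto simp: S_def sgrp_def zero_prod_def)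
    fix n assume n: "n \<in> S"
    then show "\<alpha> t n \<in> S"
      by (cases t) (auto simp: S_def \<alpha>_def zero_prod_def f_add g_add vl(4)
          Om_add Om_0_mult distrib_right vlact_VecA split: if_splits)
    obtain y e where ye: "n = (y, e)" by (cases n)
    show "\<alpha> (Sc 1) n = n"
      using n by (auto simp: S_def \<alpha>_def Om_one fun_eq_iff)
    fix a b \<xi> \<eta> u v
    show "\<alpha> (Sc a) n = 0" if "a \<notin> Om 0" using that by (simp add: ye \<alpha>_def)
    show "\<alpha> (Fm \<xi>) n = 0" if "\<xi> \<notin> Om 1" using that by (simp add: ye \<alpha>_def)
    show "\<alpha> (Vc u) n = 0" if "u \<notin> VecA" using that by (simp add: ye \<alpha>_def)
    show "\<alpha> (Sc (a * b)) n = \<alpha> (Sc a) (\<alpha> (Sc b) n)" if "a \<in> Om 0" "b \<in> Om 0"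
      using that by (auto simp: \<alpha>_def ye sc_mult Om_0_mult mult.assoc fun_eq_iff)
    show "\<alpha> (Fm (\<xi> + \<eta>)) n = \<alpha> (Fm \<xi>) n + \<alpha> (Fm \<eta>) n" if "\<xi> \<in> Om 1" "\<eta> \<in> Om 1"
      using that by (auto simp: \<alpha>_def ye fm_add Om_0_mult algebra_simps fun_eq_iff Om_add f_add)
    show "\<alpha> (Vc (vadd u v)) n = \<alpha> (Vc u) n + \<alpha> (Vc v) n" if "u \<in> VecA" "v \<in> VecA"
      using that by (auto simp: \<alpha>_def ye vc_add vadd_VecA vlact_VecA algebra_simps fun_eq_iff g_add vl(1))
    show "\<alpha> (Fm (a * \<xi>)) n = \<alpha> (Sc a) (\<alpha> (Fm \<xi>) n)" if "a \<in> Om 0" "\<xi> \<in> Om 1"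
      using that by (auto simp: \<alpha>_def ye fm_left Om_0_mult mult.assoc fun_eq_iff)
    show "\<alpha> (Vc (vlact a u)) n = \<alpha> (Sc a) (\<alpha> (Vc u) n)" if "a \<in> Om 0" "u \<in> VecA"
      using that by (auto simp: \<alpha>_def ye vc_left Om_0_mult vlact_VecA mult.assoc fun_eq_iff vl(2))
    show "\<alpha> (Fm (\<xi> * a)) n = \<alpha> (Fm \<xi>) (\<alpha> (Sc a) n)" if "\<xi> \<in> Om 1" "a \<in> Om 0"
      using that f_bal[of "_ * \<xi>" a]
      by (auto simp: \<alpha>_def ye fm_right Om_0_mult Om_mult_0 mult.assoc fun_eq_iff)
    show "\<alpha> (Vc (vract u a)) n = \<alpha> (Vc u) (\<alpha> (Sc a) n)" if "u \<in> VecA" "a \<in> Om 0"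
      using that by (auto simp: \<alpha>_def ye vc_right vract_VecA vlact_VecA mult.assoc fun_eq_iff g_bal vl(3))
    show "\<alpha> (Sc (a + b)) n = \<alpha> (Sc a) n + \<alpha> (Sc b) n" if "a \<in> Om 0" "b \<in> Om 0"
      using n that by (auto simp: \<alpha>_def ye sc_add Om_add Om_0_mult algebra_simps fun_eq_iff S_def)
  qed
  define m :: "'w tens \<times> ('w \<Rightarrow> 'g)" where "m = (1, 0)"
  have m: "m \<in> S" "fst m = 1" by (simp_all add: m_def S_def)
  have rec: "tens_rec f g x = snd (tens_act \<alpha> x m) 1" for x
    by (simp add: tens_rec_def \<alpha>_def m_def)
  have \<alpha>: "a \<in> Om 0 \<Longrightarrow> \<alpha> (Sc a) n = (sc a * fst n, \<lambda>b. if b \<in> Om 0 then snd n (b * a) else 0)"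
    "\<xi> \<in> Om 1 \<Longrightarrow> \<alpha> (Fm \<xi>) n = (fm \<xi> * fst n, \<lambda>b. if b \<in> Om 0 then f (b * \<xi>) (fst n) else 0)"
    "v \<in> VecA \<Longrightarrow> \<alpha> (Vc v) n = (vc v * fst n, \<lambda>b. if b \<in> Om 0 then g (vlact b v) (fst n) else 0)"
    for a \<xi> v n
    by (simp_all add: \<alpha>_def split_beta)
  \<comment> \<open>The first component is the acting tensor itself, so \<open>f\<close> and
    \<open>g\<close> receive the true remainder behind the first letter.\<close>
  have fst: "fst (tens_act \<alpha> x m) = x" for x
    by (induction x rule: tens_induct) (simp_all add: act_diff act_sc act_mult act_fm act_vc act_closed \<alpha> m)
  show "add_on UNIV (tens_rec f g)"
    by (rule add_onI) (simp_all add: rec act_diff m)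
  show "tens_rec f g (sc a) = 0"
    by (cases "a \<in> Om 0") (simp_all add: rec act_sc m \<alpha>, simp_all add: m_def act_sc \<alpha>_def)
  show "tens_rec f g (fm \<xi> * y) = f \<xi> y" if "\<xi> \<in> Om 1"
    using that by (simp add: rec act_mult act_fm act_closed m \<alpha> fst Om_one)
  show "tens_rec f g (vc v * y) = g v y" if "v \<in> VecA"
    using that by (simp add: rec act_mult act_vc act_closed m \<alpha> fst Om_one vlact_def)
qed

section \<open>Contractions and tensor products of maps\<close>

text \<open>Left linearity is what makes x \<otimes> y \<mapsto> x \<otimes> F(y) balanced. Working
  with maps on the whole tensor algebra avoids domain conditions when such maps are
  composed.\<close>

definition left_lin :: "('w::graded_complex_algebra tens \<Rightarrow> 'w tens) \<Rightarrow> bool" where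
  "left_lin F \<longleftrightarrow> add_on UNIV F \<and> (\<forall>a\<in>Om 0. \<forall>y. F (sc a * y) = sc a * F y)"

lemma left_linD: "left_lin F \<Longrightarrow> add_on UNIV F" "left_lin F \<Longrightarrow> a \<in> Om 0 \<Longrightarrow> F (sc a * y) = sc a * F y"
  by (auto simp: left_lin_def)

lemma left_lin_diff: "left_lin F \<Longrightarrow> F (x - y) = F x - F y"
  and left_lin_add: "left_lin F \<Longrightarrow> F (x + y) = F x + F y"
  and left_lin_zero: "left_lin F \<Longrightarrow> F 0 = 0"
  and left_lin_sum: "left_lin F \<Longrightarrow> F (sum g I) = (\<Sum>i\<in>I. F (g i))"
  by (auto simp: left_lin_def add_on_diff add_on_add add_on_zero add_on_sum)

lemma left_linI: "(\<And>x y. F (x - y) = F x - F y) \<Longrightarrow> (\<And>a y. a \<in> Om 0 \<Longrightarrow> F (sc a * y) = sc a * F y)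
  \<Longrightarrow> left_lin F"
  by (simp add: left_lin_def add_on_def)

lemma left_lin_comp: "left_lin F \<Longrightarrow> left_lin G \<Longrightarrow> left_lin (\<lambda>x. F (G x))"
  by (auto simp: left_lin_def add_on_def)

lemma left_lin_id: "left_lin (\<lambda>x. x)"
  by (auto simp: left_lin_def add_on_def)

lemma add_on_const_mult: "add_on S F \<Longrightarrow> add_on S (\<lambda>y. (x::'a::ring) * F y)"
  by (auto simp: add_on_def right_diff_distrib)

lemma add_on_minus_fun: "add_on S F \<Longrightarrow> add_on S G \<Longrightarrow> add_on S (\<lambda>y. F y - G y)"
  and add_on_plus_fun: "add_on S F \<Longrightarrow> add_on S G \<Longrightarrow> add_on S (\<lambda>y. F y + G y)"
  by (auto simp: add_on_def algebra_simps)

lemma add_on_zero_fun: "sgrp S \<Longrightarrow> add_on S (\<lambda>y. 0)"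
  by (auto simp: add_on_def)

lemma form_balanced_zero: "form_balanced (\<lambda>\<xi> y. 0)"
  and vec_balanced_zero: "vec_balanced (\<lambda>u y. 0)"
  by (auto simp: form_balanced_def vec_balanced_def add_on_def)

lemma tens_rec_left_lin:
  assumes "form_balanced f" "vec_balanced g"
    and f: "\<And>a \<xi> y. a \<in> Om 0 \<Longrightarrow> \<xi> \<in> Om 1 \<Longrightarrow> f (a * \<xi>) y = sc a * f \<xi> y"
    and g: "\<And>a u y. a \<in> Om 0 \<Longrightarrow> u \<in> VecA \<Longrightarrow> g (vlact a u) y = sc a * g u y"
  shows "left_lin (tens_rec f g)"
  unfolding left_lin_def
proof (intro conjI ballI allI)
  show add: "add_on UNIV (tens_rec f g)" using assms by (simp add: add_on_tens_rec)
  fix a :: 'a and y :: "'a tens" assume a: "a \<in> Om 0"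
  show "tens_rec f g (sc a * y) = sc a * tens_rec f g y"
  proof (rule tens_ext[of "\<lambda>y. tens_rec f g (sc a * y)" "\<lambda>y. sc a * tens_rec f g y"])
    show "add_on UNIV (\<lambda>y. tens_rec f g (sc a * y))"
      by (rule add_onI) (simp_all add: right_diff_distrib add_on_diff[OF add])
    show "add_on UNIV (\<lambda>y. sc a * tens_rec f g y)"
      by (rule add_on_const_mult[OF add])
  qed (use a in \<open>simp_all add: assms tens_rec tens_rec_sc Om_0_mult vlact_VecA sc_mult[symmetric]
      fm_left[symmetric] vc_left[symmetric] mult.assoc[symmetric]\<close>)
qed

definition contr :: "('w::graded_complex_algebra \<Rightarrow> 'w) \<Rightarrow> 'w tens \<Rightarrow> 'w tens" where
  "contr u = tens_rec (\<lambda>\<xi> y. sc (u \<xi>) * y) (\<lambda>v y. 0)"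

lemma form_balanced_contr: "u \<in> VecA \<Longrightarrow> form_balanced (\<lambda>\<xi> y. sc (u \<xi>) * y)"
  by (auto simp: form_balanced_def add_on_def right_diff_distrib VecA_app VecA_app_add sc_add
      distrib_right VecA_app_right sc_mult mult.assoc)

lemma contr:
  assumes "u \<in> VecA"
  shows add_on_contr: "add_on UNIV (contr u)"
    and contr_sc: "contr u (sc a) = 0"
    and contr_fm: "\<xi> \<in> Om 1 \<Longrightarrow> contr u (fm \<xi> * y) = sc (u \<xi>) * y"
    and contr_vc: "v \<in> VecA \<Longrightarrow> contr u (vc v * y) = 0"
  unfolding contr_def
  using tens_rec[OF form_balanced_contr[OF assms] vec_balanced_zero] by auto

lemma contr_diff: "u \<in> VecA \<Longrightarrow> contr u (x - y) = contr u x - contr u y"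
  and contr_add: "u \<in> VecA \<Longrightarrow> contr u (x + y) = contr u x + contr u y"
  and contr_uminus: "u \<in> VecA \<Longrightarrow> contr u (- x) = - contr u x"
  and contr_zero: "u \<in> VecA \<Longrightarrow> contr u 0 = 0"
  and contr_sum: "u \<in> VecA \<Longrightarrow> contr u (sum g I) = (\<Sum>i\<in>I. contr u (g i))"
  using add_on_contr[of u] by (auto simp: add_on_diff add_on_add add_on_uminus add_on_zero add_on_sum)

lemma contr_fm_1: "u \<in> VecA \<Longrightarrow> \<xi> \<in> Om 1 \<Longrightarrow> contr u (fm \<xi>) = sc (u \<xi>)"
  using contr_fm[of u \<xi> 1] by simp

lemma vract_app: "\<xi> \<in> Om 1 \<Longrightarrow> vract u a \<xi> = u (a * \<xi>)"
  and vlact_app: "\<xi> \<in> Om 1 \<Longrightarrow> vlact a u \<xi> = a * u \<xi>"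
  and vadd_app: "\<xi> \<in> Om 1 \<Longrightarrow> vadd u v \<xi> = u \<xi> + v \<xi>"
  by (simp_all add: vract_def vlact_def vadd_def)

text \<open>\<open>contr u\<close> is additive but not left linear: a scalar in front of the
  argument is absorbed by u instead. This is the balancing that makes \<open>evl\<close> well
  defined.\<close>

lemma contr_vract: "u \<in> VecA \<Longrightarrow> a \<in> Om 0 \<Longrightarrow> contr (vract u a) y = contr u (sc a * y)"
  by (rule tens_ext[of _ "\<lambda>y. contr u (sc a * y)"])
    (auto simp: contr vract_VecA add_on_def contr_diff right_diff_distrib sc_mult[symmetric] Om_0_mult
      mult.assoc[symmetric] fm_left[symmetric] vc_left[symmetric] vlact_VecA vract_app)

lemma contr_vlact: "u \<in> VecA \<Longrightarrow> a \<in> Om 0 \<Longrightarrow> contr (vlact a u) y = sc a * contr u y"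
  by (rule tens_ext[of _ "\<lambda>y. sc a * contr u y"])
    (auto simp: contr vlact_VecA add_on_def contr_diff right_diff_distrib sc_mult VecA_app
      mult.assoc[symmetric] vlact_app)

lemma contr_vadd: "u \<in> VecA \<Longrightarrow> v \<in> VecA \<Longrightarrow> contr (vadd u v) y = contr u y + contr v y"
  by (rule tens_ext[of _ "\<lambda>y. contr u y + contr v y"])
    (auto simp: contr vadd_VecA add_on_def contr_diff sc_add VecA_app vadd_app distrib_right)

text \<open>ev \<otimes> id as a total left linear map; \<open>ev\<close> and \<open>ev_id\<close>
  agree with it on their domains.\<close>

definition evl :: "'w::graded_complex_algebra tens \<Rightarrow> 'w tens" where
  "evl = tens_rec (\<lambda>\<xi> y. 0) contr"

lemma vec_balanced_contr: "vec_balanced contr"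
  by (auto simp: vec_balanced_def add_on_contr contr_vadd contr_vract)

lemma left_lin_evl: "left_lin evl"
  unfolding evl_def
  by (rule tens_rec_left_lin[OF form_balanced_zero vec_balanced_contr]) (simp_all add: contr_vlact)

lemma evl_vc: "u \<in> VecA \<Longrightarrow> evl (vc u * y) = contr u y"
  unfolding evl_def by (rule tens_rec_vc[OF form_balanced_zero vec_balanced_contr])

text \<open>id \<otimes> F where the identity takes exactly one letter, a form or a vector field.
  Iteration moves F to any position.\<close>

definition idt :: "('w::graded_complex_algebra tens \<Rightarrow> 'w tens) \<Rightarrow> 'w tens \<Rightarrow> 'w tens" where
  "idt F = tens_rec (\<lambda>\<xi> y. fm \<xi> * F y) (\<lambda>u y. vc u * F y)"

lemma
  assumes "left_lin F"
  shows left_lin_idt: "left_lin (idt F)"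
    and idt_fm: "\<xi> \<in> Om 1 \<Longrightarrow> idt F (fm \<xi> * y) = fm \<xi> * F y"
    and idt_vc: "u \<in> VecA \<Longrightarrow> idt F (vc u * y) = vc u * F y"
proof -
  have f: "form_balanced (\<lambda>\<xi> y. fm \<xi> * F y)" and v: "vec_balanced (\<lambda>u y. vc u * F y)"
    using assms by (auto simp: form_balanced_def vec_balanced_def left_lin_def add_on_const_mult fm_add
        distrib_right fm_right vc_add vc_right mult.assoc)
  show "left_lin (idt F)"
    unfolding idt_def by (rule tens_rec_left_lin[OF f v]) (simp_all add: fm_left vc_left mult.assoc)
  show "\<xi> \<in> Om 1 \<Longrightarrow> idt F (fm \<xi> * y) = fm \<xi> * F y" "u \<in> VecA \<Longrightarrow> idt F (vc u * y) = vc u * F y"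
    unfolding idt_def by (simp_all add: tens_rec[OF f v])
qed

primrec evs :: "nat \<Rightarrow> 'w::graded_complex_algebra tens \<Rightarrow> 'w tens" where
  "evs 0 = (\<lambda>x. x)"
| "evs (Suc n) = (\<lambda>x. evl (idt (evs n) x))"

lemma left_lin_evs: "left_lin (evs n)"
  by (induction n) (simp_all add: left_lin_id left_lin_comp left_lin_evl left_lin_idt)

lemma evs_vc: "u \<in> VecA \<Longrightarrow> evs (Suc n) (vc u * y) = contr u (evs n y)"
  by (simp add: idt_vc left_lin_evs evl_vc)

text \<open>The ring homomorphism to the form algebra that multiplies the letters and kills vector
  fields. Besides extending \<open>wedge\<close> it recovers a from \<open>sc a\<close> and \<xi>
  from \<open>fm \<xi>\<close>, and so shows that these symbols are faithful.\<close>

definition wedges :: "'w::graded_complex_algebra tens \<Rightarrow> 'w" where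
  "wedges x = tens_act (\<lambda>t y. case t of Sc a \<Rightarrow> (if a \<in> Om 0 then a else 0) * y
     | Fm \<xi> \<Rightarrow> (if \<xi> \<in> Om 1 then \<xi> else 0) * y | Vc v \<Rightarrow> 0) x 1"

lemma add_on_wedges: "add_on UNIV (wedges :: 'w::graded_complex_algebra tens \<Rightarrow> 'w)"
  and wedges_sc: "a \<in> Om 0 \<Longrightarrow> wedges (sc (a :: 'w)) = a"
  and wedges_fm: "\<xi> \<in> Om 1 \<Longrightarrow> wedges (fm (\<xi> :: 'w) * y) = \<xi> * wedges y"
  and wedges_vc: "wedges (vc v * (y :: 'w tens)) = 0"
  and wedges_sc_mult: "a \<in> Om 0 \<Longrightarrow> wedges (sc (a :: 'w) * y) = a * wedges y"
proof -
  interpret tens_action UNIV "\<lambda>t y. case t of Sc a \<Rightarrow> (if a \<in> Om 0 then a else 0) * y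
     | Fm \<xi> \<Rightarrow> (if \<xi> \<in> Om 1 then \<xi> else 0) * y | Vc v \<Rightarrow> (0 :: 'w)"
    by standard (auto simp: add_on_def distrib_left distrib_right right_diff_distrib mult.assoc Om_0_mult Om_mult_0 Om_add Om_one split: atom.split)
  show "add_on UNIV (wedges :: 'w tens \<Rightarrow> 'w)"
    by (simp add: add_onI act_diff wedges_def)
  show "a \<in> Om 0 \<Longrightarrow> wedges (sc (a :: 'w)) = a" by (simp add: wedges_def act_sc)
  show "\<xi> \<in> Om 1 \<Longrightarrow> wedges (fm (\<xi> :: 'w) * y) = \<xi> * wedges y" by (simp add: wedges_def act_fm act_mult)
  show "wedges (vc v * (y :: 'w tens)) = 0" by (simp add: wedges_def act_vc act_mult)
  show "a \<in> Om 0 \<Longrightarrow> wedges (sc (a :: 'w) * y) = a * wedges y" by (simp add: wedges_def act_sc act_mult)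
qed

lemma wedges_diff: "wedges (x - y) = wedges x - wedges (y :: 'w::graded_complex_algebra tens)"
  and wedges_zero: "wedges 0 = (0 :: 'w)"
  using add_on_wedges[where ?'w = 'w] by (simp_all add: add_on_diff add_on_zero)

lemma wedges_one: "wedges 1 = (1 :: 'w::graded_complex_algebra)"
  using wedges_sc[of "1 :: 'w"] by (simp add: Om_one)

lemma wedges_fm_1: "\<xi> \<in> Om 1 \<Longrightarrow> wedges (fm \<xi>) = \<xi>"
  using wedges_fm[of \<xi> 1] by (simp add: wedges_one)

lemma sc_inject: "a \<in> Om 0 \<Longrightarrow> b \<in> Om 0 \<Longrightarrow> sc a = sc b \<longleftrightarrow> a = b"
  by (metis wedges_sc)

lemma wedges_mult: "wedges (x * y) = wedges x * wedges y"
  by (induction x rule: tens_induct)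
    (simp_all add: left_diff_distrib wedges_diff mult.assoc wedges_fm wedges_vc wedges_sc_mult wedges_sc)

section \<open>Tensor powers as subgroups\<close>

lemma tprod_mem: "x \<in> X \<Longrightarrow> y \<in> Y \<Longrightarrow> x * y \<in> X \<otimes>\<^sub>A Y"
  unfolding tprod_def by (rule group_closure_gen) auto

lemma sgrp_tprod [simp]: "sgrp (X \<otimes>\<^sub>A Y)"
  by (simp add: tprod_def)

lemma tprod_subset: "sgrp S \<Longrightarrow> (\<And>x y. x \<in> X \<Longrightarrow> y \<in> Y \<Longrightarrow> x * y \<in> S) \<Longrightarrow> X \<otimes>\<^sub>A Y \<subseteq> S"
  unfolding tprod_def by (rule group_closure_subset) auto

lemma tprod_mono: "X \<subseteq> X' \<Longrightarrow> Y \<subseteq> Y' \<Longrightarrow> X \<otimes>\<^sub>A Y \<subseteq> X' \<otimes>\<^sub>A Y'"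
  by (rule tprod_subset) (auto intro: tprod_mem)

lemma tprod_eq:
  assumes "t \<in> X \<otimes>\<^sub>A Y" "add_on S f" "add_on S g" "\<And>x y. x \<in> X \<Longrightarrow> y \<in> Y \<Longrightarrow> x * y \<in> S"
    "\<And>x y. x \<in> X \<Longrightarrow> y \<in> Y \<Longrightarrow> f (x * y) = g (x * y)"
  shows "f t = g t"
  by (rule add_on_eq[OF assms(1)[unfolded tprod_def] assms(2,3)]) (use assms(4,5) in auto)

lemma tprod_into:
  assumes "t \<in> X \<otimes>\<^sub>A Y" "add_on S f" "sgrp T" "\<And>x y. x \<in> X \<Longrightarrow> y \<in> Y \<Longrightarrow> x * y \<in> S"
    "\<And>x y. x \<in> X \<Longrightarrow> y \<in> Y \<Longrightarrow> f (x * y) \<in> T"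
  shows "f t \<in> T"
  by (rule add_on_into[OF assms(1)[unfolded tprod_def] assms(2) _ assms(3)]) (use assms(4,5) in auto)

lemma tprod_mult_right: "t \<in> X \<otimes>\<^sub>A Y \<Longrightarrow> (\<And>y. y \<in> Y \<Longrightarrow> y * z \<in> Z) \<Longrightarrow> t * z \<in> X \<otimes>\<^sub>A Z"
  by (rule tprod_into[of t X Y UNIV "\<lambda>t. t * z"])
    (auto simp: mult.assoc add_on_def left_diff_distrib intro: tprod_mem)

lemma tprod_mult_left: "t \<in> X \<otimes>\<^sub>A Y \<Longrightarrow> (\<And>x. x \<in> X \<Longrightarrow> z * x \<in> Z) \<Longrightarrow> z * t \<in> Z \<otimes>\<^sub>A Y"
  by (rule tprod_into[of t X Y UNIV "\<lambda>t. z * t"])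
    (auto simp: mult.assoc[symmetric] add_on_def right_diff_distrib intro: tprod_mem)

lemma tprod_assoc: "(X \<otimes>\<^sub>A Y) \<otimes>\<^sub>A Z = X \<otimes>\<^sub>A (Y \<otimes>\<^sub>A Z)"
proof (intro subset_antisym tprod_subset sgrp_tprod)
  show "t * z \<in> X \<otimes>\<^sub>A (Y \<otimes>\<^sub>A Z)" if "t \<in> X \<otimes>\<^sub>A Y" "z \<in> Z" for t z
    by (rule tprod_mult_right[OF that(1)]) (simp add: tprod_mem that)
  show "x * t \<in> (X \<otimes>\<^sub>A Y) \<otimes>\<^sub>A Z" if "x \<in> X" "t \<in> Y \<otimes>\<^sub>A Z" for x t
    by (rule tprod_mult_left[OF that(2)]) (simp add: tprod_mem that)
qed

definition left_mod :: "'w::graded_complex_algebra tens set \<Rightarrow> bool" where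
  "left_mod X \<longleftrightarrow> sgrp X \<and> (\<forall>a\<in>Om 0. \<forall>x\<in>X. sc a * x \<in> X)"

definition right_mod :: "'w::graded_complex_algebra tens set \<Rightarrow> bool" where
  "right_mod X \<longleftrightarrow> sgrp X \<and> (\<forall>a\<in>Om 0. \<forall>x\<in>X. x * sc a \<in> X)"

lemma left_modD: "left_mod X \<Longrightarrow> sgrp X" "left_mod X \<Longrightarrow> a \<in> Om 0 \<Longrightarrow> x \<in> X \<Longrightarrow> sc a * x \<in> X"
  and right_modD: "right_mod X \<Longrightarrow> sgrp X" "right_mod X \<Longrightarrow> a \<in> Om 0 \<Longrightarrow> x \<in> X \<Longrightarrow> x * sc a \<in> X"
  by (auto simp: left_mod_def right_mod_def)

lemma left_mod_tprod: "left_mod X \<Longrightarrow> left_mod (X \<otimes>\<^sub>A Y)"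
  by (auto simp: left_mod_def intro: tprod_mult_left)

lemma right_mod_tprod: "right_mod Y \<Longrightarrow> right_mod (X \<otimes>\<^sub>A Y)"
  by (auto simp: right_mod_def intro: tprod_mult_right)

lemma sgrp_image: assumes "add_on S f" shows "sgrp (f ` S)"
  unfolding sgrp_def
proof (intro conjI ballI)
  note S = add_on_sgrp[OF assms]
  show "0 \<in> f ` S" using imageI[OF sgrp_zero[OF S], of f] by (simp add: add_on_zero[OF assms])
  fix x y assume "x \<in> f ` S" "y \<in> f ` S"
  then obtain s t where "s \<in> S" "t \<in> S" "x = f s" "y = f t" by auto
  then show "x - y \<in> f ` S"
    using imageI[OF sgrp_diff[OF S, of s t], of f] by (simp add: add_on_diff[OF assms])
qed

lemma left_mod_TA: "left_mod TA"
  unfolding left_mod_def TA_def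
  by (auto simp: sgrp_image add_on_sc sc_mult[symmetric] Om_0_mult)

lemma one_TA: "1 \<in> TA" and sc_TA: "a \<in> Om 0 \<Longrightarrow> sc a \<in> TA"
  using imageI[OF Om_one, of sc] by (auto simp: TA_def)

lemma TA_tprod: assumes "left_mod X" shows "TA \<otimes>\<^sub>A X = X"
proof (intro subset_antisym tprod_subset subsetI left_modD(1)[OF assms])
  show "x \<in> TA \<otimes>\<^sub>A X" if "x \<in> X" for x
    using tprod_mem[OF one_TA that] by simp
qed (use assms in \<open>auto simp: left_mod_def TA_def\<close>)

lemma tprod_TA: assumes "right_mod X" shows "X \<otimes>\<^sub>A TA = X"
proof (intro subset_antisym tprod_subset subsetI right_modD(1)[OF assms])
  show "x \<in> X \<otimes>\<^sub>A TA" if "x \<in> X" for x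
    using tprod_mem[OF that one_TA] by simp
qed (use assms in \<open>auto simp: right_mod_def TA_def\<close>)

lemma left_mod_tpow: "left_mod M \<Longrightarrow> left_mod (tpow M n)"
  by (cases n) (simp_all add: left_mod_TA left_mod_tprod)

lemma sgrp_tpow [simp]: "sgrp (tpow M n)"
  by (cases n) (simp_all add: left_modD[OF left_mod_TA])

lemma tpow_1: "right_mod M \<Longrightarrow> tpow M (Suc 0) = M"
  by (simp add: tprod_TA)

lemma tpow_add: "left_mod M \<Longrightarrow> right_mod M \<Longrightarrow> tpow M m \<otimes>\<^sub>A tpow M n = tpow M (m + n)"
  by (induction m) (simp_all add: TA_tprod left_mod_tpow tprod_assoc)

lemma tpow_Suc_right: "left_mod M \<Longrightarrow> right_mod M \<Longrightarrow> tpow M n \<otimes>\<^sub>A M = tpow M (Suc n)"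
  using tpow_add[of M n 1] by (simp add: tprod_TA)

lemma tpow_mono: "M \<subseteq> N \<Longrightarrow> tpow M n \<subseteq> tpow N n"
  by (induction n) (simp_all add: tprod_mono)

lemma tpowers_mem: "x \<in> tpow M n \<Longrightarrow> x \<in> tpowers M"
  unfolding tpowers_def by (rule group_closure_gen) auto

lemma sgrp_tpowers [simp]: "sgrp (tpowers M)"
  by (simp add: tpowers_def)

lemma tpowers_mono: "M \<subseteq> N \<Longrightarrow> tpowers M \<subseteq> tpowers N"
  unfolding tpowers_def by (intro group_closure_mono UN_mono tpow_mono) auto

lemma tpowers_eq:
  "x \<in> tpowers M \<Longrightarrow> add_on S f \<Longrightarrow> add_on S g \<Longrightarrow> (\<And>n. tpow M n \<subseteq> S) \<Longrightarrow>
   (\<And>n x. x \<in> tpow M n \<Longrightarrow> f x = g x) \<Longrightarrow> f x = g x"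
  unfolding tpowers_def by (rule add_on_eq) auto

lemma tpowers_into:
  "x \<in> tpowers M \<Longrightarrow> add_on S f \<Longrightarrow> sgrp T \<Longrightarrow> (\<And>n. tpow M n \<subseteq> S) \<Longrightarrow>
   (\<And>n x. x \<in> tpow M n \<Longrightarrow> f x \<in> T) \<Longrightarrow> f x \<in> T"
  unfolding tpowers_def by (rule add_on_into) auto

lemma left_mod_tpowers: assumes "left_mod M" shows "left_mod (tpowers M)"
  unfolding left_mod_def
proof (intro conjI ballI)
  fix a :: 'a and x :: "'a tens" assume a: "a \<in> Om 0" and x: "x \<in> tpowers M"
  show "sc a * x \<in> tpowers M"
    by (rule tpowers_into[OF x, of UNIV "\<lambda>x. sc a * x"])
      (simp_all add: add_on_def right_diff_distrib tpowers_mem[OF left_modD(2)[OF left_mod_tpow[OF assms] a]])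
qed simp

lemma tprod_tpowers: "M \<otimes>\<^sub>A tpowers M \<subseteq> tpowers M"
proof (rule tprod_subset)
  show "x * y \<in> tpowers M" if "x \<in> M" "y \<in> tpowers M" for x y
  proof (rule tpowers_into[OF that(2), of UNIV "\<lambda>y. x * y"])
    show "x * y \<in> tpowers M" if "y \<in> tpow M n" for n y
      using that \<open>x \<in> M\<close> by (intro tpowers_mem[of _ M "Suc n"]) (simp add: tprod_mem)
  qed (simp_all add: add_on_def right_diff_distrib)
qed simp

lemma one_tpowers: "1 \<in> tpowers M"
  using tpowers_mem[of 1 M 0] one_TA by simp

lemma vc_zero: "vc (\<lambda>\<xi>. 0) = 0"
proof -
  have z: "(\<lambda>\<xi> :: 'a. 0) \<in> VecA" by (simp add: VecA_def Om_zero)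
  show ?thesis using vc_add[OF z z] by (simp add: vadd_def)
qed

lemma sgrp_vc_image:
  fixes V :: "('w::graded_complex_algebra \<Rightarrow> 'w) set"
  assumes V: "V \<subseteq> VecA" "(\<lambda>\<xi>. 0) \<in> V" "\<And>u v. u \<in> V \<Longrightarrow> v \<in> V \<Longrightarrow> vadd u v \<in> V"
    "\<And>a u. a \<in> Om 0 \<Longrightarrow> u \<in> V \<Longrightarrow> vlact a u \<in> V"
  shows "sgrp (vc ` V)"
  unfolding sgrp_def
proof (intro conjI ballI)
  show "0 \<in> vc ` V" using imageI[OF V(2), of vc] by (simp add: vc_zero)
  fix x y assume "x \<in> vc ` V" "y \<in> vc ` V"
  then obtain u v where uv: "u \<in> V" "v \<in> V" "x = vc u" "y = vc v" by auto
  have m: "- 1 \<in> (Om 0 :: 'w set)" using sgrp_uminus[OF sgrp_Om Om_one] .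
  have "sc (- 1 :: 'w) = - 1"
    using add_on_uminus[OF add_on_sc, of "1 :: 'w"] by (simp add: Om_one)
  then have "x - y = vc (vadd u (vlact (- 1) v))"
    using m uv V(1) by (simp add: vc_add vc_left vlact_VecA subset_iff)
  then show "x - y \<in> vc ` V" using V(3)[OF uv(1) V(4)[OF m uv(2)]] by simp
qed

lemma sgrp_TVec [simp]: "sgrp TVec"
  unfolding TVec_def by (rule sgrp_vc_image) (simp_all add: vadd_VecA vlact_VecA, simp add: VecA_def Om_zero)

lemma sgrp_TOm [simp]: "sgrp TOm" and sgrp_TA [simp]: "sgrp TA"
  unfolding TOm_def using sgrp_image[OF add_on_fm] by (simp_all add: left_modD[OF left_mod_TA])

lemma left_mod_TVec: "left_mod TVec" and right_mod_TVec: "right_mod TVec"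
  unfolding left_mod_def right_mod_def using sgrp_TVec[unfolded TVec_def]
  by (auto simp: TVec_def vc_left[symmetric] vc_right[symmetric] vlact_VecA vract_VecA)

lemma left_mod_TOm: "left_mod TOm" and right_mod_TOm: "right_mod TOm"
  unfolding left_mod_def right_mod_def using sgrp_TOm[unfolded TOm_def]
  by (auto simp: TOm_def fm_left[symmetric] fm_right[symmetric] Om_0_mult Om_mult_0)

lemma fm_TOm: "\<xi> \<in> Om 1 \<Longrightarrow> fm \<xi> \<in> TOm" and vc_TVec: "u \<in> VecA \<Longrightarrow> vc u \<in> TVec"
  by (auto simp: TOm_def TVec_def)

section \<open>Direct summands and the degree decomposition\<close>

declare One_nat_def [simp del]

text \<open>A left linear retraction of the whole tensor algebra onto \<open>Y\<close>. Precomposing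
  with it turns a map that is balanced on \<open>Y\<close> only into one that is balanced
  everywhere, so the universal property applies to X \<otimes> Y.\<close>

definition retract :: "'w::graded_complex_algebra tens set \<Rightarrow> bool" where
  "retract Y \<longleftrightarrow> (\<exists>R. left_lin R \<and> (\<forall>y. R y \<in> Y) \<and> (\<forall>y\<in>Y. R y = y))"

text \<open>Only right linearity is asked for, because balancing moves scalars across the tensor
  sign to the right of the form.\<close>

definition form_proj :: "'w::graded_complex_algebra set \<Rightarrow> ('w \<Rightarrow> 'w) \<Rightarrow> bool" where
  "form_proj X p \<longleftrightarrow> X \<subseteq> Om 1 \<and> (\<forall>\<xi>\<in>Om 1. p \<xi> \<in> X) \<and> (\<forall>\<xi>\<in>X. p \<xi> = \<xi>) \<and>
     (\<forall>\<xi>\<in>Om 1. \<forall>\<eta>\<in>Om 1. p (\<xi> + \<eta>) = p \<xi> + p \<eta>) \<and>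
     (\<forall>\<xi>\<in>Om 1. \<forall>a\<in>Om 0. p (\<xi> * a) = p \<xi> * a)"

definition vec_endo :: "(('w::graded_complex_algebra \<Rightarrow> 'w) \<Rightarrow> 'w \<Rightarrow> 'w) \<Rightarrow> bool" where
  "vec_endo q \<longleftrightarrow> (\<forall>u\<in>VecA. q u \<in> VecA) \<and> (\<forall>u\<in>VecA. \<forall>v\<in>VecA. q (vadd u v) = vadd (q u) (q v)) \<and>
     (\<forall>u\<in>VecA. \<forall>a\<in>Om 0. q (vract u a) = vract (q u) a \<and> q (vlact a u) = vlact a (q u))"

definition vec_proj ::
    "('w::graded_complex_algebra \<Rightarrow> 'w) set \<Rightarrow> (('w \<Rightarrow> 'w) \<Rightarrow> 'w \<Rightarrow> 'w) \<Rightarrow> bool" where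
  "vec_proj V q \<longleftrightarrow> vec_endo q \<and> V \<subseteq> VecA \<and> (\<forall>u\<in>VecA. q u \<in> V) \<and> (\<forall>u\<in>V. q u = u)"

lemma vec_proj_VecA: "vec_proj VecA (\<lambda>u. u)"
  by (simp add: vec_proj_def vec_endo_def)

text \<open>Under \<open>vec_hom\<close> the zero endomorphism gives the projection onto degree 0,
  with which \<open>grade\<close> starts.\<close>

lemma vec_endo_zero: "vec_endo (\<lambda>u \<xi>. 0)"
  by (simp add: vec_endo_def VecA_def Om_zero vadd_def vract_def vlact_def)

text \<open>Functoriality of the tensor algebra of vector fields: the multiplicative map induced by
  \<open>q\<close>, with all forms sent to 0.\<close>

definition vec_hom ::
    "(('w::graded_complex_algebra \<Rightarrow> 'w) \<Rightarrow> 'w \<Rightarrow> 'w) \<Rightarrow> 'w tens \<Rightarrow> 'w tens" where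
  "vec_hom q x = tens_act (\<lambda>t y. case t of Sc a \<Rightarrow> sc a * y | Fm \<xi> \<Rightarrow> 0
     | Vc v \<Rightarrow> if v \<in> VecA then vc (q v) * y else 0) x 1"

lemma vec_hom:
  fixes q :: "('w::graded_complex_algebra \<Rightarrow> 'w) \<Rightarrow> 'w \<Rightarrow> 'w"
  assumes q: "vec_endo q"
  shows left_lin_vec_hom: "left_lin (vec_hom q)"
    and vec_hom_sc: "vec_hom q (sc a) = sc a"
    and vec_hom_fm: "vec_hom q (fm \<xi> * y) = 0"
    and vec_hom_vc: "v \<in> VecA \<Longrightarrow> vec_hom q (vc v * y) = vc (q v) * vec_hom q y"
proof -
  interpret tens_action UNIV "\<lambda>t y :: 'w tens. case t of Sc a \<Rightarrow> sc a * y | Fm \<xi> \<Rightarrow> 0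
     | Vc v \<Rightarrow> if v \<in> VecA then vc (q v) * y else 0"
    using q by unfold_locales
      (auto simp: add_on_def distrib_right right_diff_distrib mult.assoc sc_add sc_mult sc_junk vec_endo_def
      vc_add vc_left vc_right vadd_VecA vlact_VecA vract_VecA split: atom.split)
  show "left_lin (vec_hom q)"
    by (simp add: left_linI act_diff act_mult act_sc vec_hom_def)
  show "vec_hom q (sc a) = sc a" "vec_hom q (fm \<xi> * y) = 0"
    "v \<in> VecA \<Longrightarrow> vec_hom q (vc v * y) = vc (q v) * vec_hom q y"
    by (simp_all add: vec_hom_def act_sc act_mult act_fm act_vc)
qed

lemma retractI: "left_lin R \<Longrightarrow> (\<And>y. R y \<in> Y) \<Longrightarrow> (\<And>y. y \<in> Y \<Longrightarrow> R y = y) \<Longrightarrow> retract Y"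
  by (auto simp: retract_def)

text \<open>The multiplicative extension of the projection \<open>q\<close> is the retraction: it
  maps each vector letter into \<open>V\<close> and fixes words with letters in
  \<open>V\<close>.\<close>

lemma retract_tpowers:
  assumes "vec_proj V q" shows "retract (tpowers (vc ` V))"
proof (rule retractI)
  have q: "vec_endo q" "\<And>u. u \<in> VecA \<Longrightarrow> q u \<in> V" "\<And>u. u \<in> V \<Longrightarrow> q u = u" "V \<subseteq> VecA"
    using assms by (auto simp: vec_proj_def)
  note hom = vec_hom[OF q(1)]
  show "left_lin (vec_hom q)" by (rule hom)
  show "vec_hom q y \<in> tpowers (vc ` V)" for y
  proof (induction y rule: tens_induct)
    case (sc a)
    then show ?case using tpowers_mem[of "sc a" "vc ` V" 0] by (simp add: hom sc_TA)
  next
    case (vc u y)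
    then show ?case
      using tprod_tpowers[of "vc ` V"] tprod_mem[of "vc (q u)" "vc ` V"] by (auto simp: hom q(2))
  qed (simp_all add: hom sgrp_zero sgrp_diff left_lin_diff[OF hom(1)])
  have *: "vec_hom q y = y" if "y \<in> tpow (vc ` V) n" for n y
    using that
  proof (induction n arbitrary: y)
    case 0
    then show ?case by (auto simp: TA_def hom)
  next
    case (Suc n)
    show ?case
      by (rule tprod_eq[OF Suc.prems[simplified], of UNIV])
        (use Suc.IH in \<open>auto simp: left_linD[OF hom(1)] left_linD[OF left_lin_id] hom q(3) subsetD[OF q(4)]\<close>)
  qed
  show "vec_hom q y = y" if "y \<in> tpowers (vc ` V)" for y
    by (rule tpowers_eq[OF that, of UNIV]) (simp_all add: * left_linD[OF hom(1)] left_linD[OF left_lin_id])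
qed

text \<open>Projection onto the n-th tensor power, combined with \<open>q\<close> in every factor;
  forms are killed.\<close>

primrec grade ::
    "(('w::graded_complex_algebra \<Rightarrow> 'w) \<Rightarrow> 'w \<Rightarrow> 'w) \<Rightarrow> nat \<Rightarrow> 'w tens \<Rightarrow> 'w tens" where
  "grade q 0 = vec_hom (\<lambda>u \<xi>. 0)"
| "grade q (Suc n) = tens_rec (\<lambda>\<xi> y. 0) (\<lambda>u y. vc (q u) * grade q n y)"

context
  fixes V :: "('w::graded_complex_algebra \<Rightarrow> 'w) set" and q
  assumes vp: "vec_proj V q"
begin

lemma vec_proj_rules: "vec_endo q" "u \<in> VecA \<Longrightarrow> q u \<in> V" "u \<in> V \<Longrightarrow> q u = u" "u \<in> V \<Longrightarrow> u \<in> VecA"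
    "u \<in> VecA \<Longrightarrow> q u \<in> VecA"
    "u \<in> VecA \<Longrightarrow> v \<in> VecA \<Longrightarrow> q (vadd u v) = vadd (q u) (q v)"
    "u \<in> VecA \<Longrightarrow> a \<in> Om 0 \<Longrightarrow> q (vract u a) = vract (q u) a"
    "u \<in> VecA \<Longrightarrow> a \<in> Om 0 \<Longrightarrow> q (vlact a u) = vlact a (q u)"
  using vp by (auto simp: vec_proj_def vec_endo_def)

lemma vec_balanced_grade: "left_lin F \<Longrightarrow> vec_balanced (\<lambda>u y. vc (q u) * F y)"
  by (auto simp: vec_balanced_def left_lin_def add_on_const_mult vec_proj_rules vc_add vc_right distrib_right mult.assoc)

lemma left_lin_grade: "left_lin (grade q n)"
proof (induction n)
  case (Suc n)
  show ?case
    by (simp, rule tens_rec_left_lin[OF form_balanced_zero vec_balanced_grade[OF Suc]])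
      (simp_all add: vec_proj_rules vc_left mult.assoc)
qed (simp add: vec_hom[OF vec_endo_zero])

lemma grade_Suc: "\<xi> \<in> Om 1 \<Longrightarrow> grade q (Suc n) (fm \<xi> * y) = 0"
    "u \<in> VecA \<Longrightarrow> grade q (Suc n) (vc u * y) = vc (q u) * grade q n y"
    "grade q (Suc n) (sc a) = 0"
  by (simp_all add: tens_rec[OF form_balanced_zero vec_balanced_grade[OF left_lin_grade]])

lemma grade_mem: "grade q n y \<in> tpow (vc ` V) n"
proof (induction n arbitrary: y)
  case 0
  show ?case
    by (induction y rule: tens_induct)
      (simp_all add: vec_hom[OF vec_endo_zero] vc_zero sc_TA sgrp_zero sgrp_diff
        left_lin_diff[OF left_lin_vec_hom[OF vec_endo_zero]])
next
  case (Suc n)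
  show ?case
  proof (induction y rule: tens_induct)
    case (diff x y)
    then show ?case
      using sgrp_diff[OF sgrp_tpow diff] left_lin_diff[OF left_lin_grade, of "Suc n" x y] by simp
  next
    case (vc u y)
    then show ?case
      using Suc[of y] tprod_mem[of "vc (q u)" "vc ` V"] by (simp only: grade_Suc) (simp add: vec_proj_rules)
  qed (simp_all only: grade_Suc sgrp_zero[OF sgrp_tpow])
qed

lemma grade_tpow: "y \<in> tpow (vc ` V) m \<Longrightarrow> grade q n y = (if m = n then y else 0)"
proof (induction n arbitrary: y m)
  case 0
  then show ?case
  proof (cases m)
    case (Suc m')
    have y: "y \<in> vc ` V \<otimes>\<^sub>A tpow (vc ` V) m'" using 0 Suc by simp
    have "grade q 0 y = 0"
      by (rule tprod_eq[OF y, of UNIV])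
        (auto simp: left_linD[OF left_lin_vec_hom[OF vec_endo_zero]] vec_hom[OF vec_endo_zero] vc_zero vec_proj_rules
            add_on_zero_fun)
    then show ?thesis using Suc by simp
  qed (auto simp: TA_def vec_hom[OF vec_endo_zero])
next
  case (Suc n)
  show ?case
  proof (cases m)
    case 0
    then show ?thesis using Suc by (auto simp: TA_def grade_Suc simp del: grade.simps)
  next
    case (Suc m')
    have y: "y \<in> vc ` V \<otimes>\<^sub>A tpow (vc ` V) m'" using Suc.prems \<open>m = Suc m'\<close> by simp
    have add: "add_on UNIV (\<lambda>y. if m' = n then y else (0 :: 'w tens))" by (simp add: add_on_def)
    have "grade q (Suc n) y = (if m' = n then y else 0)"
      by (rule tprod_eq[OF y left_linD(1)[OF left_lin_grade] add])
        (auto simp: grade_Suc vec_proj_rules Suc.IH simp del: grade.simps)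
    then show ?thesis by (simp add: \<open>m = Suc m'\<close>)
  qed
qed

lemma finite_grade: "finite {n. grade q n y \<noteq> 0}"
proof (induction y rule: tens_induct)
  case (diff x y)
  then show ?case
    by (rule finite_subset[rotated, OF finite_UnI]) (auto simp: left_lin_diff[OF left_lin_grade])
next
  case (sc a)
  have "{n. grade q n (sc a) \<noteq> 0} \<subseteq> {0}"
  proof
    fix n assume "n \<in> {n. grade q n (sc a) \<noteq> 0}"
    then show "n \<in> {0}" by (cases n) (auto simp: grade_Suc simp del: grade.simps)
  qed
  then show ?case by (rule finite_subset) simp
next
  case (fm \<xi> y)
  have "grade q n (fm \<xi> * y) = 0" for n
    using fm by (cases n) (simp_all add: vec_hom[OF vec_endo_zero] grade_Suc del: grade.simps(2))
  then show ?case by simp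
next
  case (vc u y)
  have "{n. grade q n (vc u * y) \<noteq> 0} \<subseteq> Suc ` {n. grade q n y \<noteq> 0}"
  proof
    fix n assume "n \<in> {n. grade q n (vc u * y) \<noteq> 0}"
    then show "n \<in> Suc ` {n. grade q n y \<noteq> 0}"
      using vc by (cases n)
        (auto simp: vec_hom[OF vec_endo_zero] vc_zero grade_Suc simp del: grade.simps(2))
  qed
  then show ?case using vc by (simp add: finite_subset)
qed

lemma retract_tpow: "retract (tpow (vc ` V) n)"
  by (rule retractI[OF left_lin_grade grade_mem]) (simp add: grade_tpow)

text \<open>Different tensor powers are independent because \<open>grade\<close> separates them, and
  only finitely many components of an element are nonzero, so the maps \<open>f n\<close> can be
  summed.\<close>

lemma add_ext_graded:
  assumes f: "\<And>n. add_on (tpow (vc ` V) n) (f n)"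
  defines "F \<equiv> add_ext (SIGMA n:UNIV. tpow (vc ` V) n) snd (\<lambda>(n, v). f n v)"
  shows "add_on (tpowers (vc ` V)) F" and "x \<in> tpow (vc ` V) n \<Longrightarrow> F x = f n x"
proof -
  let ?I = "SIGMA n:UNIV. tpow (vc ` V) n"
  define G where "G = (\<lambda>x. Sum_any (\<lambda>n. f n (grade q n x)))"
  have fin: "finite {n. f n (grade q n x) \<noteq> 0}" for x
    by (rule finite_subset[OF _ finite_grade[of x]]) (auto simp: add_on_zero[OF f])
  have "add_on UNIV G"
    by (rule add_onI_plus)
      (simp_all add: G_def Sum_any.distrib[OF fin fin, symmetric] add_on_add[OF f] grade_mem
        left_lin_add[OF left_lin_grade])
  moreover have "G x = f n x" if "x \<in> tpow (vc ` V) n" for n x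
  proof -
    have "G x = Sum_any (\<lambda>m. f n x when m = n)"
      unfolding G_def by (rule Sum_any.cong) (use that in \<open>auto simp: when_def grade_tpow add_on_zero[OF f]\<close>)
    then show ?thesis by simp
  qed
  ultimately have ok: "add_ext_ok ?I snd (\<lambda>(n, v). f n v)"
    by (intro add_ext_okI[of UNIV G]) auto
  have "snd ` ?I = (\<Union>n. tpow (vc ` V) n)" by force
  then show "add_on (tpowers (vc ` V)) F"
    using add_on_add_ext[OF ok] by (simp add: F_def tpowers_def)
  show "F x = f n x" if "x \<in> tpow (vc ` V) n"
    using add_ext_gen[OF ok, of "(n, x)"] that by (simp add: F_def)
qed

text \<open>Recursions that split off a leading vector field enter here. The projection
  \<open>q\<close> and a retraction onto \<open>Y\<close> extend \<open>\<beta>\<close> to a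
  balanced map on all vector fields and all tensors, whose restriction is \<open>F\<close>.\<close>

lemma add_ext_vec:
  assumes Y: "retract Y"
    and add: "\<And>u. u \<in> V \<Longrightarrow> add_on Y (\<beta> u)"
    and vadd: "\<And>u v y. u \<in> V \<Longrightarrow> v \<in> V \<Longrightarrow> y \<in> Y \<Longrightarrow> \<beta> (vadd u v) y = \<beta> u y + \<beta> v y"
    and bal: "\<And>u a y. u \<in> V \<Longrightarrow> a \<in> Om 0 \<Longrightarrow> y \<in> Y \<Longrightarrow> \<beta> (vract u a) y = \<beta> u (sc a * y)"
  defines "F \<equiv> add_ext (V \<times> Y) (\<lambda>(u, y). vc u * y) (\<lambda>(u, y). \<beta> u y)"
  shows "add_on (vc ` V \<otimes>\<^sub>A Y) F" and "u \<in> V \<Longrightarrow> y \<in> Y \<Longrightarrow> F (vc u * y) = \<beta> u y"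
proof -
  obtain R where R: "left_lin R" "\<And>y. R y \<in> Y" "\<And>y. y \<in> Y \<Longrightarrow> R y = y"
    using Y by (auto simp: retract_def)
  have "vec_balanced (\<lambda>u y. \<beta> (q u) (R y))"
    using left_linD(1)[OF R(1)] by (auto simp: vec_balanced_def vec_proj_rules vadd bal R left_linD
        intro: add_on_comp[OF _ add])
  note rec = tens_rec[OF form_balanced_zero this]
  have ok: "add_ext_ok (V \<times> Y) (\<lambda>(u, y). vc u * y) (\<lambda>(u, y). \<beta> u y)"
    by (rule add_ext_okI[OF rec(1)]) (auto simp: rec vec_proj_rules R)
  have "(\<lambda>(u, y). vc u * y) ` (V \<times> Y) = {x * y |x y. x \<in> vc ` V \<and> y \<in> Y}" by force
  then show "add_on (vc ` V \<otimes>\<^sub>A Y) F"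
    using add_on_add_ext[OF ok] by (simp add: F_def tprod_def)
  show "u \<in> V \<Longrightarrow> y \<in> Y \<Longrightarrow> F (vc u * y) = \<beta> u y"
    using add_ext_gen[OF ok, of "(u, y)"] by (simp add: F_def)
qed

end

lemma add_ext_form:
  assumes p: "form_proj X p" and Y: "retract Y"
    and add: "\<And>\<xi>. \<xi> \<in> X \<Longrightarrow> add_on Y (\<beta> \<xi>)"
    and fadd: "\<And>\<xi> \<eta> y. \<xi> \<in> X \<Longrightarrow> \<eta> \<in> X \<Longrightarrow> y \<in> Y \<Longrightarrow> \<beta> (\<xi> + \<eta>) y = \<beta> \<xi> y + \<beta> \<eta> y"
    and bal: "\<And>\<xi> a y. \<xi> \<in> X \<Longrightarrow> a \<in> Om 0 \<Longrightarrow> y \<in> Y \<Longrightarrow> \<beta> (\<xi> * a) y = \<beta> \<xi> (sc a * y)"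
  shows "add_ext_ok (X \<times> Y) (\<lambda>(\<xi>, y). fm \<xi> * y) (\<lambda>(\<xi>, y). \<beta> \<xi> y)"
proof -
  obtain R where R: "left_lin R" "\<And>y. R y \<in> Y" "\<And>y. y \<in> Y \<Longrightarrow> R y = y"
    using Y by (auto simp: retract_def)
  have q: "\<xi> \<in> Om 1 \<Longrightarrow> p \<xi> \<in> X" "\<xi> \<in> X \<Longrightarrow> p \<xi> = \<xi>" "\<xi> \<in> X \<Longrightarrow> \<xi> \<in> Om 1"
    "\<xi> \<in> Om 1 \<Longrightarrow> \<eta> \<in> Om 1 \<Longrightarrow> p (\<xi> + \<eta>) = p \<xi> + p \<eta>"
    "\<xi> \<in> Om 1 \<Longrightarrow> a \<in> Om 0 \<Longrightarrow> p (\<xi> * a) = p \<xi> * a" for \<xi> \<eta> a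
    using p by (auto simp: form_proj_def)
  have "form_balanced (\<lambda>\<xi> y. \<beta> (p \<xi>) (R y))"
    unfolding form_balanced_def
    by (intro conjI ballI allI add_on_comp[OF left_linD(1)[OF R(1)] add])
      (simp_all only: q fadd bal R left_linD)
  note rec = tens_rec[OF this vec_balanced_zero]
  show ?thesis
    by (rule add_ext_okI[OF rec(1)]) (use q in \<open>auto simp: rec R\<close>)
qed

lemma add_ext_form_gens:
  "group_closure ((\<lambda>(\<xi>, y). fm \<xi> * y) ` (X \<times> Y)) = fm ` X \<otimes>\<^sub>A Y"
proof -
  have "(\<lambda>(\<xi>, y). fm \<xi> * y) ` (X \<times> Y) = {x * y |x y. x \<in> fm ` X \<and> y \<in> Y}" by force
  then show ?thesis by (simp add: tprod_def)
qed

section \<open>Evaluation of the basic maps\<close>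

lemma tprod_one_left: "sgrp Y \<Longrightarrow> {1} \<otimes>\<^sub>A Y = Y" and tprod_one_right: "sgrp Y \<Longrightarrow> Y \<otimes>\<^sub>A {1} = Y"
proof -
  have "{1 * y |y. y \<in> Y} = Y" "{y * 1 |y. y \<in> Y} = Y" by auto
  then show "sgrp Y \<Longrightarrow> {1} \<otimes>\<^sub>A Y = Y" "sgrp Y \<Longrightarrow> Y \<otimes>\<^sub>A {1} = Y"
    by (simp_all add: tprod_def group_closure_sgrp)
qed

text \<open>Through this, occurrences of \<open>tmap\<close> are replaced by maps on the whole
  tensor algebra. The map \<open>G\<close> also witnesses that the formula with \<open>f\<close> is
  well defined.\<close>

lemma tmap_eq:
  assumes y: "y \<in> X \<otimes>\<^sub>A T \<otimes>\<^sub>A Z" and G: "add_on S G"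
    and S: "\<And>x t z. x \<in> X \<Longrightarrow> t \<in> T \<Longrightarrow> z \<in> Z \<Longrightarrow> x * t * z \<in> S"
    and val: "\<And>x t z. x \<in> X \<Longrightarrow> t \<in> T \<Longrightarrow> z \<in> Z \<Longrightarrow> G (x * t * z) = x * f t * z"
  shows "tmap X T Z f y = G y"
  unfolding tmap_def
proof (rule add_ext_unique[OF G])
  show "(\<lambda>(x, t, z). x * t * z) ` (X \<times> T \<times> Z) \<subseteq> S" using S by auto
  show "G (case i of (x, t, z) \<Rightarrow> x * t * z) = (case i of (x, t, z) \<Rightarrow> x * f t * z)"
    if "i \<in> X \<times> T \<times> Z" for i using that val by auto
  let ?C = "group_closure ((\<lambda>(x, t, z). x * t * z) ` (X \<times> T \<times> Z))"
  have gen: "x * (t * z) \<in> ?C" if "x \<in> X" "t \<in> T" "z \<in> Z" for x t z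
    by (rule group_closure_gen, rule image_eqI[of _ _ "(x, t, z)"]) (use that in \<open>auto simp: mult.assoc\<close>)
  have "x * s \<in> ?C" if "x \<in> X" "s \<in> T \<otimes>\<^sub>A Z" for x s
    by (rule tprod_into[OF that(2), of UNIV "\<lambda>s. x * s"])
      (use that gen in \<open>auto simp: add_on_def right_diff_distrib\<close>)
  then show "y \<in> ?C"
    using y tprod_subset[of ?C X "T \<otimes>\<^sub>A Z"] by auto
qed

lemma TVecE: "x \<in> TVec \<Longrightarrow> (\<And>u. u \<in> VecA \<Longrightarrow> x = vc u \<Longrightarrow> P) \<Longrightarrow> P"
  and TOmE: "x \<in> TOm \<Longrightarrow> (\<And>\<xi>. \<xi> \<in> Om 1 \<Longrightarrow> x = fm \<xi> \<Longrightarrow> P) \<Longrightarrow> P"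
  by (auto simp: TVec_def TOm_def)

lemma ev_eq:
  fixes t :: "'w::graded_complex_algebra tens"
  assumes t: "t \<in> TVec \<otimes>\<^sub>A TOm"
  shows "ev t = evl t"
proof -
  have "(\<lambda>(v, \<xi> :: 'w). vc v * fm \<xi>) ` (VecA \<times> Om 1) = {x * y |x y. x \<in> TVec \<and> y \<in> TOm}"
    by (force simp: TVec_def TOm_def)
  then show ?thesis
    unfolding ev_def using t
    by (intro add_ext_unique[OF left_linD(1)[OF left_lin_evl]])
      (auto simp only: tprod_def evl_vc contr_fm_1)
qed

lemma contr_right: "u \<in> VecA \<Longrightarrow> x \<in> TOm \<otimes>\<^sub>A UNIV \<Longrightarrow> contr u (x * z) = contr u x * z"
  by (rule tprod_eq[of x TOm UNIV UNIV "\<lambda>x. contr u (x * z)" "\<lambda>x. contr u x * z"])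
    (auto simp: TOm_def add_on_def contr_diff left_diff_distrib mult.assoc contr_fm)

lemma TOm_UNIV: "x \<in> TOm \<Longrightarrow> x \<in> TOm \<otimes>\<^sub>A UNIV"
  using tprod_mem[of x TOm 1 UNIV] by simp

lemma contr_mem:
  assumes "u \<in> VecA" "x \<in> TOm \<otimes>\<^sub>A Y" "left_mod Y" shows "contr u x \<in> Y"
  by (rule tprod_into[OF assms(2) add_on_contr[OF assms(1)] left_modD(1)[OF assms(3)]])
    (use assms in \<open>auto simp: TOm_def contr_fm left_modD VecA_app\<close>)

lemma evl_right:
  assumes "t \<in> TVec \<otimes>\<^sub>A TOm" shows "evl (t * z) = evl t * z"
  by (rule tprod_eq[OF assms, of UNIV "\<lambda>t. evl (t * z)" "\<lambda>t. evl t * z"])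
    (auto simp: left_lin_diff[OF left_lin_evl] add_on_def left_diff_distrib TVec_def mult.assoc evl_vc
      contr_right TOm_UNIV)

lemma ev_id_eq: "x \<in> TVec \<otimes>\<^sub>A TOm \<otimes>\<^sub>A UNIV \<Longrightarrow> ev_id x = evl x"
  unfolding ev_id_def
  by (rule tmap_eq[OF _ left_linD(1)[OF left_lin_evl]]) (auto simp: tprod_one_left tprod_assoc evl_right ev_eq)

text \<open>The inner evaluation must be known to be a scalar before the next form can absorb it, so
  scalar values and indifference to a trailing factor are proved together.\<close>

lemma evs_forms:
  fixes v x z :: "'w::graded_complex_algebra tens"
  assumes "v \<in> tpow TVec n" "x \<in> tpow TOm n"
  shows "evs n (v * (x * z)) = evs n (v * x) * z \<and> evs n (v * x) \<in> TA"
  using assms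
proof (induction n arbitrary: v x z)
  case 0
  then show ?case by (auto simp: TA_def mult.assoc sc_mult[symmetric] Om_0_mult)
next
  case (Suc n)
  have x: "x \<in> tpow TOm n \<otimes>\<^sub>A TOm" using Suc.prems tpow_Suc_right[OF left_mod_TOm right_mod_TOm] by blast
  \<comment> \<open>The nested evaluation pairs the first vector with the last form, hence vectors
    are split on the left and forms on the right.\<close>
  have *: "evs (Suc n) (vc u * w * (y * fm \<xi> * z)) = contr u (evs n (w * y) * fm \<xi>) * z \<and>
      contr u (evs n (w * y) * fm \<xi>) \<in> TA"
    if "u \<in> VecA" "w \<in> tpow TVec n" "y \<in> tpow TOm n" "\<xi> \<in> Om 1" for u :: "'w \<Rightarrow> 'w" and w y \<xi> z
  proof -
    from Suc.IH[OF that(2,3)] obtain a where a: "a \<in> Om 0" "evs n (w * y) = sc a" by (auto simp: TA_def)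
    have "evs n (w * (y * (fm \<xi> * z))) = sc a * (fm \<xi> * z)" for z
      using Suc.IH[OF that(2,3), of "fm \<xi> * z"] a by simp
    then show ?thesis
      using that a
      using contr_fm[of u "a * \<xi>"]
      by (simp add: mult.assoc evs_vc del: evs.simps)
        (simp add: mult.assoc[symmetric] fm_left[symmetric] contr_fm contr_fm_1 Om_0_mult VecA_app sc_TA)
  qed
  have **: "evs (Suc n) (v * (x * z)) = evs (Suc n) (v * x) * z \<and> evs (Suc n) (v * x) \<in> TA"
    if "v \<in> TVec \<otimes>\<^sub>A tpow TVec n" "x = y * fm \<xi>" "y \<in> tpow TOm n" "\<xi> \<in> Om 1" for v x y z :: "'w tens" and \<xi>
    using that
    by (intro conjI tprod_eq[OF that(1), of UNIV "\<lambda>v. evs (Suc n) (v * (x * z))" "\<lambda>v. evs (Suc n) (v * x) * z"]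
        tprod_into[OF that(1), of UNIV "\<lambda>v. evs (Suc n) (v * x)" TA])
      (auto elim!: TVecE simp: add_on_def left_lin_diff[OF left_lin_evs] left_diff_distrib
        *[of _ _ _ _ 1, unfolded mult_1_right mult.assoc[symmetric]] *[unfolded mult.assoc[symmetric]]
        mult.assoc[symmetric]
        simp del: evs.simps)
  show ?case
    using Suc.prems
    by (intro conjI tprod_eq[OF x, of UNIV "\<lambda>x. evs (Suc n) (v * (x * z))" "\<lambda>x. evs (Suc n) (v * x) * z"]
        tprod_into[OF x, of UNIV "\<lambda>x. evs (Suc n) (v * x)" TA])
      (auto elim!: TOmE simp: add_on_def left_lin_diff[OF left_lin_evs] left_diff_distrib right_diff_distrib **
        simp del: evs.simps)
qed


lemma evs_right:
  assumes "t \<in> tpow TVec n \<otimes>\<^sub>A tpow TOm n" shows "evs n (t * z) = evs n t * z"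
  by (rule tprod_eq[OF assms, of UNIV "\<lambda>t. evs n (t * z)" "\<lambda>t. evs n t * z"])
    (auto simp: add_on_def left_lin_diff[OF left_lin_evs] left_diff_distrib mult.assoc evs_forms)

lemma evs_TA:
  assumes "t \<in> tpow TVec n \<otimes>\<^sub>A tpow TOm n" shows "evs n t \<in> TA"
  by (rule tprod_into[OF assms left_linD(1)[OF left_lin_evs]]) (auto simp: evs_forms)

definition idts :: "nat \<Rightarrow> ('w::graded_complex_algebra tens \<Rightarrow> 'w tens) \<Rightarrow> 'w tens \<Rightarrow> 'w tens" where
  "idts n F = (idt ^^ n) F"

lemma left_lin_idts: "left_lin F \<Longrightarrow> left_lin (idts n F)"
  by (induction n) (simp_all add: idts_def left_lin_idt)

lemma idts_forms:
  assumes F: "left_lin F" shows "x \<in> tpow TOm n \<Longrightarrow> idts n F (x * y) = x * F y"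
proof (induction n arbitrary: x)
  case 0
  then show ?case by (auto simp: idts_def TA_def left_linD[OF F])
next
  case (Suc n)
  have *: "idts (Suc n) F = idt (idts n F)" by (simp add: idts_def)
  show ?case
    unfolding *
    by (rule tprod_eq[OF Suc.prems[simplified], of UNIV])
      (auto elim!: TOmE simp: add_on_def left_diff_distrib left_lin_diff[OF left_lin_idt[OF left_lin_idts[OF F]]]
        mult.assoc idt_fm[OF left_lin_idts[OF F]] Suc.IH)
qed

text \<open>After the n evaluations only a scalar remains in front of the trailing factor, and
  \<open>F\<close> commutes with it by left linearity.\<close>

lemma evs_idts:
  assumes F: "left_lin F" and v: "v \<in> tpow TVec n" and y: "y \<in> tpow TOm n \<otimes>\<^sub>A UNIV"
  shows "evs n (v * idts n F y) = F (evs n (v * y))"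
proof (rule tprod_eq[OF y, of UNIV "\<lambda>y. evs n (v * idts n F y)" "\<lambda>y. F (evs n (v * y))"])
  show "evs n (v * idts n F (x * z)) = F (evs n (v * (x * z)))" if x: "x \<in> tpow TOm n" for x z
  proof -
    obtain a where "a \<in> Om 0" "evs n (v * x) = sc a"
      using evs_forms[OF v x] by (auto simp: TA_def)
    then show ?thesis
      using evs_forms[OF v x] by (simp add: idts_forms[OF F that] left_linD[OF F])
  qed
qed (simp_all add: add_on_def left_lin_diff[OF left_lin_evs] left_lin_diff[OF F]
    left_lin_diff[OF left_lin_idts[OF F]] right_diff_distrib)

text \<open>Peels off the innermost pair, the last vector against the first form, where
  \<open>evs_vc\<close> peels off the outermost one. Induction on a tensor of forms from the left
  needs this version.\<close>

lemma evs_snoc: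
  assumes "u \<in> VecA" shows "v \<in> tpow TVec n \<Longrightarrow> evs (Suc n) (v * (vc u * y)) = evs n (v * contr u y)"
proof (induction n arbitrary: v)
  case 0
  then show ?case
    using assms by (auto simp: TA_def left_linD[OF left_lin_evs] evs_vc simp del: evs.simps(2))
next
  case (Suc n)
  show ?case
    by (rule tprod_eq[OF Suc.prems[simplified], of UNIV])
      (auto elim!: TVecE simp: add_on_def left_diff_distrib left_lin_diff[OF left_lin_evs]
        mult.assoc evs_vc Suc.IH simp del: evs.simps)
qed

lemma evn_eq:
  fixes t :: "'w::graded_complex_algebra tens"
  shows "t \<in> tpow TVec n \<otimes>\<^sub>A tpow TOm n \<Longrightarrow> evn n t = evs n t"
proof (induction n t rule: evn.induct)
  case (2 t)
  have t: "t \<in> TVec \<otimes>\<^sub>A TOm"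
    using 2 by (simp add: tprod_TA right_mod_TVec right_mod_TOm)
  have "idt (\<lambda>x. x) t = t"
    by (rule tprod_eq[OF t, of UNIV])
      (auto elim!: TVecE simp: left_linD[OF left_lin_idt[OF left_lin_id]] left_linD[OF left_lin_id]
        idt_vc[OF left_lin_id])
  then show ?case by (simp add: ev_eq[OF t])
next
  case (3 n x)
  let ?T = "tpow TVec (Suc n) \<otimes>\<^sub>A tpow TOm (Suc n) :: 'w tens set"
  have split: "tpow TVec (Suc (Suc n)) \<otimes>\<^sub>A tpow TOm (Suc (Suc n)) = TVec \<otimes>\<^sub>A ?T \<otimes>\<^sub>A TOm"
    by (simp only: tpow.simps(2)[of TVec "Suc n"] tprod_assoc
        tpow_Suc_right[OF left_mod_TOm right_mod_TOm, of "Suc n"])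
  have val: "idt (evs (Suc n)) (vc u * s * fm \<xi>) = vc u * evs (Suc n) s * fm \<xi>"
    if "u \<in> VecA" "s \<in> ?T" for u s \<xi>
    using that by (simp only: mult.assoc idt_vc[OF left_lin_evs] evs_right)
  have t: "x \<in> TVec \<otimes>\<^sub>A ?T \<otimes>\<^sub>A TOm" using 3(2) split by simp
  have tm: "tmap TVec ?T TOm (evn (Suc n)) x = idt (evs (Suc n)) x"
    by (rule tmap_eq[OF t left_linD(1)[OF left_lin_idt[OF left_lin_evs]]])
      (auto elim!: TVecE TOmE simp: val 3(1) simp del: evs.simps tpow.simps evn.simps)
  have "idt (evs (Suc n)) x \<in> TVec \<otimes>\<^sub>A TOm"
  proof (rule tprod_into[OF t left_linD(1)[OF left_lin_idt[OF left_lin_evs]]])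
    fix v y :: "'w tens" assume v: "v \<in> TVec" and y: "y \<in> ?T \<otimes>\<^sub>A TOm"
    have e: "evs (Suc n) y \<in> TOm"
      by (rule tprod_into[OF y left_linD(1)[OF left_lin_evs]])
        (auto simp: evs_right simp del: evs.simps tpow.simps
          dest!: evs_TA intro!: TA_tprod[OF left_mod_TOm, THEN equalityD1, THEN subsetD, OF tprod_mem])
    from v obtain u where u: "u \<in> VecA" "v = vc u" by (rule TVecE)
    show "idt (evs (Suc n)) (v * y) \<in> TVec \<otimes>\<^sub>A TOm"
      unfolding u(2) idt_vc[OF left_lin_evs u(1)] by (rule tprod_mem[OF vc_TVec[OF u(1)] e])
  qed auto
  then show ?case
    unfolding evn.simps tm by (simp add: ev_eq)
qed simp

lemma tmap_evn_eq:
  assumes "y \<in> tpow TVec n \<otimes>\<^sub>A tpow TOm n \<otimes>\<^sub>A E"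
  shows "tmap {1} (tpow TVec n \<otimes>\<^sub>A tpow TOm n) E (evn n) y = evs n y"
  by (rule tmap_eq[OF _ left_linD(1)[OF left_lin_evs]])
    (use assms in \<open>auto simp: tprod_one_left tprod_assoc evs_right evn_eq\<close>)

section \<open>The type decomposition\<close>

lemma cscale_diff: "cscale c (x - y) = cscale c x - cscale c (y :: 'w::graded_complex_algebra)"
  using cscale_add_right[of c "x - y" y] by (simp add: algebra_simps)

lemma cscale_zero: "cscale c 0 = (0 :: 'w::graded_complex_algebra)"
  using cscale_diff[of c 0 "0 :: 'w"] by simp

lemma cscale_uminus: "cscale c (- x) = - cscale c (x :: 'w::graded_complex_algebra)"
  using cscale_diff[of c 0 x] by (simp add: cscale_zero)

lemma cscale_zero_left: "cscale 0 x = (0 :: 'w::graded_complex_algebra)"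
  using cscale_add_left[of 0 0 x] by simp

lemma cscale_uminus_left: "cscale (- c) x = - cscale c (x :: 'w::graded_complex_algebra)"
  using cscale_add_left[of c "- c" x] by (simp add: cscale_zero_left eq_neg_iff_add_eq_0 add.commute)

lemma cscale_Om_0: "cscale c 1 \<in> (Om 0 :: 'w::graded_complex_algebra set)"
  by (simp add: Om_cscale Om_one)

lemma cscale_eq_zero: "cscale c x = 0 \<Longrightarrow> c \<noteq> 0 \<Longrightarrow> x = (0 :: 'w::graded_complex_algebra)"
  using cscale_cscale[of "inverse c" c x] by (simp add: cscale_zero cscale_one)

lemma cscale_i_i: "cscale \<i> (cscale \<i> x) = - (x :: 'w::graded_complex_algebra)"
  by (simp add: cscale_cscale cscale_uminus_left cscale_one)

lemma cscale_half: "cscale (1 / 2) (x + x) = (x :: 'w::graded_complex_algebra)"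
proof -
  have "cscale (1 / 2) (x + x) = cscale (1 / 2 + 1 / 2) x"
    by (simp only: cscale_add_right cscale_add_left)
  then show ?thesis by (simp add: cscale_one)
qed

lemma cscale_commute: "cscale b (cscale c x) = cscale c (cscale b (x :: 'w::graded_complex_algebra))"
  by (simp add: cscale_cscale mult.commute)

locale almost_complex_structure =
  fixes J :: "'w::star_dga \<Rightarrow> 'w"
  assumes acs: "almost_complex J"
begin

lemma J_mem: "\<xi> \<in> Om 1 \<Longrightarrow> J \<xi> \<in> Om 1"
  and J_add: "\<xi> \<in> Om 1 \<Longrightarrow> \<eta> \<in> Om 1 \<Longrightarrow> J (\<xi> + \<eta>) = J \<xi> + J \<eta>"
  and J_left: "a \<in> Om 0 \<Longrightarrow> \<xi> \<in> Om 1 \<Longrightarrow> J (a * \<xi>) = a * J \<xi>"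
  and J_right: "\<xi> \<in> Om 1 \<Longrightarrow> a \<in> Om 0 \<Longrightarrow> J (\<xi> * a) = J \<xi> * a"
  and J_J: "\<xi> \<in> Om 1 \<Longrightarrow> J (J \<xi>) = - \<xi>"
  and J_ok: "n \<ge> 1 \<Longrightarrow> add_ext_ok (J_form_tuples n) prod_list (J_form_rhs J)"
  using acs by (auto simp: almost_complex_def)

lemma add_on_J: "add_on (Om 1) J"
  by (simp add: add_onI_plus J_add)

lemma J_cscale: "\<xi> \<in> Om 1 \<Longrightarrow> J (cscale c \<xi>) = cscale c (J \<xi>)"
  using J_left[OF cscale_Om_0, of \<xi> c] by (simp add: cscale_mult_left)

lemma J_form_1: "\<xi> \<in> Om 1 \<Longrightarrow> J_form J 1 \<xi> = J \<xi>"
  using add_ext_gen[OF J_ok, of 1 "[\<xi>]"]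
  by (simp add: J_form_def J_form_tuples_def J_form_rhs_def One_nat_def)

lemma J_form_2: "\<xi> \<in> Om 1 \<Longrightarrow> \<eta> \<in> Om 1 \<Longrightarrow> J_form J 2 (\<xi> * \<eta>) = J \<xi> * \<eta> + \<xi> * J \<eta>"
  using add_ext_gen[OF J_ok, of 2 "[\<xi>, \<eta>]"]
  by (simp add: J_form_def J_form_tuples_def J_form_rhs_def numeral_2_eq_2 One_nat_def)

lemma Om_2_gens: "Om 2 = group_closure {x * y |x y. x \<in> Om 1 \<and> y \<in> (Om 1 :: 'w set)}"
proof
  show "Om 2 \<subseteq> group_closure {x * y |x y. x \<in> Om 1 \<and> y \<in> (Om 1 :: 'w set)}"
    using Om_generated[of 1, where ?'a = 'w] by (simp add: numeral_2_eq_2 One_nat_def)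
  show "group_closure {x * y |x y. x \<in> Om 1 \<and> y \<in> (Om 1 :: 'w set)} \<subseteq> Om 2"
    by (rule group_closure_subset) (auto dest: Om_mult)
qed

lemma Om_1_mult: "\<xi> \<in> Om 1 \<Longrightarrow> \<eta> \<in> Om 1 \<Longrightarrow> \<xi> * \<eta> \<in> (Om 2 :: 'w set)"
  using Om_mult[of \<xi> 1 \<eta> 1] by simp

lemma add_on_J_form_2: "add_on (Om 2) (J_form J 2)"
proof -
  have "{x * y |x y. x \<in> Om 1 \<and> y \<in> (Om 1 :: 'w set)} \<subseteq> prod_list ` J_form_tuples 2"
  proof clarify
    fix x y :: 'w assume "x \<in> Om 1" "y \<in> Om 1"
    then show "x * y \<in> prod_list ` J_form_tuples 2"
      by (intro image_eqI[of _ _ "[x, y]"]) (simp_all add: J_form_tuples_def)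
  qed
  then have "Om 2 \<subseteq> group_closure (prod_list ` (J_form_tuples 2 :: 'w list set))"
    using Om_2_gens group_closure_mono by blast
  from add_on_subset[OF add_on_add_ext[OF J_ok] this]
  have "add_on (Om 2) (add_ext (J_form_tuples 2) prod_list (J_form_rhs J))" by simp
  then show ?thesis by (simp add: J_form_def[abs_def])
qed

lemma Om_pq_1: "\<xi> \<in> Om_pq J 1 0 \<longleftrightarrow> \<xi> \<in> Om 1 \<and> J \<xi> = cscale \<i> \<xi>"
  "\<xi> \<in> Om_pq J 0 1 \<longleftrightarrow> \<xi> \<in> Om 1 \<and> J \<xi> = - cscale \<i> \<xi>"
  by (auto simp: Om_pq_def J_form_1 cscale_uminus_left)

lemma Om_pq_2: "x \<in> Om_pq J 1 1 \<longleftrightarrow> x \<in> Om 2 \<and> J_form J 2 x = 0"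
  "x \<in> Om_pq J 2 0 \<longleftrightarrow> x \<in> Om 2 \<and> J_form J 2 x = cscale (2 * \<i>) x"
  "x \<in> Om_pq J 0 2 \<longleftrightarrow> x \<in> Om 2 \<and> J_form J 2 x = - cscale (2 * \<i>) x"
  by (auto simp: Om_pq_def cscale_zero_left cscale_uminus_left[symmetric] mult.commute
      simp flip: numeral_2_eq_2)

lemma sgrp_Om_pq_1: "sgrp (Om_pq J 1 0)" "sgrp (Om_pq J 0 1)"
  unfolding sgrp_def
  by (auto simp: Om_pq_1 add_on_zero[OF add_on_J] add_on_diff[OF add_on_J] cscale_zero cscale_diff Om_zero
      sgrp_diff[OF sgrp_Om])

lemma sgrp_Om_pq_2: "sgrp (Om_pq J 1 1)" "sgrp (Om_pq J 2 0)" "sgrp (Om_pq J 0 2)"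
  unfolding sgrp_def
  by (auto simp: Om_pq_2 add_on_zero[OF add_on_J_form_2] add_on_diff[OF add_on_J_form_2] cscale_zero
      cscale_diff Om_zero sgrp_diff[OF sgrp_Om])

abbreviation "p10 \<equiv> proj J 1 0"
abbreviation "p01 \<equiv> proj J 0 1"
abbreviation "p11 \<equiv> proj J 1 1"

text \<open>(id - iJ)/2 is the spectral projection for the eigenvalue i. Applied to a sum of the two
  types it returns the (1,0) part, which proves uniqueness of the decomposition.\<close>

lemma p10_unique: "\<xi> \<in> Om_pq J 0 1 \<Longrightarrow> \<eta> \<in> Om_pq J 1 0 \<Longrightarrow>
    cscale (1 / 2) ((\<xi> + \<eta>) - cscale \<i> (J (\<xi> + \<eta>))) = \<eta>"
proof -
  assume *: "\<xi> \<in> Om_pq J 0 1" "\<eta> \<in> Om_pq J 1 0"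
  have "J (\<xi> + \<eta>) = - cscale \<i> \<xi> + cscale \<i> \<eta>" using * by (simp add: Om_pq_1 J_add)
  then have "cscale \<i> (J (\<xi> + \<eta>)) = \<xi> - \<eta>"
    by (simp only: cscale_add_right cscale_uminus cscale_i_i) simp
  then have "cscale (1 / 2) ((\<xi> + \<eta>) - cscale \<i> (J (\<xi> + \<eta>))) = cscale (1 / 2) (\<eta> + \<eta>)"
    by simp
  then show ?thesis by (simp only: cscale_half)
qed

lemma decompose_1:
  assumes \<xi>: "\<xi> \<in> Om 1"
  defines "\<eta> \<equiv> cscale (1 / 2) (\<xi> - cscale \<i> (J \<xi>))"
  shows "\<eta> \<in> Om_pq J 1 0" "\<xi> - \<eta> \<in> Om_pq J 0 1"
proof -
  have \<eta>: "\<eta> \<in> Om 1" unfolding \<eta>_def by (simp add: Om_cscale sgrp_diff[OF sgrp_Om] J_mem \<xi>)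
  have J\<eta>: "J \<eta> = cscale (1 / 2) (J \<xi> + cscale \<i> \<xi>)"
    unfolding \<eta>_def
    by (simp add: J_cscale \<xi> Om_cscale sgrp_diff[OF sgrp_Om] J_mem add_on_diff[OF add_on_J] J_J cscale_uminus)
  have i\<eta>: "cscale \<i> \<eta> = cscale (1 / 2) (J \<xi> + cscale \<i> \<xi>)"
    unfolding \<eta>_def cscale_commute[of \<i>]
    by (simp only: cscale_diff cscale_i_i) (simp add: cscale_add_right cscale_uminus add.commute)
  show "\<eta> \<in> Om_pq J 1 0"
    unfolding Om_pq_1 using \<eta> J\<eta> i\<eta> by simp
  have "cscale (1 / 2) (J \<xi> + cscale \<i> \<xi>) + cscale (1 / 2) (J \<xi> + cscale \<i> \<xi>) = J \<xi> + cscale \<i> \<xi>"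
    by (simp only: cscale_add_right[symmetric] cscale_half)
  then have "J (\<xi> - \<eta>) = - cscale \<i> (\<xi> - \<eta>)"
    by (simp only: add_on_diff[OF add_on_J \<xi> \<eta>] cscale_diff J\<eta> i\<eta>) (simp add: algebra_simps)
  then show "\<xi> - \<eta> \<in> Om_pq J 0 1"
    unfolding Om_pq_1 using \<eta> \<xi> by (simp add: sgrp_diff[OF sgrp_Om])
qed

lemma p10_p01:
  assumes "\<xi> \<in> Om_pq J 0 1" "\<eta> \<in> Om_pq J 1 0"
  shows p10_sum: "p10 (\<xi> + \<eta>) = \<eta>" and p01_sum: "p01 (\<xi> + \<eta>) = \<xi>"
proof -
  have ex: "\<exists>f. (\<forall>k\<le>1. f k \<in> Om_pq J k (1 - k)) \<and> \<xi> + \<eta> = (\<Sum>k\<le>1. f k) \<and> f 0 = \<xi> \<and> f 1 = \<eta>"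
    using assms by (intro exI[of _ "\<lambda>k. if k = 0 then \<xi> else \<eta>"]) (auto simp: le_Suc_eq One_nat_def)
  have uniq: "f 0 = \<xi> \<and> f 1 = \<eta>"
    if "\<forall>k\<le>1. f k \<in> Om_pq J k (1 - k)" "\<xi> + \<eta> = (\<Sum>k\<le>1. f k)" for f
  proof -
    have f: "f 0 \<in> Om_pq J 0 1" "f 1 \<in> Om_pq J 1 0" "\<xi> + \<eta> = f 0 + f 1"
      using that by (auto simp: One_nat_def)
    then have "f 1 = \<eta>" using p10_unique[OF f(1,2)] p10_unique[OF assms] by simp
    then show ?thesis using f(3) by simp
  qed
  show "p10 (\<xi> + \<eta>) = \<eta>" "p01 (\<xi> + \<eta>) = \<xi>"
    unfolding proj_def using ex uniq by (auto intro!: the_equality)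
qed

lemma p10_p01_form:
  assumes \<xi>: "\<xi> \<in> Om 1"
  shows p10_eq: "p10 \<xi> = cscale (1 / 2) (\<xi> - cscale \<i> (J \<xi>))" and p01_eq: "p01 \<xi> = \<xi> - p10 \<xi>"
    and p10_mem: "p10 \<xi> \<in> Om_pq J 1 0" and p01_mem: "p01 \<xi> \<in> Om_pq J 0 1"
  using p10_p01[OF decompose_1(2,1)[OF \<xi>]] decompose_1[OF \<xi>] by simp_all

lemma p10_plus_p01: "\<xi> \<in> Om 1 \<Longrightarrow> p10 \<xi> + p01 \<xi> = \<xi>"
  by (simp add: p01_eq)

lemma Om_pq_Om_1: "\<xi> \<in> Om_pq J 1 0 \<Longrightarrow> \<xi> \<in> Om 1" "\<xi> \<in> Om_pq J 0 1 \<Longrightarrow> \<xi> \<in> Om 1"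
  by (simp_all add: Om_pq_1)

lemma p10_p01_Om: "\<xi> \<in> Om 1 \<Longrightarrow> p10 \<xi> \<in> Om 1" "\<xi> \<in> Om 1 \<Longrightarrow> p01 \<xi> \<in> Om 1"
  by (simp_all add: Om_pq_Om_1 p10_mem p01_mem)

lemma p10_on: "\<xi> \<in> Om_pq J 1 0 \<Longrightarrow> p10 \<xi> = \<xi>" "\<xi> \<in> Om_pq J 1 0 \<Longrightarrow> p01 \<xi> = 0"
  and p01_on: "\<xi> \<in> Om_pq J 0 1 \<Longrightarrow> p01 \<xi> = \<xi>" "\<xi> \<in> Om_pq J 0 1 \<Longrightarrow> p10 \<xi> = 0"
  using p10_p01[of 0 \<xi>] p10_p01[of \<xi> 0] by (simp_all add: sgrp_zero sgrp_Om_pq_1)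

lemma p10_lin:
  assumes "\<xi> \<in> Om 1"
  shows p10_add: "\<eta> \<in> Om 1 \<Longrightarrow> p10 (\<xi> + \<eta>) = p10 \<xi> + p10 \<eta>"
    and p01_add: "\<eta> \<in> Om 1 \<Longrightarrow> p01 (\<xi> + \<eta>) = p01 \<xi> + p01 \<eta>"
    and p10_left: "a \<in> Om 0 \<Longrightarrow> p10 (a * \<xi>) = a * p10 \<xi>"
    and p01_left: "a \<in> Om 0 \<Longrightarrow> p01 (a * \<xi>) = a * p01 \<xi>"
    and p10_right: "a \<in> Om 0 \<Longrightarrow> p10 (\<xi> * a) = p10 \<xi> * a"
    and p01_right: "a \<in> Om 0 \<Longrightarrow> p01 (\<xi> * a) = p01 \<xi> * a"
  using assms
  by (simp_all add: p10_eq p01_eq Om_add Om_0_mult Om_mult_0 J_add J_left J_right cscale_add_right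
      cscale_diff cscale_mult_left cscale_mult_right right_diff_distrib left_diff_distrib)

lemma add_on_p10: "add_on (Om 1) p10" and add_on_p01: "add_on (Om 1) p01"
  by (auto intro!: add_onI_plus simp: p10_add p01_add)

lemma form_proj_p01: "form_proj (Om_pq J 0 1) p01"
  by (auto simp: form_proj_def Om_pq_Om_1 p01_mem p01_on p10_lin)

lemma Om_pq_1_mult:
  "a \<in> Om 0 \<Longrightarrow> \<xi> \<in> Om_pq J 1 0 \<Longrightarrow> a * \<xi> \<in> Om_pq J 1 0"
  "a \<in> Om 0 \<Longrightarrow> \<xi> \<in> Om_pq J 1 0 \<Longrightarrow> \<xi> * a \<in> Om_pq J 1 0"
  "a \<in> Om 0 \<Longrightarrow> \<xi> \<in> Om_pq J 0 1 \<Longrightarrow> a * \<xi> \<in> Om_pq J 0 1"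
  "a \<in> Om 0 \<Longrightarrow> \<xi> \<in> Om_pq J 0 1 \<Longrightarrow> \<xi> * a \<in> Om_pq J 0 1"
  by (auto simp: Om_pq_1 Om_0_mult Om_mult_0 J_left J_right cscale_mult_left cscale_mult_right)

lemma cscale_2i: "cscale (2 * \<i>) x = cscale \<i> x + cscale \<i> (x :: 'w)"
  by (simp only: mult_2 cscale_add_left)

lemma Om_pq_mult:
  "\<xi> \<in> Om_pq J 1 0 \<Longrightarrow> \<eta> \<in> Om_pq J 1 0 \<Longrightarrow> \<xi> * \<eta> \<in> Om_pq J 2 0"
  "\<xi> \<in> Om_pq J 1 0 \<Longrightarrow> \<eta> \<in> Om_pq J 0 1 \<Longrightarrow> \<xi> * \<eta> \<in> Om_pq J 1 1"
  "\<xi> \<in> Om_pq J 0 1 \<Longrightarrow> \<eta> \<in> Om_pq J 1 0 \<Longrightarrow> \<xi> * \<eta> \<in> Om_pq J 1 1"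
  "\<xi> \<in> Om_pq J 0 1 \<Longrightarrow> \<eta> \<in> Om_pq J 0 1 \<Longrightarrow> \<xi> * \<eta> \<in> Om_pq J 0 2"
  unfolding Om_pq_1 Om_pq_2
  by (simp_all only: Om_1_mult J_form_2 cscale_mult_left cscale_mult_right cscale_2i
      mult_minus_left mult_minus_right simp_thms) simp_all

lemma p11_sum:
  assumes "x \<in> Om_pq J 0 2" "y \<in> Om_pq J 1 1" "z \<in> Om_pq J 2 0"
  shows "p11 (x + y + z) = y"
  unfolding proj_def
proof (rule the_equality)
  show "\<exists>f. (\<forall>k\<le>1 + 1. f k \<in> Om_pq J k (1 + 1 - k)) \<and> x + y + z = (\<Sum>k\<le>1 + 1. f k) \<and> y = f 1"
    using assms
    by (intro exI[of _ "\<lambda>k. if k = 0 then x else if k = 1 then y else z"])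
      (auto simp: le_Suc_eq One_nat_def numeral_2_eq_2)
  fix y' assume "\<exists>f. (\<forall>k\<le>1 + 1. f k \<in> Om_pq J k (1 + 1 - k)) \<and> x + y + z = (\<Sum>k\<le>1 + 1. f k) \<and> y' = f 1"
  then obtain f where f: "\<And>k. k \<le> 2 \<Longrightarrow> f k \<in> Om_pq J k (2 - k)" "x + y + z = (\<Sum>k\<le>2. f k)" "y' = f 1"
    by auto
  define A B C where "A = f 0 - x" "B = f 1 - y" "C = f 2 - z"
  have ABC: "A \<in> Om_pq J 0 2" "B \<in> Om_pq J 1 1" "C \<in> Om_pq J 2 0"
    using f(1)[of 0] f(1)[of 1] f(1)[of 2] assms sgrp_Om_pq_2
    by (auto simp: A_B_C_def sgrp_diff One_nat_def)
  have sum: "A + B + C = 0"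
  proof -
    have "x + y + z = f 0 + f 1 + f 2" using f(2) by (simp add: numeral_2_eq_2 One_nat_def)
    moreover have "A + B + C = (f 0 + f 1 + f 2) - (x + y + z)" by (simp add: A_B_C_def algebra_simps)
    ultimately show ?thesis by simp
  qed
  \<comment> \<open>J has the eigenvalues -2i, 0 and 2i on A, B and C. Applying it to A + B + C = 0
    gives C = A; then A + A = - B is annihilated by J too, so A + A = 0 and B = 0.\<close>
  then have "J_form J 2 (A + B + C) = 0" by (simp add: add_on_zero[OF add_on_J_form_2])
  moreover have "J_form J 2 (A + B + C) = cscale (2 * \<i>) (C - A)"
    using ABC by (simp add: add_on_add[OF add_on_J_form_2] Om_pq_2 Om_add cscale_diff)
  ultimately have CA: "C = A" using cscale_eq_zero[of "2 * \<i>" "C - A"] by simp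
  have AAB: "A + A + B = 0" using sum CA by (simp add: add.assoc add.commute[of B])
  then have "A + A = - B" by (simp only: eq_neg_iff_add_eq_0)
  then have "J_form J 2 (A + A) = J_form J 2 (- B)" by (simp only:)
  then have "cscale (2 * \<i>) (A + A) = 0"
    using ABC CA by (simp add: add_on_add[OF add_on_J_form_2] add_on_uminus[OF add_on_J_form_2] Om_pq_2 cscale_add_right)
  then have "A + A = 0" using cscale_eq_zero[of "2 * \<i>"] by simp
  then have "B = 0" using AAB by simp
  then show "y' = y" using f(3) by (simp add: A_B_C_def)
qed

lemma decompose_2:
  assumes "x \<in> Om 2"
  shows "\<exists>y\<in>Om_pq J 0 2. \<exists>z\<in>Om_pq J 1 1. \<exists>w\<in>Om_pq J 2 0. x = y + z + w"
  using assms unfolding Om_2_gens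
proof induction
  case (base s)
  then consider "s = 0" | \<xi> \<eta> where "s = \<xi> * \<eta>" "\<xi> \<in> Om 1" "\<eta> \<in> Om 1" by auto
  then show ?case
  proof cases
    case 1
    then show ?thesis using sgrp_Om_pq_2[THEN sgrp_zero] by (intro bexI[of _ 0]) simp_all
  next
    case 2
    have "s = (p10 \<xi> + p01 \<xi>) * (p10 \<eta> + p01 \<eta>)" using 2 by (simp add: p10_plus_p01)
    then have s: "s = p01 \<xi> * p01 \<eta> + (p10 \<xi> * p01 \<eta> + p01 \<xi> * p10 \<eta>) + p10 \<xi> * p10 \<eta>"
      by (simp add: algebra_simps)
    have "p10 \<xi> * p01 \<eta> + p01 \<xi> * p10 \<eta> \<in> Om_pq J 1 1"
      using 2 by (auto intro: sgrp_add[OF sgrp_Om_pq_2(1)] Om_pq_mult p10_mem p01_mem)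
    then show ?thesis using s Om_pq_mult(1,4) 2 p10_mem p01_mem by blast
  qed
next
  case (diff s t)
  then obtain y z w y' z' w' where
    "y \<in> Om_pq J 0 2" "z \<in> Om_pq J 1 1" "w \<in> Om_pq J 2 0" "s = y + z + w"
    "y' \<in> Om_pq J 0 2" "z' \<in> Om_pq J 1 1" "w' \<in> Om_pq J 2 0" "t = y' + z' + w'" by blast
  then have "y - y' \<in> Om_pq J 0 2" "z - z' \<in> Om_pq J 1 1" "w - w' \<in> Om_pq J 2 0"
    "s - t = (y - y') + (z - z') + (w - w')"
    using sgrp_Om_pq_2 by (auto simp: sgrp_diff algebra_simps)
  then show ?case by blast
qed

lemma p11_mem: "x \<in> Om 2 \<Longrightarrow> p11 x \<in> Om_pq J 1 1"
  using decompose_2[of x] p11_sum by auto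

lemma p11_on: "x \<in> Om_pq J 1 1 \<Longrightarrow> p11 x = x"
  using p11_sum[of 0 x 0] sgrp_Om_pq_2[THEN sgrp_zero] by simp

lemma add_on_p11: "add_on (Om 2) p11"
proof (rule add_onI)
  fix s t :: 'w assume "s \<in> Om 2" "t \<in> Om 2"
  from decompose_2[OF this(1)] decompose_2[OF this(2)] obtain y z w y' z' w' where *:
    "y \<in> Om_pq J 0 2" "z \<in> Om_pq J 1 1" "w \<in> Om_pq J 2 0" "s = y + z + w"
    "y' \<in> Om_pq J 0 2" "z' \<in> Om_pq J 1 1" "w' \<in> Om_pq J 2 0" "t = y' + z' + w'" by blast
  then have "y - y' \<in> Om_pq J 0 2" "z - z' \<in> Om_pq J 1 1" "w - w' \<in> Om_pq J 2 0"
    and st: "s - t = (y - y') + (z - z') + (w - w')"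
    using sgrp_Om_pq_2 by (auto simp: sgrp_diff algebra_simps)
  from p11_sum[OF this(1-3)] show "p11 (s - t) = p11 s - p11 t"
    unfolding st using * p11_sum by simp
qed simp

lemma p11_mult:
  assumes "\<xi> \<in> Om 1" "\<eta> \<in> Om 1"
  shows "p11 (\<xi> * \<eta>) = p10 \<xi> * p01 \<eta> + p01 \<xi> * p10 \<eta>"
proof -
  have s: "\<xi> * \<eta> = p01 \<xi> * p01 \<eta> + (p10 \<xi> * p01 \<eta> + p01 \<xi> * p10 \<eta>) + p10 \<xi> * p10 \<eta>"
  proof -
    have "\<xi> * \<eta> = (p10 \<xi> + p01 \<xi>) * (p10 \<eta> + p01 \<eta>)" using assms by (simp add: p10_plus_p01)
    then show ?thesis by (simp add: algebra_simps)
  qed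
  show ?thesis
    by (subst s) (use assms in \<open>intro p11_sum sgrp_add[OF sgrp_Om_pq_2(1)] Om_pq_mult p10_mem p01_mem\<close>)
qed

lemma p11_left: "a \<in> Om 0 \<Longrightarrow> x \<in> Om 2 \<Longrightarrow> p11 (a * x) = a * p11 x"
  unfolding Om_2_gens
  by (erule add_on_eq[of x _ "Om 2" "\<lambda>x. p11 (a * x)" "\<lambda>x. a * p11 x"])
    (auto simp: add_on_def right_diff_distrib add_on_diff[OF add_on_p11] Om_0_mult Om_1_mult
      mult.assoc[symmetric] p11_mult p10_lin distrib_left)

lemma p11_right: "a \<in> Om 0 \<Longrightarrow> x \<in> Om 2 \<Longrightarrow> p11 (x * a) = p11 x * a"
  unfolding Om_2_gens
  by (erule add_on_eq[of x _ "Om 2" "\<lambda>x. p11 (x * a)" "\<lambda>x. p11 x * a"])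
    (auto simp: add_on_def left_diff_distrib add_on_diff[OF add_on_p11] Om_mult_0 Om_1_mult
      mult.assoc p11_mult p10_lin distrib_right)

lemma Om_11_mult: "a \<in> Om 0 \<Longrightarrow> x \<in> Om_pq J 1 1 \<Longrightarrow> a * x \<in> Om_pq J 1 1"
    "a \<in> Om 0 \<Longrightarrow> x \<in> Om_pq J 1 1 \<Longrightarrow> x * a \<in> Om_pq J 1 1"
  using p11_mem[of "a * x"] p11_mem[of "x * a"]
  by (auto simp: p11_left p11_right p11_on Om_pq_2(1) Om_0_mult Om_mult_0)

subsection \<open>Vector fields of type (1,0)\<close>

lemma Vec_cscale: "u \<in> VecA \<Longrightarrow> \<xi> \<in> Om 1 \<Longrightarrow> u (cscale c \<xi>) = cscale c (u (\<xi> :: 'w))"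
  using VecA_app_right[OF _ _ cscale_Om_0, of u \<xi> c] by (simp add: cscale_mult_right)

lemma p10_J: "\<xi> \<in> Om 1 \<Longrightarrow> p10 (J \<xi>) = cscale \<i> (p10 \<xi>)"
  unfolding p10_eq p10_eq[OF J_mem] cscale_commute[of \<i>]
  by (simp only: cscale_diff cscale_i_i J_J cscale_uminus) (simp add: cscale_add_right cscale_uminus add.commute)

text \<open>The eigenspace condition says that u factors through \<open>p10\<close>. In this form
  the vector fields of type (1,0) become the image of the projection \<open>q10\<close>, and a
  \<open>p10\<close> in front of a contraction with u disappears.\<close>

lemma Vec10_iff: "u \<in> Vec10 J \<longleftrightarrow> u \<in> VecA \<and> (\<forall>\<xi>\<in>Om 1. u (p10 \<xi>) = u \<xi>)"
proof (intro iffI conjI ballI)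
  assume u: "u \<in> Vec10 J"
  then show uV: "u \<in> VecA" by (simp add: Vec10_def)
  fix \<xi> :: 'w assume \<xi>: "\<xi> \<in> Om 1"
  have "u (J \<xi>) = cscale \<i> (u \<xi>)" using u \<xi> by (auto simp: Vec10_def J_vec_def fun_eq_iff split: if_splits)
  then have "cscale \<i> (u (J \<xi>)) = - u \<xi>" by (simp only: cscale_i_i)
  then have "u (p10 \<xi>) = cscale (1 / 2) (u \<xi> + u \<xi>)"
    using uV \<xi> by (simp add: p10_eq Vec_cscale add_on_diff[OF add_on_VecA] Om_cscale J_mem
        sgrp_diff[OF sgrp_Om])
  then show "u (p10 \<xi>) = u \<xi>" by (simp only: cscale_half)
next
  assume u: "u \<in> VecA \<and> (\<forall>\<xi>\<in>Om 1. u (p10 \<xi>) = u \<xi>)"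
  have "u (J \<xi>) = cscale \<i> (u \<xi>)" if "\<xi> \<in> Om 1" for \<xi>
  proof -
    have "u (J \<xi>) = u (p10 (J \<xi>))" using u that by (simp add: J_mem)
    then show ?thesis using u that by (simp add: p10_J Vec_cscale p10_p01_Om)
  qed
  then show "u \<in> Vec10 J"
    using u by (auto simp: Vec10_def J_vec_def fun_eq_iff VecA_junk cscale_zero)
qed

lemma Vec10_VecA: "u \<in> Vec10 J \<Longrightarrow> u \<in> VecA"
  by (simp add: Vec10_iff)

lemma Vec10_p10: "u \<in> Vec10 J \<Longrightarrow> \<xi> \<in> Om 1 \<Longrightarrow> u (p10 \<xi>) = u \<xi>"
  by (simp add: Vec10_iff)

definition q10 :: "('w \<Rightarrow> 'w) \<Rightarrow> 'w \<Rightarrow> 'w" where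
  "q10 u = (\<lambda>\<xi>. if \<xi> \<in> Om 1 then u (p10 \<xi>) else 0)"

lemma vec_proj_q10: "vec_proj (Vec10 J) q10"
proof -
  have V: "q10 u \<in> VecA" if "u \<in> VecA" for u
    using that by (auto simp: VecA_def q10_def Om_add Om_mult_0 p10_lin p10_p01_Om)
  have p: "p10 (p10 \<xi>) = p10 \<xi>" if "\<xi> \<in> Om 1" for \<xi> using that by (simp add: p10_on p10_mem)
  show ?thesis
    unfolding vec_proj_def vec_endo_def
  proof (intro conjI ballI subsetI)
    show "q10 u \<in> Vec10 J" if "u \<in> VecA" for u
      using V that p by (auto simp: Vec10_iff q10_def p10_p01_Om)
    show "q10 u = u" if "u \<in> Vec10 J" for u
      using that by (auto simp: q10_def Vec10_iff fun_eq_iff VecA_junk)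
  qed (auto simp: V Vec10_VecA, auto simp: q10_def vadd_def vract_def vlact_def fun_eq_iff
      Om_0_mult p10_left p10_p01_Om)
qed

lemma vract_Vec10: "u \<in> Vec10 J \<Longrightarrow> a \<in> Om 0 \<Longrightarrow> vract u a \<in> Vec10 J"
  and vlact_Vec10: "u \<in> Vec10 J \<Longrightarrow> a \<in> Om 0 \<Longrightarrow> vlact a u \<in> Vec10 J"
  and vadd_Vec10: "u \<in> Vec10 J \<Longrightarrow> v \<in> Vec10 J \<Longrightarrow> vadd u v \<in> Vec10 J"
  unfolding Vec10_iff
  by (auto simp: vract_VecA vlact_VecA vadd_VecA vract_app vlact_app vadd_app p10_p01_Om
      p10_left[symmetric] Om_0_mult)

lemma sgrp_TVec10 [simp]: "sgrp (TVec10 J)"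
  unfolding TVec10_def
  by (rule sgrp_vc_image) (auto simp: Vec10_VecA vadd_Vec10 vlact_Vec10, simp add: Vec10_iff VecA_def Om_zero)

lemma left_mod_TVec10: "left_mod (TVec10 J)" and right_mod_TVec10: "right_mod (TVec10 J)"
  unfolding left_mod_def right_mod_def using sgrp_TVec10[unfolded TVec10_def]
  by (auto simp: TVec10_def vc_left[symmetric] vc_right[symmetric] Vec10_VecA vract_Vec10 vlact_Vec10)

lemma sgrp_TOm10 [simp]: "sgrp (TOm10 J)" and sgrp_TOm01 [simp]: "sgrp (TOm01 J)"
proof -
  have "Om_pq J 1 0 \<subseteq> Om 1" "Om_pq J 0 1 \<subseteq> Om 1" using Om_pq_Om_1 by auto
  then show "sgrp (TOm10 J)" "sgrp (TOm01 J)"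
    unfolding TOm10_def TOm01_def
    using sgrp_image[OF add_on_subset[OF add_on_fm]] sgrp_Om_pq_1 by blast+
qed

lemma TOm10E: "x \<in> TOm10 J \<Longrightarrow> (\<And>\<xi>. \<xi> \<in> Om_pq J 1 0 \<Longrightarrow> x = fm \<xi> \<Longrightarrow> P) \<Longrightarrow> P"
  and TOm01E: "x \<in> TOm01 J \<Longrightarrow> (\<And>\<xi>. \<xi> \<in> Om_pq J 0 1 \<Longrightarrow> x = fm \<xi> \<Longrightarrow> P) \<Longrightarrow> P"
  and TVec10E: "x \<in> TVec10 J \<Longrightarrow> (\<And>u. u \<in> Vec10 J \<Longrightarrow> x = vc u \<Longrightarrow> P) \<Longrightarrow> P"
  unfolding TOm10_def TOm01_def TVec10_def by blast+

lemma fm_TOm10: "\<xi> \<in> Om_pq J 1 0 \<Longrightarrow> fm \<xi> \<in> TOm10 J"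
  and fm_TOm01: "\<xi> \<in> Om_pq J 0 1 \<Longrightarrow> fm \<xi> \<in> TOm01 J"
  and vc_TVec10: "u \<in> Vec10 J \<Longrightarrow> vc u \<in> TVec10 J"
  unfolding TOm10_def TOm01_def TVec10_def by blast+

lemma left_mod_TOm10: "left_mod (TOm10 J)" and right_mod_TOm10: "right_mod (TOm10 J)"
  and left_mod_TOm01: "left_mod (TOm01 J)" and right_mod_TOm01: "right_mod (TOm01 J)"
proof -
  have "sc a * x \<in> TOm10 J \<and> x * sc a \<in> TOm10 J" if "a \<in> Om 0" "x \<in> TOm10 J" for a x
    using that(2)
  proof (rule TOm10E)
    fix \<xi> assume \<xi>: "\<xi> \<in> Om_pq J 1 0" "x = fm \<xi>"
    have "sc a * x = fm (a * \<xi>)" "x * sc a = fm (\<xi> * a)"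
      unfolding \<xi>(2) using fm_left fm_right Om_pq_Om_1(1)[OF \<xi>(1)] that(1) by metis+
    then show ?thesis using \<xi>(1) that(1) by (simp only: fm_TOm10 Om_pq_1_mult simp_thms)
  qed
  moreover have "sc a * x \<in> TOm01 J \<and> x * sc a \<in> TOm01 J" if "a \<in> Om 0" "x \<in> TOm01 J" for a x
    using that(2)
  proof (rule TOm01E)
    fix \<xi> assume \<xi>: "\<xi> \<in> Om_pq J 0 1" "x = fm \<xi>"
    have "sc a * x = fm (a * \<xi>)" "x * sc a = fm (\<xi> * a)"
      unfolding \<xi>(2) using fm_left fm_right Om_pq_Om_1(2)[OF \<xi>(1)] that(1) by metis+
    then show ?thesis using \<xi>(1) that(1) by (simp only: fm_TOm01 Om_pq_1_mult simp_thms)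
  qed
  ultimately show "left_mod (TOm10 J)" "right_mod (TOm10 J)" "left_mod (TOm01 J)" "right_mod (TOm01 J)"
    by (simp_all add: left_mod_def right_mod_def)
qed

end

section \<open>Bimodule maps extended to tensor products\<close>

lemma sum_list_pairs: "(\<Sum>(x, y)\<leftarrow>bs. f x y) = (\<Sum>i<length bs. f (fst (bs ! i)) (snd (bs ! i)))"
  by (simp add: sum_list_sum_nth atLeast0LessThan split_beta)

definition form_endo :: "('w::graded_complex_algebra \<Rightarrow> 'w) \<Rightarrow> bool" where
  "form_endo f \<longleftrightarrow> (\<forall>\<xi>\<in>Om 1. f \<xi> \<in> Om 1) \<and> (\<forall>\<xi>\<in>Om 1. \<forall>\<eta>\<in>Om 1. f (\<xi> + \<eta>) = f \<xi> + f \<eta>) \<and>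
     (\<forall>\<xi>\<in>Om 1. \<forall>a\<in>Om 0. f (a * \<xi>) = a * f \<xi> \<and> f (\<xi> * a) = f \<xi> * a)"

definition form_map :: "('w::graded_complex_algebra \<Rightarrow> 'w) \<Rightarrow> 'w tens \<Rightarrow> 'w tens" where
  "form_map f = tens_rec (\<lambda>\<xi> y. fm (f \<xi>) * y) (\<lambda>u y. 0)"

context
  fixes f :: "'w::graded_complex_algebra \<Rightarrow> 'w"
  assumes f: "form_endo f"
begin

lemma form_balanced_map: "form_balanced (\<lambda>\<xi> y. fm (f \<xi>) * y)"
  using f by (auto simp: form_balanced_def form_endo_def add_on_def right_diff_distrib fm_add
      distrib_right fm_right mult.assoc)

lemma left_lin_form_map: "left_lin (form_map f)"
  unfolding form_map_def using f
  by (intro tens_rec_left_lin[OF form_balanced_map vec_balanced_zero])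
    (auto simp: form_endo_def fm_left mult.assoc)

lemma form_map_fm: "\<xi> \<in> Om 1 \<Longrightarrow> form_map f (fm \<xi> * y) = fm (f \<xi>) * y"
  unfolding form_map_def by (simp add: tens_rec[OF form_balanced_map vec_balanced_zero])

lemma form_map_fm_1: "\<xi> \<in> Om 1 \<Longrightarrow> form_map f (fm \<xi>) = fm (f \<xi>)"
  using form_map_fm[of \<xi> 1] by simp

lemma form_map_right: "t \<in> TOm \<otimes>\<^sub>A UNIV \<Longrightarrow> form_map f (t * z) = form_map f t * z"
  by (erule tprod_eq[where S = UNIV and f = "\<lambda>t. form_map f (t * z)" and g = "\<lambda>t. form_map f t * z"])
    (auto elim!: TOmE simp: add_on_def left_lin_diff[OF left_lin_form_map] left_diff_distrib mult.assoc form_map_fm)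

lemma fmap1_eq: "t \<in> TOm \<Longrightarrow> fmap1 f t = form_map f t"
  unfolding fmap1_def TOm_def
  by (rule add_ext_unique[OF left_linD(1)[OF left_lin_form_map]])
    (auto simp: form_map_fm_1 intro: group_closure_gen)

lemma tmap_fmap1: "y \<in> tpow TOm n \<otimes>\<^sub>A TOm \<otimes>\<^sub>A Z \<Longrightarrow> tmap (tpow TOm n) TOm Z (fmap1 f) y = idts n (form_map f) y"
  by (rule tmap_eq[OF _ left_linD(1)[OF left_lin_idts[OF left_lin_form_map]]])
    (auto elim!: TOmE simp: mult.assoc idts_forms[OF left_lin_form_map] form_map_fm fmap1_eq fm_TOm form_map_fm_1)

lemma tmap_fmap1_left: "sgrp Z \<Longrightarrow> y \<in> TOm \<otimes>\<^sub>A Z \<Longrightarrow> tmap {1} TOm Z (fmap1 f) y = form_map f y"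
  by (rule tmap_eq[OF _ left_linD(1)[OF left_lin_form_map]])
    (auto elim!: TOmE simp: form_map_fm fmap1_eq fm_TOm form_map_fm_1 tprod_one_left)

end

lemma form_endo_id: "form_endo (\<lambda>\<xi>. \<xi>)"
  by (simp add: form_endo_def)

lemma gens_TOm_TOm:
  "{x * y |x y. x \<in> TOm \<and> y \<in> TOm} = (\<lambda>(\<xi>, \<eta>). fm \<xi> * fm \<eta>) ` (Om 1 \<times> (Om 1 :: 'w::graded_complex_algebra set))"
  by (force simp: TOm_def)

lemma tens2_eq:
  fixes f g :: "'w::graded_complex_algebra \<Rightarrow> 'w"
  assumes f: "form_endo f" and g: "form_endo g" and t: "t \<in> TOm \<otimes>\<^sub>A TOm"
  shows "tens2 f g t = form_map f (idt (form_map g) t)"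
  unfolding tens2_def
  by (rule add_ext_unique[OF left_linD(1)[OF left_lin_comp[OF left_lin_form_map left_lin_idt]]])
    (use t f g in \<open>auto simp: idt_fm left_lin_form_map form_map_fm form_map_fm_1 gens_TOm_TOm[symmetric]
      tprod_def\<close>)

lemma wedge_eq: "t \<in> TOm \<otimes>\<^sub>A TOm \<Longrightarrow> wedge t = wedges (t :: 'w::graded_complex_algebra tens)"
  unfolding wedge_def
  by (rule add_ext_unique[OF add_on_wedges])
    (auto simp: gens_TOm_TOm[symmetric] tprod_def wedges_fm wedges_fm_1)

section \<open>The covariant derivative on vector fields\<close>

lemma dif_diff: "dif (x - y) = dif x - dif (y :: 'w::star_dga)"
  using dif_add[of "x - y" y] by (simp add: algebra_simps)

lemma dif_A: "a \<in> Om 0 \<Longrightarrow> dif a \<in> Om 1"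
  using dif_degree[of a 0] by (simp add: One_nat_def)

lemma dif_A_mult: "a \<in> Om 0 \<Longrightarrow> dif (a * x) = dif a * x + a * dif x"
  using dif_mult[of a 0 x] by simp

lemma dif_one: "dif 1 = (0 :: 'w::star_dga)"
  using dif_A_mult[OF Om_one, of "1 :: 'w"] by simp

lemma add_on_fm_dif: "add_on (Om 0) (\<lambda>a :: 'w::star_dga. fm (dif a))"
  by (rule add_on_comp[OF _ add_on_fm]) (auto simp: add_on_def dif_diff dif_A)

lemma tdif_TA: "x \<in> TA \<Longrightarrow> tdif x = fm (dif (wedges (x :: 'w::star_dga tens)))"
  and add_on_tdif: "add_on TA (tdif :: 'w tens \<Rightarrow> 'w tens)"
proof -
  have *: "add_on TA (\<lambda>x :: 'w tens. fm (dif (wedges x)))"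
    by (rule add_on_comp[OF _ add_on_fm_dif])
      (auto simp: TA_def wedges_sc intro: add_on_subset[OF add_on_wedges] left_modD(1)[OF left_mod_TA, unfolded TA_def])
  show eq: "tdif x = fm (dif (wedges x))" if "x \<in> TA" for x :: "'w tens"
    unfolding tdif_def
    by (rule add_ext_unique[OF *]) (use that in \<open>auto simp: TA_def wedges_sc intro: group_closure_gen\<close>)
  show "add_on TA (tdif :: 'w tens \<Rightarrow> 'w tens)"
    using * by (auto simp: add_on_def eq sgrp_diff)
qed

lemma tdif_sc: "a \<in> Om 0 \<Longrightarrow> tdif (sc a) = fm (dif a)"
  by (simp add: tdif_TA sc_TA wedges_sc)

locale hd_setting = almost_complex_structure J for J :: "'w::star_dga \<Rightarrow> 'w" +
  fixes box :: "'w \<Rightarrow> 'w tens"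
    and sinv :: "'w tens \<Rightarrow> 'w tens"
    and xis etas :: "('w \<times> ('w \<Rightarrow> 'w)) list"
  assumes xis: "dual_basis (Om 1) VecA xis"
    and etas: "dual_basis (Om_pq J 1 0) (Vec10 J) etas"
    and cov: "right_bimod_cov_deriv box sinv"
    and wedge_bij: "bij_betw wedge (TOm10 J \<otimes>\<^sub>A TOm01 J) (Om_pq J 1 1)"
    and box_J: "\<forall>\<xi>\<in>Om 1. tens2 J (\<lambda>\<eta>. \<eta>) (box \<xi>) = box (J \<xi>)"
    and torsion: "\<forall>\<xi>\<in>Om 1. proj J 1 1 (torsion_R box \<xi>) = 0"
    and sinv_wedge: "\<forall>t\<in>TOm \<otimes>\<^sub>A TOm. proj J 1 1 (wedge (sinv t)) =
              - wedge (tens2 (proj J 0 1) (proj J 1 0) t)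
              - wedge (tens2 (proj J 1 0) (proj J 0 1) t)"
begin

section \<open>Expansions in the dual bases\<close>

definition X where "X i = fst (xis ! i)"
definition U where "U i = snd (xis ! i)"
definition Et where "Et i = fst (etas ! i)"
definition H where "H i = snd (etas ! i)"
definition IX where "IX = {..<length xis}"
definition IE where "IE = {..<length etas}"

lemma basis_mem: "i \<in> IX \<Longrightarrow> X i \<in> Om 1" "i \<in> IX \<Longrightarrow> U i \<in> VecA"
  "i \<in> IE \<Longrightarrow> Et i \<in> Om_pq J 1 0" "i \<in> IE \<Longrightarrow> H i \<in> Vec10 J"
  using xis etas unfolding dual_basis_def X_def U_def Et_def H_def IX_def IE_def lessThan_iff
  by (auto dest!: nth_mem simp: subset_iff mem_Times_iff split: prod.splits)
    (metis fst_conv snd_conv prod.collapse)+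

lemma Et_Om_1: "i \<in> IE \<Longrightarrow> Et i \<in> Om 1" and H_VecA: "i \<in> IE \<Longrightarrow> H i \<in> VecA"
  by (simp_all add: basis_mem Om_pq_Om_1 Vec10_VecA)

lemma dual_X: "\<xi> \<in> Om 1 \<Longrightarrow> (\<Sum>i\<in>IX. X i * U i \<xi>) = \<xi>"
  using xis by (simp add: dual_basis_def sum_list_pairs X_def U_def IX_def)

lemma dual_Et: "\<xi> \<in> Om_pq J 1 0 \<Longrightarrow> (\<Sum>i\<in>IE. Et i * H i \<xi>) = \<xi>"
  using etas by (simp add: dual_basis_def sum_list_pairs Et_def H_def IE_def)

text \<open>A right linear f corresponds to the element \<Sum>f(X_i) \<otimes> U_i. The derivative
  \<open>bv u\<close>, the map \<sigma> and the sum \<open>P\<close> are all elements of this form,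
  so the lemmas on such sums serve them together.\<close>

definition right_lin :: "('w \<Rightarrow> 'w tens) \<Rightarrow> bool" where
  "right_lin f \<longleftrightarrow> add_on (Om 1) f \<and> (\<forall>\<xi>\<in>Om 1. \<forall>a\<in>Om 0. f (\<xi> * a) = f \<xi> * sc a)"

lemma right_linD: "right_lin f \<Longrightarrow> add_on (Om 1) f"
  "right_lin f \<Longrightarrow> \<xi> \<in> Om 1 \<Longrightarrow> a \<in> Om 0 \<Longrightarrow> f (\<xi> * a) = f \<xi> * sc a"
  by (auto simp: right_lin_def)

lemma right_lin_dual: 
  assumes f: "right_lin f" and \<xi>: "\<xi> \<in> Om 1"
  shows "(\<Sum>i\<in>IX. f (X i) * sc (U i \<xi>)) = f \<xi>"
proof -
  have "f \<xi> = f (\<Sum>i\<in>IX. X i * U i \<xi>)" by (simp only: dual_X[OF \<xi>])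
  also have "\<dots> = (\<Sum>i\<in>IX. f (X i * U i \<xi>))"
    by (rule add_on_sum[OF right_linD(1)[OF f]]) (simp add: basis_mem \<xi> VecA_app Om_mult_0)
  also have "\<dots> = (\<Sum>i\<in>IX. f (X i) * sc (U i \<xi>))"
    by (rule sum.cong) (simp_all add: right_linD(2)[OF f] basis_mem \<xi> VecA_app)
  finally show ?thesis by simp
qed

lemma right_lin_fm: "right_lin fm"
  by (simp add: right_lin_def add_on_fm fm_right)

lemma TVec_ext:
  assumes "x \<in> TVec" "y \<in> TVec" "\<And>\<xi>. \<xi> \<in> Om 1 \<Longrightarrow> evl (x * fm \<xi>) = evl (y * fm (\<xi> :: 'w))"
  shows "x = y"
proof -
  obtain u v where uv: "u \<in> VecA" "v \<in> VecA" "x = vc u" "y = vc v" using assms(1,2) by (auto elim!: TVecE)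
  have "u \<xi> = v \<xi>" for \<xi>
  proof (cases "\<xi> \<in> Om 1")
    case True
    then have "sc (u \<xi>) = sc (v \<xi>)" using assms(3)[OF True] uv by (simp add: evl_vc contr_fm_1)
    then show ?thesis using uv True by (simp add: sc_inject VecA_app)
  qed (simp add: uv VecA_junk)
  then show ?thesis using uv by (metis ext)
qed

text \<open>The other half of the duality: the \<open>U i\<close> span \<open>VecA\<close> from the
  left, with the values of v as coefficients.\<close>

lemma vec_expand:
  assumes v: "v \<in> VecA" shows "(\<Sum>i\<in>IX. sc (v (X i)) * vc (U i)) = vc v"
proof (rule TVec_ext)
  show "(\<Sum>i\<in>IX. sc (v (X i)) * vc (U i)) \<in> TVec"
    using v by (auto intro!: sgrp_sum left_modD(2)[OF left_mod_TVec] simp: basis_mem VecA_app vc_TVec)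
  show "vc v \<in> TVec" by (simp add: vc_TVec v)
  fix \<xi> :: 'w assume \<xi>: "\<xi> \<in> Om 1"
  have "right_lin (\<lambda>\<xi>. sc (v \<xi>))"
    using v by (auto simp: right_lin_def VecA_app_right sc_mult VecA_app add_on_diff[OF add_on_sc]
        add_on_diff[OF add_on_VecA] intro!: add_onI)
  from right_lin_dual[OF this \<xi>]
  show "evl ((\<Sum>i\<in>IX. sc (v (X i)) * vc (U i)) * fm \<xi>) = evl (vc v * fm \<xi>)"
    using v \<xi> by (simp add: sum_distrib_right mult.assoc left_lin_sum[OF left_lin_evl] left_linD(2)[OF left_lin_evl]
        VecA_app basis_mem evl_vc contr_fm_1 cong: sum.cong_simp)
qed

lemma expand_swap:
  assumes "\<And>k. k \<in> K \<Longrightarrow> v k \<in> VecA"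
  shows "(\<Sum>i\<in>IX. (\<Sum>k\<in>K. F k * sc (v k (X i))) * vc (U i)) = (\<Sum>k\<in>K. F k * vc (v k))"
proof -
  have "(\<Sum>i\<in>IX. (\<Sum>k\<in>K. F k * sc (v k (X i))) * vc (U i)) = (\<Sum>k\<in>K. \<Sum>i\<in>IX. F k * (sc (v k (X i)) * vc (U i)))"
    by (subst sum.swap) (simp add: sum_distrib_right mult.assoc)
  also have "\<dots> = (\<Sum>k\<in>K. F k * vc (v k))"
    by (rule sum.cong) (simp_all add: sum_distrib_left[symmetric] vec_expand assms)
  finally show ?thesis .
qed

text \<open>Centrality of the coevaluation, \<Sum>aX_i \<otimes> U_i = \<Sum>X_i \<otimes> U_i a,
  seen through a right linear map. It yields the balancing of maps that insert a dual basis.\<close>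

lemma basis_left:
  assumes f: "right_lin f" and a: "a \<in> Om 0"
  shows "(\<Sum>i\<in>IX. f (a * X i) * vc (U i)) = (\<Sum>i\<in>IX. f (X i) * vc (U i)) * sc a"
proof -
  have "(\<Sum>i\<in>IX. f (a * X i) * vc (U i)) = (\<Sum>i\<in>IX. (\<Sum>k\<in>IX. f (X k) * sc (vract (U k) a (X i))) * vc (U i))"
    by (rule sum.cong) (simp_all add: right_lin_dual[OF f] vract_app basis_mem a Om_0_mult)
  also have "\<dots> = (\<Sum>k\<in>IX. f (X k) * vc (vract (U k) a))"
    by (rule expand_swap) (simp add: basis_mem vract_VecA a)
  also have "\<dots> = (\<Sum>i\<in>IX. f (X i) * vc (U i)) * sc a"
    by (simp add: sum_distrib_right mult.assoc vc_right basis_mem a cong: sum.cong_simp)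
  finally show ?thesis .
qed

text \<open>Projecting the coevaluation of all 1-forms by \<open>p10\<close> gives the coevaluation
  of the (1,0) forms. This exchanges the basis \<open>xis\<close> for \<open>etas\<close>, whose
  vectors have type (1,0).\<close>

lemma basis_10:
  assumes f: "right_lin f"
  shows "(\<Sum>i\<in>IX. f (p10 (X i)) * vc (U i)) = (\<Sum>k\<in>IE. f (Et k) * vc (H k))"
proof -
  have "f (p10 \<xi>) = (\<Sum>k\<in>IE. f (Et k) * sc (H k \<xi>))" if \<xi>: "\<xi> \<in> Om 1" for \<xi>
  proof -
    have "f (p10 \<xi>) = f (\<Sum>i\<in>IE. Et i * H i (p10 \<xi>))" by (simp only: dual_Et[OF p10_mem[OF \<xi>]])
    also have "\<dots> = (\<Sum>i\<in>IE. f (Et i * H i (p10 \<xi>)))"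
      by (rule add_on_sum[OF right_linD(1)[OF f]])
        (simp add: Et_Om_1 H_VecA p10_p01_Om \<xi> VecA_app Om_mult_0)
    also have "\<dots> = (\<Sum>i\<in>IE. f (Et i) * sc (H i \<xi>))"
      by (rule sum.cong) (simp_all add: right_linD(2)[OF f] Et_Om_1 H_VecA Vec10_p10 basis_mem \<xi> VecA_app)
    finally show ?thesis .
  qed
  then have "(\<Sum>i\<in>IX. f (p10 (X i)) * vc (U i)) = (\<Sum>i\<in>IX. (\<Sum>k\<in>IE. f (Et k) * sc (H k (X i))) * vc (U i))"
    by (intro sum.cong) (simp_all add: basis_mem)
  also have "\<dots> = (\<Sum>k\<in>IE. f (Et k) * vc (H k))"
    by (rule expand_swap) (simp add: H_VecA)
  finally show ?thesis .
qed

text \<open>Contractions with the \<open>U i\<close> determine a tensor that begins with a form;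
  nondegeneracy of the iterated evaluation rests on this.\<close>

lemma form_expand:
  assumes "y \<in> TOm \<otimes>\<^sub>A UNIV" shows "(\<Sum>i\<in>IX. fm (X i) * contr (U i) y) = y"
proof (rule tprod_eq[OF assms, of UNIV "\<lambda>y. \<Sum>i\<in>IX. fm (X i) * contr (U i) y" "\<lambda>y. y"])
  fix x y :: "'w tens" assume "x \<in> TOm"
  then obtain \<xi> where \<xi>: "\<xi> \<in> Om 1" "x = fm \<xi>" by (rule TOmE)
  show "(\<Sum>i\<in>IX. fm (X i) * contr (U i) (x * y)) = x * y"
    using right_lin_dual[OF right_lin_fm \<xi>(1)]
    by (simp add: \<xi> contr_fm basis_mem mult.assoc[symmetric] sum_distrib_right[symmetric]
        cong: sum.cong_simp)
qed (auto simp: add_on_def contr_diff basis_mem right_diff_distrib sum_subtractf[symmetric]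
    intro!: sum.cong)

lemma sinv:
  shows sinv_mem: "x \<in> TOm \<otimes>\<^sub>A TOm \<Longrightarrow> sinv x \<in> TOm \<otimes>\<^sub>A TOm"
    and add_on_sinv: "add_on (TOm \<otimes>\<^sub>A TOm) sinv"
    and sinv_left: "x \<in> TOm \<otimes>\<^sub>A TOm \<Longrightarrow> a \<in> Om 0 \<Longrightarrow> sinv (sc a * x) = sc a * sinv x"
    and sinv_right: "x \<in> TOm \<otimes>\<^sub>A TOm \<Longrightarrow> a \<in> Om 0 \<Longrightarrow> sinv (x * sc a) = sinv x * sc a"
  using cov by (auto simp: right_bimod_cov_deriv_def intro: add_onI_plus)

lemma box:
  shows box_mem: "\<xi> \<in> Om 1 \<Longrightarrow> box \<xi> \<in> TOm \<otimes>\<^sub>A TOm"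
    and add_on_box: "add_on (Om 1) box"
    and box_right: "\<xi> \<in> Om 1 \<Longrightarrow> a \<in> Om 0 \<Longrightarrow> box (\<xi> * a) = box \<xi> * sc a + fm \<xi> * fm (dif a)"
    and box_left: "\<xi> \<in> Om 1 \<Longrightarrow> a \<in> Om 0 \<Longrightarrow> box (a * \<xi>) = sc a * box \<xi> + sinv (fm (dif a) * fm \<xi>)"
  using cov by (auto simp: right_bimod_cov_deriv_def intro: add_onI_plus)

lemma TOm2: "\<xi> \<in> Om 1 \<Longrightarrow> \<eta> \<in> Om 1 \<Longrightarrow> fm \<xi> * fm \<eta> \<in> TOm \<otimes>\<^sub>A TOm"
  by (simp add: tprod_mem fm_TOm)

lemma TOm_TOm_UNIV: "x \<in> TOm \<otimes>\<^sub>A TOm \<Longrightarrow> x \<in> TOm \<otimes>\<^sub>A UNIV"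
  using tprod_mono[of TOm TOm TOm UNIV] by auto

lemma sinv_lin:
  assumes "\<xi> \<in> Om 1" "\<eta> \<in> Om 1"
  shows "\<zeta> \<in> Om 1 \<Longrightarrow> sinv (fm (\<xi> + \<zeta>) * fm \<eta>) = sinv (fm \<xi> * fm \<eta>) + sinv (fm \<zeta> * fm \<eta>)"
    "\<zeta> \<in> Om 1 \<Longrightarrow> sinv (fm \<xi> * fm (\<eta> + \<zeta>)) = sinv (fm \<xi> * fm \<eta>) + sinv (fm \<xi> * fm \<zeta>)"
    "a \<in> Om 0 \<Longrightarrow> sinv (fm (a * \<xi>) * fm \<eta>) = sc a * sinv (fm \<xi> * fm \<eta>)"
    "a \<in> Om 0 \<Longrightarrow> sinv (fm (\<xi> * a) * fm \<eta>) = sinv (fm \<xi> * fm (a * \<eta>))"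
    "a \<in> Om 0 \<Longrightarrow> sinv (fm \<xi> * fm (\<eta> * a)) = sinv (fm \<xi> * fm \<eta>) * sc a"
  using assms
  by (simp_all add: fm_add distrib_left distrib_right add_on_add[OF add_on_sinv] TOm2 fm_left fm_right
      mult.assoc sinv_left sinv_right)
    (simp_all add: mult.assoc[symmetric] sinv_right TOm2)

text \<open>\<open>sinv\<close> consumes two letters, so the recursion is nested: the inner one is
  balanced in the second form, the outer one in the first.\<close>

definition sinv_map :: "'w tens \<Rightarrow> 'w tens" where
  "sinv_map = tens_rec (\<lambda>\<xi>. tens_rec (\<lambda>\<eta> z. sinv (fm \<xi> * fm \<eta>) * z) (\<lambda>u y. 0)) (\<lambda>u y. 0)"

lemma sinv_map_balanced_1: "\<xi> \<in> Om 1 \<Longrightarrow> form_balanced (\<lambda>\<eta> z. sinv (fm \<xi> * fm \<eta>) * z)"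
  by (auto simp: form_balanced_def add_on_def right_diff_distrib sinv_lin distrib_right mult.assoc)

lemmas sinv_map_1 = tens_rec[OF sinv_map_balanced_1 vec_balanced_zero]

lemma sinv_map_balanced_2:
  "form_balanced (\<lambda>\<xi>. tens_rec (\<lambda>\<eta> z. sinv (fm \<xi> * fm \<eta>) * z) (\<lambda>u y. 0))"
  unfolding form_balanced_def
proof (intro conjI ballI allI)
  fix \<xi> :: 'w assume \<xi>: "\<xi> \<in> Om 1"
  show "add_on UNIV (tens_rec (\<lambda>\<eta> z. sinv (fm \<xi> * fm \<eta>) * z) (\<lambda>u y. 0))"
    by (rule sinv_map_1(1)[OF \<xi>])
  show "tens_rec (\<lambda>\<eta> z. sinv (fm (\<xi> + \<zeta>) * fm \<eta>) * z) (\<lambda>u y. 0) y =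
      tens_rec (\<lambda>\<eta> z. sinv (fm \<xi> * fm \<eta>) * z) (\<lambda>u y. 0) y +
      tens_rec (\<lambda>\<eta> z. sinv (fm \<zeta> * fm \<eta>) * z) (\<lambda>u y. 0) y" if "\<zeta> \<in> Om 1" for \<zeta> y
    by (rule tens_ext[of _ "\<lambda>y. tens_rec (\<lambda>\<eta> z. sinv (fm \<xi> * fm \<eta>) * z) (\<lambda>u y. 0) y +
      tens_rec (\<lambda>\<eta> z. sinv (fm \<zeta> * fm \<eta>) * z) (\<lambda>u y. 0) y"])
      (use \<xi> that in \<open>simp_all add: sinv_map_1 Om_add add_on_plus_fun sinv_lin distrib_right\<close>)
  show "tens_rec (\<lambda>\<eta> z. sinv (fm (\<xi> * a) * fm \<eta>) * z) (\<lambda>u y. 0) y =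
      tens_rec (\<lambda>\<eta> z. sinv (fm \<xi> * fm \<eta>) * z) (\<lambda>u y. 0) (sc a * y)" if a: "a \<in> Om 0" for a y
  proof (rule tens_ext[of _ "\<lambda>y. tens_rec (\<lambda>\<eta> z. sinv (fm \<xi> * fm \<eta>) * z) (\<lambda>u y. 0) (sc a * y)"])
    show "add_on UNIV (\<lambda>y. tens_rec (\<lambda>\<eta> z. sinv (fm \<xi> * fm \<eta>) * z) (\<lambda>u y. 0) (sc a * y))"
      by (rule add_on_comp[OF _ sinv_map_1(1)[OF \<xi>]]) (auto simp: add_on_def right_diff_distrib)
  qed (use \<xi> a in \<open>simp_all add: sinv_map_1 Om_mult_0 Om_0_mult sinv_lin vlact_VecA
      sc_mult[symmetric] mult.assoc[symmetric] fm_left[symmetric] vc_left[symmetric]\<close>)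
qed

lemma sinv_map_fm:
  assumes "\<xi> \<in> Om 1" "\<eta> \<in> Om 1" shows "sinv_map (fm \<xi> * (fm \<eta> * z)) = sinv (fm \<xi> * fm \<eta>) * z"
  using assms unfolding sinv_map_def
  by (simp add: tens_rec[OF sinv_map_balanced_2 vec_balanced_zero] sinv_map_1)

lemma left_lin_sinv_map: "left_lin sinv_map"
  unfolding sinv_map_def
proof (rule tens_rec_left_lin[OF sinv_map_balanced_2 vec_balanced_zero])
  fix a \<xi> :: 'w and y assume a: "a \<in> Om 0" and \<xi>: "\<xi> \<in> Om 1"
  show "tens_rec (\<lambda>\<eta> z. sinv (fm (a * \<xi>) * fm \<eta>) * z) (\<lambda>u y. 0) y =
      sc a * tens_rec (\<lambda>\<eta> z. sinv (fm \<xi> * fm \<eta>) * z) (\<lambda>u y. 0) y"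
    by (rule tens_ext[of _ "\<lambda>y. sc a * tens_rec (\<lambda>\<eta> z. sinv (fm \<xi> * fm \<eta>) * z) (\<lambda>u y. 0) y"])
      (use \<xi> a in \<open>simp_all add: sinv_map_1 Om_0_mult sinv_lin add_on_const_mult mult.assoc\<close>)
qed simp

lemma sinv_map_eq: "t \<in> TOm \<otimes>\<^sub>A TOm \<Longrightarrow> sinv_map (t * z) = sinv t * z"
proof -
  assume t: "t \<in> TOm \<otimes>\<^sub>A TOm"
  show ?thesis
    by (rule tprod_eq[OF t, of "TOm \<otimes>\<^sub>A TOm" "\<lambda>t. sinv_map (t * z)" "\<lambda>t. sinv t * z"])
      (auto elim!: TOmE simp: add_on_def left_lin_diff[OF left_lin_sinv_map] left_diff_distrib TOm2
        add_on_diff[OF add_on_sinv] mult.assoc sinv_map_fm)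
qed

lemma tmap_sinv:
  "y \<in> tpow TOm n \<otimes>\<^sub>A (TOm \<otimes>\<^sub>A TOm) \<otimes>\<^sub>A Z \<Longrightarrow>
   tmap (tpow TOm n) (TOm \<otimes>\<^sub>A TOm) Z sinv y = idts n sinv_map y"
  by (rule tmap_eq[OF _ left_linD(1)[OF left_lin_idts[OF left_lin_sinv_map]]])
    (auto simp: mult.assoc idts_forms[OF left_lin_sinv_map] sinv_map_eq)

section \<open>The map \<sigma> dual to the inverse braiding on forms\<close>

definition sig_aux :: "'w tens \<Rightarrow> 'w tens" where
  "sig_aux = tens_rec (\<lambda>\<xi> y. (\<Sum>i\<in>IX. sinv (fm \<xi> * fm (X i)) * vc (U i)) * y) (\<lambda>u y. 0)"

lemma right_lin_sinv: "\<xi> \<in> Om 1 \<Longrightarrow> right_lin (\<lambda>\<eta>. sinv (fm \<xi> * fm \<eta>))"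
  by (auto simp: right_lin_def sinv_lin intro: add_onI_plus)

lemma sig_aux_balanced:
  "form_balanced (\<lambda>\<xi> y. (\<Sum>i\<in>IX. sinv (fm \<xi> * fm (X i)) * vc (U i)) * y)"
  by (auto simp: form_balanced_def add_on_def right_diff_distrib sinv_lin basis_mem sum.distrib distrib_right
      basis_left[OF right_lin_sinv] mult.assoc[symmetric] cong: sum.cong_simp)

lemma sig_aux_fm: "\<xi> \<in> Om 1 \<Longrightarrow> sig_aux (fm \<xi> * y) = (\<Sum>i\<in>IX. sinv (fm \<xi> * fm (X i)) * vc (U i)) * y"
  unfolding sig_aux_def by (rule tens_rec_fm[OF sig_aux_balanced vec_balanced_zero])

lemma left_lin_sig_aux: "left_lin sig_aux"
  unfolding sig_aux_def
  by (rule tens_rec_left_lin[OF sig_aux_balanced vec_balanced_zero])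
    (simp_all add: sinv_lin basis_mem sum_distrib_left mult.assoc sum_distrib_right
      cong: sum.cong_simp)

text \<open>\<sigma> \<otimes> id as a total map: the dual basis is inserted behind the form,
  \<open>sinv\<close> is applied, and the leading vector contracts the first resulting form.\<close>

definition sigma_map :: "'w tens \<Rightarrow> 'w tens" where
  "sigma_map y = evl (idt sig_aux y)"

lemma left_lin_sigma_map: "left_lin sigma_map"
  unfolding sigma_map_def[abs_def] by (rule left_lin_comp[OF left_lin_evl left_lin_idt[OF left_lin_sig_aux]])

text \<open>The right linear map of \<eta> that corresponds to \<sigma>(u \<otimes> \<zeta>) under
  the dual basis.\<close>

abbreviation gsig :: "('w \<Rightarrow> 'w) \<Rightarrow> 'w \<Rightarrow> 'w \<Rightarrow> 'w tens" where
  "gsig u \<zeta> \<equiv> (\<lambda>\<eta>. contr u (sinv (fm \<zeta> * fm \<eta>)))"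

lemma sinv_fm_UNIV: "\<xi> \<in> Om 1 \<Longrightarrow> \<eta> \<in> Om 1 \<Longrightarrow> sinv (fm \<xi> * fm \<eta>) \<in> TOm \<otimes>\<^sub>A UNIV"
  by (intro TOm_TOm_UNIV sinv_mem TOm2)

lemma right_lin_gsig: "u \<in> VecA \<Longrightarrow> \<zeta> \<in> Om 1 \<Longrightarrow> right_lin (gsig u \<zeta>)"
  unfolding right_lin_def
proof (intro conjI ballI)
  assume u: "u \<in> VecA" "\<zeta> \<in> Om 1"
  show "add_on (Om 1) (gsig u \<zeta>)"
    by (rule add_onI_plus) (simp_all add: sinv_lin u contr_add)
  show "gsig u \<zeta> (\<xi> * a) = gsig u \<zeta> \<xi> * sc a" if "\<xi> \<in> Om 1" "a \<in> Om 0" for \<xi> a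
    by (simp only: sinv_lin(5)[OF u(2) that] contr_right[OF u(1) sinv_fm_UNIV[OF u(2) that(1)]])
qed

lemma sigma_map_fm:
  assumes u: "u \<in> VecA" and \<zeta>: "\<zeta> \<in> Om 1"
  shows "sigma_map (vc u * (fm \<zeta> * y)) = (\<Sum>i\<in>IX. gsig u \<zeta> (X i) * vc (U i)) * y"
proof -
  have "sigma_map (vc u * (fm \<zeta> * y)) = contr u (\<Sum>i\<in>IX. sinv (fm \<zeta> * fm (X i)) * (vc (U i) * y))"
    by (simp only: sigma_map_def idt_vc[OF left_lin_sig_aux u] evl_vc[OF u] sig_aux_fm[OF \<zeta>]
        sum_distrib_right mult.assoc)
  also have "\<dots> = (\<Sum>i\<in>IX. gsig u \<zeta> (X i) * (vc (U i) * y))"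
    unfolding contr_sum[OF u]
    by (rule sum.cong) (simp_all only: contr_right[OF u sinv_fm_UNIV[OF \<zeta>]] basis_mem)
  finally show ?thesis by (simp only: sum_distrib_right mult.assoc)
qed

lemma sigma_map_fm_1:
  assumes "u \<in> VecA" "\<zeta> \<in> Om 1"
  shows "sigma_map (vc u * fm \<zeta>) = (\<Sum>i\<in>IX. gsig u \<zeta> (X i) * vc (U i))"
  using sigma_map_fm[OF assms, of 1] by simp

lemma gsig_TOm: "u \<in> VecA \<Longrightarrow> \<zeta> \<in> Om 1 \<Longrightarrow> \<eta> \<in> Om 1 \<Longrightarrow> gsig u \<zeta> \<eta> \<in> TOm"
  by (rule contr_mem) (auto intro: sinv_mem TOm2 left_mod_TOm)

lemma sigma_map_right: "t \<in> TVec \<otimes>\<^sub>A TOm \<Longrightarrow> sigma_map (t * z) = sigma_map t * z"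
  by (erule tprod_eq[where S = UNIV and f = "\<lambda>t. sigma_map (t * z)" and g = "\<lambda>t. sigma_map t * z"])
    (auto elim!: TOmE TVecE simp: add_on_def left_lin_diff[OF left_lin_sigma_map] left_diff_distrib
      mult.assoc sigma_map_fm sigma_map_fm_1)

abbreviation "sigma' \<equiv> sigma sinv xis"

lemma sigma_eq: "t \<in> TVec \<otimes>\<^sub>A TOm \<Longrightarrow> sigma' t = sigma_map t"
proof -
  have c: "coev1 xis = (\<Sum>i\<in>IX. fm (X i) * vc (U i))"
    by (simp add: coev1_def sum_list_pairs X_def U_def IX_def)
  have idt: "tmap TVec (TOm \<otimes>\<^sub>A TOm) TVec sinv y = idt sinv_map y"
    if "y \<in> TVec \<otimes>\<^sub>A (TOm \<otimes>\<^sub>A TOm) \<otimes>\<^sub>A TVec" for y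
    by (rule tmap_eq[OF that left_linD(1)[OF left_lin_idt[OF left_lin_sinv_map]]])
      (auto elim!: TVecE simp: mult.assoc idt_vc[OF left_lin_sinv_map] sinv_map_eq)
  have mem: "t * coev1 xis \<in> TVec \<otimes>\<^sub>A (TOm \<otimes>\<^sub>A TOm) \<otimes>\<^sub>A TVec" if "t \<in> TVec \<otimes>\<^sub>A TOm" for t
  proof -
    have "coev1 xis \<in> TOm \<otimes>\<^sub>A TVec"
      unfolding c by (intro sgrp_sum sgrp_tprod tprod_mem fm_TOm vc_TVec basis_mem)
    then have "t * coev1 xis \<in> (TVec \<otimes>\<^sub>A TOm) \<otimes>\<^sub>A (TOm \<otimes>\<^sub>A TVec)" by (rule tprod_mem[OF that])
    then show ?thesis by (simp add: tprod_assoc)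
  qed
  have mem2: "idt sinv_map y \<in> TVec \<otimes>\<^sub>A TOm \<otimes>\<^sub>A UNIV" if "y \<in> TVec \<otimes>\<^sub>A (TOm \<otimes>\<^sub>A TOm) \<otimes>\<^sub>A TVec" for y
  proof (rule tprod_into[OF that left_linD(1)[OF left_lin_idt[OF left_lin_sinv_map]]])
    fix v z :: "'w tens" assume v: "v \<in> TVec" and z: "z \<in> (TOm \<otimes>\<^sub>A TOm) \<otimes>\<^sub>A TVec"
    have "sinv_map z \<in> TOm \<otimes>\<^sub>A UNIV"
    proof (rule tprod_into[OF z left_linD(1)[OF left_lin_sinv_map]])
      show "sinv_map (x * y) \<in> TOm \<otimes>\<^sub>A UNIV" if "x \<in> TOm \<otimes>\<^sub>A TOm" for x y
        unfolding sinv_map_eq[OF that] by (rule tprod_mult_right[OF sinv_mem[OF that]]) simp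
    qed simp_all
    then show "idt sinv_map (v * z) \<in> TVec \<otimes>\<^sub>A TOm \<otimes>\<^sub>A UNIV"
      using v by (elim TVecE) (simp only: idt_vc[OF left_lin_sinv_map] tprod_mem vc_TVec)
  qed simp_all
  assume t: "t \<in> TVec \<otimes>\<^sub>A TOm"
  have "sigma' t = evl (idt sinv_map (t * coev1 xis))"
    unfolding sigma_def idt[OF mem[OF t]] by (rule ev_id_eq[OF mem2[OF mem[OF t]]])
  also have "\<dots> = sigma_map t"
  proof (rule tprod_eq[OF t, of UNIV "\<lambda>t. evl (idt sinv_map (t * coev1 xis))"])
    fix x y :: "'w tens" assume "x \<in> TVec" "y \<in> TOm"
    then obtain u \<zeta> where u: "u \<in> VecA" "x = vc u" "\<zeta> \<in> Om 1" "y = fm \<zeta>" by (auto elim!: TVecE TOmE)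
    show "evl (idt sinv_map (x * y * coev1 xis)) = sigma_map (x * y)"
      using u by (simp add: c mult.assoc idt_vc left_lin_sinv_map evl_vc sum_distrib_left sinv_map_fm
          left_lin_sum[OF left_lin_evl] left_lin_sum[OF left_lin_idt[OF left_lin_sinv_map]]
          contr_right sinv_fm_UNIV basis_mem sigma_map_fm_1 cong: sum.cong_simp)
  qed (auto simp: add_on_def left_lin_diff[OF left_lin_evl] left_lin_diff[OF left_lin_idt[OF left_lin_sinv_map]]
      left_diff_distrib left_lin_diff[OF left_lin_sigma_map])
  finally show ?thesis .
qed

end

lemma add_ext_cong: "(\<And>i. i \<in> I \<Longrightarrow> f i = g i) \<Longrightarrow> add_ext I b f = add_ext I b g"
proof -
  assume "\<And>i. i \<in> I \<Longrightarrow> f i = g i"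
  then have "(\<lambda>i. (b i, f i)) ` I = (\<lambda>i. (b i, g i)) ` I" by (intro image_cong) auto
  then show ?thesis unfolding add_ext_def by (intro ext) simp
qed

lemma idt_TOm:
  "left_lin F \<Longrightarrow> z \<in> TOm \<Longrightarrow> idt F (z * y) = z * F y"
  by (auto elim!: TOmE simp: idt_fm)

context hd_setting
begin

text \<open>What the defining identity of the dual derivative forces the pairing of
  \<open>box_vec\<close> at u with \<xi> to be.\<close>

abbreviation "fbox u \<equiv> (\<lambda>\<xi>. fm (dif (u \<xi>)) - contr u (box \<xi>))"

lemma box_UNIV: "\<xi> \<in> Om 1 \<Longrightarrow> box \<xi> \<in> TOm \<otimes>\<^sub>A UNIV"
  by (intro TOm_TOm_UNIV box_mem)

lemma contr_box_TOm: "u \<in> VecA \<Longrightarrow> \<xi> \<in> Om 1 \<Longrightarrow> contr u (box \<xi>) \<in> TOm"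
  by (rule contr_mem[OF _ box_mem left_mod_TOm])

lemma fbox_TOm: "u \<in> VecA \<Longrightarrow> \<xi> \<in> Om 1 \<Longrightarrow> fbox u \<xi> \<in> TOm"
  by (intro sgrp_diff[OF sgrp_TOm] fm_TOm dif_A VecA_app contr_box_TOm)

lemma right_lin_fbox: assumes u: "u \<in> VecA" shows "right_lin (fbox u)"
  unfolding right_lin_def
proof (intro conjI ballI)
  show "add_on (Om 1) (fbox u)"
    by (rule add_on_minus_fun[OF add_on_comp[OF add_on_VecA[OF u] add_on_fm_dif]
          add_on_comp[OF add_on_box add_on_contr[OF u]]])
      (simp_all add: VecA_app u)
  show "fbox u (\<xi> * a) = fbox u \<xi> * sc a" if "\<xi> \<in> Om 1" "a \<in> Om 0" for \<xi> a
    using u that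
    by (simp add: VecA_app_right dif_A_mult VecA_app fm_add dif_A Om_0_mult Om_mult_0 box_right contr_add
        contr_right box_UNIV contr_fm fm_left fm_right left_diff_distrib)
qed

definition bv :: "('w \<Rightarrow> 'w) \<Rightarrow> 'w tens" where
  "bv u = (\<Sum>i\<in>IX. fbox u (X i) * vc (U i))"

lemma bv_mem: "u \<in> VecA \<Longrightarrow> bv u \<in> TOm \<otimes>\<^sub>A TVec"
  unfolding bv_def by (intro sgrp_sum sgrp_tprod tprod_mem fbox_TOm vc_TVec basis_mem)

lemma evl_bv: "u \<in> VecA \<Longrightarrow> \<xi> \<in> Om 1 \<Longrightarrow> idt evl (bv u * fm \<xi>) = fbox u \<xi>"
proof -
  assume u: "u \<in> VecA" and \<xi>: "\<xi> \<in> Om 1"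
  have "idt evl (bv u * fm \<xi>) = (\<Sum>i\<in>IX. fbox u (X i) * sc (U i \<xi>))"
    unfolding bv_def sum_distrib_right left_lin_sum[OF left_lin_idt[OF left_lin_evl]]
    by (rule sum.cong) (simp_all only: mult.assoc idt_TOm[OF left_lin_evl fbox_TOm[OF u]]
        basis_mem evl_vc contr_fm_1 \<xi>)
  then show ?thesis by (simp only: right_lin_dual[OF right_lin_fbox[OF u] \<xi>])
qed

text \<open>An element of this tensor product is determined by its pairings with the
  \<open>X i\<close>, which supplies uniqueness for \<open>box_vec\<close>.\<close>

lemma TOm_TVec_expand:
  assumes "y \<in> TOm \<otimes>\<^sub>A TVec"
  shows "(\<Sum>i\<in>IX. idt evl (y * fm (X i)) * vc (U i)) = y"
proof (rule tprod_eq[OF assms, of UNIV "\<lambda>y. \<Sum>i\<in>IX. idt evl (y * fm (X i)) * vc (U i)" "\<lambda>y. y"])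
  fix x y :: "'w tens" assume x: "x \<in> TOm" and "y \<in> TVec"
  then obtain v where v: "v \<in> VecA" "y = vc v" by (auto elim!: TVecE)
  show "(\<Sum>i\<in>IX. idt evl (x * y * fm (X i)) * vc (U i)) = x * y"
    using vec_expand[OF v(1)]
    by (simp add: mult.assoc idt_TOm[OF left_lin_evl x] v evl_vc contr_fm_1 basis_mem
        sum_distrib_left[symmetric] cong: sum.cong_simp)
qed (auto simp: add_on_def left_diff_distrib left_lin_diff[OF left_lin_idt[OF left_lin_evl]] sum_subtractf)

lemma tmap_ev: "y \<in> TOm \<otimes>\<^sub>A TVec \<otimes>\<^sub>A TOm \<Longrightarrow> tmap TOm (TVec \<otimes>\<^sub>A TOm) {1} ev y = idt evl y"
  by (rule tmap_eq[OF _ left_linD(1)[OF left_lin_idt[OF left_lin_evl]]])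
    (auto simp: tprod_one_right idt_TOm[OF left_lin_evl] ev_eq)

lemma ev_id_vc: "u \<in> VecA \<Longrightarrow> y \<in> TOm \<otimes>\<^sub>A UNIV \<Longrightarrow> ev_id (vc u * y) = contr u y"
  by (simp only: ev_id_eq[OF tprod_mem[OF vc_TVec]] evl_vc)

lemma box_vec_eq: assumes u: "u \<in> VecA" shows "box_vec box u = bv u"
  unfolding box_vec_def
proof (rule the_equality)
  have *: "tdif (ev (vc u * fm \<xi>)) = tmap TOm (TVec \<otimes>\<^sub>A TOm) {1} ev (y * fm \<xi>) + ev_id (vc u * box \<xi>) \<longleftrightarrow>
      idt evl (y * fm \<xi>) = fbox u \<xi>" if y: "y \<in> TOm \<otimes>\<^sub>A TVec" and \<xi>: "\<xi> \<in> Om 1" for y \<xi>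
  proof -
    have "y * fm \<xi> \<in> TOm \<otimes>\<^sub>A TVec \<otimes>\<^sub>A TOm"
      using tprod_mem[OF y fm_TOm[OF \<xi>]] by (simp only: tprod_assoc)
    then show ?thesis
      using u \<xi>
      by (simp only: tmap_ev ev_id_vc box_UNIV ev_eq[OF tprod_mem[OF vc_TVec fm_TOm]] evl_vc contr_fm_1
          tdif_sc VecA_app) (auto simp: algebra_simps)
  qed
  show "bv u \<in> TOm \<otimes>\<^sub>A TVec \<and> (\<forall>\<xi>\<in>Om 1. tdif (ev (vc u * fm \<xi>)) =
      tmap TOm (TVec \<otimes>\<^sub>A TOm) {1} ev (bv u * fm \<xi>) + ev_id (vc u * box \<xi>))"
    by (simp add: * bv_mem u evl_bv)
  fix y assume y: "y \<in> TOm \<otimes>\<^sub>A TVec \<and> (\<forall>\<xi>\<in>Om 1. tdif (ev (vc u * fm \<xi>)) =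
      tmap TOm (TVec \<otimes>\<^sub>A TOm) {1} ev (y * fm \<xi>) + ev_id (vc u * box \<xi>))"
  then have "idt evl (y * fm \<xi>) = fbox u \<xi>" if "\<xi> \<in> Om 1" for \<xi>
    using *[of y \<xi>] that by blast
  then have "(\<Sum>i\<in>IX. idt evl (y * fm (X i)) * vc (U i)) = bv u"
    unfolding bv_def by (intro sum.cong) (simp_all only: basis_mem)
  then show "y = bv u" using y by (simp add: TOm_TVec_expand)
qed

lemma bv_add: "u \<in> VecA \<Longrightarrow> v \<in> VecA \<Longrightarrow> bv (vadd u v) = bv u + bv v"
  unfolding bv_def sum.distrib[symmetric]
  by (rule sum.cong) (simp_all add: vadd_app basis_mem dif_add fm_add dif_A VecA_app contr_vadd algebra_simps)

lemma bv_left: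
  assumes "u \<in> VecA" "a \<in> Om 0" shows "bv (vlact a u) = fm (dif a) * vc u + sc a * bv u"
proof -
  have "bv (vlact a u) = (\<Sum>i\<in>IX. fm (dif a) * (sc (u (X i)) * vc (U i)) + sc a * (fbox u (X i) * vc (U i)))"
    unfolding bv_def using assms
    by (intro sum.cong) (simp_all add: vlact_app basis_mem dif_A_mult fm_add dif_A VecA_app Om_0_mult
        Om_mult_0 fm_left fm_right contr_vlact left_diff_distrib right_diff_distrib distrib_right mult.assoc)
  then show ?thesis
    using assms by (simp only: sum.distrib sum_distrib_left[symmetric] vec_expand bv_def)
qed

text \<open>u.a pairs with \<xi> as u does with a\<xi>, so the \<open>sinv\<close> term in the left
  Leibniz rule of \<open>box\<close> reappears here as \<sigma>.\<close>

lemma bv_right: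
  assumes u: "u \<in> VecA" and a: "a \<in> Om 0"
  shows "bv (vract u a) = bv u * sc a + sigma_map (vc u * fm (dif a))"
proof -
  have "fbox (vract u a) \<xi> = fbox u (a * \<xi>) + gsig u (dif a) \<xi>" if "\<xi> \<in> Om 1" for \<xi>
    using u a that by (simp add: vract_app contr_vract box_left contr_add)
  then have "bv (vract u a) = (\<Sum>i\<in>IX. fbox u (a * X i) * vc (U i)) + (\<Sum>i\<in>IX. gsig u (dif a) (X i) * vc (U i))"
    unfolding bv_def sum.distrib[symmetric]
    by (intro sum.cong) (simp_all only: basis_mem distrib_right)
  then show ?thesis
    by (simp only: basis_left[OF right_lin_fbox[OF u] a] sigma_map_fm_1[OF u dif_A[OF a]] bv_def)
qed

lemma sigma_map_mem:
  assumes u: "u \<in> VecA" and y: "y \<in> TOm \<otimes>\<^sub>A Y"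
  shows "sigma_map (vc u * y) \<in> TOm \<otimes>\<^sub>A TVec \<otimes>\<^sub>A Y"
proof (rule tprod_into[OF y, of UNIV "\<lambda>y. sigma_map (vc u * y)"])
  show "sigma_map (vc u * (x * y)) \<in> TOm \<otimes>\<^sub>A TVec \<otimes>\<^sub>A Y" if "x \<in> TOm" "y \<in> Y" for x y
  proof -
    from that(1) obtain \<zeta> where \<zeta>: "\<zeta> \<in> Om 1" "x = fm \<zeta>" by (rule TOmE)
    show ?thesis
      unfolding \<zeta>(2) sigma_map_fm[OF u \<zeta>(1)] sum_distrib_right mult.assoc
      by (intro sgrp_sum sgrp_tprod tprod_mem gsig_TOm u \<zeta>(1) vc_TVec basis_mem that(2))
  qed
qed (auto simp: add_on_def right_diff_distrib left_lin_diff[OF left_lin_sigma_map])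

lemma tmap_sigma: "y \<in> TVec \<otimes>\<^sub>A TOm \<otimes>\<^sub>A Z \<Longrightarrow> tmap {1} (TVec \<otimes>\<^sub>A TOm) Z sigma' y = sigma_map y"
  by (rule tmap_eq[OF _ left_linD(1)[OF left_lin_sigma_map]])
    (auto simp: tprod_one_left tprod_assoc sigma_eq sigma_map_right)

abbreviation "boxV \<equiv> box_Vec box sinv xis"

lemma retract_tpow_TVec: "retract (tpow TVec n)"
  unfolding TVec_def by (rule retract_tpow[OF vec_proj_VecA])

text \<open>Balancing in the next degree: the extra \<sigma>(u \<otimes> da) \<otimes> w of
  \<open>bv_right\<close> is matched by the da \<otimes> w that the left Leibniz rule adds to the
  derivative of aw.\<close>

lemma box_Vec_Suc_aux:
  assumes add: "add_on (tpow TVec n) (boxV n)"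
    and mem: "\<forall>w\<in>tpow TVec n. boxV n w \<in> TOm \<otimes>\<^sub>A tpow TVec n"
    and leib: "\<forall>a\<in>Om 0. \<forall>w\<in>tpow TVec n. boxV n (sc a * w) = fm (dif a) * w + sc a * boxV n w"
  shows "add_on (tpow TVec (Suc n)) (boxV (Suc n))"
    and "u \<in> VecA \<Longrightarrow> w \<in> tpow TVec n \<Longrightarrow> boxV (Suc n) (vc u * w) = bv u * w + sigma_map (vc u * boxV n w)"
proof -
  let ?\<beta> = "\<lambda>u w. bv u * w + sigma_map (vc u * boxV n w)"
  have eq: "boxV (Suc n) = add_ext (VecA \<times> tpow TVec n) (\<lambda>(u, w). vc u * w) (\<lambda>(u, w). ?\<beta> u w)"
    unfolding box_Vec.simps
    by (rule add_ext_cong) (auto simp: box_vec_eq tmap_sigma tprod_mem vc_TVec mem)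
  have 1: "add_on (tpow TVec n) (?\<beta> u)" if "u \<in> VecA" for u
    by (rule add_onI) (simp_all add: right_diff_distrib add_on_diff[OF add] left_lin_diff[OF left_lin_sigma_map])
  have 2: "?\<beta> (vadd u v) y = ?\<beta> u y + ?\<beta> v y" if "u \<in> VecA" "v \<in> VecA" for u v y
    using that by (simp add: bv_add vc_add distrib_right left_lin_add[OF left_lin_sigma_map])
  have 3: "?\<beta> (vract u a) y = ?\<beta> u (sc a * y)" if "u \<in> VecA" "a \<in> Om 0" "y \<in> tpow TVec n" for u a y
    using that sigma_map_right[OF tprod_mem[OF vc_TVec[OF that(1)] fm_TOm[OF dif_A[OF that(2)]]], of y]
    by (simp add: bv_right vc_right leib distrib_left distrib_right mult.assoc left_lin_add[OF left_lin_sigma_map])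
  note ext = add_ext_vec[OF vec_proj_VecA retract_tpow_TVec 1 2 3, folded TVec_def eq]
  show "add_on (tpow TVec (Suc n)) (boxV (Suc n))" using ext(1) by simp
  show "u \<in> VecA \<Longrightarrow> w \<in> tpow TVec n \<Longrightarrow> boxV (Suc n) (vc u * w) = ?\<beta> u w" by (rule ext(2))
qed

text \<open>Proved together because well-definedness in degree n + 1 rests on the Leibniz rule and
  the range in degree n.\<close>

lemma box_Vec_all:
  "add_on (tpow TVec n) (boxV n) \<and> (\<forall>w\<in>tpow TVec n. boxV n w \<in> TOm \<otimes>\<^sub>A tpow TVec n) \<and>
   (\<forall>a\<in>Om 0. \<forall>w\<in>tpow TVec n. boxV n (sc a * w) = fm (dif a) * w + sc a * boxV n w)"
proof (induction n)
  case 0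
  have "boxV 0 w \<in> TOm \<otimes>\<^sub>A tpow TVec 0" if w: "w \<in> TA" for w
  proof -
    obtain a where "a \<in> Om 0" "w = sc a" using w by (auto simp: TA_def)
    then have "boxV 0 w \<in> TOm" by (simp add: tdif_sc fm_TOm dif_A)
    then show ?thesis by (simp only: tpow.simps tprod_TA[OF right_mod_TOm])
  qed
  moreover have "boxV 0 (sc a * w) = fm (dif a) * w + sc a * boxV 0 w" if "a \<in> Om 0" "w \<in> TA" for a w
    using that by (auto simp: TA_def sc_mult[symmetric] tdif_sc Om_0_mult dif_A_mult fm_add dif_A
        Om_mult_0 fm_left fm_right)
  ultimately show ?case using add_on_tdif by simp
next
  case (Suc n)
  then have n: "add_on (tpow TVec n) (boxV n)" "\<forall>w\<in>tpow TVec n. boxV n w \<in> TOm \<otimes>\<^sub>A tpow TVec n"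
    "\<forall>a\<in>Om 0. \<forall>w\<in>tpow TVec n. boxV n (sc a * w) = fm (dif a) * w + sc a * boxV n w"
    by blast+
  note S = box_Vec_Suc_aux[OF n]
  have mem: "boxV (Suc n) w \<in> TOm \<otimes>\<^sub>A tpow TVec (Suc n)" if w: "w \<in> tpow TVec (Suc n)" for w
  proof (rule tprod_into[OF w[unfolded tpow.simps] S(1) sgrp_tprod])
    fix x y :: "'w tens" assume "x \<in> TVec" and y: "y \<in> tpow TVec n"
    then obtain u where u: "u \<in> VecA" "x = vc u" by (auto elim!: TVecE)
    show "x * y \<in> tpow TVec (Suc n)" using y by (simp add: u tprod_mem vc_TVec)
    show "boxV (Suc n) (x * y) \<in> TOm \<otimes>\<^sub>A tpow TVec (Suc n)"
      unfolding u(2) S(2)[OF u(1) y] tpow.simps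
      using tprod_mem[OF bv_mem[OF u(1)] y] sigma_map_mem[OF u(1) bspec[OF n(2) y]]
      by (simp only: tprod_assoc sgrp_add[OF sgrp_tprod])
  qed
  have leib: "boxV (Suc n) (sc a * w) = fm (dif a) * w + sc a * boxV (Suc n) w"
    if a: "a \<in> Om 0" and w: "w \<in> tpow TVec (Suc n)" for a w
  proof (rule tprod_eq[OF w[unfolded tpow.simps], of "tpow TVec (Suc n)" "\<lambda>w. boxV (Suc n) (sc a * w)"])
    show "add_on (tpow TVec (Suc n)) (\<lambda>w. boxV (Suc n) (sc a * w))"
      by (rule add_on_comp[OF _ S(1)])
        (simp_all add: add_on_def right_diff_distrib left_modD(2)[OF left_mod_tpow[OF left_mod_TVec] a] del: tpow.simps)
    show "add_on (tpow TVec (Suc n)) (\<lambda>w. fm (dif a) * w + sc a * boxV (Suc n) w)"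
      by (rule add_onI) (simp_all add: right_diff_distrib add_on_diff[OF S(1)] del: box_Vec.simps)
    fix x y :: "'w tens" assume "x \<in> TVec" and y: "y \<in> tpow TVec n"
    then obtain u where u: "u \<in> VecA" "x = vc u" by (auto elim!: TVecE)
    show "x * y \<in> tpow TVec (Suc n)" using y by (simp add: u tprod_mem vc_TVec)
    have "sc a * (x * y) = vc (vlact a u) * y" by (simp add: u vc_left a mult.assoc)
    then have "boxV (Suc n) (sc a * (x * y)) = bv (vlact a u) * y + sigma_map (vc (vlact a u) * boxV n y)"
      by (simp only: S(2)[OF vlact_VecA[OF a u(1)] y])
    then show "boxV (Suc n) (sc a * (x * y)) = fm (dif a) * (x * y) + sc a * boxV (Suc n) (x * y)"
      using u a
      by (simp add: bv_left vc_left S(2)[OF u(1) y] distrib_left distrib_right mult.assoc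
          left_linD(2)[OF left_lin_sigma_map] del: box_Vec.simps)
  qed
  show ?case using S(1) mem leib by blast
qed

lemma box_Vec:
  shows add_on_box_Vec: "add_on (tpow TVec n) (boxV n)"
    and box_Vec_mem: "w \<in> tpow TVec n \<Longrightarrow> boxV n w \<in> TOm \<otimes>\<^sub>A tpow TVec n"
    and box_Vec_left: "a \<in> Om 0 \<Longrightarrow> w \<in> tpow TVec n \<Longrightarrow> boxV n (sc a * w) = fm (dif a) * w + sc a * boxV n w"
  using box_Vec_all[of n] by blast+

lemma box_Vec_Suc:
  "u \<in> VecA \<Longrightarrow> w \<in> tpow TVec n \<Longrightarrow> boxV (Suc n) (vc u * w) = bv u * w + sigma_map (vc u * boxV n w)"
  using box_Vec_all[of n] by (intro box_Vec_Suc_aux(2)) blast+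

subsection \<open>Compatibility with the complex structure\<close>

lemma form_endo_p10: "form_endo p10" and form_endo_p01: "form_endo p01" and form_endo_J: "form_endo J"
  by (simp_all add: form_endo_def p10_p01_Om p10_lin J_mem J_add J_left J_right)

lemmas form_map_p10 = left_lin_form_map[OF form_endo_p10] form_map_fm[OF form_endo_p10]
  form_map_fm_1[OF form_endo_p10] form_map_right[OF form_endo_p10]
lemmas form_map_p01 = left_lin_form_map[OF form_endo_p01] form_map_fm[OF form_endo_p01]
  form_map_fm_1[OF form_endo_p01] form_map_right[OF form_endo_p01]
lemmas form_map_J = left_lin_form_map[OF form_endo_J] form_map_fm[OF form_endo_J]

lemma form_map_p10_J:
  assumes "t \<in> TOm \<otimes>\<^sub>A UNIV"
  shows "form_map p10 t = sc (cscale (1/2) 1) * (t - sc (cscale \<i> 1) * form_map J t)"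
proof (rule tprod_eq[OF assms, of UNIV _ "\<lambda>t. sc (cscale (1/2) 1) * (t - sc (cscale \<i> 1) * form_map J t)"])
  fix x y :: "'w tens" assume "x \<in> TOm"
  then obtain \<xi> where \<xi>: "\<xi> \<in> Om 1" "x = fm \<xi>" by (rule TOmE)
  have "p10 \<xi> = cscale (1/2) 1 * (\<xi> - cscale \<i> 1 * J \<xi>)"
    unfolding p10_eq[OF \<xi>(1)] by (simp add: cscale_mult_left)
  then show "form_map p10 (x * y) = sc (cscale (1/2) 1) * (x * y - sc (cscale \<i> 1) * form_map J (x * y))"
    using \<xi> by (simp add: form_map_p10 form_map_J fm_left cscale_Om_0 sgrp_diff Om_0_mult J_mem
        add_on_diff[OF add_on_fm] mult.assoc left_diff_distrib right_diff_distrib)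
qed (auto simp: add_on_def left_lin_diff[OF form_map_p10(1)] left_lin_diff[OF form_map_J(1)] right_diff_distrib)

lemma form_map_p01_p10:
  assumes "t \<in> TOm \<otimes>\<^sub>A UNIV" shows "form_map p01 t = t - form_map p10 t"
  by (rule tprod_eq[OF assms, of UNIV _ "\<lambda>t. t - form_map p10 t"])
    (auto elim!: TOmE simp: add_on_def left_lin_diff[OF form_map_p10(1)] left_lin_diff[OF form_map_p01(1)]
      form_map_p10 form_map_p01 p01_eq p10_p01_Om add_on_diff[OF add_on_fm] left_diff_distrib)

lemma dif_cscale_one: "dif (cscale c 1) = (0 :: 'w)"
  by (simp add: dif_cscale dif_one cscale_zero)

lemma fm_zero: "fm 0 = (0 :: 'w tens)"
  by (rule add_on_zero[OF add_on_fm])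

lemma box_cscale: "\<xi> \<in> Om 1 \<Longrightarrow> box (cscale c 1 * \<xi>) = sc (cscale c 1) * box \<xi>"
  by (simp add: box_left cscale_Om_0 dif_cscale_one fm_zero add_on_zero[OF add_on_sinv])

text \<open>By b), \<open>box\<close> commutes with J. It also commutes with complex constants,
  which d annihilates, hence with (id - iJ)/2.\<close>

lemma box_p10: assumes \<xi>: "\<xi> \<in> Om 1" shows "box (p10 \<xi>) = form_map p10 (box \<xi>)"
proof -
  have "idt (form_map (\<lambda>\<eta>. \<eta>)) (box \<xi>) = box \<xi>"
    by (rule tprod_eq[OF box_mem[OF \<xi>], of UNIV _ "\<lambda>y. y"])
      (auto elim!: TOmE simp: left_linD(1)[OF left_lin_idt[OF left_lin_form_map[OF form_endo_id]]]
        left_linD(1)[OF left_lin_id] idt_fm[OF left_lin_form_map[OF form_endo_id]] form_map_fm_1[OF form_endo_id])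
  then have J: "box (J \<xi>) = form_map J (box \<xi>)"
    using box_J \<xi> tens2_eq[OF form_endo_J form_endo_id box_mem[OF \<xi>]] by simp
  have "p10 \<xi> = cscale (1/2) 1 * (\<xi> - cscale \<i> 1 * J \<xi>)"
    unfolding p10_eq[OF \<xi>(1)] by (simp add: cscale_mult_left)
  then show ?thesis
    using \<xi> by (simp add: box_cscale sgrp_diff Om_0_mult cscale_Om_0 J_mem add_on_diff[OF add_on_box] J
        form_map_p10_J box_UNIV)
qed

lemma box_p01: "\<xi> \<in> Om 1 \<Longrightarrow> box (p01 \<xi>) = form_map p01 (box \<xi>)"
  by (simp add: p01_eq add_on_diff[OF add_on_box] p10_p01_Om box_p10 form_map_p01_p10 box_UNIV)

text \<open>The left Leibniz rule expresses \<open>sinv\<close> on db \<otimes> \<xi> as the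
  derivative of b\<xi> minus b times the derivative of \<xi>, and 1-forms are sums of a db. So
  \<open>sinv\<close> inherits compatibility with \<open>p10\<close> from
  \<open>box\<close>.\<close>

lemma sinv_p10:
  assumes \<zeta>: "\<zeta> \<in> Om 1" and \<xi>: "\<xi> \<in> Om 1"
  shows "sinv (fm \<zeta> * fm (p10 \<xi>)) = form_map p10 (sinv (fm \<zeta> * fm \<xi>))"
proof -
  have "\<zeta> \<in> group_closure {a * dif b |a b :: 'w. a \<in> Om 0 \<and> b \<in> Om 0}" using \<zeta> Om_1_eq_A_dA by blast
  then show ?thesis
  proof (rule add_on_eq[of \<zeta> _ "Om 1" "\<lambda>\<zeta>. sinv (fm \<zeta> * fm (p10 \<xi>))" "\<lambda>\<zeta>. form_map p10 (sinv (fm \<zeta> * fm \<xi>))"])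
    show "add_on (Om 1) (\<lambda>\<zeta>. sinv (fm \<zeta> * fm (p10 \<xi>)))"
      by (rule add_onI_plus) (simp_all add: sinv_lin \<xi> p10_p01_Om)
    show "add_on (Om 1) (\<lambda>\<zeta>. form_map p10 (sinv (fm \<zeta> * fm \<xi>)))"
      by (rule add_onI_plus) (simp_all add: sinv_lin \<xi> left_lin_add[OF form_map_p10(1)])
    show "{a * dif b |a b :: 'w. a \<in> Om 0 \<and> b \<in> Om 0} \<subseteq> Om 1" by (auto simp: Om_0_mult dif_A)
    fix x assume "x \<in> {a * dif b |a b :: 'w. a \<in> Om 0 \<and> b \<in> Om 0}"
    then obtain a b where ab: "a \<in> Om 0" "b \<in> Om 0" "x = a * dif b" by auto
    have d: "sinv (fm (dif b) * fm \<eta>) = box (b * \<eta>) - sc b * box \<eta>" if "\<eta> \<in> Om 1" for \<eta>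
      using that ab by (simp add: box_left)
    have "sinv (fm (dif b) * fm (p10 \<xi>)) = box (p10 (b * \<xi>)) - sc b * box (p10 \<xi>)"
      using \<xi> ab by (simp add: d p10_p01_Om p10_lin)
    also have "\<dots> = form_map p10 (sinv (fm (dif b) * fm \<xi>))"
      using \<xi> ab by (simp add: d box_p10 Om_0_mult left_lin_diff[OF form_map_p10(1)] left_linD(2)[OF form_map_p10(1)])
    finally show "sinv (fm x * fm (p10 \<xi>)) = form_map p10 (sinv (fm x * fm \<xi>))"
      using ab \<xi> by (simp add: sinv_lin dif_A p10_p01_Om left_linD(2)[OF form_map_p10(1)])
  qed
qed

lemma contr_p10:
  assumes u: "u \<in> Vec10 J" and t: "t \<in> TOm \<otimes>\<^sub>A UNIV" shows "contr u (form_map p10 t) = contr u t"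
  by (rule tprod_eq[OF t, of UNIV "\<lambda>t. contr u (form_map p10 t)" "contr u"])
    (use u in \<open>auto elim!: TOmE simp: add_on_def left_lin_diff[OF form_map_p10(1)] contr_diff Vec10_VecA
      form_map_p10 contr_fm p10_p01_Om Vec10_p10\<close>)

text \<open>For u of type (1,0) neither term of \<open>fbox u\<close> sees the (0,1) part of its
  argument, so the derivative of u can be written with the vectors of \<open>etas\<close>. Hence
  differentiation keeps vector fields in type (1,0).\<close>

lemma bv_10:
  assumes u: "u \<in> Vec10 J" shows "bv u = (\<Sum>k\<in>IE. fbox u (Et k) * vc (H k))"
proof -
  have "fbox u (p10 \<xi>) = fbox u \<xi>" if "\<xi> \<in> Om 1" for \<xi>
    using u that by (simp add: Vec10_p10 box_p10 contr_p10 box_UNIV)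
  then have "bv u = (\<Sum>i\<in>IX. fbox u (p10 (X i)) * vc (U i))"
    unfolding bv_def by (intro sum.cong) (simp_all only: basis_mem)
  then show ?thesis by (simp only: basis_10[OF right_lin_fbox[OF Vec10_VecA[OF u]]])
qed

lemma sigma_map_10:
  assumes u: "u \<in> Vec10 J" and \<zeta>: "\<zeta> \<in> Om 1"
  shows "sigma_map (vc u * (fm \<zeta> * y)) = (\<Sum>k\<in>IE. gsig u \<zeta> (Et k) * vc (H k)) * y"
proof -
  note uV = Vec10_VecA[OF u]
  have "gsig u \<zeta> (p10 \<xi>) = gsig u \<zeta> \<xi>" if "\<xi> \<in> Om 1" for \<xi>
    using u that \<zeta> by (simp add: sinv_p10 contr_p10 sinv_fm_UNIV)
  then have "(\<Sum>i\<in>IX. gsig u \<zeta> (X i) * vc (U i)) = (\<Sum>i\<in>IX. gsig u \<zeta> (p10 (X i)) * vc (U i))"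
    by (intro sum.cong) (simp_all only: basis_mem)
  then show ?thesis
    by (simp only: sigma_map_fm[OF uV \<zeta>] basis_10[OF right_lin_gsig[OF uV \<zeta>]])
qed

lemma bv_mem_10: "u \<in> Vec10 J \<Longrightarrow> bv u \<in> TOm \<otimes>\<^sub>A TVec10 J"
  unfolding bv_10 by (intro sgrp_sum sgrp_tprod tprod_mem fbox_TOm vc_TVec10 basis_mem Et_Om_1 Vec10_VecA)

lemma sigma_map_mem_10:
  assumes u: "u \<in> Vec10 J" and y: "y \<in> TOm \<otimes>\<^sub>A Y"
  shows "sigma_map (vc u * y) \<in> TOm \<otimes>\<^sub>A TVec10 J \<otimes>\<^sub>A Y"
proof (rule tprod_into[OF y, of UNIV "\<lambda>y. sigma_map (vc u * y)"])
  show "sigma_map (vc u * (x * y)) \<in> TOm \<otimes>\<^sub>A TVec10 J \<otimes>\<^sub>A Y" if "x \<in> TOm" "y \<in> Y" for x y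
  proof -
    from that(1) obtain \<zeta> where \<zeta>: "\<zeta> \<in> Om 1" "x = fm \<zeta>" by (rule TOmE)
    show ?thesis
      unfolding \<zeta>(2) sigma_map_10[OF u \<zeta>(1)] sum_distrib_right mult.assoc
      by (intro sgrp_sum sgrp_tprod tprod_mem gsig_TOm Vec10_VecA[OF u] \<zeta>(1) vc_TVec10 basis_mem Et_Om_1 that(2))
  qed
qed (auto simp: add_on_def right_diff_distrib left_lin_diff[OF left_lin_sigma_map])

lemma TVec10_TVec: "TVec10 J \<subseteq> TVec"
  by (auto elim!: TVec10E simp: vc_TVec Vec10_VecA)

lemma tpow_10: "tpow (TVec10 J) n \<subseteq> tpow TVec n"
  by (rule tpow_mono[OF TVec10_TVec])

lemma box_Vec_mem_10: "w \<in> tpow (TVec10 J) n \<Longrightarrow> boxV n w \<in> TOm \<otimes>\<^sub>A tpow (TVec10 J) n"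
proof (induction n arbitrary: w)
  case 0
  then show ?case using box_Vec_mem[of w 0] by simp
next
  case (Suc n)
  show ?case
  proof (rule tprod_into[OF Suc.prems[unfolded tpow.simps] add_on_box_Vec sgrp_tprod])
    fix x y :: "'w tens" assume "x \<in> TVec10 J" and y: "y \<in> tpow (TVec10 J) n"
    then obtain u where u: "u \<in> Vec10 J" "x = vc u" by (auto elim!: TVec10E)
    have y': "y \<in> tpow TVec n" using y tpow_10 by auto
    show "x * y \<in> tpow TVec (Suc n)" using y' by (simp add: u tprod_mem vc_TVec Vec10_VecA)
    show "boxV (Suc n) (x * y) \<in> TOm \<otimes>\<^sub>A tpow (TVec10 J) (Suc n)"
      unfolding u(2) box_Vec_Suc[OF Vec10_VecA[OF u(1)] y'] tpow.simps
      using tprod_mem[OF bv_mem_10[OF u(1)] y] sigma_map_mem_10[OF u(1) Suc.IH[OF y]]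
      by (simp only: tprod_assoc sgrp_add[OF sgrp_tprod])
  qed
qed


subsection \<open>The product\<close>

abbreviation "TV \<equiv> tpowers (TVec :: 'w tens set)"
abbreviation "B \<equiv> box_TVec box sinv xis"
abbreviation "vb \<equiv> vec_bullet box sinv xis"
abbreviation "bh \<equiv> bullet_hom box sinv xis"
abbreviation bul (infixl "\<odot>" 70) where "bul \<equiv> bullet box sinv xis"

lemma tpow_TV: "w \<in> tpow TVec n \<Longrightarrow> w \<in> TV"
  by (rule tpowers_mem)

lemma sc_left_TV: "a \<in> Om 0 \<Longrightarrow> w \<in> TV \<Longrightarrow> sc a * w \<in> TV"
  by (rule left_modD(2)[OF left_mod_tpowers[OF left_mod_TVec]])

lemma sc_left_tpow: "a \<in> Om 0 \<Longrightarrow> w \<in> tpow TVec n \<Longrightarrow> sc a * w \<in> tpow TVec n"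
  by (rule left_modD(2)[OF left_mod_tpow[OF left_mod_TVec]])

lemma vc_left_TV: "u \<in> VecA \<Longrightarrow> w \<in> TV \<Longrightarrow> vc u * w \<in> TV"
  by (rule subsetD[OF tprod_tpowers tprod_mem[OF vc_TVec]])

lemma box_TVec:
  shows add_on_box_TVec: "add_on TV B"
    and box_TVec_eq: "w \<in> tpow TVec n \<Longrightarrow> B w = boxV n w"
  using add_ext_graded[OF vec_proj_VecA, folded TVec_def, of boxV, OF add_on_box_Vec]
  unfolding box_TVec_def by blast+

lemma box_TVec_mem: "w \<in> TV \<Longrightarrow> B w \<in> TOm \<otimes>\<^sub>A TV"
  by (erule tpowers_into[OF _ add_on_box_TVec sgrp_tprod])
    (auto simp: box_TVec_eq tpow_TV intro: box_Vec_mem[THEN subsetD[OF tprod_mono[OF subset_refl], rotated]])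

lemma box_TVec_UNIV: "w \<in> TV \<Longrightarrow> B w \<in> TOm \<otimes>\<^sub>A UNIV"
  using box_TVec_mem tprod_mono[OF subset_refl subset_UNIV] by blast

lemma box_TVec_left:
  assumes a: "a \<in> Om 0" and w: "w \<in> TV" shows "B (sc a * w) = fm (dif a) * w + sc a * B w"
proof (rule tpowers_eq[OF w, of TV "\<lambda>w. B (sc a * w)"])
  show "add_on TV (\<lambda>w. B (sc a * w))"
    by (rule add_on_comp[OF _ add_on_box_TVec]) (simp_all add: add_on_def right_diff_distrib sc_left_TV a)
  show "add_on TV (\<lambda>w. fm (dif a) * w + sc a * B w)"
    by (rule add_onI) (simp_all add: right_diff_distrib add_on_diff[OF add_on_box_TVec])
  show "B (sc a * w) = fm (dif a) * w + sc a * B w" if "w \<in> tpow TVec n" for n w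
    using that a by (simp add: box_TVec_eq[of _ n] sc_left_tpow box_Vec_left)
qed (auto simp: tpow_TV)

lemma vec_bullet_eq: "u \<in> VecA \<Longrightarrow> w \<in> TV \<Longrightarrow> vb u w = vc u * w + contr u (B w)"
  by (simp add: vec_bullet_def ev_id_vc box_TVec_UNIV)

lemma contr_B: "u \<in> VecA \<Longrightarrow> w \<in> TV \<Longrightarrow> contr u (B w) \<in> TV"
  by (rule contr_mem[OF _ box_TVec_mem left_mod_tpowers[OF left_mod_TVec]])

lemma contr_boxV: "u \<in> VecA \<Longrightarrow> w \<in> tpow TVec n \<Longrightarrow> contr u (boxV n w) \<in> tpow TVec n"
  by (rule contr_mem[OF _ box_Vec_mem left_mod_tpow[OF left_mod_TVec]])

lemma vec_bullet_mem: "u \<in> VecA \<Longrightarrow> w \<in> TV \<Longrightarrow> vb u w \<in> TV"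
  by (simp add: vec_bullet_eq sgrp_add[OF sgrp_tpowers] vc_left_TV contr_B)

lemma add_on_vec_bullet: "u \<in> VecA \<Longrightarrow> add_on TV (vb u)"
  by (rule add_onI)
    (simp_all add: vec_bullet_eq sgrp_diff[OF sgrp_tpowers] right_diff_distrib add_on_diff[OF add_on_box_TVec] contr_diff)

lemma vec_bullet_lin:
  assumes u: "u \<in> VecA" and w: "w \<in> TV"
  shows vec_bullet_vadd: "v \<in> VecA \<Longrightarrow> vb (vadd u v) w = vb u w + vb v w"
    and vec_bullet_vlact: "a \<in> Om 0 \<Longrightarrow> vb (vlact a u) w = sc a * vb u w"
    and vec_bullet_left: "a \<in> Om 0 \<Longrightarrow> vb u (sc a * w) = vb (vract u a) w + sc (u (dif a)) * w"
  using assms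
  by (simp_all add: vec_bullet_eq vadd_VecA vlact_VecA vract_VecA sc_left_TV vc_add vc_left vc_right
      contr_vadd contr_vlact contr_vract distrib_right distrib_left mult.assoc box_TVec_left contr_add
      contr_fm dif_A)

text \<open>Balancing of the product: u \<bullet> (ay \<bullet> w) produces an extra u(da) (y
  \<bullet> w), and the contraction of the derivative of ay produces the same term, which is
  subtracted.\<close>

lemma bullet_hom_Suc_aux:
  assumes add': "\<forall>w\<in>TV. add_on (tpow TVec n) (\<lambda>v. bh n v w)"
    and mem: "\<forall>v\<in>tpow TVec n. \<forall>w\<in>TV. bh n v w \<in> TV"
    and left: "\<forall>a\<in>Om 0. \<forall>v\<in>tpow TVec n. \<forall>w\<in>TV. bh n (sc a * v) w = sc a * bh n v w"
    and w: "w \<in> TV"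
  shows "add_on (tpow TVec (Suc n)) (\<lambda>v. bh (Suc n) v w)"
    and "u \<in> VecA \<Longrightarrow> v \<in> tpow TVec n \<Longrightarrow>
      bh (Suc n) (vc u * v) w = vb u (bh n v w) - bh n (contr u (boxV n v)) w"
proof -
  note add = bspec[OF add']
  let ?\<beta> = "\<lambda>u v. vb u (bh n v w) - bh n (contr u (boxV n v)) w"
  have eq: "(\<lambda>v. bh (Suc n) v w) = add_ext (VecA \<times> tpow TVec n) (\<lambda>(u, v). vc u * v) (\<lambda>(u, v). ?\<beta> u v)"
    unfolding bullet_hom.simps
    by (subst add_ext_cong[of _ "\<lambda>(u, v). vb u (bh n v w) - bh n (ev_id (vc u * boxV n v)) w" "\<lambda>(u, v). ?\<beta> u v"])
      (auto simp: ev_id_vc subsetD[OF tprod_mono[OF subset_refl subset_UNIV] box_Vec_mem])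
  have 1: "add_on (tpow TVec n) (?\<beta> u)" if "u \<in> VecA" for u
    using that add_on_comp[OF add_on_comp[OF add_on_box_Vec add_on_contr[OF that]] add[OF w]]
    by (intro add_on_minus_fun add_on_comp[OF add[OF w] add_on_vec_bullet]) (auto simp: mem w contr_boxV)
  have 2: "?\<beta> (vadd u v) y = ?\<beta> u y + ?\<beta> v y" if "u \<in> VecA" "v \<in> VecA" "y \<in> tpow TVec n" for u v y
    using that w by (simp add: vec_bullet_vadd mem contr_vadd add_on_add[OF add[OF w]] contr_boxV)
  have 3: "?\<beta> (vract u a) y = ?\<beta> u (sc a * y)" if "u \<in> VecA" "a \<in> Om 0" "y \<in> tpow TVec n" for u a y
  proof -
    have "contr u (boxV n (sc a * y)) = sc (u (dif a)) * y + contr (vract u a) (boxV n y)"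
      using that by (simp add: box_Vec_left contr_add contr_fm dif_A contr_vract)
    then show ?thesis
      using that w by (simp add: left vec_bullet_left mem add_on_add[OF add[OF w]] sc_left_tpow VecA_app dif_A
          contr_boxV vract_VecA)
  qed
  note ext = add_ext_vec[OF vec_proj_VecA retract_tpow_TVec 1 2 3, folded TVec_def eq]
  show "add_on (tpow TVec (Suc n)) (\<lambda>v. bh (Suc n) v w)" using ext(1) by (simp only: tpow.simps)
  show "u \<in> VecA \<Longrightarrow> v \<in> tpow TVec n \<Longrightarrow> bh (Suc n) (vc u * v) w = ?\<beta> u v"
    using ext(2)[of u v] by (simp only: fun_cong[OF eq, symmetric])
qed

text \<open>Left linearity in the first factor is carried through the induction because balancing in
  the next degree consumes it.\<close>

lemma bullet_hom_all:
  "(\<forall>w\<in>TV. add_on (tpow TVec n) (\<lambda>v. bh n v w)) \<and> (\<forall>v\<in>tpow TVec n. \<forall>w\<in>TV. bh n v w \<in> TV) \<and>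
   (\<forall>a\<in>Om 0. \<forall>v\<in>tpow TVec n. \<forall>w\<in>TV. bh n (sc a * v) w = sc a * bh n v w) \<and>
   (\<forall>v\<in>tpow TVec n. add_on TV (bh n v))"
proof (induction n)
  case 0
  have "v * w \<in> TV" if "v \<in> TA" "w \<in> TV" for v w
    using that by (auto simp: TA_def sc_left_TV)
  then show ?case
    by (auto simp: add_on_def left_diff_distrib right_diff_distrib mult.assoc)
next
  case (Suc n)
  then have no: "\<forall>w\<in>TV. add_on (tpow TVec n) (\<lambda>v. bh n v w)"
    "\<forall>v\<in>tpow TVec n. \<forall>w\<in>TV. bh n v w \<in> TV"
    "\<forall>a\<in>Om 0. \<forall>v\<in>tpow TVec n. \<forall>w\<in>TV. bh n (sc a * v) w = sc a * bh n v w"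
    and n: "\<And>w. w \<in> TV \<Longrightarrow> add_on (tpow TVec n) (\<lambda>v. bh n v w)"
    "\<And>v w. v \<in> tpow TVec n \<Longrightarrow> w \<in> TV \<Longrightarrow> bh n v w \<in> TV"
    "\<And>a v w. a \<in> Om 0 \<Longrightarrow> v \<in> tpow TVec n \<Longrightarrow> w \<in> TV \<Longrightarrow> bh n (sc a * v) w = sc a * bh n v w"
    and n4: "\<And>v. v \<in> tpow TVec n \<Longrightarrow> add_on TV (bh n v)"
    by blast+
  note S = bullet_hom_Suc_aux[OF no]
  have gen: "x * y \<in> tpow TVec (Suc n)" if "x \<in> TVec" "y \<in> tpow TVec n" for x y :: "'w tens"
    using that by (simp add: tprod_mem)
  have mem: "bh (Suc n) v w \<in> TV" if v: "v \<in> tpow TVec (Suc n)" and w: "w \<in> TV" for v w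
  proof (rule tprod_into[OF v[unfolded tpow.simps] S(1)[OF w] sgrp_tpowers gen])
    fix x y :: "'w tens" assume "x \<in> TVec" and y: "y \<in> tpow TVec n"
    then obtain u where u: "u \<in> VecA" "x = vc u" by (auto elim!: TVecE)
    show "bh (Suc n) (x * y) w \<in> TV"
      unfolding u(2) S(2)[OF w u(1) y]
      by (intro sgrp_diff[OF sgrp_tpowers] vec_bullet_mem n contr_boxV u(1) y w)
  qed
  have left: "bh (Suc n) (sc a * v) w = sc a * bh (Suc n) v w"
    if a: "a \<in> Om 0" and v: "v \<in> tpow TVec (Suc n)" and w: "w \<in> TV" for a v w
  proof (rule tprod_eq[OF v[unfolded tpow.simps], of "tpow TVec (Suc n)" "\<lambda>v. bh (Suc n) (sc a * v) w"
        "\<lambda>v. sc a * bh (Suc n) v w"])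
    show "add_on (tpow TVec (Suc n)) (\<lambda>v. bh (Suc n) (sc a * v) w)"
      by (rule add_on_comp[OF _ S(1)[OF w]])
        (auto simp only: add_on_def sgrp_tpow right_diff_distrib sc_left_tpow a)
    show "add_on (tpow TVec (Suc n)) (\<lambda>v. sc a * bh (Suc n) v w)"
      by (rule add_on_const_mult[OF S(1)[OF w]])
    fix x y :: "'w tens" assume x: "x \<in> TVec" and y: "y \<in> tpow TVec n"
    from gen[OF this] show "x * y \<in> tpow TVec (Suc n)" .
    obtain u where u: "u \<in> VecA" "x = vc u" using x by (auto elim!: TVecE)
    have "sc a * (x * y) = vc (vlact a u) * y" by (simp add: u vc_left a mult.assoc)
    then have "bh (Suc n) (sc a * (x * y)) w = vb (vlact a u) (bh n y w) - bh n (contr (vlact a u) (boxV n y)) w"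
      by (simp only: S(2)[OF w vlact_VecA[OF a u(1)] y])
    also have "\<dots> = sc a * bh (Suc n) (x * y) w"
      unfolding u(2) S(2)[OF w u(1) y]
      by (simp only: vec_bullet_vlact n u(1) a y w contr_vlact contr_boxV right_diff_distrib)
    finally show "bh (Suc n) (sc a * (x * y)) w = sc a * bh (Suc n) (x * y) w" .
  qed
  have add: "add_on TV (bh (Suc n) v)" if v: "v \<in> tpow TVec (Suc n)" for v
  proof (rule add_onI[OF sgrp_tpowers])
    fix w w' :: "'w tens" assume w: "w \<in> TV" "w' \<in> TV"
    then have w3: "w - w' \<in> TV" by (simp add: sgrp_diff)
    show "bh (Suc n) v (w - w') = bh (Suc n) v w - bh (Suc n) v w'"
    proof (rule tprod_eq[OF v[unfolded tpow.simps] S(1)[OF w3] add_on_minus_fun[OF S(1)[OF w(1)] S(1)[OF w(2)]] gen])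
      fix x y :: "'w tens" assume "x \<in> TVec" and y: "y \<in> tpow TVec n"
      then obtain u where u: "u \<in> VecA" "x = vc u" by (auto elim!: TVecE)
      show "bh (Suc n) (x * y) (w - w') = bh (Suc n) (x * y) w - bh (Suc n) (x * y) w'"
        unfolding u(2) S(2)[OF w3 u(1) y] S(2)[OF w(1) u(1) y] S(2)[OF w(2) u(1) y]
        using u y w by (simp add: add_on_diff[OF n4] n contr_boxV add_on_diff[OF add_on_vec_bullet])
    qed
  qed
  show ?case using S(1) mem left add by blast
qed

lemma bullet_hom:
  shows "w \<in> TV \<Longrightarrow> add_on (tpow TVec n) (\<lambda>v. bh n v w)"
    and "v \<in> tpow TVec n \<Longrightarrow> w \<in> TV \<Longrightarrow> bh n v w \<in> TV"
    and "a \<in> Om 0 \<Longrightarrow> v \<in> tpow TVec n \<Longrightarrow> w \<in> TV \<Longrightarrow> bh n (sc a * v) w = sc a * bh n v w"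
    and "v \<in> tpow TVec n \<Longrightarrow> add_on TV (bh n v)"
  using bullet_hom_all[of n] by blast+

lemma bullet_hom_Suc:
  "w \<in> TV \<Longrightarrow> u \<in> VecA \<Longrightarrow> v \<in> tpow TVec n \<Longrightarrow>
    bh (Suc n) (vc u * v) w = vb u (bh n v w) - bh n (contr u (boxV n v)) w"
  using bullet_hom_all[of n] by (intro bullet_hom_Suc_aux(2)) blast+

lemma bullet_graded:
  assumes "w \<in> TV"
  shows add_on_bullet_left: "add_on TV (\<lambda>v. v \<odot> w)" and bullet_eq: "v \<in> tpow TVec n \<Longrightarrow> v \<odot> w = bh n v w"
  using add_ext_graded[OF vec_proj_VecA, folded TVec_def, of "\<lambda>n v. bh n v w", OF bullet_hom(1)[OF assms]]
  unfolding bullet_def by blast+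

lemma bullet_mem: "v \<in> TV \<Longrightarrow> w \<in> TV \<Longrightarrow> v \<odot> w \<in> TV"
  by (rule tpowers_into[OF _ add_on_bullet_left sgrp_tpowers, of v TVec w])
    (auto simp: bullet_eq bullet_hom(2) tpow_TV)

lemma add_on_bullet_right: assumes v: "v \<in> TV" shows "add_on TV (\<lambda>w. v \<odot> w)"
proof (rule add_onI[OF sgrp_tpowers])
  fix w w' :: "'w tens" assume w: "w \<in> TV" "w' \<in> TV"
  then have w3: "w - w' \<in> TV" by (simp add: sgrp_diff)
  show "v \<odot> (w - w') = v \<odot> w - v \<odot> w'"
    by (rule tpowers_eq[OF v add_on_bullet_left[OF w3]
          add_on_minus_fun[OF add_on_bullet_left[OF w(1)] add_on_bullet_left[OF w(2)]]])
      (auto simp: tpow_TV bullet_eq[OF w3] bullet_eq[OF w(1)] bullet_eq[OF w(2)] add_on_diff[OF bullet_hom(4)] w)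
qed

lemma bullet_left:
  assumes a: "a \<in> Om 0" and v: "v \<in> TV" and w: "w \<in> TV" shows "sc a * v \<odot> w = sc a * (v \<odot> w)"
proof (rule tpowers_eq[OF v, of TV "\<lambda>v. sc a * v \<odot> w" "\<lambda>v. sc a * (v \<odot> w)"])
  show "add_on TV (\<lambda>v. sc a * v \<odot> w)"
    by (rule add_on_comp[OF _ add_on_bullet_left[OF w]]) (simp_all add: add_on_def right_diff_distrib sc_left_TV a)
  show "add_on TV (\<lambda>v. sc a * (v \<odot> w))"
    by (rule add_on_const_mult[OF add_on_bullet_left[OF w]])
  show "sc a * v \<odot> w = sc a * (v \<odot> w)" if "v \<in> tpow TVec n" for n v
    using that a w by (simp add: bullet_eq[OF w, of _ n] sc_left_tpow bullet_hom(3))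
qed (auto simp: tpow_TV)

lemma bullet_sc: "a \<in> Om 0 \<Longrightarrow> w \<in> TV \<Longrightarrow> sc a \<odot> w = sc a * w"
  by (simp add: bullet_eq[of w _ 0] sc_TA)

lemma box_sc_one: "boxV 0 1 = 0"
  using tdif_sc[OF Om_one, where ?'a = 'w] by (simp add: dif_one fm_zero)

lemma vc_tpow_1: "u \<in> VecA \<Longrightarrow> vc u \<in> tpow TVec (Suc 0)"
  by (simp add: tpow_1[OF right_mod_TVec, unfolded tpow.simps] vc_TVec)

lemma bullet_vc_mult:
  assumes u: "u \<in> VecA" and v: "v \<in> TV" and w: "w \<in> TV"
  shows "(vc u * v) \<odot> w = vb u (v \<odot> w) - contr u (B v) \<odot> w"
proof (rule tpowers_eq[OF v, of TV "\<lambda>v. (vc u * v) \<odot> w"])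
  show "add_on TV (\<lambda>v. (vc u * v) \<odot> w)"
    by (rule add_on_comp[OF _ add_on_bullet_left[OF w]]) (simp_all add: add_on_def right_diff_distrib vc_left_TV u)
  show "add_on TV (\<lambda>v. vb u (v \<odot> w) - contr u (B v) \<odot> w)"
    by (intro add_on_minus_fun add_on_comp[OF add_on_bullet_left[OF w] add_on_vec_bullet[OF u]]
        add_on_comp[OF add_on_comp[OF add_on_box_TVec add_on_contr[OF u]] add_on_bullet_left[OF w]])
      (simp_all add: bullet_mem w contr_B u)
  show "(vc u * v) \<odot> w = vb u (v \<odot> w) - contr u (B v) \<odot> w" if v: "v \<in> tpow TVec n" for n v
  proof -
    have "vc u * v \<in> tpow TVec (Suc n)" using u v by (simp add: tprod_mem vc_TVec)
    then show ?thesis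
      using u v w bullet_hom_Suc[OF w u v]
      by (simp only: bullet_eq[OF w, of _ n] bullet_eq[OF w, of _ "Suc n"] box_TVec_eq[OF v] contr_boxV)
  qed
qed (auto simp: tpow_TV)

text \<open>The subtracted contraction in the rule for (u \<otimes> v) \<bullet> w is there
  precisely so that this degree-one associativity holds.\<close>

lemma bullet_vb: "u \<in> VecA \<Longrightarrow> v \<in> TV \<Longrightarrow> w \<in> TV \<Longrightarrow> vb u v \<odot> w = vb u (v \<odot> w)"
  by (simp add: vec_bullet_eq[of u v] add_on_add[OF add_on_bullet_left] vc_left_TV contr_B bullet_vc_mult)

lemma bullet_vc: "u \<in> VecA \<Longrightarrow> w \<in> TV \<Longrightarrow> vc u \<odot> w = vb u w"
  using bullet_vc_mult[of u 1 w] bullet_sc[OF Om_one, of w] add_on_zero[OF add_on_bullet_left, of w]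
  by (simp add: one_tpowers box_TVec_eq[of 1 0] one_TA box_sc_one[unfolded box_Vec.simps] contr_zero)

lemma bullet_assoc:
  assumes v: "v \<in> TV" and w: "w \<in> TV" and x: "x \<in> TV"
  shows "(v \<odot> w) \<odot> x = v \<odot> (w \<odot> x)"
proof (rule tpowers_eq[OF v, of TV "\<lambda>v. (v \<odot> w) \<odot> x" "\<lambda>v. v \<odot> (w \<odot> x)"])
  show "add_on TV (\<lambda>v. (v \<odot> w) \<odot> x)"
    by (rule add_on_comp[OF add_on_bullet_left[OF w] add_on_bullet_left[OF x]]) (simp add: bullet_mem w)
  show "add_on TV (\<lambda>v. v \<odot> (w \<odot> x))"
    by (rule add_on_bullet_left[OF bullet_mem[OF w x]])
  show "(v \<odot> w) \<odot> x = v \<odot> (w \<odot> x)" if "v \<in> tpow TVec n" for n v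
    using that
  proof (induction n arbitrary: v)
    case 0
    then obtain a where "a \<in> Om 0" "v = sc a" by (auto simp: TA_def)
    then show ?case using w x by (simp add: bullet_sc bullet_left bullet_mem)
  next
    case (Suc n)
    show ?case
    proof (rule tprod_eq[OF Suc.prems[unfolded tpow.simps], of TV "\<lambda>v. (v \<odot> w) \<odot> x" "\<lambda>v. v \<odot> (w \<odot> x)"])
      show "add_on TV (\<lambda>v. (v \<odot> w) \<odot> x)" "add_on TV (\<lambda>v. v \<odot> (w \<odot> x))" by fact+
      fix y z :: "'w tens" assume "y \<in> TVec" and z: "z \<in> tpow TVec n"
      then obtain u where u: "u \<in> VecA" "y = vc u" by (auto elim!: TVecE)
      note z' = tpow_TV[OF z]
      show "y * z \<in> TV" using u z' by (simp add: vc_left_TV)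
      \<comment> \<open>The contraction has degree n like z, so the induction hypothesis covers
        both; on the leading part \<open>bullet_vb\<close> applies.\<close>
      have "contr u (B z) \<in> tpow TVec n" using u z by (simp add: box_TVec_eq[OF z] contr_boxV)
      then show "(y * z \<odot> w) \<odot> x = y * z \<odot> (w \<odot> x)"
        using u z' w x Suc.IH[OF z] Suc.IH[of "contr u (B z)"]
        by (simp add: bullet_vc_mult bullet_mem add_on_diff[OF add_on_bullet_left] contr_B
            vec_bullet_mem bullet_vb)
    qed
  qed
qed (auto simp: tpow_TV)

abbreviation "TV10 \<equiv> TVecs10 J"

lemma TV10_TV: "w \<in> TV10 \<Longrightarrow> w \<in> TV"
  using tpowers_mono[OF TVec10_TVec] by (auto simp: TVecs10_def)

lemma sgrp_TV10 [simp]: "sgrp TV10"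
  by (simp add: TVecs10_def)

lemma left_mod_TV10: "left_mod TV10"
  by (simp add: TVecs10_def left_mod_tpowers left_mod_TVec10)

lemma tpow_TV10: "w \<in> tpow (TVec10 J) n \<Longrightarrow> w \<in> TV10"
  by (simp add: TVecs10_def tpowers_mem)

lemma vc_left_TV10: "u \<in> Vec10 J \<Longrightarrow> w \<in> TV10 \<Longrightarrow> vc u * w \<in> TV10"
  unfolding TVecs10_def by (rule subsetD[OF tprod_tpowers tprod_mem[OF vc_TVec10]])

lemma box_TVec_mem_10: "w \<in> TV10 \<Longrightarrow> B w \<in> TOm \<otimes>\<^sub>A TV10"
proof -
  assume w: "w \<in> TV10"
  show ?thesis
  proof (rule tpowers_into[OF w[unfolded TVecs10_def] add_on_box_TVec sgrp_tprod])
    show "tpow (TVec10 J) n \<subseteq> TV" for n using tpow_10 tpow_TV by blast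
    show "B x \<in> TOm \<otimes>\<^sub>A TV10" if x: "x \<in> tpow (TVec10 J) n" for n x
    proof -
      have "B x = boxV n x" using x tpow_10 by (intro box_TVec_eq) auto
      then show ?thesis
        using box_Vec_mem_10[OF x] tprod_mono[of TOm TOm "tpow (TVec10 J) n" TV10] tpow_TV10 by auto
    qed
  qed
qed

lemma contr_B_10: "u \<in> VecA \<Longrightarrow> w \<in> TV10 \<Longrightarrow> contr u (B w) \<in> TV10"
  by (rule contr_mem[OF _ box_TVec_mem_10 left_mod_TV10])

lemma contr_boxV_10: "u \<in> VecA \<Longrightarrow> w \<in> tpow (TVec10 J) n \<Longrightarrow> contr u (boxV n w) \<in> tpow (TVec10 J) n"
  by (rule contr_mem[OF _ box_Vec_mem_10 left_mod_tpow[OF left_mod_TVec10]])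

lemma vec_bullet_mem_10: "u \<in> Vec10 J \<Longrightarrow> w \<in> TV10 \<Longrightarrow> vb u w \<in> TV10"
  by (simp add: vec_bullet_eq TV10_TV Vec10_VecA sgrp_add[OF sgrp_TV10] vc_left_TV10 contr_B_10)

lemma bullet_mem_10:
  assumes v: "v \<in> TV10" and w: "w \<in> TV10" shows "v \<odot> w \<in> TV10"
proof (rule tpowers_into[OF v[unfolded TVecs10_def] add_on_bullet_left[OF TV10_TV[OF w]] sgrp_TV10])
  show T: "tpow (TVec10 J) n \<subseteq> TV" for n using tpow_10 tpow_TV by blast
  show "x \<odot> w \<in> TV10" if "x \<in> tpow (TVec10 J) n" for n x
    using that
  proof (induction n arbitrary: x)
    case 0
    then obtain a where "a \<in> Om 0" "x = sc a" by (auto simp: TA_def)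
    then show ?case using w by (simp add: bullet_sc TV10_TV left_modD(2)[OF left_mod_TV10])
  next
    case (Suc n)
    show ?case
    proof (rule tprod_into[OF Suc.prems[unfolded tpow.simps] add_on_bullet_left[OF TV10_TV[OF w]] sgrp_TV10])
      fix y z assume "y \<in> TVec10 J" and z: "z \<in> tpow (TVec10 J) n"
      then obtain u where u: "u \<in> Vec10 J" "y = vc u" by (auto elim!: TVec10E)
      note z' = subsetD[OF T z] and zV = subsetD[OF tpow_10 z]
      show "y * z \<in> TV" using u z' by (simp add: vc_left_TV Vec10_VecA)
      have "contr u (B z) \<in> tpow (TVec10 J) n"
        using u z by (simp add: box_TVec_eq[OF zV] contr_boxV_10 Vec10_VecA)
      then show "y * z \<odot> w \<in> TV10"
        using u z' w Suc.IH[OF z] Suc.IH[of "contr u (B z)"]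
        by (simp add: bullet_vc_mult Vec10_VecA TV10_TV vec_bullet_mem_10 sgrp_diff[OF sgrp_TV10])
    qed
  qed
qed

end

text \<open>Places the value over 0 in the span of the prescribed values, where the pairing with
  vector fields can detect that it vanishes.\<close>

lemma add_ext_snd: "(x, y) \<in> group_closure ((\<lambda>i. (b i, f i)) ` I) \<Longrightarrow> y \<in> group_closure (f ` I)"
proof -
  have "snd z \<in> group_closure (f ` I)" if "z \<in> group_closure ((\<lambda>i. (b i, f i)) ` I)" for z
    using that
    by induction (auto intro: group_closure_gen group_closure.diff)
  then show "(x, y) \<in> group_closure ((\<lambda>i. (b i, f i)) ` I) \<Longrightarrow> y \<in> group_closure (f ` I)"
    by fastforce
qed

lemma evs_mult_right:
  assumes v: "v \<in> tpow TVec n" and y: "y \<in> tpow TOm n \<otimes>\<^sub>A UNIV"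
  shows "evs n (v * (y * z)) = evs n (v * y) * z"
  by (rule tprod_eq[OF y, of UNIV "\<lambda>y. evs n (v * (y * z))" "\<lambda>y. evs n (v * y) * z"])
    (auto simp: add_on_def left_lin_diff[OF left_lin_evs] left_diff_distrib right_diff_distrib mult.assoc
      evs_forms[OF v])

lemma idt_evs_right:
  assumes t: "t \<in> TOm \<otimes>\<^sub>A tpow TVec n" and x: "x \<in> tpow TOm n"
  shows "idt (evs n) (t * (x * z)) = idt (evs n) (t * x) * z" and "idt (evs n) (t * x) \<in> TOm"
proof -
  note lin = left_lin_idt[OF left_lin_evs, of n]
  show "idt (evs n) (t * (x * z)) = idt (evs n) (t * x) * z"
    by (rule tprod_eq[OF t, of UNIV "\<lambda>t. idt (evs n) (t * (x * z))" "\<lambda>t. idt (evs n) (t * x) * z"])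
      (auto elim!: TOmE simp: add_on_def left_lin_diff[OF lin] left_diff_distrib mult.assoc
        idt_fm[OF left_lin_evs] evs_forms[OF _ x])
  show "idt (evs n) (t * x) \<in> TOm"
  proof (rule tprod_into[OF t, of UNIV "\<lambda>t. idt (evs n) (t * x)"])
    fix y v :: "'a tens" assume y: "y \<in> TOm" and v: "v \<in> tpow TVec n"
    obtain a where a: "a \<in> Om 0" "evs n (v * x) = sc a" using evs_forms[OF v x] by (auto simp: TA_def)
    have "idt (evs n) (y * v * x) = y * sc a"
      by (simp add: mult.assoc idt_TOm[OF left_lin_evs y] a)
    then show "idt (evs n) (y * v * x) \<in> TOm" using y a by (simp add: right_modD(2)[OF right_mod_TOm])
  qed (auto simp: add_on_def left_lin_diff[OF lin] left_diff_distrib)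
qed

lemma contr_idt_evs:
  assumes u: "u \<in> VecA" and t: "t \<in> TOm \<otimes>\<^sub>A Y"
  shows "contr u (idt (evs n) (t * s)) = evs n (contr u t * s)"
  by (rule tprod_eq[OF t, of UNIV "\<lambda>t. contr u (idt (evs n) (t * s))" "\<lambda>t. evs n (contr u t * s)"])
    (use u in \<open>auto elim!: TOmE simp: add_on_def left_lin_diff[OF left_lin_idt[OF left_lin_evs]] contr_diff
      left_lin_diff[OF left_lin_evs] left_diff_distrib mult.assoc idt_fm[OF left_lin_evs] contr_fm
      left_linD(2)[OF left_lin_evs] VecA_app\<close>)

context hd_setting
begin

text \<open>Iterated evaluation is a nondegenerate pairing, because \<open>\<Omega>\<^sup>1A\<close> has a dual basis. This is what makes
  the iterated derivatives on forms well defined.\<close>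

lemma evs_nondegenerate:
  "r \<in> tpow TOm n \<otimes>\<^sub>A UNIV \<Longrightarrow> (\<And>v. v \<in> tpow TVec n \<Longrightarrow> evs n (v * r) = 0) \<Longrightarrow> r = (0 :: 'w tens)"
proof (induction n arbitrary: r)
  case 0
  then show ?case using one_TA by force
next
  case (Suc n)
  have r: "r \<in> TOm \<otimes>\<^sub>A (tpow TOm n \<otimes>\<^sub>A UNIV)" using Suc.prems(1) by (simp add: tprod_assoc)
  \<comment> \<open>Testing against v \<otimes> U_i peels the first form off r, since the last
    vector is evaluated innermost.\<close>
  have "contr (U i) r = 0" if i: "i \<in> IX" for i
  proof (rule Suc.IH)
    show "contr (U i) r \<in> tpow TOm n \<otimes>\<^sub>A UNIV"
      by (rule contr_mem[OF basis_mem(2)[OF i] r left_mod_tprod[OF left_mod_tpow[OF left_mod_TOm]]])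
    fix v :: "'w tens" assume v: "v \<in> tpow TVec n"
    have "v * vc (U i) \<in> tpow TVec (Suc n)"
      unfolding tpow_Suc_right[OF left_mod_TVec right_mod_TVec, symmetric]
      by (rule tprod_mem[OF v vc_TVec[OF basis_mem(2)[OF i]]])
    from Suc.prems(2)[OF this] show "evs n (v * contr (U i) r) = 0"
      by (simp only: mult.assoc evs_snoc[OF basis_mem(2)[OF i] v])
  qed
  moreover have "r \<in> TOm \<otimes>\<^sub>A UNIV" using r tprod_mono[of TOm TOm "tpow TOm n \<otimes>\<^sub>A UNIV" UNIV] by auto
  ultimately show ?case using form_expand[of r] by simp
qed

section \<open>Iterated derivatives on forms, by duality with vector fields\<close>

abbreviation "BO \<equiv> box_Om box sinv"
abbreviation "dA c \<equiv> fm (dif (wedges c))"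



lemma add_on_dA: "add_on TA (\<lambda>c :: 'w tens. dA c)"
  by (rule add_on_comp[OF _ add_on_fm_dif])
    (auto simp: TA_def wedges_sc intro: add_on_subset[OF add_on_wedges] left_modD(1)[OF left_mod_TA, unfolded TA_def])

lemma idt_evs_bv:
  assumes u: "u \<in> VecA" and z: "evs n z = fm \<xi>" and \<xi>: "\<xi> \<in> Om 1"
  shows "idt (evs (Suc n)) (bv u * z) = fbox u \<xi>"
proof -
  have "idt (evs (Suc n)) (bv u * z) = (\<Sum>i\<in>IX. fbox u (X i) * sc (U i \<xi>))"
    unfolding bv_def sum_distrib_right left_lin_sum[OF left_lin_idt[OF left_lin_evs]]
    by (rule sum.cong) (simp_all only: mult.assoc idt_TOm[OF left_lin_evs fbox_TOm[OF u]]
        basis_mem evs_vc z contr_fm_1[OF _ \<xi>])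
  then show ?thesis by (simp only: right_lin_dual[OF right_lin_fbox[OF u] \<xi>])
qed

text \<open>Pairing with forms turns \<sigma> back into \<open>sinv\<close>: both are the same data
  read through the dual basis.\<close>

lemma idt_evs_sigma:
  assumes u: "u \<in> VecA" and \<xi>: "\<xi> \<in> Om 1" and x: "x \<in> tpow TOm n" and t: "t \<in> TOm \<otimes>\<^sub>A tpow TVec n"
  shows "idt (evs (Suc n)) (sigma_map (vc u * t) * (x * fm \<xi>)) = contr u (sinv_map (idt (evs n) (t * x) * fm \<xi>))"
proof (rule tprod_eq[OF t, of UNIV "\<lambda>t. idt (evs (Suc n)) (sigma_map (vc u * t) * (x * fm \<xi>))"
      "\<lambda>t. contr u (sinv_map (idt (evs n) (t * x) * fm \<xi>))"])
  fix y v :: "'w tens" assume "y \<in> TOm" and v: "v \<in> tpow TVec n"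
  then obtain \<zeta> where \<zeta>: "\<zeta> \<in> Om 1" "y = fm \<zeta>" by (auto elim!: TOmE)
  obtain a where a: "a \<in> Om 0" "evs n (v * x) = sc a" using evs_forms[OF v x] by (auto simp: TA_def)
  have a\<xi>: "a * \<xi> \<in> Om 1" using a \<xi> by (simp add: Om_0_mult)
  have e: "evs n (v * (x * fm \<xi>)) = fm (a * \<xi>)"
    using evs_forms[OF v x, of "fm \<xi>"] a \<xi> by (simp add: fm_left)
  have "idt (evs (Suc n)) (sigma_map (vc u * (y * v)) * (x * fm \<xi>)) =
      (\<Sum>i\<in>IX. gsig u \<zeta> (X i) * sc (U i (a * \<xi>)))"
    unfolding \<zeta>(2) sigma_map_fm[OF u \<zeta>(1)] sum_distrib_right left_lin_sum[OF left_lin_idt[OF left_lin_evs]]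
    by (rule sum.cong) (simp_all only: mult.assoc idt_TOm[OF left_lin_evs gsig_TOm[OF u \<zeta>(1)]]
        basis_mem evs_vc e contr_fm_1[OF _ a\<xi>])
  also have "\<dots> = gsig u \<zeta> (a * \<xi>)"
    by (rule right_lin_dual[OF right_lin_gsig[OF u \<zeta>(1)] a\<xi>])
  also have "\<dots> = contr u (sinv_map (idt (evs n) (y * v * x) * fm \<xi>))"
    using sinv_map_fm[OF \<zeta>(1) a\<xi>, of 1] \<xi>
    by (simp add: \<zeta> mult.assoc idt_fm left_lin_evs a fm_left)
  finally show "idt (evs (Suc n)) (sigma_map (vc u * (y * v)) * (x * fm \<xi>)) =
      contr u (sinv_map (idt (evs n) (y * v * x) * fm \<xi>))" .
qed (auto simp: add_on_def left_lin_diff[OF left_lin_idt[OF left_lin_evs]] left_lin_diff[OF left_lin_sigma_map]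
    left_lin_diff[OF left_lin_sinv_map] contr_diff[OF u] left_diff_distrib right_diff_distrib simp del: evs.simps)

abbreviation "BOr n \<equiv> (\<lambda>x \<xi>. x * box \<xi> + idts n sinv_map (BO n x * fm \<xi>))"

text \<open>The last clause is the duality between the derivatives on forms and on vector fields: d
  of the evaluation of v on x is the sum of the evaluations with v or with x differentiated. Solved
  for the derivative of x, its right side depends on x as a tensor only, which later proves that the
  formula on x \<otimes> \<xi> is well defined.\<close>

definition BO_props :: "nat \<Rightarrow> bool" where
  "BO_props n \<longleftrightarrow> add_on (tpow TOm n) (BO n) \<and> (\<forall>x\<in>tpow TOm n. BO n x \<in> tpow TOm n \<otimes>\<^sub>A TOm) \<and>
     (\<forall>v\<in>tpow TVec n. \<forall>x\<in>tpow TOm n.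
        evs n (v * BO n x) = dA (evs n (v * x)) - idt (evs n) (boxV n v * x))"

lemma BO_propsD:
  assumes "BO_props n"
  shows "add_on (tpow TOm n) (BO n)" "x \<in> tpow TOm n \<Longrightarrow> BO n x \<in> tpow TOm n \<otimes>\<^sub>A TOm"
    "v \<in> tpow TVec n \<Longrightarrow> x \<in> tpow TOm n \<Longrightarrow> evs n (v * BO n x) = dA (evs n (v * x)) - idt (evs n) (boxV n v * x)"
  using assms by (auto simp: BO_props_def)

lemma tpow_TOm_UNIV: "y \<in> tpow TOm n \<otimes>\<^sub>A TOm \<Longrightarrow> y \<in> tpow TOm n \<otimes>\<^sub>A UNIV"
  using tprod_mono[of "tpow TOm n" "tpow TOm n" TOm UNIV] by auto

lemma tpow_TOm_Suc: "tpow TOm n \<otimes>\<^sub>A TOm = (tpow TOm (Suc n) :: 'w tens set)"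
  by (rule tpow_Suc_right[OF left_mod_TOm right_mod_TOm])

lemma add_on_BO_rhs:
  assumes v: "v \<in> tpow TVec n"
  shows "add_on (tpow TOm n) (\<lambda>x. dA (evs n (v * x)) - idt (evs n) (boxV n v * x))"
  by (intro add_on_minus_fun add_on_comp[OF _ add_on_dA])
    (auto simp: add_on_def left_lin_diff[OF left_lin_evs] left_lin_diff[OF left_lin_idt[OF left_lin_evs]]
      right_diff_distrib evs_forms[OF v])

text \<open>Duality for the prospective value on x \<otimes> \<xi>, established before that value is
  known to depend on the product alone.\<close>

lemma evs_BOr:
  assumes n: "BO_props n" and v: "v \<in> tpow TVec (Suc n)" and x: "x \<in> tpow TOm n" and \<xi>: "\<xi> \<in> Om 1"
  shows "evs (Suc n) (v * BOr n x \<xi>) = dA (evs (Suc n) (v * (x * fm \<xi>))) - idt (evs (Suc n)) (boxV (Suc n) v * (x * fm \<xi>))"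
proof (rule tprod_eq[OF v[unfolded tpow.simps], of "tpow TVec (Suc n)" "\<lambda>v. evs (Suc n) (v * BOr n x \<xi>)"
      "\<lambda>v. dA (evs (Suc n) (v * (x * fm \<xi>))) - idt (evs (Suc n)) (boxV (Suc n) v * (x * fm \<xi>))"])
  have x\<xi>: "x * fm \<xi> \<in> tpow TOm (Suc n)" unfolding tpow_TOm_Suc[symmetric] by (rule tprod_mem[OF x fm_TOm[OF \<xi>]])
  show "add_on (tpow TVec (Suc n)) (\<lambda>v. evs (Suc n) (v * BOr n x \<xi>))"
    by (auto simp: add_on_def left_lin_diff[OF left_lin_evs] left_diff_distrib simp del: evs.simps tpow.simps)
  show "add_on (tpow TVec (Suc n)) (\<lambda>v. dA (evs (Suc n) (v * (x * fm \<xi>))) - idt (evs (Suc n)) (boxV (Suc n) v * (x * fm \<xi>)))"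
    by (intro add_on_minus_fun add_on_comp[OF _ add_on_dA])
      (auto simp: add_on_def left_lin_diff[OF left_lin_evs] left_lin_diff[OF left_lin_idt[OF left_lin_evs]]
        add_on_diff[OF add_on_box_Vec] left_diff_distrib evs_forms[OF _ x\<xi>] simp del: evs.simps tpow.simps box_Vec.simps)
  fix y w :: "'w tens" assume "y \<in> TVec" and w: "w \<in> tpow TVec n"
  then obtain u where u: "u \<in> VecA" "y = vc u" by (auto elim!: TVecE)
  show "y * w \<in> tpow TVec (Suc n)" using u w by (simp add: tprod_mem vc_TVec)
  obtain a where a: "a \<in> Om 0" "evs n (w * x) = sc a" using evs_forms[OF w x] by (auto simp: TA_def)
  have a\<xi>: "a * \<xi> \<in> Om 1" using a \<xi> by (simp add: Om_0_mult)
  let ?Z = "idt (evs n) (boxV n w * x)"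
  have BO: "BO n x \<in> tpow TOm n \<otimes>\<^sub>A TOm" by (rule BO_propsD(2)[OF n x])
  have e: "evs n (w * (x * z)) = sc a * z" for z
    using evs_forms[OF w x, of z] a by simp
  have "evs n (w * (BO n x * fm \<xi>)) = (fm (dif a) - ?Z) * fm \<xi>"
    using evs_mult_right[OF w tpow_TOm_UNIV[OF BO]] BO_propsD(3)[OF n w x] a by (simp add: wedges_sc)
  moreover have "evs n (w * idts n sinv_map (BO n x * fm \<xi>)) = sinv_map (evs n (w * (BO n x * fm \<xi>)))"
    by (rule evs_idts[OF left_lin_sinv_map w tprod_mult_right[OF BO]]) simp
  ultimately have "evs n (w * BOr n x \<xi>) = sc a * box \<xi> + (sinv (fm (dif a) * fm \<xi>) - sinv_map (?Z * fm \<xi>))"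
    using sinv_map_eq[OF TOm2[OF dif_A[OF a(1)] \<xi>], of 1]
    by (simp add: distrib_left left_lin_add[OF left_lin_evs] e left_diff_distrib left_lin_diff[OF left_lin_sinv_map])
  \<comment> \<open>The scalar left by the inner evaluation and its differential recombine by the
    left Leibniz rule of \<open>box\<close>.\<close>
  also have "\<dots> = box (a * \<xi>) - sinv_map (?Z * fm \<xi>)" using a \<xi> by (simp add: box_left)
  finally have "evs (Suc n) (y * w * BOr n x \<xi>) = contr u (box (a * \<xi>)) - contr u (sinv_map (?Z * fm \<xi>))"
    unfolding u(2) mult.assoc evs_vc[OF u(1)] by (simp only: contr_diff[OF u(1)])
  moreover have "dA (evs (Suc n) (y * w * (x * fm \<xi>))) = fm (dif (u (a * \<xi>)))"
    using a \<xi> u by (simp add: mult.assoc evs_vc e contr_fm_1[OF _ a\<xi>] fm_left[symmetric] wedges_sc VecA_app a\<xi> del: evs.simps)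
  moreover have "idt (evs (Suc n)) (bv u * (w * (x * fm \<xi>))) = fbox u (a * \<xi>)"
    by (rule idt_evs_bv[OF u(1) _ a\<xi>]) (simp add: e fm_left a \<xi>)
  ultimately show "evs (Suc n) (y * w * BOr n x \<xi>) =
      dA (evs (Suc n) (y * w * (x * fm \<xi>))) - idt (evs (Suc n)) (boxV (Suc n) (y * w) * (x * fm \<xi>))"
    using idt_evs_sigma[OF u(1) \<xi> x box_Vec_mem[OF w]]
    by (simp add: u(2) box_Vec_Suc[OF u(1) w] distrib_right left_lin_add[OF left_lin_idt[OF left_lin_evs]] mult.assoc
        del: evs.simps box_Vec.simps)
qed

lemma BOr_mem:
  assumes n: "BO_props n" and x: "x \<in> tpow TOm n" and \<xi>: "\<xi> \<in> Om 1"
  shows "BOr n x \<xi> \<in> tpow TOm (Suc n) \<otimes>\<^sub>A TOm"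
proof -
  have BO: "BO n x \<in> tpow TOm n \<otimes>\<^sub>A TOm" by (rule BO_propsD(2)[OF n x])
  have "idts n sinv_map (BO n x * fm \<xi>) \<in> tpow TOm n \<otimes>\<^sub>A TOm \<otimes>\<^sub>A TOm"
  proof (rule tprod_into[OF BO, of UNIV "\<lambda>y. idts n sinv_map (y * fm \<xi>)"])
    show "idts n sinv_map (y * z * fm \<xi>) \<in> tpow TOm n \<otimes>\<^sub>A TOm \<otimes>\<^sub>A TOm" if "y \<in> tpow TOm n" "z \<in> TOm" for y z
      using that \<xi> sinv_map_eq[OF tprod_mem[OF that(2) fm_TOm[OF \<xi>]], of 1]
      by (simp add: mult.assoc idts_forms[OF left_lin_sinv_map] tprod_mem sinv_mem fm_TOm)
  qed (auto simp: add_on_def left_lin_diff[OF left_lin_idts[OF left_lin_sinv_map]] left_diff_distrib)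
  then have "BOr n x \<xi> \<in> tpow TOm n \<otimes>\<^sub>A TOm \<otimes>\<^sub>A TOm"
    by (intro sgrp_add[OF sgrp_tprod] tprod_mem x box_mem \<xi>)
  then show ?thesis by (simp only: tprod_assoc[symmetric] tpow_TOm_Suc)
qed

lemma tmap_sinv_BO:
  assumes n: "BO_props n" and x: "x \<in> tpow TOm n" and \<xi>: "\<xi> \<in> Om 1"
  shows "tmap (tpow TOm n) (TOm \<otimes>\<^sub>A TOm) {1} sinv (BO n x * fm \<xi>) = idts n sinv_map (BO n x * fm \<xi>)"
proof (rule tmap_sinv)
  show "BO n x * fm \<xi> \<in> tpow TOm n \<otimes>\<^sub>A (TOm \<otimes>\<^sub>A TOm) \<otimes>\<^sub>A {1}"
    using tprod_mem[OF BO_propsD(2)[OF n x] fm_TOm[OF \<xi>]] by (simp add: tprod_one_right tprod_assoc)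
qed

lemma BO_gens: "(\<lambda>(x, \<xi>). x * fm \<xi>) ` (tpow TOm n \<times> Om 1) = {x * y |x y :: 'w tens. x \<in> tpow TOm n \<and> y \<in> TOm}"
proof (intro subset_antisym subsetI)
  fix z assume "z \<in> {x * y |x y :: 'w tens. x \<in> tpow TOm n \<and> y \<in> TOm}"
  then obtain x \<xi> where "x \<in> tpow TOm n" "\<xi> \<in> Om 1" "z = x * fm \<xi>" by (auto elim!: TOmE)
  then show "z \<in> (\<lambda>(x, \<xi>). x * fm \<xi>) ` (tpow TOm n \<times> Om 1)"
    by (intro image_eqI[of _ _ "(x, \<xi>)"]) auto
qed (auto intro: fm_TOm)

text \<open>If a combination of products x \<otimes> \<xi> vanishes, duality makes the corresponding
  combination of values pair to 0 with every v, so it is 0 by nondegeneracy. This replaces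
  \<open>tens_rec\<close>, which splits off the first letter and not the last.\<close>

lemma BO_Suc_aux:
  assumes n: "BO_props n" and eq: "BO (Suc n) = add_ext (tpow TOm n \<times> Om 1) (\<lambda>(x, \<xi>). x * fm \<xi>) (\<lambda>(x, \<xi>). BOr n x \<xi>)"
  shows "add_on (tpow TOm (Suc n)) (BO (Suc n))"
    and "x \<in> tpow TOm n \<Longrightarrow> \<xi> \<in> Om 1 \<Longrightarrow> BO (Suc n) (x * fm \<xi>) = BOr n x \<xi>"
proof -
  let ?I = "tpow TOm n \<times> (Om 1 :: 'w set)"
  have span: "group_closure ((\<lambda>(x, \<xi>). x * fm \<xi>) ` ?I) = tpow TOm (Suc n)"
    unfolding BO_gens using tpow_TOm_Suc by (simp add: tprod_def)
  have ok: "add_ext_ok ?I (\<lambda>(x, \<xi>). x * fm \<xi>) (\<lambda>(x, \<xi>). BOr n x \<xi>)"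
    unfolding add_ext_ok_def
  proof (intro allI impI)
    fix y assume y: "(0, y) \<in> group_closure ((\<lambda>i. (case i of (x, \<xi>) \<Rightarrow> x * fm \<xi>, case i of (x, \<xi>) \<Rightarrow> BOr n x \<xi>)) ` ?I)"
    have "(\<lambda>(x, \<xi>). BOr n x \<xi>) ` ?I \<subseteq> tpow TOm (Suc n) \<otimes>\<^sub>A TOm" using BOr_mem[OF n] by auto
    then have "y \<in> tpow TOm (Suc n) \<otimes>\<^sub>A TOm"
      using add_ext_snd[OF y] group_closure_subset[OF _ sgrp_tprod] by blast
    from tpow_TOm_UNIV[OF this] show "y = 0"
    proof (rule evs_nondegenerate)
      fix v :: "'w tens" assume v: "v \<in> tpow TVec (Suc n)"
      have "(\<lambda>x. dA (evs (Suc n) (v * x)) - idt (evs (Suc n)) (boxV (Suc n) v * x)) 0 = evs (Suc n) (v * y)"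
      proof (rule add_ext_rel[OF y add_on_BO_rhs[OF v], of "\<lambda>y. evs (Suc n) (v * y)"])
        show "(\<lambda>(x, \<xi>). x * fm \<xi>) ` ?I \<subseteq> tpow TOm (Suc n)"
          unfolding span[symmetric] by (auto intro: group_closure_gen)
        show "add_on UNIV (\<lambda>y. evs (Suc n) (v * y))"
          by (simp add: add_on_def left_lin_diff[OF left_lin_evs] right_diff_distrib del: evs.simps)
      qed (use evs_BOr[OF n v] in \<open>auto simp del: evs.simps box_Vec.simps\<close>)
      then show "evs (Suc n) (v * y) = 0"
        by (simp add: left_lin_zero[OF left_lin_evs] left_lin_zero[OF left_lin_idt[OF left_lin_evs]] wedges_zero
            add_on_zero[OF add_on_fm_dif] del: evs.simps box_Vec.simps)
    qed
  qed
  show "add_on (tpow TOm (Suc n)) (BO (Suc n))"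
    using add_on_add_ext[OF ok] unfolding span eq .
  show "x \<in> tpow TOm n \<Longrightarrow> \<xi> \<in> Om 1 \<Longrightarrow> BO (Suc n) (x * fm \<xi>) = BOr n x \<xi>"
    using add_ext_gen[OF ok, of "(x, \<xi>)"] unfolding eq by simp
qed

lemma BO_Suc_eq:
  assumes n: "BO_props (Suc n)"
  shows "BO (Suc (Suc n)) = add_ext (tpow TOm (Suc n) \<times> Om 1) (\<lambda>(x, \<xi>). x * fm \<xi>) (\<lambda>(x, \<xi>). BOr (Suc n) x \<xi>)"
  unfolding box_Om.simps
  by (rule add_ext_cong) (auto simp only: tmap_sinv_BO[OF n] split: prod.split)

lemma BO_1: "\<xi> \<in> Om 1 \<Longrightarrow> BO (Suc 0) (fm \<xi>) = box \<xi>" and add_on_BO_1: "add_on TOm (BO (Suc 0))"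
proof -
  have add: "add_on TOm (\<lambda>x :: 'w tens. box (wedges x))"
    by (rule add_on_comp[OF _ add_on_box])
      (auto elim!: TOmE simp: wedges_fm_1 intro: add_on_subset[OF add_on_wedges])
  have ok: "add_ext_ok (Om 1) fm box"
    by (rule add_ext_okI[OF add]) (auto simp: wedges_fm_1 fm_TOm)
  show "\<xi> \<in> Om 1 \<Longrightarrow> BO (Suc 0) (fm \<xi>) = box \<xi>"
    using add_ext_gen[OF ok] by simp
  have "group_closure (fm ` Om 1) = (TOm :: 'w tens set)"
    using group_closure_sgrp[OF sgrp_TOm] by (simp add: TOm_def)
  then show "add_on TOm (BO (Suc 0))"
    using add_on_add_ext[OF ok] by simp
qed

lemma tpow_TOm_1: "tpow TOm (Suc 0) = (TOm :: 'w tens set)" and tpow_TVec_1: "tpow TVec (Suc 0) = (TVec :: 'w tens set)"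
  by (simp_all only: tpow_1 right_mod_TOm right_mod_TVec)

text \<open>Stated from degree 1 on, because the recursive clause of \<open>box_Om\<close> builds on
  positive degrees.\<close>

lemma BO_props: "BO_props (Suc n)"
proof (induction n)
  case 0
  show ?case
    unfolding BO_props_def tpow_TOm_1 tpow_TVec_1
  proof (intro conjI ballI add_on_BO_1)
    fix x :: "'w tens" assume "x \<in> TOm"
    then obtain \<xi> where \<xi>: "\<xi> \<in> Om 1" "x = fm \<xi>" by (rule TOmE)
    show "BO (Suc 0) x \<in> TOm \<otimes>\<^sub>A TOm" unfolding \<xi>(2) BO_1[OF \<xi>(1)] by (rule box_mem[OF \<xi>(1)])
    fix v :: "'w tens" assume "v \<in> TVec"
    then obtain u where u: "u \<in> VecA" "v = vc u" by (rule TVecE)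
    have "boxV (Suc 0) (vc u * 1) = bv u * 1 + sigma_map (vc u * boxV 0 1)"
      by (rule box_Vec_Suc[OF u(1)]) (simp add: one_TA)
    then have "boxV (Suc 0) v = bv u" by (simp only: u(2) box_sc_one mult_zero_right mult_1_right
          left_lin_zero[OF left_lin_sigma_map] add_0_right)
    moreover have "idt (evs (Suc 0)) (bv u * x) = fbox u \<xi>" by (rule idt_evs_bv[OF u(1) _ \<xi>(1)]) (simp add: \<xi>)
    ultimately show "evs (Suc 0) (v * BO (Suc 0) x) = dA (evs (Suc 0) (v * x)) - idt (evs (Suc 0)) (boxV (Suc 0) v * x)"
      unfolding u(2) \<xi>(2) BO_1[OF \<xi>(1)] evs_vc[OF u(1)]
      by (simp add: contr_fm_1[OF u(1) \<xi>(1)] wedges_sc VecA_app[OF u(1) \<xi>(1)] del: evs.simps(2) box_Vec.simps)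
  qed
next
  case (Suc n)
  note S = BO_Suc_aux[OF Suc BO_Suc_eq[OF Suc]]
  let ?m = "Suc (Suc n)"
  show ?case
    unfolding BO_props_def
  proof (intro conjI ballI S(1))
    fix x :: "'w tens" assume "x \<in> tpow TOm ?m"
    then have x: "x \<in> tpow TOm (Suc n) \<otimes>\<^sub>A TOm" by (simp only: tpow_TOm_Suc)
    have gen: "y * z \<in> tpow TOm ?m" if "y \<in> tpow TOm (Suc n)" "z \<in> TOm" for y z :: "'w tens"
      unfolding tpow_TOm_Suc[of "Suc n", symmetric] by (rule tprod_mem[OF that])
    show "BO ?m x \<in> tpow TOm ?m \<otimes>\<^sub>A TOm"
    proof (rule tprod_into[OF x S(1) sgrp_tprod gen])
      fix y z :: "'w tens" assume y: "y \<in> tpow TOm (Suc n)" and "z \<in> TOm"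
      then obtain \<xi> where "\<xi> \<in> Om 1" "z = fm \<xi>" by (auto elim!: TOmE)
      then show "BO ?m (y * z) \<in> tpow TOm ?m \<otimes>\<^sub>A TOm"
        using S(2)[OF y] BOr_mem[OF Suc y] by (simp only:)
    qed
    fix v :: "'w tens" assume v: "v \<in> tpow TVec ?m"
    show "evs ?m (v * BO ?m x) = dA (evs ?m (v * x)) - idt (evs ?m) (boxV ?m v * x)"
    proof (rule tprod_eq[OF x _ add_on_BO_rhs[OF v] gen, of "\<lambda>x. evs ?m (v * BO ?m x)"])
      show "add_on (tpow TOm ?m) (\<lambda>x. evs ?m (v * BO ?m x))"
        using S(1) by (auto simp: add_on_def left_lin_diff[OF left_lin_evs] right_diff_distrib
            simp del: evs.simps tpow.simps box_Om.simps)
      fix y z :: "'w tens" assume y: "y \<in> tpow TOm (Suc n)" and "z \<in> TOm"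
      then obtain \<xi> where "\<xi> \<in> Om 1" "z = fm \<xi>" by (auto elim!: TOmE)
      then show "evs ?m (v * BO ?m (y * z)) = dA (evs ?m (v * (y * z))) - idt (evs ?m) (boxV ?m v * (y * z))"
        using S(2)[OF y] evs_BOr[OF Suc v y] by (simp only:)
    qed
  qed
qed

lemma BO_Suc:
  "x \<in> tpow TOm (Suc n) \<Longrightarrow> \<xi> \<in> Om 1 \<Longrightarrow> BO (Suc (Suc n)) (x * fm \<xi>) = BOr (Suc n) x \<xi>"
  by (rule BO_Suc_aux(2)[OF BO_props BO_Suc_eq[OF BO_props]])

subsection \<open>Forms of type (1,0)\<close>

lemma TOm10_TOm: "TOm10 J \<subseteq> TOm"
  by (auto elim!: TOm10E simp: fm_TOm Om_pq_Om_1)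

lemma tpow_TOm10: "tpow (TOm10 J) n \<subseteq> tpow TOm n"
  by (rule tpow_mono[OF TOm10_TOm])

lemma tpow_TOm10_Suc: "tpow (TOm10 J) n \<otimes>\<^sub>A TOm10 J = tpow (TOm10 J) (Suc n)"
  by (rule tpow_Suc_right[OF left_mod_TOm10 right_mod_TOm10])

lemma form_map_p10_mem: "t \<in> TOm \<otimes>\<^sub>A Y \<Longrightarrow> form_map p10 t \<in> TOm10 J \<otimes>\<^sub>A Y"
  by (erule tprod_into[OF _ left_linD(1)[OF form_map_p10(1)]])
    (auto elim!: TOmE simp: form_map_p10 p10_mem intro!: tprod_mem fm_TOm10)

lemma form_map_p01_mem: "t \<in> TOm \<otimes>\<^sub>A Y \<Longrightarrow> form_map p01 t \<in> TOm01 J \<otimes>\<^sub>A Y"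
  by (erule tprod_into[OF _ left_linD(1)[OF form_map_p01(1)]])
    (auto elim!: TOmE simp: form_map_p01 p01_mem intro!: tprod_mem fm_TOm01)

lemma box_mem_10: "\<xi> \<in> Om_pq J 1 0 \<Longrightarrow> box \<xi> \<in> TOm10 J \<otimes>\<^sub>A TOm"
  using box_p10[of \<xi>] form_map_p10_mem[OF box_mem, of \<xi>] by (simp add: p10_on Om_pq_Om_1)

lemma box_mem_01: "\<xi> \<in> Om_pq J 0 1 \<Longrightarrow> box \<xi> \<in> TOm01 J \<otimes>\<^sub>A TOm"
  using box_p01[of \<xi>] form_map_p01_mem[OF box_mem, of \<xi>] by (simp add: p01_on Om_pq_Om_1)

lemma sinv_mem_10: "\<zeta> \<in> Om 1 \<Longrightarrow> \<xi> \<in> Om_pq J 1 0 \<Longrightarrow> sinv (fm \<zeta> * fm \<xi>) \<in> TOm10 J \<otimes>\<^sub>A TOm"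
  using sinv_p10[of \<zeta> \<xi>] form_map_p10_mem[OF sinv_mem[OF TOm2], of \<zeta> \<xi>] by (simp add: p10_on Om_pq_Om_1)

text \<open>Differentiation preserves the type of the form it acts on, and so does the reordering by
  \<open>sinv\<close>; only the new last factor may have another type.\<close>

lemma BO_mem_10: "x \<in> tpow (TOm10 J) (Suc n) \<Longrightarrow> BO (Suc n) x \<in> tpow (TOm10 J) (Suc n) \<otimes>\<^sub>A TOm"
proof (induction n arbitrary: x)
  case 0
  have "tpow (TOm10 J) (Suc 0) = TOm10 J" by (simp only: tpow_1 right_mod_TOm10)
  with 0 show ?case by (auto elim!: TOm10E simp only: BO_1 Om_pq_Om_1 box_mem_10)
next
  case (Suc n)
  let ?m = "Suc (Suc n)"
  have x: "x \<in> tpow (TOm10 J) (Suc n) \<otimes>\<^sub>A TOm10 J" using Suc.prems by (simp only: tpow_TOm10_Suc)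
  show ?case
  proof (rule tprod_into[OF x BO_propsD(1)[OF BO_props] sgrp_tprod])
    fix y z :: "'w tens" assume y: "y \<in> tpow (TOm10 J) (Suc n)" and z: "z \<in> TOm10 J"
    then obtain \<xi> where \<xi>: "\<xi> \<in> Om_pq J 1 0" "z = fm \<xi>" by (auto elim!: TOm10E)
    have y': "y \<in> tpow TOm (Suc n)" using y tpow_TOm10 by blast
    show "y * z \<in> tpow TOm ?m" using tprod_mem[OF y z] tpow_TOm10[of ?m] by (auto simp only: tpow_TOm10_Suc)
    have "idts (Suc n) sinv_map (BO (Suc n) y * fm \<xi>) \<in> tpow (TOm10 J) (Suc n) \<otimes>\<^sub>A TOm10 J \<otimes>\<^sub>A TOm"
    proof (rule tprod_into[OF Suc.IH[OF y], of UNIV "\<lambda>y. idts (Suc n) sinv_map (y * fm \<xi>)"])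
      fix s t :: "'w tens" assume s: "s \<in> tpow (TOm10 J) (Suc n)" and "t \<in> TOm"
      then obtain \<zeta> where \<zeta>: "\<zeta> \<in> Om 1" "t = fm \<zeta>" by (auto elim!: TOmE)
      have s': "s \<in> tpow TOm (Suc n)" using s tpow_TOm10 by blast
      show "idts (Suc n) sinv_map (s * t * fm \<xi>) \<in> tpow (TOm10 J) (Suc n) \<otimes>\<^sub>A TOm10 J \<otimes>\<^sub>A TOm"
        using sinv_map_eq[OF TOm2[OF \<zeta>(1) Om_pq_Om_1(1)[OF \<xi>(1)]], of 1] tprod_mem[OF s sinv_mem_10[OF \<zeta>(1) \<xi>(1)]]
        by (simp add: \<zeta>(2) mult.assoc idts_forms[OF left_lin_sinv_map s'] del: tpow.simps)
    qed (auto simp: add_on_def left_lin_diff[OF left_lin_idts[OF left_lin_sinv_map]] left_diff_distrib simp del: tpow.simps)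
    then have "BOr (Suc n) y \<xi> \<in> tpow (TOm10 J) (Suc n) \<otimes>\<^sub>A TOm10 J \<otimes>\<^sub>A TOm"
      by (intro sgrp_add[OF sgrp_tprod] tprod_mem y box_mem_10 \<xi>(1))
    then show "BO ?m (y * z) \<in> tpow (TOm10 J) ?m \<otimes>\<^sub>A TOm"
      unfolding \<xi>(2) BO_Suc[OF y' Om_pq_Om_1(1)[OF \<xi>(1)]] by (simp only: tprod_assoc[symmetric] tpow_TOm10_Suc)
  qed
qed


section \<open>The action\<close>

context
  fixes E :: "'w tens set" and dE :: "'w tens \<Rightarrow> 'w tens"
  assumes E: "left_mod E" and dE: "add_on E dE"
    and dE_mem: "\<And>e. e \<in> E \<Longrightarrow> dE e \<in> TOm10 J \<otimes>\<^sub>A E"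
    and dE_left: "\<And>a e. a \<in> Om 0 \<Longrightarrow> e \<in> E \<Longrightarrow> dE (sc a * e) = fm (p10 (dif a)) * e + sc a * dE e"
begin

abbreviation "DI \<equiv> del_iter J box sinv E dE"
abbreviation "Nr n \<equiv> (\<lambda>x e. idts n (form_map p10) (BO n x) * e + x * dE e)"

lemma evs_mem_E:
  assumes v: "v \<in> tpow TVec n" and s: "s \<in> tpow TOm n \<otimes>\<^sub>A E" shows "evs n (v * s) \<in> E"
proof (rule tprod_into[OF s, of UNIV "\<lambda>s. evs n (v * s)"])
  fix x e :: "'w tens" assume x: "x \<in> tpow TOm n" and e: "e \<in> E"
  obtain a where "a \<in> Om 0" "evs n (v * x) = sc a" using evs_forms[OF v x] by (auto simp: TA_def)
  then show "evs n (v * (x * e)) \<in> E"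
    using evs_forms[OF v x, of e] e by (simp add: left_modD(2)[OF E])
qed (auto simp: add_on_def left_lin_diff[OF left_lin_evs] right_diff_distrib left_modD(1)[OF E])

text \<open>The duality of \<open>BO_props\<close> with \<open>dE\<close> acting on the
  coefficients. The \<open>p10\<close> in the last form factor passes through the evaluation by
  \<open>evs_idts\<close>.\<close>

lemma evs_Nr:
  assumes v: "v \<in> tpow TVec (Suc m)" and x: "x \<in> tpow TOm (Suc m)" and e: "e \<in> E"
  shows "evs (Suc m) (v * Nr (Suc m) x e) = dE (evs (Suc m) (v * (x * e))) -
    form_map p10 (idt (evs (Suc m)) (boxV (Suc m) v * (x * e)))"
proof -
  let ?n = "Suc m"
  obtain a where a: "a \<in> Om 0" "evs ?n (v * x) = sc a" using evs_forms[OF v x] by (auto simp: TA_def)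
  let ?Z = "idt (evs ?n) (boxV ?n v * x)"
  have Z: "?Z \<in> TOm" by (rule idt_evs_right(2)[OF box_Vec_mem[OF v] x])
  have BO: "BO ?n x \<in> tpow TOm ?n \<otimes>\<^sub>A TOm" by (rule BO_propsD(2)[OF BO_props x])
  have idts_mem: "idts ?n (form_map p10) (BO ?n x) \<in> tpow TOm ?n \<otimes>\<^sub>A UNIV"
    by (rule tprod_into[OF BO left_linD(1)[OF left_lin_idts[OF form_map_p10(1)]]])
      (simp_all add: idts_forms[OF form_map_p10(1)] tprod_mem del: tpow.simps)
  have "evs ?n (v * (idts ?n (form_map p10) (BO ?n x) * e)) = form_map p10 (evs ?n (v * BO ?n x)) * e"
    by (simp only: evs_mult_right[OF v idts_mem] evs_idts[OF form_map_p10(1) v tpow_TOm_UNIV[OF BO]])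
  also have "\<dots> = fm (p10 (dif a)) * e - form_map p10 ?Z * e"
    using a by (simp only: BO_propsD(3)[OF BO_props v x] wedges_sc left_lin_diff[OF form_map_p10(1)]
        form_map_p10(3)[OF dif_A] left_diff_distrib)
  finally have "evs ?n (v * Nr ?n x e) = fm (p10 (dif a)) * e + sc a * dE e - form_map p10 ?Z * e"
    using evs_forms[OF v x, of "dE e"] a by (simp add: distrib_left left_lin_add[OF left_lin_evs] del: evs.simps tpow.simps)
  moreover have "evs ?n (v * (x * e)) = sc a * e" using evs_forms[OF v x, of e] a by (simp del: evs.simps)
  moreover have "form_map p10 (idt (evs ?n) (boxV ?n v * (x * e))) = form_map p10 ?Z * e"
    by (simp only: idt_evs_right(1)[OF box_Vec_mem[OF v] x] form_map_p10(4)[OF TOm_UNIV[OF Z]])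
  ultimately show ?thesis using a e by (simp add: dE_left del: evs.simps box_Vec.simps)
qed

lemma Nr_mem:
  assumes x: "x \<in> tpow (TOm10 J) (Suc m)" and e: "e \<in> E"
  shows "Nr (Suc m) x e \<in> tpow (TOm10 J) (Suc (Suc m)) \<otimes>\<^sub>A E"
proof -
  let ?n = "Suc m"
  have "idts ?n (form_map p10) (BO ?n x) \<in> tpow (TOm10 J) ?n \<otimes>\<^sub>A TOm10 J"
  proof (rule tprod_into[OF BO_mem_10[OF x] left_linD(1)[OF left_lin_idts[OF form_map_p10(1)]]])
    fix y z :: "'w tens" assume y: "y \<in> tpow (TOm10 J) ?n" and "z \<in> TOm"
    then obtain \<xi> where \<xi>: "\<xi> \<in> Om 1" "z = fm \<xi>" by (auto elim!: TOmE)
    have y': "y \<in> tpow TOm ?n" using y tpow_TOm10 by blast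
    show "idts ?n (form_map p10) (y * z) \<in> tpow (TOm10 J) ?n \<otimes>\<^sub>A TOm10 J"
      unfolding \<xi>(2) idts_forms[OF form_map_p10(1) y'] form_map_p10(3)[OF \<xi>(1)]
      by (rule tprod_mem[OF y fm_TOm10[OF p10_mem[OF \<xi>(1)]]])
  qed simp_all
  from tprod_mem[OF this e] tprod_mem[OF x dE_mem[OF e]]
  have "Nr ?n x e \<in> tpow (TOm10 J) ?n \<otimes>\<^sub>A TOm10 J \<otimes>\<^sub>A E"
    by (simp only: tprod_assoc sgrp_add[OF sgrp_tprod])
  then show ?thesis by (simp only: tprod_assoc[symmetric] tpow_TOm10_Suc)
qed

lemma add_on_Nr_rhs:
  assumes v: "v \<in> tpow TVec n"
  shows "add_on (tpow TOm n \<otimes>\<^sub>A E) (\<lambda>s. dE (evs n (v * s)) - form_map p10 (idt (evs n) (boxV n v * s)))"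
proof (rule add_on_minus_fun[OF add_on_comp[OF _ dE]])
  show "add_on (tpow TOm n \<otimes>\<^sub>A E) (\<lambda>s. evs n (v * s))"
    "add_on (tpow TOm n \<otimes>\<^sub>A E) (\<lambda>s. form_map p10 (idt (evs n) (boxV n v * s)))"
    by (simp_all add: add_on_def left_lin_diff[OF left_lin_evs] left_lin_diff[OF left_lin_idt[OF left_lin_evs]]
      left_lin_diff[OF form_map_p10(1)] right_diff_distrib)
qed (rule evs_mem_E[OF v])

definition Nab :: "nat \<Rightarrow> 'w tens \<Rightarrow> 'w tens" where
  "Nab n = add_ext (tpow (TOm10 J) n \<times> E) (\<lambda>(x, e). x * e) (\<lambda>(x, e). Nr n x e)"

lemma Nab_gens: "(\<lambda>(x, e). x * e) ` (Z \<times> E) = {x * y |x y :: 'w tens. x \<in> Z \<and> y \<in> E}"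
  by auto

lemma Nab:
  shows add_on_Nab: "add_on (tpow (TOm10 J) (Suc m) \<otimes>\<^sub>A E) (Nab (Suc m))"
    and Nab_eq: "x \<in> tpow (TOm10 J) (Suc m) \<Longrightarrow> e \<in> E \<Longrightarrow> Nab (Suc m) (x * e) = Nr (Suc m) x e"
proof -
  let ?n = "Suc m" and ?I = "tpow (TOm10 J) (Suc m) \<times> E"
  have ok: "add_ext_ok ?I (\<lambda>(x, e). x * e) (\<lambda>(x, e). Nr ?n x e)"
    unfolding add_ext_ok_def
  proof (intro allI impI)
    fix y assume y: "(0, y) \<in> group_closure ((\<lambda>i. (case i of (x, e) \<Rightarrow> x * e, case i of (x, e) \<Rightarrow> Nr ?n x e)) ` ?I)"
    have "(\<lambda>(x, e). Nr ?n x e) ` ?I \<subseteq> tpow (TOm10 J) (Suc ?n) \<otimes>\<^sub>A E" using Nr_mem by auto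
    then have "y \<in> tpow (TOm10 J) (Suc ?n) \<otimes>\<^sub>A E"
      using add_ext_snd[OF y] group_closure_subset[OF _ sgrp_tprod] by blast
    then have "y \<in> tpow (TOm10 J) ?n \<otimes>\<^sub>A TOm10 J \<otimes>\<^sub>A E" by (simp only: tpow_TOm10_Suc[symmetric] tprod_assoc)
    then have "y \<in> tpow TOm ?n \<otimes>\<^sub>A UNIV"
      using tprod_mono[OF tpow_TOm10 subset_UNIV] by blast
    then show "y = 0"
    proof (rule evs_nondegenerate)
      fix v :: "'w tens" assume v: "v \<in> tpow TVec ?n"
      have "(\<lambda>s. dE (evs ?n (v * s)) - form_map p10 (idt (evs ?n) (boxV ?n v * s))) 0 = evs ?n (v * y)"
      proof (rule add_ext_rel[OF y add_on_Nr_rhs[OF v], of "\<lambda>y. evs ?n (v * y)"])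
        show "(\<lambda>(x, e). x * e) ` ?I \<subseteq> tpow TOm ?n \<otimes>\<^sub>A E"
          using tpow_TOm10[of ?n] by (auto intro!: tprod_mem simp del: tpow.simps)
        show "add_on UNIV (\<lambda>y. evs ?n (v * y))"
          by (simp add: add_on_def left_lin_diff[OF left_lin_evs] right_diff_distrib del: evs.simps)
        fix i assume "i \<in> ?I"
        then obtain x e where i: "i = (x, e)" "x \<in> tpow TOm ?n" "e \<in> E" using tpow_TOm10[of ?n] by blast
        show "dE (evs ?n (v * (case i of (x, e) \<Rightarrow> x * e))) -
          form_map p10 (idt (evs ?n) (boxV ?n v * (case i of (x, e) \<Rightarrow> x * e))) =
          evs ?n (v * (case i of (x, e) \<Rightarrow> Nr ?n x e))"
          unfolding i(1) prod.case by (rule evs_Nr[OF v i(2,3), symmetric])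
      qed
      then show "evs ?n (v * y) = 0"
        by (simp add: left_lin_zero[OF left_lin_evs] left_lin_zero[OF left_lin_idt[OF left_lin_evs]]
            left_lin_zero[OF form_map_p10(1)] add_on_zero[OF dE] del: evs.simps box_Vec.simps)
    qed
  qed
  show "add_on (tpow (TOm10 J) ?n \<otimes>\<^sub>A E) (Nab ?n)"
    using add_on_add_ext[OF ok] unfolding Nab_gens tprod_def[symmetric] Nab_def .
  show "x \<in> tpow (TOm10 J) ?n \<Longrightarrow> e \<in> E \<Longrightarrow> Nab ?n (x * e) = Nr ?n x e"
    unfolding Nab_def using add_ext_gen[OF ok, of "(x, e)"] by simp
qed

lemma Nab_mem: "s \<in> tpow (TOm10 J) (Suc m) \<otimes>\<^sub>A E \<Longrightarrow> Nab (Suc m) s \<in> tpow (TOm10 J) (Suc (Suc m)) \<otimes>\<^sub>A E"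
  by (erule tprod_into[OF _ add_on_Nab sgrp_tprod]) (simp_all only: tprod_mem Nab_eq Nr_mem)

lemma evs_Nab:
  assumes v: "v \<in> tpow TVec (Suc m)" and s: "s \<in> tpow (TOm10 J) (Suc m) \<otimes>\<^sub>A E"
  shows "evs (Suc m) (v * Nab (Suc m) s) = dE (evs (Suc m) (v * s)) -
    form_map p10 (idt (evs (Suc m)) (boxV (Suc m) v * s))"
proof (rule tprod_eq[OF s, of "tpow (TOm10 J) (Suc m) \<otimes>\<^sub>A E" "\<lambda>s. evs (Suc m) (v * Nab (Suc m) s)"])
  show "add_on (tpow (TOm10 J) (Suc m) \<otimes>\<^sub>A E) (\<lambda>s. evs (Suc m) (v * Nab (Suc m) s))"
    by (rule add_on_comp[OF add_on_Nab, of UNIV "\<lambda>s. evs (Suc m) (v * s)"])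
      (simp_all add: add_on_def left_lin_diff[OF left_lin_evs] right_diff_distrib del: evs.simps)
  show "add_on (tpow (TOm10 J) (Suc m) \<otimes>\<^sub>A E) (\<lambda>s. dE (evs (Suc m) (v * s)) -
      form_map p10 (idt (evs (Suc m)) (boxV (Suc m) v * s)))"
    by (rule add_on_subset[OF add_on_Nr_rhs[OF v] tprod_mono[OF tpow_TOm10 subset_refl]]) simp
  fix x e assume x: "x \<in> tpow (TOm10 J) (Suc m)" and e: "e \<in> E"
  show "x * e \<in> tpow (TOm10 J) (Suc m) \<otimes>\<^sub>A E" by (rule tprod_mem[OF x e])
  show "evs (Suc m) (v * Nab (Suc m) (x * e)) = dE (evs (Suc m) (v * (x * e))) -
      form_map p10 (idt (evs (Suc m)) (boxV (Suc m) v * (x * e)))"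
    unfolding Nab_eq[OF x e] by (rule evs_Nr[OF v subsetD[OF tpow_TOm10 x] e])
qed

lemma DI_Suc: "DI (Suc (Suc m)) e = Nab (Suc m) (DI (Suc m) e)"
proof -
  have "tmap (tpow TOm (Suc m)) TOm {1} (fmap1 p10) (BO (Suc m) x) = idts (Suc m) (form_map p10) (BO (Suc m) x)"
    if "x \<in> tpow (TOm10 J) (Suc m)" for x
    by (rule tmap_fmap1[OF form_endo_p10])
      (simp only: tprod_one_right[OF sgrp_TOm] BO_propsD(2)[OF BO_props subsetD[OF tpow_TOm10 that]])
  then have "add_ext (tpow (TOm10 J) (Suc m) \<times> E) (\<lambda>(x, e'). x * e')
     (\<lambda>(x, e'). tmap (tpow TOm (Suc m)) TOm {1} (fmap1 p10) (BO (Suc m) x) * e' + x * dE e') = Nab (Suc m)"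
    unfolding Nab_def by (intro add_ext_cong) (auto simp only: split: prod.split)
  then show ?thesis by (simp only: del_iter.simps)
qed

lemma DI_mem: "e \<in> E \<Longrightarrow> DI n e \<in> tpow (TOm10 J) n \<otimes>\<^sub>A E"
proof (induction n rule: less_induct)
  case (less n)
  consider "n = 0" | "n = Suc 0" | m where "n = Suc (Suc m)" by (metis nat.exhaust)
  then show ?case
  proof cases
    case (3 m)
    then show ?thesis using less Nab_mem[of "DI (Suc m) e" m] by (simp only: DI_Suc)
  qed (use less in \<open>simp_all add: TA_tprod[OF E] dE_mem tprod_TA[OF right_mod_TOm10]\<close>)
qed

abbreviation "actE \<equiv> act J box sinv E dE"

lemma TVec10_image: "TVec10 J = vc ` Vec10 J"
  by (simp add: TVec10_def)

lemma tpow_TOm10_E: "s \<in> tpow (TOm10 J) n \<otimes>\<^sub>A E \<Longrightarrow> s \<in> tpow TOm n \<otimes>\<^sub>A E"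
  using tprod_mono[OF tpow_TOm10 subset_refl] by blast

lemma act:
  assumes e: "e \<in> E"
  shows add_on_act_E: "add_on TV10 (\<lambda>v. actE v e)"
    and act_eq: "v \<in> tpow (TVec10 J) n \<Longrightarrow> actE v e = evs n (v * DI n e)"
proof -
  have add: "add_on (tpow (TVec10 J) n) (\<lambda>v. tmap {1} (tpow TVec n \<otimes>\<^sub>A tpow TOm n) E (evn n) (v * DI n e))"
    and val: "v \<in> tpow (TVec10 J) n \<Longrightarrow> tmap {1} (tpow TVec n \<otimes>\<^sub>A tpow TOm n) E (evn n) (v * DI n e) = evs n (v * DI n e)"
    for n v
  proof -
    have *: "tmap {1} (tpow TVec n \<otimes>\<^sub>A tpow TOm n) E (evn n) (v * DI n e) = evs n (v * DI n e)"
      if "v \<in> tpow (TVec10 J) n" for v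
      by (rule tmap_evn_eq) (rule tprod_mem[OF subsetD[OF tpow_10 that] tpow_TOm10_E[OF DI_mem[OF e]]])
    then show "v \<in> tpow (TVec10 J) n \<Longrightarrow> tmap {1} (tpow TVec n \<otimes>\<^sub>A tpow TOm n) E (evn n) (v * DI n e) = evs n (v * DI n e)" .
    show "add_on (tpow (TVec10 J) n) (\<lambda>v. tmap {1} (tpow TVec n \<otimes>\<^sub>A tpow TOm n) E (evn n) (v * DI n e))"
      by (rule add_onI) (simp_all only: * sgrp_diff[OF sgrp_tpow] sgrp_tpow,
          simp only: left_diff_distrib left_lin_diff[OF left_lin_evs])
  qed
  note graded = add_ext_graded[OF vec_proj_q10, folded TVec10_image, OF add]
  show "add_on TV10 (\<lambda>v. actE v e)"
    unfolding act_def TVecs10_def using graded(1) .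
  show "actE v e = evs n (v * DI n e)" if "v \<in> tpow (TVec10 J) n"
    unfolding act_def graded(2)[OF that] by (rule val[OF that])
qed

lemma act_mem:
  assumes v: "v \<in> TV10" and e: "e \<in> E" shows "actE v e \<in> E"
proof (rule tpowers_into[OF v[unfolded TVecs10_def] add_on_act_E[OF e] left_modD(1)[OF E]])
  show "tpow (TVec10 J) n \<subseteq> TV10" for n using tpow_TV10 by blast
  show "actE x e \<in> E" if "x \<in> tpow (TVec10 J) n" for n x
    unfolding act_eq[OF e that] by (rule evs_mem_E[OF subsetD[OF tpow_10 that] tpow_TOm10_E[OF DI_mem[OF e]]])
qed

lemma act_sc: "a \<in> Om 0 \<Longrightarrow> e \<in> E \<Longrightarrow> actE (sc a) e = sc a * e"
  using act_eq[of e "sc a" 0] by (simp add: sc_TA)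

text \<open>The action property u \<triangleright> (v \<triangleright> e) = (u \<bullet> v)
  \<triangleright> e for u of degree one, solved for u \<otimes> v.\<close>

lemma act_vc_mult:
  assumes u: "u \<in> Vec10 J" and v: "v \<in> tpow (TVec10 J) n" and e: "e \<in> E"
  shows "actE (vc u * v) e = contr u (dE (actE v e)) - actE (contr u (boxV n v)) e"
proof -
  note uV = Vec10_VecA[OF u] and vV = subsetD[OF tpow_10 v]
  have uv: "vc u * v \<in> tpow (TVec10 J) (Suc n)" using u v by (simp add: tprod_mem vc_TVec10)
  have "actE (vc u * v) e = contr u (evs n (v * DI (Suc n) e))"
    unfolding act_eq[OF e uv] mult.assoc by (rule evs_vc[OF uV])
  also have "\<dots> = contr u (dE (evs n (v * DI n e))) - evs n (contr u (boxV n v) * DI n e)"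
  proof (cases n)
    case 0
    \<comment> \<open>Degree 0 is the Leibniz rule of \<open>dE\<close>: contracting p10(da) with u
      of type (1,0) gives u(da).\<close>
    then obtain a where a: "a \<in> Om 0" "v = sc a" using v by (auto simp: TA_def)
    then show ?thesis
      unfolding 0 using u e uV
      by (simp add: dE_left contr_add contr_fm p10_p01_Om dif_A Vec10_p10 tdif_sc contr_fm_1)
  next
    case (Suc m)
    have t: "boxV (Suc m) v \<in> TOm \<otimes>\<^sub>A tpow TVec (Suc m)" using vV Suc by (intro box_Vec_mem) simp
    have idt: "idt (evs (Suc m)) (boxV (Suc m) v * DI (Suc m) e) \<in> TOm \<otimes>\<^sub>A UNIV"
      by (rule tprod_into[OF t, of UNIV "\<lambda>t. idt (evs (Suc m)) (t * DI (Suc m) e)"])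
        (auto elim!: TOmE simp: add_on_def left_diff_distrib left_lin_diff[OF left_lin_idt[OF left_lin_evs]] mult.assoc
          idt_fm[OF left_lin_evs] simp del: evs.simps tpow.simps intro!: tprod_mem fm_TOm)
    \<comment> \<open>Duality leaves a \<open>p10\<close> on the derivative of v, which u of type
      (1,0) does not see.\<close>
    show ?thesis
      unfolding Suc DI_Suc evs_Nab[OF vV[unfolded Suc] DI_mem[OF e]] contr_diff[OF uV] contr_p10[OF u idt]
        contr_idt_evs[OF uV t] ..
  qed
  also have "\<dots> = contr u (dE (actE v e)) - actE (contr u (boxV n v)) e"
    by (simp only: act_eq[OF e v] act_eq[OF e contr_boxV_10[OF uV v]])
  finally show ?thesis .
qed

text \<open>Used for holomorphic elements, whose differential is 0.\<close>

lemma act_zero: "v \<in> TV10 \<Longrightarrow> actE v 0 = 0"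
proof -
  assume v: "v \<in> TV10"
  have z: "0 \<in> E" by (rule sgrp_zero[OF left_modD(1)[OF E]])
  have DI: "DI n 0 = 0" for n
  proof (induction n rule: less_induct)
    case (less n)
    consider "n = 0" | "n = Suc 0" | m where "n = Suc (Suc m)" by (metis nat.exhaust)
    then show ?case
    proof cases
      case (3 m)
      then show ?thesis using less[of "Suc m"] by (simp only: DI_Suc add_on_zero[OF add_on_Nab])
    qed (simp_all add: add_on_zero[OF dE])
  qed
  show ?thesis
  proof (rule tpowers_eq[OF v[unfolded TVecs10_def] add_on_act_E[OF z], of "\<lambda>v. 0"])
    show "add_on TV10 (\<lambda>v. 0)" by (simp add: add_on_def)
    show "tpow (TVec10 J) n \<subseteq> TV10" for n using tpow_TV10 by blast
    show "actE x 0 = 0" if "x \<in> tpow (TVec10 J) n" for n x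
      unfolding act_eq[OF z that] DI by (simp add: left_lin_zero[OF left_lin_evs])
  qed
qed

end


section \<open>The inverse of the wedge product\<close>

lemma TOm10_01: "t \<in> TOm10 J \<otimes>\<^sub>A TOm01 J \<Longrightarrow> t \<in> TOm \<otimes>\<^sub>A TOm"
proof -
  have "TOm01 J \<subseteq> TOm" by (auto elim!: TOm01E simp: fm_TOm Om_pq_Om_1)
  then show "t \<in> TOm10 J \<otimes>\<^sub>A TOm01 J \<Longrightarrow> t \<in> TOm \<otimes>\<^sub>A TOm"
    using tprod_mono[OF TOm10_TOm] by blast
qed

abbreviation "\<phi> \<equiv> phi J"

lemma phi_wedges: "t \<in> TOm10 J \<otimes>\<^sub>A TOm01 J \<Longrightarrow> \<phi> (wedges t) = t"
  using bij_betw_inv_into_left[OF wedge_bij] by (simp add: phi_def wedge_eq[OF TOm10_01, symmetric])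

lemma wedges_11: "t \<in> TOm10 J \<otimes>\<^sub>A TOm01 J \<Longrightarrow> wedges t \<in> Om_pq J 1 1"
  using bij_betwE[OF wedge_bij] by (simp add: wedge_eq[OF TOm10_01, symmetric])

lemma phi_cases:
  assumes "x \<in> Om_pq J 1 1"
  obtains t where "t \<in> TOm10 J \<otimes>\<^sub>A TOm01 J" "x = wedges t"
proof -
  obtain t where "t \<in> TOm10 J \<otimes>\<^sub>A TOm01 J" "x = wedge t"
    using assms bij_betw_imp_surj_on[OF wedge_bij] by blast
  then show thesis using that by (simp add: wedge_eq TOm10_01)
qed

lemma phi_mem: "x \<in> Om_pq J 1 1 \<Longrightarrow> \<phi> x \<in> TOm10 J \<otimes>\<^sub>A TOm01 J"
  by (erule phi_cases) (simp add: phi_wedges)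

lemma phi_TOm: "x \<in> Om_pq J 1 1 \<Longrightarrow> \<phi> x \<in> TOm \<otimes>\<^sub>A TOm"
  by (rule TOm10_01[OF phi_mem])

lemma phi_UNIV: "x \<in> Om_pq J 1 1 \<Longrightarrow> \<phi> x \<in> TOm \<otimes>\<^sub>A UNIV"
  by (rule TOm_TOm_UNIV[OF phi_TOm])

text \<open>As the inverse of the bijection in a), \<open>\<phi>\<close> inherits additivity from
  \<open>wedges\<close>; the two module laws below follow in the same way.\<close>

lemma add_on_phi: "add_on (Om_pq J 1 1) \<phi>"
proof (rule add_onI[OF sgrp_Om_pq_2(1)])
  fix x y assume "x \<in> Om_pq J 1 1" "y \<in> Om_pq J 1 1"
  then obtain s t where st: "s \<in> TOm10 J \<otimes>\<^sub>A TOm01 J" "x = wedges s" "t \<in> TOm10 J \<otimes>\<^sub>A TOm01 J" "y = wedges t"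
    by (metis phi_cases)
  then have "\<phi> (x - y) = \<phi> (wedges (s - t))" by (simp add: wedges_diff)
  also have "\<dots> = s - t" by (rule phi_wedges[OF sgrp_diff[OF sgrp_tprod st(1,3)]])
  finally show "\<phi> (x - y) = \<phi> x - \<phi> y" using st by (simp add: phi_wedges)
qed

lemma phi_left: assumes x: "x \<in> Om_pq J 1 1" and a: "a \<in> Om 0" shows "\<phi> (a * x) = sc a * \<phi> x"
proof -
  obtain t where t: "t \<in> TOm10 J \<otimes>\<^sub>A TOm01 J" "x = wedges t" using x by (rule phi_cases)
  have "\<phi> (a * x) = \<phi> (wedges (sc a * t))" using t a by (simp add: wedges_sc_mult)
  also have "\<dots> = sc a * t" by (rule phi_wedges[OF left_modD(2)[OF left_mod_tprod[OF left_mod_TOm10] a t(1)]])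
  finally show ?thesis using t by (simp add: phi_wedges)
qed

lemma phi_right: assumes x: "x \<in> Om_pq J 1 1" and a: "a \<in> Om 0" shows "\<phi> (x * a) = \<phi> x * sc a"
proof -
  obtain t where t: "t \<in> TOm10 J \<otimes>\<^sub>A TOm01 J" "x = wedges t" using x by (rule phi_cases)
  have "\<phi> (x * a) = \<phi> (wedges (t * sc a))" using t a by (simp add: wedges_mult wedges_sc)
  also have "\<dots> = t * sc a" by (rule phi_wedges[OF right_modD(2)[OF right_mod_tprod[OF right_mod_TOm01] a t(1)]])
  finally show ?thesis using t by (simp add: phi_wedges)
qed

lemma phi_10_01: "\<xi> \<in> Om_pq J 1 0 \<Longrightarrow> \<eta> \<in> Om_pq J 0 1 \<Longrightarrow> \<phi> (\<xi> * \<eta>) = fm \<xi> * fm \<eta>"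
  using phi_wedges[OF tprod_mem[OF fm_TOm10 fm_TOm01]] by (simp add: wedges_fm wedges_fm_1 Om_pq_Om_1)

lemma wedges_Om_2: "t \<in> TOm \<otimes>\<^sub>A TOm \<Longrightarrow> wedges t \<in> (Om 2 :: 'w set)"
  by (rule tprod_into[OF _ add_on_wedges sgrp_Om]) (auto elim!: TOmE simp: wedges_fm wedges_fm_1 Om_1_mult)

lemma idt_p01_mem: "t \<in> TOm10 J \<otimes>\<^sub>A TOm \<Longrightarrow> idt (form_map p01) t \<in> TOm10 J \<otimes>\<^sub>A TOm01 J"
  by (erule tprod_into[OF _ left_linD(1)[OF left_lin_idt[OF form_map_p01(1)]]])
    (auto elim!: TOmE TOm10E simp: idt_fm form_map_p01 Om_pq_Om_1 intro!: tprod_mem fm_TOm10 fm_TOm01 p01_mem)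

text \<open>In type (1,1) a first factor of type (1,0) leaves only the (0,1) part of the
  second.\<close>

lemma p11_wedges_10:
  assumes t: "t \<in> TOm10 J \<otimes>\<^sub>A TOm" shows "p11 (wedges t) = wedges (idt (form_map p01) t)"
proof (rule tprod_eq[OF t, of "TOm \<otimes>\<^sub>A TOm" "\<lambda>t. p11 (wedges t)"])
  show "add_on (TOm \<otimes>\<^sub>A TOm) (\<lambda>t. p11 (wedges t))"
    by (rule add_on_comp[OF add_on_subset[OF add_on_wedges] add_on_p11]) (simp_all add: wedges_Om_2)
  show "add_on (TOm \<otimes>\<^sub>A TOm) (\<lambda>t. wedges (idt (form_map p01) t))"
    by (simp add: add_on_def wedges_diff left_lin_diff[OF left_lin_idt[OF form_map_p01(1)]])
  fix x y :: "'w tens" assume "x \<in> TOm10 J" "y \<in> TOm"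
  then obtain \<xi> \<eta> where *: "\<xi> \<in> Om_pq J 1 0" "x = fm \<xi>" "\<eta> \<in> Om 1" "y = fm \<eta>" by (auto elim!: TOm10E TOmE)
  then show "x * y \<in> TOm \<otimes>\<^sub>A TOm" by (simp add: TOm2 Om_pq_Om_1)
  show "p11 (wedges (x * y)) = wedges (idt (form_map p01) (x * y))"
    using * by (simp add: Om_pq_Om_1 wedges_fm wedges_fm_1 p11_mult p10_on idt_fm form_map_p01 p10_p01_Om)
qed

lemma p11_wedges_01:
  assumes t: "t \<in> TOm01 J \<otimes>\<^sub>A TOm" shows "p11 (wedges t) = wedges (tens2 p01 p10 t)"
proof (rule tprod_eq[OF t, of "TOm \<otimes>\<^sub>A TOm" "\<lambda>t. p11 (wedges t)" "\<lambda>t. wedges (tens2 p01 p10 t)"])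
  show "add_on (TOm \<otimes>\<^sub>A TOm) (\<lambda>t. p11 (wedges t))"
    by (rule add_on_comp[OF add_on_subset[OF add_on_wedges] add_on_p11]) (simp_all add: wedges_Om_2)
  show "add_on (TOm \<otimes>\<^sub>A TOm) (\<lambda>t. wedges (tens2 p01 p10 t))"
    by (simp add: add_on_def wedges_diff left_lin_diff[OF left_lin_idt[OF form_map_p10(1)]] sgrp_diff[OF sgrp_tprod]
        left_lin_diff[OF form_map_p01(1)] tens2_eq[OF form_endo_p01 form_endo_p10])
  fix x y :: "'w tens" assume "x \<in> TOm01 J" "y \<in> TOm"
  then obtain \<xi> \<eta> where *: "\<xi> \<in> Om_pq J 0 1" "x = fm \<xi>" "\<eta> \<in> Om 1" "y = fm \<eta>" by (auto elim!: TOm01E TOmE)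
  then show "x * y \<in> TOm \<otimes>\<^sub>A TOm" by (simp add: TOm2 Om_pq_Om_1)
  then show "p11 (wedges (x * y)) = wedges (tens2 p01 p10 (x * y))"
    using * by (simp add: Om_pq_Om_1 wedges_fm wedges_fm_1 p11_mult p01_on idt_fm form_map_p01 form_map_p10 p10_p01_Om
        tens2_eq[OF form_endo_p01 form_endo_p10])
qed

lemma dif_Om_2: "\<xi> \<in> Om 1 \<Longrightarrow> dif \<xi> \<in> (Om 2 :: 'w set)"
  using dif_degree[of \<xi> 1] by (simp add: numeral_2_eq_2 One_nat_def)

lemma p11_dif: assumes \<xi>: "\<xi> \<in> Om 1" shows "p11 (dif \<xi>) = - p11 (wedges (box \<xi>))"
proof -
  have "p11 (dif \<xi> + wedges (box \<xi>)) = 0" using torsion \<xi> by (simp add: torsion_R_def wedge_eq box_mem)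
  then show ?thesis
    using \<xi> by (simp add: add_on_add[OF add_on_p11] dif_Om_2 wedges_Om_2 box_mem eq_neg_iff_add_eq_0)
qed

text \<open>c) replaces d by minus the wedge of \<open>box\<close> in type (1,1), and b) keeps the
  first factor in type (0,1). This identifies the first correction term in the recursion for
  \<open>HD\<close> with \<open>\<phi>\<close> of the (1,1) part of d\<xi>.\<close>

lemma p11_dif_01:
  "\<xi> \<in> Om_pq J 0 1 \<Longrightarrow> p11 (dif \<xi>) = - wedge (tens2 p01 p10 (box \<xi>))"
proof -
  assume \<xi>: "\<xi> \<in> Om_pq J 0 1"
  have "tens2 p01 p10 (box \<xi>) \<in> TOm \<otimes>\<^sub>A TOm"
    unfolding tens2_eq[OF form_endo_p01 form_endo_p10 box_mem[OF Om_pq_Om_1(2)[OF \<xi>]]]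
  proof (rule tprod_into[OF box_mem_01[OF \<xi>] left_linD(1)[OF left_lin_comp[OF form_map_p01(1) left_lin_idt[OF form_map_p10(1)]]]])
  qed (auto elim!: TOmE TOm01E simp: idt_fm form_map_p10 form_map_p01 Om_pq_Om_1 p10_p01_Om TOm2)
  then show ?thesis
    using p11_dif[OF Om_pq_Om_1(2)[OF \<xi>]] p11_wedges_01[OF box_mem_01[OF \<xi>]] by (simp add: wedge_eq)
qed

lemma phi_uminus: "x \<in> Om_pq J 1 1 \<Longrightarrow> \<phi> (- x) = - \<phi> x"
  by (rule add_on_uminus[OF add_on_phi])

text \<open>The counterpart for (1,0) forms, where the first factor already has the type that
  \<open>\<phi>\<close> expects, so \<open>\<phi>\<close> returns the projected tensor itself. It
  feeds the cancellation in \<open>evl_h1_dif\<close>.\<close>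

lemma phi_dif_10:
  assumes "\<eta> \<in> Om_pq J 1 0" shows "\<phi> (p11 (dif \<eta>)) = - idt (form_map p01) (box \<eta>)"
  using p11_dif[OF Om_pq_Om_1(1)[OF assms]] p11_wedges_10[OF box_mem_10[OF assms]]
    phi_wedges[OF idt_p01_mem[OF box_mem_10[OF assms]]] wedges_11[OF idt_p01_mem[OF box_mem_10[OF assms]]]
  by (simp add: phi_uminus)

lemma p01_10_mem: "\<xi> \<in> Om_pq J 0 1 \<Longrightarrow> \<eta> \<in> Om_pq J 1 0 \<Longrightarrow> \<xi> * \<eta> \<in> Om_pq J 1 1"
  by (rule Om_pq_mult(3))

text \<open>Condition d) on \<zeta> \<otimes> \<eta> with \<eta> of type (1,0): one of the two wedge
  terms drops out, and \<open>\<phi>\<close> recovers the tensor on the left because its first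
  factor has type (1,0).\<close>

lemma idt_sinv:
  assumes \<zeta>: "\<zeta> \<in> Om 1" and \<eta>: "\<eta> \<in> Om_pq J 1 0"
  shows "idt (form_map p01) (sinv (fm \<zeta> * fm \<eta>)) = - \<phi> (p01 \<zeta> * \<eta>)"
proof -
  note \<eta>1 = Om_pq_Om_1(1)[OF \<eta>]
  have t: "fm \<zeta> * fm \<eta> \<in> TOm \<otimes>\<^sub>A TOm" by (rule TOm2[OF \<zeta> \<eta>1])
  have "tens2 p01 p10 (fm \<zeta> * fm \<eta>) = fm (p01 \<zeta>) * fm \<eta>" "tens2 p10 p01 (fm \<zeta> * fm \<eta>) = 0"
    using \<zeta> \<eta> \<eta>1
    by (simp_all add: tens2_eq[OF form_endo_p01 form_endo_p10] tens2_eq[OF form_endo_p10 form_endo_p01] TOm2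
        idt_fm form_map_p10 form_map_p01 p10_on fm_zero left_lin_zero[OF form_map_p10(1)])
  then have "p11 (wedges (sinv (fm \<zeta> * fm \<eta>))) = - (p01 \<zeta> * \<eta>)"
    using sinv_wedge t \<zeta> \<eta>1 wedge_eq[of "0 :: 'w tens"]
    by (simp add: wedge_eq sinv_mem TOm2 p10_p01_Om wedges_fm wedges_fm_1 wedges_zero sgrp_zero)
  then have "\<phi> (wedges (idt (form_map p01) (sinv (fm \<zeta> * fm \<eta>)))) = - \<phi> (p01 \<zeta> * \<eta>)"
    using p11_wedges_10[OF sinv_mem_10[OF \<zeta> \<eta>]] by (simp add: phi_uminus p01_10_mem p01_mem \<zeta> \<eta>)
  then show ?thesis by (simp only: phi_wedges[OF idt_p01_mem[OF sinv_mem_10[OF \<zeta> \<eta>]]])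
qed

lemma p11_da_mult: "a \<in> Om 0 \<Longrightarrow> \<xi> \<in> Om_pq J 0 1 \<Longrightarrow> p11 (dif a * \<xi>) = p10 (dif a) * \<xi>"
  "a \<in> Om 0 \<Longrightarrow> \<xi> \<in> Om_pq J 0 1 \<Longrightarrow> p11 (\<xi> * dif a) = \<xi> * p10 (dif a)"
  by (simp_all add: p11_mult dif_A Om_pq_Om_1 p01_on)

section \<open>The derivative on \<open>\<Omega>\<^sup>0\<^sup>,\<^sup>1A \<otimes>\<^sub>A TVec\<^sup>*\<^sup>,\<^sup>0A\<close>\<close>

abbreviation "EE \<equiv> E01 J"
abbreviation "dl \<equiv> del_E01 J box sinv xis etas"
abbreviation "Eb \<equiv> E01_bullet J box sinv xis"

lemma left_mod_EE: "left_mod EE"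
  by (simp add: E01_def left_mod_tprod left_mod_TOm01)

lemma sgrp_EE [simp]: "sgrp EE"
  by (simp add: E01_def)

lemma EE_mem: "\<xi> \<in> Om_pq J 0 1 \<Longrightarrow> w \<in> TV10 \<Longrightarrow> fm \<xi> * w \<in> EE"
  unfolding E01_def by (rule tprod_mem[OF fm_TOm01])

lemma TOm01_EE: "z \<in> TOm01 J \<Longrightarrow> w \<in> TV10 \<Longrightarrow> z * w \<in> EE"
  unfolding E01_def by (rule tprod_mem)

lemma EE_eq:
  assumes "y \<in> EE" "add_on EE f" "add_on EE g" "\<And>\<xi> w. \<xi> \<in> Om_pq J 0 1 \<Longrightarrow> w \<in> TV10 \<Longrightarrow> f (fm \<xi> * w) = g (fm \<xi> * w)"
  shows "f y = g y"
  by (rule tprod_eq[OF assms(1)[unfolded E01_def] assms(2,3)]) (auto elim!: TOm01E intro: EE_mem assms(4))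

lemma EE_into:
  assumes "y \<in> EE" "add_on EE f" "sgrp T" "\<And>\<xi> w. \<xi> \<in> Om_pq J 0 1 \<Longrightarrow> w \<in> TV10 \<Longrightarrow> f (fm \<xi> * w) \<in> T"
  shows "f y \<in> T"
  by (rule tprod_into[OF assms(1)[unfolded E01_def] assms(2,3)]) (auto elim!: TOm01E intro: EE_mem assms(4))

lemma retract_TV10: "retract TV10"
  using retract_tpowers[OF vec_proj_q10] by (simp add: TVecs10_def TVec10_def)

lemma add_on_TV10: "add_on TV f \<Longrightarrow> add_on TV10 f"
  by (erule add_on_subset) (auto intro: TV10_TV)

lemma sc_left_TV10: "a \<in> Om 0 \<Longrightarrow> w \<in> TV10 \<Longrightarrow> sc a * w \<in> TV10"
  by (rule left_modD(2)[OF left_mod_TV10])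

lemma Eb_graded:
  assumes w: "w \<in> TV10"
  shows add_on_Eb: "add_on EE (\<lambda>y. Eb y w)"
    and Eb_fm: "\<xi> \<in> Om_pq J 0 1 \<Longrightarrow> x \<in> TV10 \<Longrightarrow> Eb (fm \<xi> * x) w = fm \<xi> * (x \<odot> w)"
proof -
  note wV = TV10_TV[OF w]
  let ?f = "\<lambda>\<xi> x. fm \<xi> * (x \<odot> w)"
  have ok: "add_ext_ok (Om_pq J 0 1 \<times> TV10) (\<lambda>(\<xi>, x). fm \<xi> * x) (\<lambda>(\<xi>, x). ?f \<xi> x)"
  proof (rule add_ext_form[OF form_proj_p01 retract_TV10])
    show "add_on TV10 (?f \<xi>)" for \<xi> by (rule add_on_const_mult[OF add_on_TV10[OF add_on_bullet_left[OF wV]]])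
  qed (simp_all add: fm_add fm_right Om_pq_Om_1 distrib_right bullet_left wV TV10_TV mult.assoc)
  let ?G = "add_ext (Om_pq J 0 1 \<times> TV10) (\<lambda>(\<xi>, x). fm \<xi> * x) (\<lambda>(\<xi>, x). ?f \<xi> x)"
  have G: "add_on EE ?G"
    using add_on_add_ext[OF ok] unfolding add_ext_form_gens by (simp add: E01_def TOm01_def)
  have Gv: "?G (fm \<xi> * x) = ?f \<xi> x" if "\<xi> \<in> Om_pq J 0 1" "x \<in> TV10" for \<xi> x
    using add_ext_gen[OF ok, of "(\<xi>, x)"] that by simp
  have eq: "Eb y w = ?G y" if "y \<in> EE" for y
    unfolding E01_bullet_def
    by (rule tmap_eq[OF _ G]) (use that in \<open>auto elim!: TOm01E simp: Gv tprod_one_right EE_mem, simp add: E01_def\<close>)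
  show "add_on EE (\<lambda>y. Eb y w)"
    by (rule add_onI) (simp_all add: eq sgrp_diff[OF sgrp_EE] add_on_diff[OF G])
  show "\<xi> \<in> Om_pq J 0 1 \<Longrightarrow> x \<in> TV10 \<Longrightarrow> Eb (fm \<xi> * x) w = fm \<xi> * (x \<odot> w)"
    by (simp add: eq EE_mem Gv)
qed

lemma Eb_TOm01: "z \<in> TOm01 J \<Longrightarrow> x \<in> TV10 \<Longrightarrow> w \<in> TV10 \<Longrightarrow> Eb (z * x) w = z * (x \<odot> w)"
  by (auto elim!: TOm01E simp: Eb_fm)

lemma Eb_mem: "y \<in> EE \<Longrightarrow> w \<in> TV10 \<Longrightarrow> Eb y w \<in> EE"
  by (erule EE_into[OF _ add_on_Eb]) (simp_all add: Eb_fm EE_mem bullet_mem_10)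

lemma Eb_assoc:
  assumes y: "y \<in> EE" and v: "v \<in> TV10" and w: "w \<in> TV10" shows "Eb (Eb y v) w = Eb y (v \<odot> w)"
proof (rule EE_eq[OF y, of "\<lambda>y. Eb (Eb y v) w" "\<lambda>y. Eb y (v \<odot> w)"])
  show "add_on EE (\<lambda>y. Eb (Eb y v) w)" by (rule add_on_comp[OF add_on_Eb[OF v] add_on_Eb[OF w]]) (simp add: Eb_mem v)
  show "add_on EE (\<lambda>y. Eb y (v \<odot> w))" by (rule add_on_Eb[OF bullet_mem_10[OF v w]])
qed (simp add: Eb_fm v w bullet_mem_10 bullet_assoc TV10_TV)

lemma add_on_Eb_right: assumes y: "y \<in> EE" shows "add_on TV10 (\<lambda>w. Eb y w)"
proof (rule add_onI[OF sgrp_TV10])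
  fix v w assume v: "v \<in> TV10" and w: "w \<in> TV10"
  then have d: "v - w \<in> TV10" by (simp add: sgrp_diff[OF sgrp_TV10])
  show "Eb y (v - w) = Eb y v - Eb y w"
    by (rule EE_eq[OF y add_on_Eb[OF d] add_on_minus_fun[OF add_on_Eb[OF v] add_on_Eb[OF w]]])
      (simp add: Eb_fm d v w add_on_diff[OF add_on_bullet_right] TV10_TV right_diff_distrib)
qed

lemma Eb_left: assumes a: "a \<in> Om 0" and y: "y \<in> EE" and w: "w \<in> TV10" shows "Eb (sc a * y) w = sc a * Eb y w"
proof (rule EE_eq[OF y, of "\<lambda>y. Eb (sc a * y) w" "\<lambda>y. sc a * Eb y w"])
  show "add_on EE (\<lambda>y. Eb (sc a * y) w)"
    by (rule add_on_comp[OF _ add_on_Eb[OF w]]) (simp_all add: add_on_def right_diff_distrib left_modD(2)[OF left_mod_EE] a)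
  show "add_on EE (\<lambda>y. sc a * Eb y w)" by (rule add_on_const_mult[OF add_on_Eb[OF w]])
  fix \<xi> :: 'w and x :: "'w tens" assume "\<xi> \<in> Om_pq J 0 1" "x \<in> TV10"
  then show "Eb (sc a * (fm \<xi> * x)) w = sc a * Eb (fm \<xi> * x) w"
    using Eb_fm[OF w, of "a * \<xi>" x] a by (simp add: Eb_fm w Om_pq_1_mult fm_left Om_pq_Om_1 mult.assoc)
qed

lemma right_lin_phi: "\<xi> \<in> Om_pq J 0 1 \<Longrightarrow> right_lin (\<lambda>\<zeta>. \<phi> (\<xi> * p10 \<zeta>))"
  unfolding right_lin_def
proof (intro conjI ballI)
  assume \<xi>: "\<xi> \<in> Om_pq J 0 1"
  have m: "\<xi> * p10 \<zeta> \<in> Om_pq J 1 1" if "\<zeta> \<in> Om 1" for \<zeta> using that \<xi> by (simp add: p01_10_mem p10_mem)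
  show "add_on (Om 1) (\<lambda>\<zeta>. \<phi> (\<xi> * p10 \<zeta>))"
    by (rule add_on_comp[OF add_on_const_mult[OF add_on_p10] add_on_phi]) (rule m)
  show "\<phi> (\<xi> * p10 (\<zeta> * a)) = \<phi> (\<xi> * p10 \<zeta>) * sc a" if "\<zeta> \<in> Om 1" "a \<in> Om 0" for \<zeta> a
    using that phi_right[OF m[OF that(1)] that(2)] by (simp add: p10_lin mult.assoc)
qed

text \<open>The sum of \<phi>(\<xi> \<and> \<eta>_i) \<otimes> \<eta>^i from the derivative on
  \<open>E\<close>. It is written in the basis \<open>xis\<close> so that centrality of the
  coevaluation gives \<open>P_right\<close>.\<close>

definition P where "P \<xi> = (\<Sum>i\<in>IX. \<phi> (\<xi> * p10 (X i)) * vc (U i))"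

lemma P_eq: "\<xi> \<in> Om_pq J 0 1 \<Longrightarrow> P \<xi> = (\<Sum>k\<in>IE. \<phi> (\<xi> * Et k) * vc (H k))"
proof -
  assume \<xi>: "\<xi> \<in> Om_pq J 0 1"
  have "P \<xi> = (\<Sum>i\<in>IX. \<phi> (\<xi> * p10 (p10 (X i))) * vc (U i))"
    unfolding P_def by (rule sum.cong) (simp_all add: p10_on p10_mem basis_mem)
  also have "\<dots> = (\<Sum>k\<in>IE. \<phi> (\<xi> * p10 (Et k)) * vc (H k))"
    by (rule basis_10[OF right_lin_phi[OF \<xi>]])
  also have "\<dots> = (\<Sum>k\<in>IE. \<phi> (\<xi> * Et k) * vc (H k))"
    by (rule sum.cong) (simp_all add: p10_on basis_mem)
  finally show ?thesis .
qed

lemma P_right: "\<xi> \<in> Om_pq J 0 1 \<Longrightarrow> a \<in> Om 0 \<Longrightarrow> P (\<xi> * a) = P \<xi> * sc a"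
proof -
  assume \<xi>: "\<xi> \<in> Om_pq J 0 1" and a: "a \<in> Om 0"
  have "P (\<xi> * a) = (\<Sum>i\<in>IX. \<phi> (\<xi> * p10 (a * X i)) * vc (U i))"
    unfolding P_def by (rule sum.cong) (simp_all add: p10_lin basis_mem a mult.assoc)
  then show ?thesis unfolding P_def by (simp only: basis_left[OF right_lin_phi[OF \<xi>] a])
qed

text \<open>\<open>Phi w\<close> sends \<open>z \<otimes> h\<close> to \<open>z \<otimes> (h \<bullet> w)\<close> for \<open>z \<in> \<Omega>\<^sup>1A \<otimes>\<^sub>A \<Omega>\<^sup>1A\<close> and \<open>h \<in> VecA\<close>.\<close>

definition Phi where "Phi w T = T * w + idt (idt evl) (T * B w)"

lemma idt_idt: "left_lin F \<Longrightarrow> t \<in> TOm \<otimes>\<^sub>A TOm \<Longrightarrow> idt (idt F) (t * z) = t * F z"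
proof -
  assume F: "left_lin F" and t: "t \<in> TOm \<otimes>\<^sub>A TOm"
  show ?thesis
    by (rule tprod_eq[OF t, of UNIV "\<lambda>t. idt (idt F) (t * z)" "\<lambda>t. t * F z"])
      (auto simp: add_on_def left_diff_distrib left_lin_diff[OF left_lin_idt[OF left_lin_idt[OF F]]] mult.assoc
        idt_TOm[OF left_lin_idt[OF F]] idt_TOm[OF F])
qed

lemma Phi_P:
  assumes \<xi>: "\<xi> \<in> Om_pq J 0 1" and w: "w \<in> TV10"
  shows "Phi w (P \<xi>) = (\<Sum>k\<in>IE. \<phi> (\<xi> * Et k) * (vc (H k) \<odot> w))"
proof -
  have "\<phi> (\<xi> * Et k) * (vc (H k) \<odot> w) = \<phi> (\<xi> * Et k) * vc (H k) * w + idt (idt evl) (\<phi> (\<xi> * Et k) * vc (H k) * B w)"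
    if "k \<in> IE" for k
    using that \<xi> w
    by (simp add: mult.assoc idt_idt[OF left_lin_evl phi_TOm] p01_10_mem basis_mem bullet_vc H_VecA TV10_TV evl_vc
        vec_bullet_eq distrib_left)
  then show ?thesis
    unfolding P_eq[OF \<xi>] Phi_def sum_distrib_right left_lin_sum[OF left_lin_idt[OF left_lin_idt[OF left_lin_evl]]]
      sum.distrib[symmetric] by (intro sum.cong) simp_all
qed

lemma evl_P:
  assumes \<xi>: "\<xi> \<in> Om_pq J 0 1" and \<zeta>: "\<zeta> \<in> Om 1"
  shows "idt (idt evl) (P \<xi> * fm \<zeta> * z) = \<phi> (\<xi> * p10 \<zeta>) * z"
proof -
  have "idt (idt evl) (P \<xi> * fm \<zeta> * z) = (\<Sum>i\<in>IX. \<phi> (\<xi> * p10 (X i)) * sc (U i \<zeta>) * z)"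
    unfolding P_def sum_distrib_right left_lin_sum[OF left_lin_idt[OF left_lin_idt[OF left_lin_evl]]]
    by (rule sum.cong) (simp_all add: mult.assoc idt_idt[OF left_lin_evl phi_TOm] p01_10_mem p10_mem \<xi> \<zeta> basis_mem
        evl_vc contr_fm)
  then show ?thesis using right_lin_dual[OF right_lin_phi[OF \<xi>] \<zeta>] by (simp add: sum_distrib_right[symmetric])
qed

abbreviation "dlr \<equiv> (\<lambda>\<xi> w. \<phi> (p11 (dif \<xi>)) * w - (\<Sum>k\<in>IE. \<phi> (\<xi> * Et k) * (vc (H k) \<odot> w)))"

lemma dif_mult_1: "\<xi> \<in> Om 1 \<Longrightarrow> dif (\<xi> * x) = dif \<xi> * x - \<xi> * dif (x :: 'w)"
  using dif_mult[of \<xi> 1 x] by simp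

text \<open>The two summands are not balanced separately. d(\<xi>a) contributes -\<phi>(\<xi> \<and>
  p10(da)) \<otimes> w to the first, and the Leibniz rule for the derivative of aw contributes the
  same term to the second after a is moved to w.\<close>

lemma dl_ok: "add_ext_ok (Om_pq J 0 1 \<times> TV10) (\<lambda>(\<xi>, w). fm \<xi> * w) (\<lambda>(\<xi>, w). dlr \<xi> w)"
proof (rule add_ext_form[OF form_proj_p01 retract_TV10])
  fix \<xi> \<eta> a :: 'w and w :: "'w tens" assume \<xi>: "\<xi> \<in> Om_pq J 0 1"
  note \<xi>1 = Om_pq_Om_1(2)[OF \<xi>]
  have m: "\<xi> * Et k \<in> Om_pq J 1 1" if "\<xi> \<in> Om_pq J 0 1" "k \<in> IE" for \<xi> k using that by (simp add: p01_10_mem basis_mem)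
  have d: "p11 (dif \<xi>) \<in> Om_pq J 1 1" if "\<xi> \<in> Om 1" for \<xi> using that by (simp add: p11_mem dif_Om_2)
  show "add_on TV10 (dlr \<xi>)"
    by (rule add_onI) (simp_all add: right_diff_distrib add_on_diff[OF add_on_bullet_right] vc_left_TV10 TV10_TV
        tpow_TV[OF vc_tpow_1] H_VecA sum_subtractf algebra_simps cong: sum.cong_simp)
  show "dlr (\<xi> + \<eta>) w = dlr \<xi> w + dlr \<eta> w" if "\<eta> \<in> Om_pq J 0 1" "w \<in> TV10"
    using \<xi> \<xi>1 that Om_pq_Om_1(2)[OF that(1)]
    by (simp add: dif_add add_on_add[OF add_on_p11] dif_Om_2 add_on_add[OF add_on_phi] d m distrib_right sum.distrib
        cong: sum.cong_simp)
  show "dlr (\<xi> * a) w = dlr \<xi> (sc a * w)" if a: "a \<in> Om 0" and w: "w \<in> TV10"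
  proof -
    have "p11 (dif (\<xi> * a)) = p11 (dif \<xi>) * a - \<xi> * p10 (dif a)"
      using \<xi> \<xi>1 a by (simp add: dif_mult_1 add_on_diff[OF add_on_p11] dif_Om_2 Om_mult_0 Om_1_mult dif_A p11_right
          p11_da_mult)
    then have 1: "\<phi> (p11 (dif (\<xi> * a))) = \<phi> (p11 (dif \<xi>)) * sc a - \<phi> (\<xi> * p10 (dif a))"
      using \<xi> \<xi>1 a by (simp add: add_on_diff[OF add_on_phi] d Om_11_mult p01_10_mem p10_mem dif_A phi_right)
    have "Phi (sc a * w) (P \<xi>) = Phi w (P \<xi> * sc a) + \<phi> (\<xi> * p10 (dif a)) * w"
      using evl_P[OF \<xi> dif_A[OF a], of w]
      by (simp add: Phi_def box_TVec_left a TV10_TV w distrib_left mult.assoc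
          left_lin_add[OF left_lin_idt[OF left_lin_idt[OF left_lin_evl]]])
    moreover have "\<xi> * a \<in> Om_pq J 0 1" using \<xi> a by (simp add: Om_pq_1_mult)
    ultimately show ?thesis
      using Phi_P[OF \<xi> sc_left_TV10[OF a w]] Phi_P[of "\<xi> * a" w] w
      by (simp add: P_right[OF \<xi> a] 1 left_diff_distrib mult.assoc)
  qed
qed

lemma dl_eq: "dl = add_ext (Om_pq J 0 1 \<times> TV10) (\<lambda>(\<xi>, w). fm \<xi> * w) (\<lambda>(\<xi>, w). dlr \<xi> w)"
  unfolding del_E01_def by (simp only: sum_list_pairs Et_def H_def IE_def)

lemma add_on_dl: "add_on EE dl" and dl_fm: "\<xi> \<in> Om_pq J 0 1 \<Longrightarrow> w \<in> TV10 \<Longrightarrow> dl (fm \<xi> * w) = dlr \<xi> w"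
  using add_on_add_ext[OF dl_ok] add_ext_gen[OF dl_ok, of "(\<xi>, w)"] unfolding add_ext_form_gens
  by (simp_all add: dl_eq E01_def TOm01_def)

lemma vc_H_bullet_mem: "k \<in> IE \<Longrightarrow> w \<in> TV10 \<Longrightarrow> vc (H k) \<odot> w \<in> TV10"
  by (simp add: bullet_vc H_VecA TV10_TV vec_bullet_mem_10 basis_mem)

lemma p11_dif_mem: "\<xi> \<in> Om_pq J 0 1 \<Longrightarrow> p11 (dif \<xi>) \<in> Om_pq J 1 1"
  by (simp add: p11_mem dif_Om_2 Om_pq_Om_1)

lemma phi_Et_mem: "\<xi> \<in> Om_pq J 0 1 \<Longrightarrow> k \<in> IE \<Longrightarrow> \<xi> * Et k \<in> Om_pq J 1 1"
  by (simp add: p01_10_mem basis_mem)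

lemma dl_mem: "y \<in> EE \<Longrightarrow> dl y \<in> TOm10 J \<otimes>\<^sub>A EE"
proof (erule EE_into[OF _ add_on_dl sgrp_tprod])
  fix \<xi> :: 'w and w :: "'w tens" assume \<xi>: "\<xi> \<in> Om_pq J 0 1" and w: "w \<in> TV10"
  have "dlr \<xi> w \<in> (TOm10 J \<otimes>\<^sub>A TOm01 J) \<otimes>\<^sub>A TV10"
    by (intro sgrp_diff[OF sgrp_tprod] sgrp_sum[OF sgrp_tprod] tprod_mem phi_mem p11_dif_mem phi_Et_mem \<xi> w vc_H_bullet_mem)
  then show "dl (fm \<xi> * w) \<in> TOm10 J \<otimes>\<^sub>A EE" by (simp only: dl_fm[OF \<xi> w] tprod_assoc E01_def)
qed

text \<open>The (1,1) part of da \<and> \<xi> is p10(da) \<and> \<xi>, which \<open>\<phi>\<close>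
  turns back into the tensor p10(da) \<otimes> \<xi>.\<close>

lemma dl_left:
  assumes a: "a \<in> Om 0" and y: "y \<in> EE" shows "dl (sc a * y) = fm (p10 (dif a)) * y + sc a * dl y"
proof (rule EE_eq[OF y, of "\<lambda>y. dl (sc a * y)" "\<lambda>y. fm (p10 (dif a)) * y + sc a * dl y"])
  show "add_on EE (\<lambda>y. dl (sc a * y))"
    by (rule add_on_comp[OF _ add_on_dl]) (simp_all add: add_on_def right_diff_distrib left_modD(2)[OF left_mod_EE] a)
  show "add_on EE (\<lambda>y. fm (p10 (dif a)) * y + sc a * dl y)"
    by (rule add_on_plus_fun[OF _ add_on_const_mult[OF add_on_dl]]) (simp add: add_on_def right_diff_distrib)
  fix \<xi> :: 'w and w :: "'w tens" assume \<xi>: "\<xi> \<in> Om_pq J 0 1" and w: "w \<in> TV10"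
  note \<xi>1 = Om_pq_Om_1(2)[OF \<xi>]
  have a\<xi>: "a * \<xi> \<in> Om_pq J 0 1" using \<xi> a by (simp add: Om_pq_1_mult)
  have "p11 (dif (a * \<xi>)) = p10 (dif a) * \<xi> + a * p11 (dif \<xi>)"
    using \<xi> \<xi>1 a by (simp add: dif_A_mult add_on_add[OF add_on_p11] dif_Om_2 Om_0_mult Om_1_mult dif_A p11_left p11_da_mult)
  then have 1: "\<phi> (p11 (dif (a * \<xi>))) = fm (p10 (dif a)) * fm \<xi> + sc a * \<phi> (p11 (dif \<xi>))"
    using \<xi> a by (simp add: add_on_add[OF add_on_phi] Om_11_mult p11_dif_mem Om_pq_mult p10_mem dif_A phi_left phi_10_01)
  have "dl (sc a * (fm \<xi> * w)) = dlr (a * \<xi>) w"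
    using dl_fm[OF a\<xi> w] a \<xi>1 by (simp add: fm_left mult.assoc)
  also have "\<dots> = fm (p10 (dif a)) * (fm \<xi> * w) + sc a * dlr \<xi> w"
    using \<xi> a by (simp add: 1 mult.assoc phi_left phi_Et_mem distrib_right right_diff_distrib sum_distrib_left
        cong: sum.cong_simp)
  finally show "dl (sc a * (fm \<xi> * w)) = fm (p10 (dif a)) * (fm \<xi> * w) + sc a * dl (fm \<xi> * w)"
    by (simp only: dl_fm[OF \<xi> w])
qed

lemma contr_phi: "u \<in> VecA \<Longrightarrow> x \<in> Om_pq J 1 1 \<Longrightarrow> contr u (\<phi> x) \<in> TOm01 J"
proof -
  assume u: "u \<in> VecA" and x: "x \<in> Om_pq J 1 1"
  have "\<phi> x \<in> TOm \<otimes>\<^sub>A TOm01 J" using phi_mem[OF x] tprod_mono[OF TOm10_TOm subset_refl] by blast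
  then show ?thesis by (rule contr_mem[OF u _ left_mod_TOm01])
qed

lemma contr_dl:
  assumes "u \<in> VecA" "\<xi> \<in> Om_pq J 0 1" "w \<in> TV10"
  shows "contr u (dl (fm \<xi> * w)) = contr u (\<phi> (p11 (dif \<xi>))) * w -
    (\<Sum>k\<in>IE. contr u (\<phi> (\<xi> * Et k)) * (vc (H k) \<odot> w))"
  using assms by (simp add: dl_fm contr_diff contr_sum contr_right phi_UNIV p11_dif_mem phi_Et_mem cong: sum.cong_simp)

lemma contr_dl_mem: "u \<in> VecA \<Longrightarrow> y \<in> EE \<Longrightarrow> contr u (dl y) \<in> EE"
  using contr_mem[OF _ _ left_mod_EE] dl_mem tprod_mono[OF TOm10_TOm subset_refl] by blast

text \<open>The derivative on \<open>E\<close> differentiates the tensor factor only through left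
  products \<eta>^i \<bullet> x, so by associativity a right factor w passes through.\<close>

lemma contr_dl_Eb:
  assumes u: "u \<in> VecA" and y: "y \<in> EE" and w: "w \<in> TV10"
  shows "contr u (dl (Eb y w)) = Eb (contr u (dl y)) w"
proof (rule EE_eq[OF y, of "\<lambda>y. contr u (dl (Eb y w))" "\<lambda>y. Eb (contr u (dl y)) w"])
  show "add_on EE (\<lambda>y. contr u (dl (Eb y w)))"
    by (rule add_on_comp[OF add_on_comp[OF add_on_Eb[OF w] add_on_dl] add_on_contr[OF u]]) (simp_all add: Eb_mem w)
  show "add_on EE (\<lambda>y. Eb (contr u (dl y)) w)"
    by (rule add_on_comp[OF add_on_comp[OF add_on_dl add_on_contr[OF u]] add_on_Eb[OF w]]) (simp_all add: contr_dl_mem u)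
  fix \<xi> :: 'w and x :: "'w tens" assume \<xi>: "\<xi> \<in> Om_pq J 0 1" and x: "x \<in> TV10"
  have m: "contr u (\<phi> (p11 (dif \<xi>))) * x \<in> EE" "\<And>k. k \<in> IE \<Longrightarrow> contr u (\<phi> (\<xi> * Et k)) * (vc (H k) \<odot> x) \<in> EE"
    by (intro TOm01_EE contr_phi u p11_dif_mem phi_Et_mem \<xi> x vc_H_bullet_mem; assumption?)+
  show "contr u (dl (Eb (fm \<xi> * x) w)) = Eb (contr u (dl (fm \<xi> * x))) w"
    using u \<xi> x w m
    by (simp add: Eb_fm contr_dl bullet_mem_10 add_on_diff[OF add_on_Eb] add_on_sum[OF add_on_Eb] sgrp_sum
        Eb_TOm01 contr_phi p11_dif_mem phi_Et_mem vc_H_bullet_mem bullet_assoc TV10_TV tpow_TV[OF vc_tpow_1] H_VecA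
        cong: sum.cong_simp)
qed

lemma HD_correction_eq:
  assumes u: "u \<in> VecA" and y: "y \<in> EE" shows "HD_correction J box sinv xis etas u y = contr u (dl y)"
  unfolding HD_correction_def
proof (rule add_ext_unique[OF add_on_comp[OF add_on_dl add_on_contr[OF u]]])
  show "y \<in> group_closure ((\<lambda>(\<xi>, w). fm \<xi> * w) ` (Om_pq J 0 1 \<times> TV10))"
    using y unfolding add_ext_form_gens by (simp add: E01_def TOm01_def)
  fix i assume "i \<in> Om_pq J 0 1 \<times> TV10"
  then obtain \<xi> w where i: "i = (\<xi>, w)" "\<xi> \<in> Om_pq J 0 1" "w \<in> TV10" by auto
  \<comment> \<open>The sign flips here: minus this wedge is the (1,1) part of d\<xi>, the first
    term of the derivative on \<open>E\<close>.\<close>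
  have w: "wedge (tens2 p01 p10 (box \<xi>)) = - p11 (dif \<xi>)" using p11_dif_01[OF i(2)] by simp
  have m: "- p11 (dif \<xi>) \<in> Om_pq J 1 1" by (rule sgrp_uminus[OF sgrp_Om_pq_2(1) p11_dif_mem[OF i(2)]])
  have e: "ev_id (vc u * \<phi> (- p11 (dif \<xi>))) = - contr u (\<phi> (p11 (dif \<xi>)))"
    using ev_id_vc[OF u phi_UNIV[OF m]] by (simp add: phi_uminus[OF p11_dif_mem[OF i(2)]] contr_uminus[OF u])
  have "contr u (dl (fm \<xi> * w)) =
      - ev_id (vc u * \<phi> (wedge (tens2 p01 p10 (box \<xi>)))) * w - (\<Sum>(\<eta>, h)\<leftarrow>etas. ev_id (vc u * \<phi> (\<xi> * \<eta>)) * (vc h \<odot> w))"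
    unfolding w contr_dl[OF u i(2,3)] sum_list_pairs Et_def[symmetric] H_def[symmetric] IE_def[symmetric]
    using u i(2)
    by (simp add: e ev_id_vc phi_UNIV phi_Et_mem cong: sum.cong_simp)
  then show "contr u (dl (case i of (\<xi>, w) \<Rightarrow> fm \<xi> * w)) = (case i of (\<xi>, w) \<Rightarrow>
      - ev_id (vc u * \<phi> (wedge (tens2 p01 p10 (box \<xi>)))) * w - (\<Sum>(\<eta>, h)\<leftarrow>etas. ev_id (vc u * \<phi> (\<xi> * \<eta>)) * (vc h \<odot> w)))"
    by (simp add: i(1))
qed (auto intro: EE_mem)


section \<open>The holomorphic differential\<close>

definition h1 where "h1 u = form_map p01 (bv u)"

lemma h1_mem: "u \<in> Vec10 J \<Longrightarrow> h1 u \<in> TOm01 J \<otimes>\<^sub>A TVec10 J"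
  unfolding h1_def by (rule form_map_p01_mem[OF bv_mem_10])

lemma TVec10_TV10: "TVec10 J \<subseteq> TV10"
  using tpow_TV10[of _ "Suc 0"] by (auto simp only: tpow_1[OF right_mod_TVec10])

lemma TOm01_TVec10_EE: "y \<in> TOm01 J \<otimes>\<^sub>A TVec10 J \<Longrightarrow> y \<in> EE"
  unfolding E01_def using tprod_mono[OF subset_refl TVec10_TV10] by blast

lemma h1_EE: "u \<in> Vec10 J \<Longrightarrow> h1 u \<in> EE"
  by (rule TOm01_TVec10_EE[OF h1_mem])

lemma bv_UNIV: "u \<in> VecA \<Longrightarrow> bv u \<in> TOm \<otimes>\<^sub>A UNIV"
  using bv_mem tprod_mono[OF subset_refl subset_UNIV] by blast

lemma p01_id_box_vec: "u \<in> VecA \<Longrightarrow> p01_id J (box_vec box u) = h1 u"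
  unfolding p01_id_def h1_def box_vec_eq by (rule tmap_fmap1_left[OF form_endo_p01 sgrp_UNIV bv_UNIV])

lemma h1_vadd: "u \<in> VecA \<Longrightarrow> v \<in> VecA \<Longrightarrow> h1 (vadd u v) = h1 u + h1 v"
  by (simp add: h1_def bv_add left_lin_add[OF form_map_p01(1)])

lemma h1_vlact: "u \<in> VecA \<Longrightarrow> a \<in> Om 0 \<Longrightarrow> h1 (vlact a u) = fm (p01 (dif a)) * vc u + sc a * h1 u"
  by (simp add: h1_def bv_left left_lin_add[OF form_map_p01(1)] left_linD(2)[OF form_map_p01(1)] form_map_p01 dif_A)

lemma form_map_p01_contr:
  assumes u: "u \<in> VecA" and t: "t \<in> TOm \<otimes>\<^sub>A TOm"
  shows "form_map p01 (contr u t) = contr u (idt (form_map p01) t)"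
  by (rule tprod_eq[OF t, of UNIV "\<lambda>t. form_map p01 (contr u t)" "\<lambda>t. contr u (idt (form_map p01) t)"])
    (use u in \<open>auto elim!: TOmE simp: add_on_def contr_diff left_lin_diff[OF form_map_p01(1)]
      left_lin_diff[OF left_lin_idt[OF form_map_p01(1)]] contr_fm idt_fm form_map_p01
      left_linD(2)[OF form_map_p01(1)] VecA_app\<close>)

text \<open>By d) the (0,1) part of \<sigma>(u \<otimes> \<zeta>) has the shape of the second term
  of the derivative on \<open>E\<close>, contracted with u. This match is used in
  \<open>Hdr_balanced\<close>.\<close>

lemma p01_sigma_map:
  assumes u: "u \<in> Vec10 J" and \<zeta>: "\<zeta> \<in> Om 1"
  shows "form_map p01 (sigma_map (vc u * fm \<zeta>)) = - (\<Sum>k\<in>IE. contr u (\<phi> (p01 \<zeta> * Et k)) * vc (H k))"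
proof -
  note uV = Vec10_VecA[OF u]
  have "form_map p01 (gsig u \<zeta> (Et k) * vc (H k)) = - (contr u (\<phi> (p01 \<zeta> * Et k)) * vc (H k))" if k: "k \<in> IE" for k
  proof -
    have "form_map p01 (gsig u \<zeta> (Et k)) = - contr u (\<phi> (p01 \<zeta> * Et k))"
      using uV \<zeta> k
      by (simp add: form_map_p01_contr sinv_mem TOm2 Et_Om_1 idt_sinv basis_mem contr_uminus)
    then show ?thesis
      using form_map_p01(4)[OF TOm_UNIV[OF gsig_TOm[OF uV \<zeta> Et_Om_1[OF k]]], of "vc (H k)"] by simp
  qed
  then show ?thesis
    using sigma_map_10[OF u \<zeta>, of 1]
    by (simp add: left_lin_sum[OF form_map_p01(1)] sum_negf cong: sum.cong_simp)
qed

lemma idt_evl_p01: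
  assumes y: "y \<in> TOm \<otimes>\<^sub>A TVec" shows "idt evl (form_map p01 y * z) = form_map p01 (idt evl (y * z))"
  by (rule tprod_eq[OF y, of UNIV "\<lambda>y. idt evl (form_map p01 y * z)" "\<lambda>y. form_map p01 (idt evl (y * z))"])
    (auto elim!: TOmE simp: add_on_def left_diff_distrib left_lin_diff[OF form_map_p01(1)]
      left_lin_diff[OF left_lin_idt[OF left_lin_evl]] mult.assoc form_map_p01 idt_fm[OF left_lin_evl] p10_p01_Om)

text \<open>dda = 0 turns d of the (0,1) part of da into minus d of the (1,0) part. By c) the latter
  is expressed through \<open>box\<close> in type (1,1), and this cancels the \<open>box\<close>
  term in the pairing of \<open>h1 u\<close> with da.\<close>

lemma evl_h1_dif:
  assumes u: "u \<in> Vec10 J" and a: "a \<in> Om 0"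
  shows "idt evl (h1 u * fm (dif a)) + contr u (\<phi> (p11 (dif (p01 (dif a))))) = fm (p01 (dif (u (dif a))))"
proof -
  note uV = Vec10_VecA[OF u] and da = dif_A[OF a]
  have "dif (p10 (dif a)) + dif (p01 (dif a)) = 0"
    using p10_plus_p01[OF da] by (simp add: dif_add[symmetric] dif_dif)
  then have "dif (p01 (dif a)) = - dif (p10 (dif a))" by (simp add: eq_neg_iff_add_eq_0 add.commute)
  then have \<phi>: "\<phi> (p11 (dif (p01 (dif a)))) = idt (form_map p01) (box (p10 (dif a)))"
    using da by (simp add: add_on_uminus[OF add_on_p11] dif_Om_2 p10_p01_Om phi_uminus p11_mem phi_dif_10 p10_mem)
  have "fbox u (dif a) = fm (dif (u (dif a))) - contr u (box (p10 (dif a)))"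
    using u da by (simp add: box_p10 contr_p10 box_UNIV)
  then have "idt evl (h1 u * fm (dif a)) = fm (p01 (dif (u (dif a)))) - form_map p01 (contr u (box (p10 (dif a))))"
    unfolding h1_def idt_evl_p01[OF bv_mem[OF uV]] evl_bv[OF uV da]
    using uV da by (simp add: left_lin_diff[OF form_map_p01(1)] form_map_p01 dif_A VecA_app)
  then show ?thesis
    using uV da by (simp add: \<phi> form_map_p01_contr box_mem p10_p01_Om)
qed

text \<open>For a vector field h, the product h \<bullet> (aw) exceeds (h.a) \<bullet> w by h(da) w.
  The last term collects these defects; for y = \<open>h1 u\<close> it is a term of
  \<open>evl_h1_dif\<close>.\<close>

lemma Eb_left_mult:
  assumes y: "y \<in> TOm01 J \<otimes>\<^sub>A TVec10 J" and a: "a \<in> Om 0" and w: "w \<in> TV10"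
  shows "Eb y (sc a * w) = Eb (y * sc a) w + idt evl (y * fm (dif a)) * w"
proof -
  note aw = sc_left_TV10[OF a w]
  have ysc: "y * sc a \<in> EE" if "y \<in> TOm01 J \<otimes>\<^sub>A TVec10 J" for y
    using that a by (intro TOm01_TVec10_EE right_modD(2)[OF right_mod_tprod[OF right_mod_TVec10]])
  show ?thesis
  proof (rule tprod_eq[OF y, of "TOm01 J \<otimes>\<^sub>A TVec10 J" "\<lambda>y. Eb y (sc a * w)"
        "\<lambda>y. Eb (y * sc a) w + idt evl (y * fm (dif a)) * w"])
    show "add_on (TOm01 J \<otimes>\<^sub>A TVec10 J) (\<lambda>y. Eb y (sc a * w))"
      by (rule add_on_subset[OF add_on_Eb[OF aw]]) (auto intro: TOm01_TVec10_EE)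
    show "add_on (TOm01 J \<otimes>\<^sub>A TVec10 J) (\<lambda>y. Eb (y * sc a) w + idt evl (y * fm (dif a)) * w)"
      by (rule add_on_plus_fun[OF add_on_comp[OF _ add_on_Eb[OF w] ysc]])
        (simp_all add: add_on_def left_diff_distrib left_lin_diff[OF left_lin_idt[OF left_lin_evl]])
    fix x y assume "x \<in> TOm01 J" "y \<in> TVec10 J"
    then obtain \<xi> h where *: "\<xi> \<in> Om_pq J 0 1" "x = fm \<xi>" "h \<in> Vec10 J" "y = vc h" by (auto elim!: TOm01E TVec10E)
    note hV = Vec10_VecA[OF *(3)]
    show "x * y \<in> TOm01 J \<otimes>\<^sub>A TVec10 J" by (rule tprod_mem) fact+
    have m: "vc h \<in> TV10" "vc (vract h a) \<in> TV10"
      using TVec10_TV10 vc_TVec10 *(3) a by (auto simp: vract_Vec10)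
    have "x * y * sc a = fm \<xi> * vc (vract h a)" using * a hV by (simp add: vc_right mult.assoc)
    then show "Eb (x * y) (sc a * w) = Eb (x * y * sc a) w + idt evl (x * y * fm (dif a)) * w"
      using * a hV w m
      by (simp add: Eb_fm[OF aw] Eb_fm[OF w] bullet_vc TV10_TV aw vec_bullet_left vract_VecA distrib_left mult.assoc
          idt_fm[OF left_lin_evl] Om_pq_Om_1 evl_vc contr_fm_1 dif_A)
  qed
qed

text \<open>The recursion is given for u \<bullet> v, whereas maps on tensor powers are determined
  on u \<otimes> v. The last summand subtracts the value on the contraction, which lies in degree n,
  so the definition is recursive in the degree.\<close>

primrec Hd :: "nat \<Rightarrow> 'w tens \<Rightarrow> 'w tens" where
  "Hd 0 = (\<lambda>x. fm (p01 (dif (wedges x))))"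
| "Hd (Suc n) = add_ext (Vec10 J \<times> tpow (TVec10 J) n) (\<lambda>(u, v). vc u * v)
     (\<lambda>(u, v). Eb (h1 u) v + contr u (dl (Hd n v)) - Hd n (contr u (boxV n v)))"

definition Hd_props :: "nat \<Rightarrow> bool" where
  "Hd_props n \<longleftrightarrow> add_on (tpow (TVec10 J) n) (Hd n) \<and> (\<forall>v\<in>tpow (TVec10 J) n. Hd n v \<in> EE) \<and>
     (\<forall>a\<in>Om 0. \<forall>v\<in>tpow (TVec10 J) n. Hd n (sc a * v) = fm (p01 (dif a)) * v + sc a * Hd n v)"

lemma Hd_propsD:
  assumes "Hd_props n"
  shows "add_on (tpow (TVec10 J) n) (Hd n)" "v \<in> tpow (TVec10 J) n \<Longrightarrow> Hd n v \<in> EE"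
    "a \<in> Om 0 \<Longrightarrow> v \<in> tpow (TVec10 J) n \<Longrightarrow> Hd n (sc a * v) = fm (p01 (dif a)) * v + sc a * Hd n v"
  using assms by (auto simp: Hd_props_def)

abbreviation "Hdr n \<equiv> (\<lambda>u v. Eb (h1 u) v + contr u (dl (Hd n v)) - Hd n (contr u (boxV n v)))"

lemma tpow_VecA: "v \<in> tpow (TVec10 J) n \<Longrightarrow> v \<in> tpow TVec n"
  using tpow_10 by blast

lemma sc_left_tpow_10: "a \<in> Om 0 \<Longrightarrow> v \<in> tpow (TVec10 J) n \<Longrightarrow> sc a * v \<in> tpow (TVec10 J) n"
  by (rule left_modD(2)[OF left_mod_tpow[OF left_mod_TVec10]])

text \<open>The key to well-definedness. Moving a from u to v creates the defect of \<bullet> on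
  \<open>h1 u\<close>, the term \<phi> of the (1,1) part of d p01(da), and, through the contraction,
  p01 of d(u(da)). Their balance is \<open>evl_h1_dif\<close>; the other new terms agree in
  pairs.\<close>

lemma Hdr_balanced:
  assumes n: "Hd_props n" and u: "u \<in> Vec10 J" and a: "a \<in> Om 0" and v: "v \<in> tpow (TVec10 J) n"
  shows "Hdr n (vract u a) v = Hdr n u (sc a * v)"
proof -
  note uV = Vec10_VecA[OF u] and da = dif_A[OF a] and v' = tpow_TV10[OF v] and vV = tpow_VecA[OF v]
  note Hv = Hd_propsD(2)[OF n v]
  have uda: "u (dif a) \<in> Om 0" using uV da by (simp add: VecA_app)
  have p: "p01 (dif a) \<in> Om_pq J 0 1" using da by (rule p01_mem)
  \<comment> \<open>S occurs twice: as the \<sigma> defect of \<open>h1\<close> under the right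
    action, and as the second term of the derivative of p01(da) \<otimes> v. The two occurrences
    stand on opposite sides of the claim and cancel.\<close>
  define S where "S = (\<Sum>k\<in>IE. contr u (\<phi> (p01 (dif a) * Et k)) * (vc (H k) \<odot> v))"
  have sig: "Eb (form_map p01 (sigma_map (vc u * fm (dif a)))) v = - S"
  proof -
    have "contr u (\<phi> (p01 (dif a) * Et k)) * vc (H k) \<in> EE" if "k \<in> IE" for k
      using that TVec10_TV10 vc_TVec10[OF basis_mem(4)[OF that]] by (intro TOm01_EE contr_phi uV phi_Et_mem p) auto
    moreover have "vc (H k) \<in> TV10" if "k \<in> IE" for k
      using TVec10_TV10 vc_TVec10[OF basis_mem(4)[OF that]] by auto
    ultimately show ?thesis
      unfolding p01_sigma_map[OF u da] S_def using v'
      by (simp add: add_on_uminus[OF add_on_Eb] sgrp_sum add_on_sum[OF add_on_Eb] Eb_TOm01 contr_phi uV phi_Et_mem p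
          cong: sum.cong_simp)
  qed
  have h1a: "h1 u * sc a \<in> EE"
    using right_modD(2)[OF right_mod_tprod[OF right_mod_TVec10] a h1_mem[OF u]] by (rule TOm01_TVec10_EE)
  have "h1 (vract u a) = h1 u * sc a + form_map p01 (sigma_map (vc u * fm (dif a)))"
    by (simp add: h1_def bv_right[OF uV a] left_lin_add[OF form_map_p01(1)] form_map_p01(4)[OF bv_UNIV[OF uV]])
  moreover have "form_map p01 (sigma_map (vc u * fm (dif a))) \<in> EE"
  proof -
    have "form_map p01 (sigma_map (vc u * fm (dif a))) = h1 (vract u a) - h1 u * sc a" using calculation by simp
    then show ?thesis using h1_EE[OF vract_Vec10[OF u a]] h1a by (simp add: sgrp_diff[OF sgrp_EE])
  qed
  ultimately have 1: "Eb (h1 (vract u a)) v = Eb (h1 u * sc a) v - S"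
    using sig h1a by (simp add: add_on_add[OF add_on_Eb[OF v']])
  have 2: "Eb (h1 u) (sc a * v) = Eb (h1 u * sc a) v + idt evl (h1 u * fm (dif a)) * v"
    by (rule Eb_left_mult[OF h1_mem[OF u] a v'])
  have aH: "sc a * Hd n v \<in> EE" "fm (p01 (dif a)) * v \<in> EE"
    using a Hv p v' by (simp_all add: left_modD(2)[OF left_mod_EE] EE_mem)
  have 3: "contr u (dl (Hd n (sc a * v))) = contr u (\<phi> (p11 (dif (p01 (dif a))))) * v - S +
      (sc (u (dif a)) * Hd n v + contr (vract u a) (dl (Hd n v)))"
    using aH a uV u da by (simp add: Hd_propsD(3)[OF n a v] add_on_add[OF add_on_dl] contr_add contr_dl[OF uV p v'] S_def
        dl_left Hv contr_fm p10_p01_Om Vec10_p10 contr_vract)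
  have c: "contr (vract u a) (boxV n v) \<in> tpow (TVec10 J) n"
    by (rule contr_boxV_10[OF vract_VecA[OF uV a] v])
  have "contr u (boxV n (sc a * v)) = sc (u (dif a)) * v + contr (vract u a) (boxV n v)"
    using a uV da by (simp add: box_Vec_left vV contr_add contr_fm contr_vract)
  then have 4: "Hd n (contr u (boxV n (sc a * v))) = fm (p01 (dif (u (dif a)))) * v + sc (u (dif a)) * Hd n v +
      Hd n (contr (vract u a) (boxV n v))"
    by (simp add: add_on_add[OF Hd_propsD(1)[OF n]] sc_left_tpow_10 uda v c Hd_propsD(3)[OF n uda v])
  have "idt evl (h1 u * fm (dif a)) * v + contr u (\<phi> (p11 (dif (p01 (dif a))))) * v = fm (p01 (dif (u (dif a)))) * v"
    by (simp only: evl_h1_dif[OF u a, symmetric] distrib_right)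
  then show ?thesis
    unfolding 1 2 3 4 by (simp add: algebra_simps)
qed

lemma TVec10_tpow: "u \<in> Vec10 J \<Longrightarrow> v \<in> tpow (TVec10 J) n \<Longrightarrow> vc u * v \<in> tpow (TVec10 J) (Suc n)"
  by (simp add: tprod_mem vc_TVec10)

lemma Hdr_mem: "Hd_props n \<Longrightarrow> u \<in> Vec10 J \<Longrightarrow> v \<in> tpow (TVec10 J) n \<Longrightarrow> Hdr n u v \<in> EE"
  by (intro sgrp_diff[OF sgrp_EE] sgrp_add[OF sgrp_EE] Eb_mem h1_EE contr_dl_mem Vec10_VecA Hd_propsD(2)
      contr_boxV_10 tpow_TV10)

lemma Hd_Suc_aux:
  assumes n: "Hd_props n"
  shows "add_on (tpow (TVec10 J) (Suc n)) (Hd (Suc n))"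
    and "u \<in> Vec10 J \<Longrightarrow> v \<in> tpow (TVec10 J) n \<Longrightarrow> Hd (Suc n) (vc u * v) = Hdr n u v"
proof -
  have add: "add_on (tpow (TVec10 J) n) (Hdr n u)" if u: "u \<in> Vec10 J" for u
  proof (intro add_on_minus_fun add_on_plus_fun)
    show "add_on (tpow (TVec10 J) n) (Eb (h1 u))"
      by (rule add_on_subset[OF add_on_Eb_right[OF h1_EE[OF u]]]) (auto intro: tpow_TV10)
    show "add_on (tpow (TVec10 J) n) (\<lambda>v. contr u (dl (Hd n v)))"
      by (rule add_on_comp[OF add_on_comp[OF Hd_propsD(1)[OF n] add_on_dl] add_on_contr[OF Vec10_VecA[OF u]]])
        (simp_all add: Hd_propsD(2)[OF n])
    show "add_on (tpow (TVec10 J) n) (\<lambda>v. Hd n (contr u (boxV n v)))"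
      by (rule add_on_comp[OF add_on_comp[OF add_on_subset[OF add_on_box_Vec tpow_10] add_on_contr[OF Vec10_VecA[OF u]]]
            Hd_propsD(1)[OF n]])
        (simp_all add: contr_boxV_10 Vec10_VecA u)
  qed
  have vadd: "Hdr n (vadd u v) y = Hdr n u y + Hdr n v y"
    if "u \<in> Vec10 J" "v \<in> Vec10 J" "y \<in> tpow (TVec10 J) n" for u v y
    using that
    by (simp add: h1_vadd Vec10_VecA add_on_add[OF add_on_Eb] h1_EE tpow_TV10 contr_vadd
        add_on_add[OF Hd_propsD(1)[OF n]] contr_boxV_10)
  note ext = add_ext_vec[OF vec_proj_q10 retract_tpow[OF vec_proj_q10] add[unfolded TVec10_def] vadd[unfolded TVec10_def]
      Hdr_balanced[OF n, unfolded TVec10_def], folded TVec10_def, folded Hd.simps(2)]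
  show "add_on (tpow (TVec10 J) (Suc n)) (Hd (Suc n))" using ext(1) by (simp only: tpow.simps)
  show "u \<in> Vec10 J \<Longrightarrow> v \<in> tpow (TVec10 J) n \<Longrightarrow> Hd (Suc n) (vc u * v) = Hdr n u v" by (rule ext(2))
qed

lemma fm_EE: "\<xi> \<in> Om_pq J 0 1 \<Longrightarrow> fm \<xi> \<in> EE"
  using EE_mem[of \<xi> 1] one_tpowers[of "TVec10 J"] by (simp add: TVecs10_def)

lemma Hd_props: "Hd_props n"
proof (induction n)
  case 0
  have "add_on TA (\<lambda>x :: 'w tens. fm (p01 (dif (wedges x))))"
  proof (rule add_onI)
    fix x y :: "'w tens" assume "x \<in> TA" "y \<in> TA"
    then show "fm (p01 (dif (wedges (x - y)))) = fm (p01 (dif (wedges x))) - fm (p01 (dif (wedges y)))"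
      by (auto simp: TA_def wedges_diff wedges_sc dif_diff add_on_diff[OF add_on_p01] add_on_diff[OF add_on_fm] dif_A p10_p01_Om)
  qed simp
  then show ?case
    by (auto simp: Hd_props_def TA_def wedges_sc fm_EE p01_mem dif_A sc_mult[symmetric] Om_0_mult dif_A_mult p10_lin
        fm_add p10_p01_Om Om_mult_0 fm_left fm_right)
next
  case (Suc n)
  note S = Hd_Suc_aux[OF Suc]
  have mem: "Hd (Suc n) v \<in> EE" if v: "v \<in> tpow (TVec10 J) (Suc n)" for v
  proof (rule tprod_into[OF v[unfolded tpow.simps] S(1) sgrp_EE])
    fix x y assume "x \<in> TVec10 J" and y: "y \<in> tpow (TVec10 J) n"
    then obtain u where u: "u \<in> Vec10 J" "x = vc u" by (auto elim!: TVec10E)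
    show "x * y \<in> tpow (TVec10 J) (Suc n)" unfolding u(2) by (rule TVec10_tpow[OF u(1) y])
    show "Hd (Suc n) (x * y) \<in> EE" unfolding u(2) S(2)[OF u(1) y] by (rule Hdr_mem[OF Suc u(1) y])
  qed
  have left: "Hd (Suc n) (sc a * v) = fm (p01 (dif a)) * v + sc a * Hd (Suc n) v"
    if a: "a \<in> Om 0" and v: "v \<in> tpow (TVec10 J) (Suc n)" for a v
  proof (rule tprod_eq[OF v[unfolded tpow.simps], of "tpow (TVec10 J) (Suc n)" "\<lambda>v. Hd (Suc n) (sc a * v)"])
    show "add_on (tpow (TVec10 J) (Suc n)) (\<lambda>v. Hd (Suc n) (sc a * v))"
      by (rule add_on_comp[OF _ S(1)])
        (simp_all add: add_on_def right_diff_distrib sc_left_tpow_10 a del: tpow.simps)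
    show "add_on (tpow (TVec10 J) (Suc n)) (\<lambda>v. fm (p01 (dif a)) * v + sc a * Hd (Suc n) v)"
      by (rule add_on_plus_fun[OF _ add_on_const_mult[OF S(1)]]) (simp add: add_on_def right_diff_distrib del: tpow.simps)
    fix x y assume "x \<in> TVec10 J" and y: "y \<in> tpow (TVec10 J) n"
    then obtain u where u: "u \<in> Vec10 J" "x = vc u" by (auto elim!: TVec10E)
    note uV = Vec10_VecA[OF u(1)] and y' = tpow_TV10[OF y] and yV = tpow_VecA[OF y] and p = p01_mem[OF dif_A[OF a]]
    show "x * y \<in> tpow (TVec10 J) (Suc n)" unfolding u(2) by (rule TVec10_tpow[OF u(1) y])
    have c: "contr u (boxV n y) \<in> tpow (TVec10 J) n" by (rule contr_boxV_10[OF uV y])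
    have m: "vc u \<in> TV10" using TVec10_TV10 vc_TVec10[OF u(1)] by auto
    have "sc a * (x * y) = vc (vlact a u) * y" using u uV a by (simp add: vc_left mult.assoc)
    then have "Hd (Suc n) (sc a * (x * y)) = Hdr n (vlact a u) y"
      by (simp only: S(2)[OF vlact_Vec10[OF u(1) a] y])
    \<comment> \<open>The contraction coming from u \<bullet> y cancels against the Leibniz term of
      \<open>Hd n\<close> on that same contraction.\<close>
    also have "Eb (h1 (vlact a u)) y = fm (p01 (dif a)) * (vc u * y + contr u (boxV n y)) + sc a * Eb (h1 u) y"
      using uV a y' m p
      by (simp add: h1_vlact add_on_add[OF add_on_Eb] EE_mem left_modD(2)[OF left_mod_EE] h1_EE u(1) Eb_fm Eb_left
          bullet_vc TV10_TV vec_bullet_eq box_TVec_eq[OF yV])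
    finally show "Hd (Suc n) (sc a * (x * y)) = fm (p01 (dif a)) * (x * y) + sc a * Hd (Suc n) (x * y)"
      using a uV
      by (simp add: u(2) S(2)[OF u(1) y] contr_vlact Hd_propsD(3)[OF Suc a c] distrib_left right_diff_distrib del: Hd.simps)
  qed
  show ?case using S(1) mem left by (simp add: Hd_props_def del: Hd.simps tpow.simps)
qed

lemmas Hd_Suc = Hd_Suc_aux(2)[OF Hd_props]

definition Hol :: "'w tens \<Rightarrow> 'w tens" where
  "Hol = add_ext (SIGMA n:UNIV. tpow (TVec10 J) n) snd (\<lambda>(n, v). Hd n v)"

lemma add_on_Hol: "add_on TV10 Hol" and Hol_eq: "v \<in> tpow (TVec10 J) n \<Longrightarrow> Hol v = Hd n v"
  using add_ext_graded[OF vec_proj_q10, folded TVec10_def, of Hd, OF Hd_propsD(1)[OF Hd_props]]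
  unfolding Hol_def TVecs10_def by blast+

lemma Hol_mem: "v \<in> TV10 \<Longrightarrow> Hol v \<in> EE"
  unfolding TVecs10_def
  by (erule tpowers_into[OF _ add_on_Hol[unfolded TVecs10_def] sgrp_EE])
    (auto simp: Hol_eq Hd_propsD(2)[OF Hd_props] intro: tpowers_mem)

lemma Hol_sc: "a \<in> Om 0 \<Longrightarrow> Hol (sc a) = fm (p01 (dif a))"
  using Hol_eq[of "sc a" 0] by (simp add: sc_TA wedges_sc)

lemma TV10_eq:
  assumes "v \<in> TV10" "add_on TV10 f" "add_on TV10 g" "\<And>n v. v \<in> tpow (TVec10 J) n \<Longrightarrow> f v = g v"
  shows "f v = g v"
  by (rule tpowers_eq[OF assms(1)[unfolded TVecs10_def] assms(2,3)]) (auto intro: tpow_TV10 assms(4))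

text \<open>Adding back the value on the contraction restores the recursion in its original form,
  for v of mixed degree.\<close>

lemma Hol_vb:
  assumes u: "u \<in> Vec10 J" and v: "v \<in> TV10"
  shows "Hol (vb u v) = Eb (h1 u) v + contr u (dl (Hol v))"
proof (rule TV10_eq[OF v, of "\<lambda>v. Hol (vb u v)"])
  note uV = Vec10_VecA[OF u]
  show "add_on TV10 (\<lambda>v. Hol (vb u v))"
    by (rule add_on_comp[OF add_on_TV10[OF add_on_vec_bullet[OF uV]] add_on_Hol]) (simp add: vec_bullet_mem_10 u)
  show "add_on TV10 (\<lambda>v. Eb (h1 u) v + contr u (dl (Hol v)))"
    by (rule add_on_plus_fun[OF add_on_Eb_right[OF h1_EE[OF u]]
          add_on_comp[OF add_on_comp[OF add_on_Hol add_on_dl] add_on_contr[OF uV]]])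
      (simp_all add: Hol_mem)
  show "Hol (vb u v) = Eb (h1 u) v + contr u (dl (Hol v))" if v: "v \<in> tpow (TVec10 J) n" for n v
  proof -
    have c: "contr u (boxV n v) \<in> tpow (TVec10 J) n" by (rule contr_boxV_10[OF uV v])
    have "Hol (vb u v) = Hol (vc u * v) + Hol (contr u (boxV n v))"
      using uV tpow_TV10[OF v]
      by (simp add: vec_bullet_eq TV10_TV box_TVec_eq[OF tpow_VecA[OF v]] add_on_add[OF add_on_Hol] vc_left_TV10 u
          tpow_TV10[OF c])
    then show ?thesis
      by (simp add: Hol_eq[OF c] Hol_eq[OF TVec10_tpow[OF u v]] Hol_eq[OF v] Hd_Suc[OF u v] del: Hd.simps)
  qed
qed

lemma one_TV10: "1 \<in> TV10"
  by (simp add: TVecs10_def one_tpowers)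

lemma vb_one: "u \<in> VecA \<Longrightarrow> vb u 1 = vc u"
  by (simp add: vec_bullet_eq one_tpowers box_TVec_eq[of 1 0] one_TA box_sc_one[unfolded box_Vec.simps] contr_zero)

lemma Eb_one:
  assumes y: "y \<in> TOm01 J \<otimes>\<^sub>A TVec10 J" shows "Eb y 1 = y"
proof (rule tprod_eq[OF y, of "TOm01 J \<otimes>\<^sub>A TVec10 J" "\<lambda>y. Eb y 1" "\<lambda>y. y"])
  show "add_on (TOm01 J \<otimes>\<^sub>A TVec10 J) (\<lambda>y. Eb y 1)"
    by (rule add_on_subset[OF add_on_Eb[OF one_TV10]]) (auto intro: TOm01_TVec10_EE)
  fix x y assume x: "x \<in> TOm01 J" and y: "y \<in> TVec10 J"
  then show "x * y \<in> TOm01 J \<otimes>\<^sub>A TVec10 J" by (rule tprod_mem)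
  obtain h where "h \<in> Vec10 J" "y = vc h" using y by (auto elim!: TVec10E)
  then show "Eb (x * y) 1 = x * y"
    using Eb_TOm01[OF x subsetD[OF TVec10_TV10 y] one_TV10] by (simp add: bullet_vc Vec10_VecA one_tpowers vb_one)
qed (simp add: add_on_def)

lemma Hol_vc: "u \<in> Vec10 J \<Longrightarrow> Hol (vc u) = h1 u"
  using Hol_vb[of u 1] Hol_sc[OF Om_one]
  by (simp add: one_TV10 vb_one Vec10_VecA Eb_one h1_mem dif_one add_on_zero[OF add_on_p01] fm_zero
      add_on_zero[OF add_on_dl] contr_zero)

section \<open>The generated relation is the graph of the constructed map\<close>

abbreviation "HDg \<equiv> HD_graph J box sinv xis etas"

text \<open>The constructed map satisfies each generating rule, so the relation is contained in its
  graph and is single valued.\<close>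

lemma HD_graph_Hol: "(x, y) \<in> HDg \<Longrightarrow> x \<in> TV10 \<and> y = Hol x"
proof (induction x y rule: HD_graph.induct)
  case (scalar a)
  then show ?case using tpow_TV10[of "sc a" 0] by (simp add: sc_TA Hol_sc delbar_def One_nat_def)
next
  case (vector u)
  then show ?case using TVec10_TV10 vc_TVec10[of u] by (auto simp: Hol_vc p01_id_box_vec Vec10_VecA)
next
  case (bullet u v n y)
  then show ?case
    by (simp add: bullet_vc Vec10_VecA TV10_TV vec_bullet_mem_10 Hol_vb p01_id_box_vec HD_correction_eq Hol_mem)
next
  case (diff x y x' y')
  then show ?case by (simp add: sgrp_diff[OF sgrp_TV10] add_on_diff[OF add_on_Hol])
qed

lemma HD_graph_total:
  assumes "x \<in> TV10" shows "\<exists>y. (x, y) \<in> HDg"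
proof -
  have D: "sgrp {x. \<exists>y. (x, y) \<in> HDg}"
    unfolding sgrp_def
  proof (intro conjI ballI)
    have "(sc 1 - sc 1, fm (delbar J 0 0 1) - fm (delbar J 0 0 1)) \<in> HDg"
      by (intro HD_graph.diff HD_graph.scalar Om_one)
    then show "0 \<in> {x. \<exists>y. (x, y) \<in> HDg}" by auto
  qed (auto intro: HD_graph.diff)
  have ex: "\<exists>y. (x, y) \<in> HDg" if "x \<in> tpow (TVec10 J) n" for n x
    using that
  proof (induction n arbitrary: x)
    case 0
    then show ?case by (auto simp: TA_def intro: HD_graph.scalar)
  next
    case (Suc n)
    have "x \<in> {x. \<exists>y. (x, y) \<in> HDg}"
    proof (rule subsetD[OF tprod_subset[OF D] Suc.prems[unfolded tpow.simps]])
      fix y z assume "y \<in> TVec10 J" and z: "z \<in> tpow (TVec10 J) n"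
      then obtain u where u: "u \<in> Vec10 J" "y = vc u" by (auto elim!: TVec10E)
      note uV = Vec10_VecA[OF u(1)]
      obtain t where t: "(z, t) \<in> HDg" using Suc.IH[OF z] by auto
      obtain s where s: "(contr u (boxV n z), s) \<in> HDg" using Suc.IH[OF contr_boxV_10[OF uV z]] by auto
      \<comment> \<open>u \<otimes> z is not a generator of the relation. It is u \<bullet> z minus
        a contraction of degree n, so the product rule, the induction hypothesis and differences
        reach it.\<close>
      have "y * z = vc u \<odot> z - contr u (boxV n z)"
        using uV z by (simp add: u(2) bullet_vc TV10_TV tpow_TV10 vec_bullet_eq box_TVec_eq[OF tpow_VecA[OF z]])
      with HD_graph.diff[OF HD_graph.bullet[OF u(1) z t] s] show "y * z \<in> {x. \<exists>y. (x, y) \<in> HDg}" by auto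
    qed
    then show ?case by simp
  qed
  show ?thesis
    using group_closure_subset[OF _ D, of "\<Union>n. tpow (TVec10 J) n"] ex assms
    unfolding TVecs10_def tpowers_def by blast
qed

lemma HD_eq: "x \<in> TV10 \<Longrightarrow> HD J box sinv xis etas x = Hol x"
  unfolding HD_def using HD_graph_Hol HD_graph_total by (intro the_equality) blast+

section \<open>The product rule\<close>

abbreviation "actd \<equiv> act J box sinv EE dl"

lemmas E01_derivative = left_mod_EE add_on_dl dl_mem dl_left

lemma Hol_bullet:
  assumes v: "v \<in> TV10" and w: "w \<in> TV10"
  shows "Hol (v \<odot> w) = Eb (Hol v) w + actd v (Hol w)"
proof (rule TV10_eq[OF v, of "\<lambda>v. Hol (v \<odot> w)" "\<lambda>v. Eb (Hol v) w + actd v (Hol w)"])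
  note wV = TV10_TV[OF w] and Hw = Hol_mem[OF w]
  show 1: "add_on TV10 (\<lambda>v. Hol (v \<odot> w))"
    by (rule add_on_comp[OF add_on_TV10[OF add_on_bullet_left[OF wV]] add_on_Hol]) (simp add: bullet_mem_10 w)
  show 2: "add_on TV10 (\<lambda>v. Eb (Hol v) w + actd v (Hol w))"
    by (rule add_on_plus_fun[OF add_on_comp[OF add_on_Hol add_on_Eb[OF w] Hol_mem] add_on_act_E[OF E01_derivative Hw]])
  show "Hol (v \<odot> w) = Eb (Hol v) w + actd v (Hol w)" if "v \<in> tpow (TVec10 J) n" for n v
    using that
  proof (induction n arbitrary: v)
    case 0
    then obtain a where a: "a \<in> Om 0" "v = sc a" by (auto simp: TA_def)
    have p: "p01 (dif a) \<in> Om_pq J 0 1" by (rule p01_mem[OF dif_A[OF a(1)]])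
    have "Hol (sc a * w) = fm (p01 (dif a)) * w + sc a * Hol w"
    proof (rule TV10_eq[OF w, of "\<lambda>w. Hol (sc a * w)" "\<lambda>w. fm (p01 (dif a)) * w + sc a * Hol w"])
      show "add_on TV10 (\<lambda>w. Hol (sc a * w))"
        by (rule add_on_comp[OF _ add_on_Hol]) (simp_all add: add_on_def right_diff_distrib sc_left_TV10 a)
      show "add_on TV10 (\<lambda>w. fm (p01 (dif a)) * w + sc a * Hol w)"
        by (rule add_on_plus_fun[OF _ add_on_const_mult[OF add_on_Hol]]) (simp add: add_on_def right_diff_distrib)
      show "Hol (sc a * w) = fm (p01 (dif a)) * w + sc a * Hol w" if "w \<in> tpow (TVec10 J) n" for n w
        by (simp only: Hol_eq[OF that] Hol_eq[OF sc_left_tpow_10[OF a(1) that]] Hd_propsD(3)[OF Hd_props a(1) that])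
    qed
    moreover have "Eb (fm (p01 (dif a))) w = fm (p01 (dif a)) * w"
      using Eb_fm[OF w p one_TV10] bullet_sc[OF Om_one wV] by simp
    ultimately show ?case using a wV by (simp add: bullet_sc Hol_sc act_sc[OF E01_derivative _ Hw])
  next
    case (Suc n)
    show ?case
    proof (rule tprod_eq[OF Suc.prems[unfolded tpow.simps] 1 2])
      fix y z assume "y \<in> TVec10 J" and z: "z \<in> tpow (TVec10 J) n"
      then obtain u where u: "u \<in> Vec10 J" "y = vc u" by (auto elim!: TVec10E)
      note uV = Vec10_VecA[OF u(1)] and z' = tpow_TV10[OF z] and zV = TV10_TV[OF tpow_TV10[OF z]]
      define c where "c = contr u (boxV n z)"
      have c: "c \<in> tpow (TVec10 J) n" unfolding c_def by (rule contr_boxV_10[OF uV z])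
      note c' = tpow_TV10[OF c]
      show "y * z \<in> TV10" by (simp add: u vc_left_TV10 z')
      have vbm: "vb u z \<in> TV10" by (rule vec_bullet_mem_10[OF u(1) z'])
      \<comment> \<open>u \<bullet> z has components in degrees n + 1 and n, and c removes the lower
        one.\<close>
      have yz: "y * z = vb u z - c"
        using uV zV by (simp add: u(2) vec_bullet_eq box_TVec_eq[OF tpow_VecA[OF z]] c_def)
      have zw: "z \<odot> w \<in> TV10" by (rule bullet_mem_10[OF z' w])
      have Hz: "Hol z \<in> EE" by (rule Hol_mem[OF z'])
      have "Hol ((y * z) \<odot> w) = Hol (vb u (z \<odot> w)) - Hol (c \<odot> w)"
        using uV zV wV c' vbm
        by (simp add: yz add_on_diff[OF add_on_bullet_left[OF wV]] TV10_TV bullet_vb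
            add_on_diff[OF add_on_Hol] vec_bullet_mem_10[OF u(1) zw] bullet_mem_10 w)
      also have "Hol (vb u (z \<odot> w)) = Eb (h1 u) (z \<odot> w) + contr u (dl (Eb (Hol z) w)) + contr u (dl (actd z (Hol w)))"
        using Eb_mem[OF Hz w] act_mem[OF E01_derivative z' Hw]
        by (simp add: Hol_vb[OF u(1) zw] Suc.IH[OF z] add_on_add[OF add_on_dl] contr_add[OF uV])
      \<comment> \<open>Associativity, and the fact that contracted differentiation commutes with
        right multiplication, turn these two terms into the differential of u \<bullet> z,
        multiplied by w.\<close>
      also have "Eb (h1 u) (z \<odot> w) + contr u (dl (Eb (Hol z) w)) = Eb (Hol (vb u z)) w"
        by (simp only: Hol_vb[OF u(1) z'] Eb_assoc[OF h1_EE[OF u(1)] z' w] contr_dl_Eb[OF uV Hz w]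
            add_on_add[OF add_on_Eb[OF w] Eb_mem[OF h1_EE[OF u(1)] z'] contr_dl_mem[OF uV Hz]])
      \<comment> \<open>The action property in degree one. Its term in c cancels the action part of
        the differential of c \<bullet> w.\<close>
      also have "contr u (dl (actd z (Hol w))) = actd (y * z) (Hol w) + actd c (Hol w)"
        using act_vc_mult[OF E01_derivative u(1) z Hw] by (simp add: u(2) c_def)
      also have "Hol (c \<odot> w) = Eb (Hol c) w + actd c (Hol w)" by (rule Suc.IH[OF c])
      finally show "Hol ((y * z) \<odot> w) = Eb (Hol (y * z)) w + actd (y * z) (Hol w)"
        using c' vbm by (simp add: yz add_on_diff[OF add_on_Hol] add_on_diff[OF add_on_Eb[OF w]] Hol_mem)
    qed
  qed
qed

end

theorem proposition14p3:
  fixes J :: "'w::star_dga \<Rightarrow> 'w"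
    and box :: "'w \<Rightarrow> 'w tens"
    and sinv :: "'w tens \<Rightarrow> 'w tens"
    and xis etas :: "('w \<times> ('w \<Rightarrow> 'w)) list"
  assumes fgp: "fgp_right (Om 1 :: 'w set)"
    and xis: "dual_basis (Om 1) VecA xis"
    and acs: "almost_complex J"
    and etas: "dual_basis (Om_pq J 1 0) (Vec10 J) etas"
    and cov: "right_bimod_cov_deriv box sinv"
    and a: "bij_betw wedge (TOm10 J \<otimes>\<^sub>A TOm01 J) (Om_pq J 1 1)"
    and b: "\<forall>\<xi>\<in>Om 1. tens2 J (\<lambda>\<eta>. \<eta>) (box \<xi>) = box (J \<xi>)"
    and c: "\<forall>\<xi>\<in>Om 1. proj J 1 1 (torsion_R box \<xi>) = 0"
    and d: "\<forall>t\<in>TOm \<otimes>\<^sub>A TOm. proj J 1 1 (wedge (sinv t)) =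
              - wedge (tens2 (proj J 0 1) (proj J 1 0) t)
              - wedge (tens2 (proj J 1 0) (proj J 0 1) t)"
  shows "(\<forall>v\<in>TVecs10 J. \<forall>w\<in>TVecs10 J.
            HD J box sinv xis etas (bullet box sinv xis v w) =
              E01_bullet J box sinv xis (HD J box sinv xis etas v) w
              + act_E01 J box sinv xis etas v (HD J box sinv xis etas w)) \<and>
         (\<forall>v\<in>TVecs10 J. \<forall>w\<in>TVecs10 J.
            HD J box sinv xis etas v = 0 \<longrightarrow> HD J box sinv xis etas w = 0 \<longrightarrow>
            HD J box sinv xis etas (bullet box sinv xis v w) = 0)"
proof -
  interpret hd_setting J box sinv xis etas
    using acs xis etas cov a b c d by unfold_locales
  have *: "HD J box sinv xis etas (bullet box sinv xis v w) =
      E01_bullet J box sinv xis (HD J box sinv xis etas v) w + act_E01 J box sinv xis etas v (HD J box sinv xis etas w)"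
    if "v \<in> TVecs10 J" "w \<in> TVecs10 J" for v w
    using Hol_bullet[OF that] that by (simp add: HD_eq bullet_mem_10 act_E01_def)
  \<comment> \<open>Both operations on the right side of the product rule send 0 to 0, which gives
    the statement on holomorphic elements.\<close>
  have "act_E01 J box sinv xis etas v 0 = 0" if "v \<in> TVecs10 J" for v
    unfolding act_E01_def by (rule act_zero[OF E01_derivative that])
  moreover have "E01_bullet J box sinv xis 0 w = 0" if "w \<in> TVecs10 J" for w
    by (rule add_on_zero[OF add_on_Eb[OF that]])
  ultimately show ?thesis using * by auto
qed

end
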